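(* Let $P$ be a set of $m$ points and $\mathcal{C}$ a set of $n$ circles in $\mathbb{R}^3$, such that no plane or sphere contains more than $q$ circles of $\mathcal{C}$. Then the number of incidences between $P$ and $\mathcal{C}$ satisfies $$I(P,\mathcal{C}) = O\left( m^{3/7}n^{6/7} + m^{2/3}n^{1/3}q^{1/3} + m^{6/11}n^{5/11}q^{4/11}\log^{2/11}(m^3/q) + m + n \right),$$ with an absolute constant of proportionality.
   Context: $I(P,\mathcal{C})$ denotes the number of pairs $(p,\gamma)\in P\times\mathcal{C}$ with $p\in\gamma$. *)

theory Defs
  imports "HOL-Analysis.Analysis"
begin

definition is_plane :: "(real^3) set \<Rightarrow> bool" where
  "is_plane S \<longleftrightarrow> (\<exists>u d. u \<noteq> 0 \<and> S = {x. u \<bullet> x = d})"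

definition is_sphere :: "(real^3) set \<Rightarrow> bool" where
  "is_sphere S \<longleftrightarrow> (\<exists>c r. r > 0 \<and> S = sphere c r)"

definition is_circle :: "(real^3) set \<Rightarrow> bool" where
  "is_circle S \<longleftrightarrow> (\<exists>c u r. u \<noteq> 0 \<and> r > 0 \<and> S = {x. dist x c = r \<and> u \<bullet> (x - c) = 0})"

definition incidences :: "(real^3) set \<Rightarrow> (real^3) set set \<Rightarrow> nat" where
  "incidences P \<C> = card {(p, \<gamma>). p \<in> P \<and> \<gamma> \<in> \<C> \<and> p \<in> \<gamma>}"

end

theory Submission
  imports Defs "HOL-Computational_Algebra.Computational_Algebra" "HOL-Library.Function_Algebras" "HOL-Real_Asymp.Real_Asymp"
begin

text \<open>A polynomial of degree \<open>D\<close> cuts the points into cells. Three points determine a circle, so counting triples of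
  consecutive points in a cell bounds the incidences with circles not contained in the zero set by \<open>O(n D + m\<^sup>3 / D\<^sup>6)\<close>,
  and \<open>D\<close> is chosen to balance the two terms. For circles in the zero set, a smooth point that is not umbilic lies on
  boundedly many of them, and a circle with few umbilic points has few of the remaining incidences. Along a circle consisting
  of umbilic points the tangent plane or osculating sphere is constant; the circles are grouped accordingly, each group has at
  most \<open>q\<close> members, and the bounds for the groups are added by Hoelder's inequality.

  An inversion reduces a group to circles in the plane. These are dualised to points of three-space, where the circles
  through two given points lie on a line, and are again partitioned by a polynomial: lines in its zero set are treated by
  the same surface argument with flat points and tangent planes, while two consecutive circles of a pencil in a
  common cell form a lens. The number of lenses among \<open>n\<close> arcs is \<open>O(n\<^bsup>3/2\<^esup> log n)\<close> by a packing argument that records, at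
  every dyadic scale, the order in which an arc meets the others.\<close>

text \<open>What shapes the proof is that arbitrarily many circles pass through a point of a plane
  or a sphere, so no bound per point holds inside a zero set. Umbilicity is the differential test
  that isolates this case: for a circle through a non-umbilic point, second order fixes the normal
  curvature, orders three and four are two equations for the tangential curvature, and eliminating
  it leaves finitely many directions. Singular points are handled by replacing the polynomial by an
  iterated derivative.

  Partitions are measured by the sum of the cubes of the cell sizes, since triples in a cell are
  counted; the bound is that of \<open>D^e\<close> equal cells in dimension \<open>e\<close>.
  Averaging over functions vanishing at sample points stands in for Borsuk-Ulam and separates a
  fixed proportion of the pairs.

  The exponents 3/7 and 6/7 solve \<open>n D = m^3 / D^6\<close>. In the plane 6/11 and 9/11 come
  from equating \<open>m^(2/3) k^(1/3) n^(2/3)\<close> with \<open>n (n / k^3)^(1/2)\<close> times a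
  logarithm, \<open>k\<close> being the degree of the dual partition; trading part of
  \<open>n\<close> for \<open>q\<close> turns 9/11 into 5/11.\<close>

abbreviation rc :: "'a set => real" where "rc A == real (card A)"

abbreviation cubes :: "'a set set => real" where "cubes \<S> == (SUM S:\<S>. rc S^3)"

abbreviation prodf :: "('a => real) set => 'a => real" where "prodf fs == (%x. PROD f:fs. f x)"

section \<open>Polynomial functions\<close>

text \<open>The degree bound is part of the generation of the function, so restriction to curves,
  differentiation and composition are inductions over four rules, without coefficients of
  multivariate polynomials. \<open>d\<close> is only an upper bound of the degree.\<close>

inductive polyf :: "nat => ('a::euclidean_space => real) => bool" where
 polyf_const: "polyf d (%x. c)"
| polyf_inner: "polyf (Suc d) (%x. x\<bullet>b)"
| polyf_add: "polyf d f ==> polyf d g ==> polyf d (%x. f x+g x)"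
| polyf_mult: "polyf d f ==> polyf e g ==> polyf (d+e) (%x. f x*g x)"

lemma polyf_mono: "polyf d f ==> d <= e ==> polyf e f"
proof (induction arbitrary: e rule: polyf.induct)
 case (polyf_const d c) thus ?case by (simp add: polyf.polyf_const)
next
 case (polyf_inner d b) thus ?case by (cases e) (auto intro: polyf.polyf_inner)
next
 case (polyf_add d f g) thus ?case by (auto intro: polyf.polyf_add)
next
 case (polyf_mult d f e' g)
 have "polyf (d+(e - d)) (%x. f x*g x)"
  using polyf_mult by (intro polyf.polyf_mult) auto
 thus ?case using polyf_mult by simp
qed

lemma polyf_cmult: "polyf d f ==> polyf d (%x. c*f x)"
 using polyf_mult[OF polyf_const[of 0 c], of d f] by simp

lemma polyf_uminus: "polyf d f ==> polyf d (%x. - f x)"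
 using polyf_cmult[of d f "-1"] by simp

lemma polyf_diff: "polyf d f ==> polyf d g ==> polyf d (%x. f x - g x)"
 using polyf_add[of d f "%x. - g x"] polyf_uminus[of d g] by simp

lemma polyf_sum: "(!!i. i:I ==> polyf d (f i)) ==> polyf d (%x. SUM i:I. f i x)"
 by (induction I rule: infinite_finite_induct) (auto intro: polyf_const polyf_add)

lemma polyf_power: "polyf d f ==> polyf (d*n) (%x. f x^n)"
proof (induction n)
 case (Suc n)
 thus ?case using polyf_mult[of d f "d*n" "%x. f x^n"] by simp
qed (auto intro: polyf_const)

lemma polyf_prod: "(!!i. i:I ==> polyf (d i) (f i)) ==> polyf (SUM i:I. d i) (%x. PROD i:I. f i x)"
 by (induction I rule: infinite_finite_induct) (auto intro: polyf_const polyf_mult)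

lemma polyf_0_const: "polyf d f ==> d = 0 ==> EX c. f = (%x. c)"
 by (induction rule: polyf.induct) auto

section \<open>Directional derivatives of polynomial functions\<close>

definition dd :: "('a::real_normed_vector => real) => 'a => 'a => real" where
 "dd f v x = frechet_derivative f (at x) v"

lemma dd_eqI: "(f has_derivative f') (at x) ==> dd f v x = f' v"
 unfolding dd_def using frechet_derivative_at by metis

lemma polyf_differentiable: "polyf d f ==> f differentiable (at x)"
proof (induction rule: polyf.induct)
 case (polyf_inner d b)
 show ?case unfolding differentiable_def
  by (rule exI[of _ "%h. h\<bullet>b"]) (auto intro!: derivative_eq_intros)
qed (auto intro!: differentiable_add differentiable_mult)

lemma polyf_has_derivative: "polyf d f ==> (f has_derivative (%v. dd f v x)) (at x)"
 unfolding dd_def using polyf_differentiable frechet_derivative_works by (metis eta_contract_eq)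

lemma polyf_continuous_on: "polyf d f ==> continuous_on S f"
 by (meson continuous_at_imp_continuous_on differentiable_imp_continuous_within polyf_differentiable)

lemma linear_dd: "polyf d f ==> linear (%v. dd f v x)"
 using polyf_has_derivative has_derivative_linear by blast

lemma dd_const [simp]: "dd (%x. c) v = (%x. 0)"
 by (rule ext) (rule dd_eqI, auto intro!: derivative_eq_intros)

lemma dd_inner [simp]: "dd (%x. x\<bullet>b) v = (%x. v\<bullet>b)"
 by (rule ext) (rule dd_eqI, auto intro!: derivative_eq_intros)

lemma dd_add: "polyf d f ==> polyf e g ==> dd (%x. f x+g x) v = (%x. dd f v x+dd g v x)"
 by (rule ext) (rule dd_eqI, auto intro!: derivative_eq_intros polyf_has_derivative)

lemma dd_mult: "polyf d f ==> polyf e g ==>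
  dd (%x. f x*g x) v = (%x. f x*dd g v x+dd f v x*g x)"
 by (rule ext) (rule dd_eqI, auto intro!: derivative_eq_intros polyf_has_derivative)

text \<open>The drop of the degree is what makes a chain of derivatives end. Degree 0 is a separate
  case because \<open>d - 1\<close> truncates.\<close>

lemma polyf_dd_strong: "polyf d f ==> (if d = 0 then dd f v = (%x. 0) else polyf (d - 1) (dd f v))"
proof (induction rule: polyf.induct)
 case (polyf_const d c) thus ?case by (auto intro: polyf.polyf_const)
next
 case (polyf_inner d b) thus ?case by (auto intro: polyf.polyf_const)
next
 case (polyf_add d f g) thus ?case by (auto simp: dd_add intro: polyf.polyf_add polyf.polyf_const split: if_splits)
next
 case (polyf_mult d f e g)
 have eq: "dd (%x. f x*g x) v = (%x. f x*dd g v x+dd f v x*g x)"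
  using polyf_mult by (intro dd_mult)
 have A: "polyf (d+e - 1) (%x. f x*dd g v x)" if "d+e ~= 0"
 proof (cases "e = 0")
  case True thus ?thesis using polyf_mult by (simp add: polyf.polyf_const)
 next
  case False
  hence "polyf (d+(e - 1)) (%x. f x*dd g v x)" using polyf_mult by (intro polyf.polyf_mult) auto
  thus ?thesis using False by simp
 qed
 have B: "polyf (d+e - 1) (%x. dd f v x*g x)" if "d+e ~= 0"
 proof (cases "d = 0")
  case True thus ?thesis using polyf_mult by (simp add: polyf.polyf_const)
 next
  case False
  hence "polyf ((d - 1)+e) (%x. dd f v x*g x)" using polyf_mult by (intro polyf.polyf_mult) auto
  thus ?thesis using False by simp
 qed
 show ?case using A B polyf_mult unfolding eq by (auto intro: polyf.polyf_add)
qed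

lemma polyf_dd: "polyf d f ==> polyf d (dd f v)"
 using polyf_dd_strong[of d f v] by (cases "d = 0") (auto intro: polyf_const polyf_mono[of "d-1"])

lemma dd_commute: "polyf d f ==> dd (dd f u) v x = dd (dd f v) u x"
proof (induction arbitrary: x rule: polyf.induct)
 case (polyf_add d f g)
 thus ?case
  by (simp add: dd_add[OF polyf_add.hyps] dd_add[OF polyf_dd[OF polyf_add.hyps(1)] polyf_dd[OF polyf_add.hyps(2)]])
next
 case (polyf_mult d f e g)
 note p = polyf_dd[OF polyf_mult.hyps(1)] polyf_dd[OF polyf_mult.hyps(2)] polyf_mult.hyps
 have eq: "dd (dd (%x. f x*g x) u) v x
   = f x*dd (dd g u) v x+dd f v x*dd g u x+(dd f u x*dd g v x+dd (dd f u) v x*g x)" for u v x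
  by (simp add: dd_mult[OF p(3,4)] dd_add[OF polyf.polyf_mult[OF p(3) p(2)] polyf.polyf_mult[OF p(1) p(4)]]
    dd_mult[OF p(3) p(2)] dd_mult[OF p(1) p(4)])
 show ?case using polyf_mult.IH by (simp add: eq)
qed auto

text \<open>Clearing denominators: the coordinates of the curve are quotients with denominator
  \<open>Q\<close>, and every factor of degree one costs one power of \<open>Q\<close>. Lines are
  the case \<open>Q = 1\<close>, \<open>s = 1\<close>; circles have \<open>Q = 1 + t^2\<close>,
  \<open>s = 2\<close>.\<close>

lemma polyf_curve:
 fixes c :: "real => 'a::euclidean_space"
 assumes "polyf d f" and c: "!!b. EX p. degree p <= s & (ALL t. (c t\<bullet>b)*poly Q t = poly p t)" and Q: "degree Q <= s"
 shows "EX P. degree P <= s*d & (ALL t. f (c t)*poly Q t^d = poly P t)"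
 using assms(1)
proof (induction rule: polyf.induct)
 case (polyf_const d a)
 have "degree (smult a (Q^d)) <= s*d"
  using order_trans[OF degree_power_le[of Q d]] Q by (intro order_trans[OF degree_smult_le]) (simp add: mult_le_mono)
 thus ?case by (intro exI[of _ "smult a (Q^d)"]) (simp)
next
 case (polyf_inner d b)
 obtain p where p: "degree p <= s" "ALL t. (c t\<bullet>b)*poly Q t = poly p t" using c by blast
 have "degree (p*Q^d) <= s+s*d"
  using order_trans[OF degree_power_le[of Q d]] Q p by (intro order_trans[OF degree_mult_le] add_mono) (simp_all add: mult_le_mono)
 thus ?case using p by (intro exI[of _ "p*Q^d"]) (auto simp flip: p(2)[rule_format])
next
 case (polyf_add d f g)
 then obtain P1 P2 where "degree P1 <= s*d" "ALL t. f (c t)*poly Q t^d = poly P1 t"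
  "degree P2 <= s*d" "ALL t. g (c t)*poly Q t^d = poly P2 t" by auto
 thus ?case by (intro exI[of _ "P1+P2"]) (auto simp: algebra_simps intro: degree_add_le)
next
 case (polyf_mult d f e g)
 then obtain P1 P2 where "degree P1 <= s*d" "ALL t. f (c t)*poly Q t^d = poly P1 t"
  "degree P2 <= s*e" "ALL t. g (c t)*poly Q t^e = poly P2 t" by auto
 thus ?case by (intro exI[of _ "P1*P2"])
  (auto simp: algebra_simps power_add intro: order_trans[OF degree_mult_le] simp flip: \<open>ALL t. f (c t)*poly Q t^d = poly P1 t\<close>[rule_format] \<open>ALL t. g (c t)*poly Q t^e = poly P2 t\<close>[rule_format])
qed

lemma polyf_line:
 assumes "polyf d f"
 obtains P where "degree P <= d" "!!t. f (p+t *\<^sub>R v) = poly P t"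
proof -
 have "EX q. degree q <= 1 & (ALL t. ((p+t *\<^sub>R v)\<bullet>b)*poly 1 t = poly q t)" for b
  by (intro exI[of _ "[:p\<bullet>b, v\<bullet>b:]"]) (auto simp: inner_add_left)
 from polyf_curve[OF assms this] show ?thesis using that by auto
qed

text \<open>General position without measure or topology: on the line from a point that is good for
  the earlier functions to a point that is good for the new one, every function restricts to a
  nonzero univariate polynomial, and finitely many roots can be avoided.\<close>

lemma polyf_common_nonzero:
 assumes "finite Fs" "!!f. f:Fs ==> (EX d. polyf d f) & (EX x. f x ~= 0)"
 shows "EX x::'a::euclidean_space. ALL f:Fs. f x ~= 0"
 using assms
proof (induction)
 case (insert f Fs)
 then obtain x where x: "ALL g:Fs. g x ~= 0" by auto
 obtain y where y: "f y ~= 0" using insert.prems[of f] by blast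
 have "finite {t. g (x+t *\<^sub>R (y - x)) = 0}" if "g:insert f Fs" for g
 proof -
  have "EX d. polyf d g" using insert.prems[of g] that by blast
  then obtain d where "polyf d g" by blast
  then obtain P where P: "!!t. g (x+t *\<^sub>R (y - x)) = poly P t"
   using polyf_line[of d g x "y - x"] by blast
  have "poly P 0 ~= 0 | poly P 1 ~= 0" using P[of 0] P[of 1] x y that by auto
  thus ?thesis unfolding P by (auto intro: poly_roots_finite)
 qed
 hence "finite (UN g:insert f Fs. {t. g (x+t *\<^sub>R (y - x)) = 0})" using insert by auto
 then obtain t where "t ~: (UN g:insert f Fs. {t. g (x+t *\<^sub>R (y - x)) = 0})"
  using ex_new_if_finite infinite_UNIV_char_0 by blast
 thus ?case by auto
qed auto

text \<open>Differentiating a nonzero polynomial until it becomes a nonzero constant: at every point, some member of the chain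
 vanishes there but has nonzero gradient.\<close>

lemma derivative_chain:
 assumes "polyf d f" "EX x. f x ~= 0"
 obtains g :: "nat => 'a::euclidean_space => real" where "g 0 = f" "!!k. polyf d (g k)" "!!x. EX k. g k x ~= 0"
  "!!k x. g k x = 0 ==> g (Suc k) x ~= 0 ==> EX v. dd (g k) v x ~= 0"
proof -
 have "EX g. g 0 = f & (ALL k. polyf d (g k)) & (ALL x. EX k. g k x ~= 0) &
  (ALL k x. g k x = 0 --> g (Suc k) x ~= 0 --> (EX v. dd (g k) v x ~= 0))"
  using assms
 proof (induction d arbitrary: f)
  case 0
  then obtain c where "f = (%x. c)" "c ~= 0" using polyf_0_const by blast
  thus ?case by (intro exI[of _ "%k. f"]) (auto intro: polyf_const)
 next
  case (Suc d)
  show ?case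
  proof (cases "EX v x. dd f v x ~= 0")
   case False
   hence "(f has_derivative (%h. 0)) (at x)" for x using polyf_has_derivative[OF Suc.prems(1), of x] by auto
   then obtain c where "!!x. f x = c" using has_derivative_zero_constant[of UNIV f] by auto
   hence "f = (%x. c)" by auto
   \<comment> \<open>A nonzero constant is repeated for ever; it has no zeros, so the gradient
     condition holds vacuously.\<close>
   thus ?thesis using Suc by (intro exI[of _ "%k. f"]) (auto intro: polyf_const)
  next
   case True
   then obtain v x where v: "dd f v x ~= 0" by auto
   have "polyf d (dd f v)" using polyf_dd_strong[OF Suc.prems(1), of v] by simp
   from Suc.IH[OF this] v obtain g where g: "g 0 = dd f v" "ALL k. polyf d (g k)" "ALL x. EX k. g k x ~= 0"
    "ALL k x. g k x = 0 --> g (Suc k) x ~= 0 --> (EX v. dd (g k) v x ~= 0)" by blast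
   define h where "h = (%k. case k of 0 => f | Suc k => g k)"
   have "EX v. dd (h k) v x ~= 0" if "h k x = 0" "h (Suc k) x ~= 0" for k x
    using that g by (cases k) (auto simp: h_def)
   moreover have "polyf (Suc d) (h k)" for k using g(2) Suc.prems(1) by (cases k) (auto simp: h_def intro: polyf_mono[of d])
   moreover have "EX k. h k x ~= 0" for x
   proof -
    obtain k where "g k x ~= 0" using g(3) by auto
    thus ?thesis by (intro exI[of _ "Suc k"]) (simp add: h_def)
   qed
   ultimately show ?thesis by (intro exI[of _ h]) (auto simp: h_def)
  qed
 qed
 thus ?thesis using that by blast
qed

text \<open>A proof by comparing the leading coefficients.\<close>

lemma wronskian_zero_proportional:
 fixes X Y :: "real poly"
 assumes "pderiv X*Y = X*pderiv Y"
 shows "poly X s*poly Y t = poly X t*poly Y s"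
proof -
 \<comment> \<open>The coefficient of \<open>pderiv U * V\<close> in degree
   \<open>degree U - 1 + degree V\<close> is \<open>degree U\<close> times both leading
   coefficients; comparing the two products forces equal degrees.\<close>
 have deg: "degree U = degree V" if "pderiv U*V = U*pderiv V" "U ~= 0" "V ~= 0" for U V :: "real poly"
 proof -
  have A: "coeff (pderiv U*V) (degree U - 1+degree V) = real (degree U)*lead_coeff U*lead_coeff V" if "V ~= 0" for U V :: "real poly"
  proof (cases "degree U = 0")
   case True
   hence "pderiv U = 0" by (simp add: pderiv_eq_0_iff)
   thus ?thesis using True by simp
  next
   case False
   have "coeff (pderiv U*V) (degree (pderiv U)+degree V) = lead_coeff (pderiv U)*lead_coeff V" by (rule coeff_mult_degree_sum)
   thus ?thesis using False by (simp add: degree_pderiv coeff_pderiv)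
  qed
  consider "degree U = 0" "degree V = 0" | "degree U = 0" "degree V > 0" | "degree U > 0" "degree V = 0" | "degree U > 0" "degree V > 0" by auto
  thus ?thesis
  proof cases
   case 2
   hence "pderiv U = 0" "pderiv V ~= 0" by (auto simp: pderiv_eq_0_iff)
   thus ?thesis using that by simp
  next
   case 3
   hence "pderiv V = 0" "pderiv U ~= 0" by (auto simp: pderiv_eq_0_iff)
   thus ?thesis using that by simp
  next
   case 4
   have "coeff (pderiv U*V) (degree U - 1+degree V) = coeff (pderiv V*U) (degree V - 1+degree U)"
    using 4 that(1) by (simp add: mult.commute add.commute)
   hence "real (degree U)*lead_coeff U*lead_coeff V = real (degree V)*lead_coeff V*lead_coeff U"
    using A[of V U] A[of U V] that by simp
   thus ?thesis using that by simp
  qed simp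
 qed
 show ?thesis
 proof (cases "X = 0 | Y = 0")
  case False
  define k where "k = lead_coeff X/lead_coeff Y"
  have dXY: "degree X = degree Y" using deg assms False by auto
  \<comment> \<open>\<open>Z\<close> satisfies the same relation, but its coefficient in degree
    \<open>degree Y\<close> is cancelled; equal degrees then leave only
    \<open>Z = 0\<close>.\<close>
  define Z where "Z = X - smult k Y"
  have ZY: "pderiv Z*Y = Z*pderiv Y" using assms by (simp add: Z_def pderiv_diff pderiv_smult algebra_simps)
  have "Z = 0"
  proof (rule ccontr)
   assume "Z ~= 0"
   hence "degree Z = degree Y" using deg ZY False by auto
   moreover have "coeff Z (degree Y) = 0" using dXY False by (simp add: Z_def k_def)
   ultimately show False using \<open>Z ~= 0\<close> by (metis leading_coeff_0_iff)
  qed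
  hence "X = smult k Y" by (simp add: Z_def)
  thus ?thesis by simp
 qed auto
qed

section \<open>Packings of lenses\<close>

text \<open>Cauchy-Schwarz over at most four classes: a dyadic cell for two rankings splits into 2 x
  2 cells at the next lower height.\<close>

lemma sum_squares_le_card_classes:
 fixes f :: "'a => 'b"
 assumes "finite B" and "finite K" "f ` B <= K" "card K <= 4"
 shows "rc B^2/4 <= (SUM k:K. rc {x:B. f x = k} ^ 2)"
proof -
 have "card B = (SUM k:K. card {x:B. f x = k})"
 proof -
  have "B = (UN k:K. {x:B. f x = k})" using assms by auto
  hence "card B = card (UN k:K. {x:B. f x = k})" by simp
  also have "... = (SUM k:K. card {x:B. f x = k})" using assms by (intro card_UN_disjoint) auto
  finally show ?thesis .
 qed
 hence "rc B^2 = (SUM k:K. 1*rc {x:B. f x = k})^2" by simp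
 also have "... <= (SUM k:K. 1^2)*(SUM k:K. rc {x:B. f x = k} ^ 2)"
  by (rule Cauchy_Schwarz_ineq_sum)
 also have "... <= 4*(SUM k:K. rc {x:B. f x = k} ^ 2)"
  using assms by (intro mult_right_mono sum_nonneg) auto
 finally show ?thesis by simp
qed

text \<open>With one global comparison the correlation of two lists would only see the difference of
  the sizes of their two classes, which may be zero. Restricting the comparison to blocks of every
  dyadic length separates the classes at some scale, at the price of a logarithm.\<close>

definition block_sgn :: "nat => nat => nat => real" where
 "block_sgn h a b = (if a div 2^h = b div 2^h then (if a < b then 1 else if b < a then -1 else 0) else 0)"

lemma div_power_Suc: "a div 2^Suc h = a div 2^h div (2::nat)"
 by (metis div_mult2_eq power_Suc2)

text \<open>At height \<open>h\<close> the two rankings cut \<open>T\<close> into cells. Only one cell can meet both classes, and the elements that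
 leave the mixed cell when passing from height \<open>h + 1\<close> to \<open>h\<close> lie in at most four unmixed cells.\<close>

lemma block_correlation:
 fixes rh sg :: "'a => nat" and L :: "'a => bool"
 assumes fin: "finite T" and inj: "inj_on rh T" "inj_on sg T"
  and bound: "!!x. x:T ==> rh x < 2^H" "!!x. x:T ==> sg x < 2^H"
  and cross: "!!p q. p:T ==> q:T ==> L p ==> ~L q ==> rh p < rh q & sg p < sg q"
  and same: "!!p q. p:T ==> q:T ==> p ~= q ==> L p = L q ==> rh p < rh q \<longleftrightarrow> sg q < sg p"
 shows "rc T^2/(4*real (H+1)) - real (H+1)*rc T
  <= - (SUM h<=H. SUM x:T. SUM y:T. block_sgn h (rh x) (rh y)*block_sgn h (sg x) (sg y))"
proof -
 define cl where "cl = (%h x. (rh x div 2^h, sg x div 2^h))"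
 define l where "l = (%x. if L x then 1 else (-1::real))"
 define mixed where "mixed = (%h. {x:T. EX y:T. cl h y = cl h x & L y ~= L x})"
 \<comment> \<open>The value \<open>T\<close> above height \<open>H\<close> lets the increments of
   \<open>U\<close> exhaust \<open>T\<close>; all ranks are below \<open>2^H\<close>, so at that
   height there is a single cell.\<close>
 define U where "U = (%h. if h <= H then mixed h else T)"
 have l2: "l x*l x = 1" for x by (simp add: l_def)
 \<comment> \<open>In a common cell equal labels mean opposite orders, hence -1, and different
   labels mean the same order, hence +1. Both are \<open>- l x * l y\<close>; the term for
   \<open>x = y\<close> corrects the diagonal, where \<open>block_sgn\<close> is 0.\<close>
 have summand: "block_sgn h (rh x) (rh y)*block_sgn h (sg x) (sg y)
  = (if x = y then 1 else 0) - (if cl h x = cl h y then l x*l y else 0)" if "x:T" "y:T" for h x y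
 proof (cases "x = y")
  case True thus ?thesis by (simp add: block_sgn_def l2)
 next
  case False
  hence ne: "rh x ~= rh y" "sg x ~= sg y" using inj that by (auto simp: inj_on_def)
  show ?thesis
  proof (cases "L x = L y")
   case True
   thus ?thesis using same[OF that False True] ne False by (auto simp: block_sgn_def cl_def l_def)
  next
   case F2: False
   thus ?thesis using cross[OF that] cross[OF that(2,1)] ne False by (cases "L x") (auto simp: block_sgn_def cl_def l_def)
  qed
 qed
 have level: "- (SUM x:T. SUM y:T. block_sgn h (rh x) (rh y)*block_sgn h (sg x) (sg y))
   = (SUM k:cl h ` T. (SUM x:{x:T. cl h x = k}. l x)^2) - rc T" for h
 proof -
  have "(SUM x:T. SUM y:T. block_sgn h (rh x) (rh y)*block_sgn h (sg x) (sg y))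
   = (SUM x:T. SUM y:T. (if x = y then 1 else 0) - (if cl h x = cl h y then l x*l y else 0))"
   using summand by (intro sum.cong) auto
  also have "... = rc T - (SUM x:T. SUM y:T. if cl h x = cl h y then l x*l y else 0)"
   using fin by (simp add: sum_subtractf)
  also have "(SUM x:T. SUM y:T. if cl h x = cl h y then l x*l y else 0)
   = (SUM k:cl h ` T. SUM x:{x:T. cl h x = k}. SUM y:T. if cl h x = cl h y then l x*l y else 0)"
   using fin by (subst sum.image_gen[of T _ "cl h"]) auto
  also have "... = (SUM k:cl h ` T. (SUM x:{x:T. cl h x = k}. l x)^2)"
  proof (intro sum.cong refl)
   fix k
   have "(SUM x:{x:T. cl h x = k}. SUM y:T. if cl h x = cl h y then l x*l y else 0)
    = (SUM x:{x:T. cl h x = k}. SUM y:{y:T. cl h y = k}. l x*l y)"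
   proof (rule sum.cong[OF refl])
    fix x assume "x:{x:T. cl h x = k}"
    hence "(SUM y:T. if cl h x = cl h y then l x*l y else 0) = (SUM y:T. if cl h y = k then l x*l y else 0)"
     by (intro sum.cong) auto
    thus "(SUM y:T. if cl h x = cl h y then l x*l y else 0) = (SUM y:{y:T. cl h y = k}. l x*l y)"
     using fin by (simp add: sum.inter_filter)
   qed
   thus "(SUM x:{x:T. cl h x = k}. SUM y:T. if cl h x = cl h y then l x*l y else 0)
    = (SUM x:{x:T. cl h x = k}. l x)^2"
    by (simp add: power2_eq_square sum_product)
  qed
  finally show ?thesis by simp
 qed
 have fst_le: "rh p div 2^h <= rh q div 2^h & sg p div 2^h <= sg q div 2^h"
  if "p:T" "q:T" "L p" "~L q" for p q h
  using cross[OF that] by (auto intro!: div_le_mono)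
 \<comment> \<open>Each mixed cell contains both classes. Comparing the first class of either cell
   with the second class of the other gives inequalities both ways.\<close>
 have mixed_eq: "cl h x = cl h x'" if x: "x:mixed h" and x': "x':mixed h" for h x x'
 proof -
  obtain y where y: "y:T" "cl h y = cl h x" "L y ~= L x" and xT: "x:T" using x by (auto simp: mixed_def)
  obtain y' where y': "y':T" "cl h y' = cl h x'" "L y' ~= L x'" and xT': "x':T" using x' by (auto simp: mixed_def)
  obtain p q where pq: "p:T" "q:T" "L p" "~L q" "cl h p = cl h x" "cl h q = cl h x"
   using y xT by (cases "L x") auto
  obtain p' q' where pq': "p':T" "q':T" "L p'" "~L q'" "cl h p' = cl h x'" "cl h q' = cl h x'"
   using y' xT' by (cases "L x'") auto
  show ?thesis using fst_le[of p q' h] fst_le[of p' q h] pq pq' by (auto simp: cl_def)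
 qed
 have mixed_Suc: "mixed h <= mixed (Suc h)" for h
 proof -
  have "cl (Suc h) x = cl (Suc h) y" if "cl h x = cl h y" for x y
   using that by (simp only: cl_def div_power_Suc prod.inject)
  note cl_Suc = this
  show ?thesis
  proof
   fix x assume "x:mixed h"
   then obtain y where "x:T" "y:T" "cl h y = cl h x" "L y ~= L x" unfolding mixed_def by blast
   thus "x:mixed (Suc h)" using cl_Suc[of y x] unfolding mixed_def by blast
  qed
 qed
 have U_sub: "U h <= U (Suc h)" "U h <= T" for h
  using mixed_Suc[of h] by (auto simp: U_def mixed_def)
 have U0: "U 0 = {}"
  using inj by (auto simp: U_def mixed_def cl_def inj_on_def)
 have finU: "finite (U h)" for h using U_sub(2) fin finite_subset by blast
 have step: "(rc (U (Suc h)) - rc (U h))^2/4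
   <= (SUM k:cl h ` T. (SUM x:{x:T. cl h x = k}. l x)^2)" if "h <= H" for h
 proof -
  define B where "B = U (Suc h) - U h"
  have cardB: "rc B = rc (U (Suc h)) - rc (U h)"
   using U_sub(1)[of h] finU by (simp add: B_def card_Diff_subset card_mono of_nat_diff)
  have BT: "B <= T" "finite B" using U_sub(2) fin finU by (auto simp: B_def)
  have lab: "card (cl h ` B) <= 4"
  proof -
   obtain a b where ab: "!!x. x:B ==> cl (Suc h) x = (a, b)"
   proof (cases "B = {}")
    case False
    then obtain x0 where x0: "x0:B" by auto
    have "cl (Suc h) x = cl (Suc h) x0" if "x:B" for x
    proof (cases "Suc h <= H")
     case True thus ?thesis using mixed_eq that x0 by (auto simp: B_def U_def)
    next
     case False
     hence "h = H" using \<open>h <= H\<close> by simp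
     have "rh y div 2^Suc H = 0 & sg y div 2^Suc H = 0" if "y:T" for y
      using bound[OF that] by auto
     hence "cl (Suc H) y = (0, 0)" if "y:T" for y using that by (simp only: cl_def)
     moreover have "x:T" "x0:T" using that x0 BT by auto
     ultimately have "cl (Suc H) x = cl (Suc H) x0" by metis
     thus ?thesis by (simp only: \<open>h = H\<close>)
    qed
    thus ?thesis using that[of "fst (cl (Suc h) x0)" "snd (cl (Suc h) x0)"] by simp
   qed auto
   have "cl h ` B <= {2*a, 2*a+1} \<times> {2*b, 2*b+1}"
   proof
    fix k assume "k:cl h ` B"
    then obtain x where x: "x:B" "k = cl h x" by auto
    have "rh x div 2^h div 2 = a" "sg x div 2^h div 2 = b"
     using ab[OF x(1)] by (simp_all only: cl_def div_power_Suc prod.inject)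
    hence "rh x div 2^h:{2*a, 2*a+1}" "sg x div 2^h:{2*b, 2*b+1}" by auto
    thus "k:{2*a, 2*a+1} \<times> {2*b, 2*b+1}" using x by (auto simp: cl_def)
   qed
   hence "card (cl h ` B) <= card ({2*a, 2*a+1} \<times> {2*b, 2*b+1})"
    by (rule card_mono[rotated]) auto
   thus ?thesis by (simp add: card_cartesian_product card_insert_if)
  qed
  have "(rc (U (Suc h)) - rc (U h))^2/4 = rc B^2/4" by (simp add: cardB)
  also have "... <= (SUM k:cl h ` B. rc {x:B. cl h x = k} ^ 2)"
   using BT lab by (intro sum_squares_le_card_classes) auto
  also have "... <= (SUM k:cl h ` B. (SUM x:{x:T. cl h x = k}. l x)^2)"
  proof (intro sum_mono)
   fix k assume "k:cl h ` B"
   then obtain x where x: "x:B" "k = cl h x" by auto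
   have xm: "x:T" "x ~: mixed h" using x \<open>h <= H\<close> BT by (auto simp: B_def U_def)
   have same: "l y = l x" if y: "y:{x:T. cl h x = k}" for y
   proof (rule ccontr)
    assume "l y ~= l x"
    hence "L y ~= L x" unfolding l_def by presburger
    moreover have "y:T" "cl h y = cl h x" using y x(2) by blast+
    ultimately show False using xm unfolding mixed_def by blast
   qed
   have "(SUM y:{y:T. cl h y = k}. l y) = rc {y:T. cl h y = k} * l x"
    using same by (subst sum.cong[OF refl, of _ _ "%_. l x"]) auto
   hence "(SUM y:{y:T. cl h y = k}. l y)^2 = rc {y:T. cl h y = k} ^ 2"
    using l2[of x] by (simp add: power2_eq_square)
   moreover have "card {y:B. cl h y = k} <= card {y:T. cl h y = k}" using BT fin by (intro card_mono) auto
   ultimately show "rc {y:B. cl h y = k} ^ 2 <= (SUM x:{x:T. cl h x = k}. l x)^2"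
    by (simp add: power_mono)
  qed
  also have "... <= (SUM k:cl h ` T. (SUM x:{x:T. cl h x = k}. l x)^2)"
   using BT fin by (intro sum_mono2) auto
  finally show ?thesis .
 qed
 have tele: "(SUM h<=H. rc (U (Suc h)) - rc (U h)) = rc T"
  using sum_telescope[of "%h. - rc (U h)" H] U0 by (simp add: U_def)
 have "rc T^2 = (SUM h<=H. 1*(rc (U (Suc h)) - rc (U h)))^2" using tele by simp
 also have "... <= (SUM h<=H. 1^2)*(SUM h<=H. (rc (U (Suc h)) - rc (U h))^2)"
  by (rule Cauchy_Schwarz_ineq_sum)
 also have "... = 4*real (H+1)*(SUM h<=H. (rc (U (Suc h)) - rc (U h))^2/4)"
  by (simp add: sum_divide_distrib[symmetric])
 finally have "rc T^2/(4*real (H+1)) <= (SUM h<=H. (rc (U (Suc h)) - rc (U h))^2/4)"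
  by (simp add: field_simps)
 also have "... <= (SUM h<=H. SUM k:cl h ` T. (SUM x:{x:T. cl h x = k}. l x)^2)"
  using step by (intro sum_mono) auto
 finally have "rc T^2/(4*real (H+1)) - real (H+1)*rc T
   <= (SUM h<=H. (SUM k:cl h ` T. (SUM x:{x:T. cl h x = k}. l x)^2) - rc T)"
  by (simp add: sum_subtractf)
 also have "... = (SUM h<=H. - (SUM x:T. SUM y:T. block_sgn h (rh x) (rh y)*block_sgn h (sg x) (sg y)))"
  by (simp add: level)
 finally show ?thesis by (simp add: sum_negf)
qed

text \<open>Stands in for the property that two graphs cross at most twice. Only strict signs are
  tested, so graphs may touch or coincide on an interval.\<close>

definition no_alternation :: "(real => real) => bool" where
 "no_alternation D \<longleftrightarrow> (ALL a b c d. a < b --> b < c --> c < d -->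
   ~(D a > 0 & D b < 0 & D c > 0 & D d < 0) & ~(D a < 0 & D b > 0 & D c < 0 & D d > 0))"

lemma no_alternationD:
 assumes "no_alternation D" "a < b" "b < c" "c < d"
 shows "~(D a > 0 & D b < 0 & D c > 0 & D d < 0)" "~(D a < 0 & D b > 0 & D c < 0 & D d > 0)"
 using assms unfolding no_alternation_def by blast+

text \<open>Two lists with a common part \<open>T\<close>, at positions \<open>a\<close> and \<open>b\<close>: the common part is reversed up to one rotation.\<close>

lemma common_part_reversed:
 fixes a b :: "'a => real" and G :: "'a => real => real"
 assumes D: "no_alternation D" and E: "!!x y. x:T ==> y:T ==> no_alternation (%z. G x z - G y z)"
  and Da: "!!x. x:T ==> D (a x) > 0" and Db: "!!x. x:T ==> D (b x) < 0"
  and Ga: "!!x y. x:T ==> y:T ==> x ~= y ==> G x (a x) < G y (a x)"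
  and Gb: "!!x y. x:T ==> y:T ==> x ~= y ==> G x (b x) < G y (b x)"
 obtains L where "!!p q. p:T ==> q:T ==> L p ==> ~L q ==> a p < a q & b p < b q"
  "!!p q. p:T ==> q:T ==> p ~= q ==> L p = L q ==> a p < a q \<longleftrightarrow> b q < b p"
proof -
 \<comment> \<open>\<open>D\<close> is positive at each \<open>a x\<close> and negative at each
   \<open>b x\<close>; \<open>M x\<close> tells which comes first. The condition on \<open>D\<close>
   restricts how these signs interleave, the one on \<open>G x - G y\<close> how the positions of
   \<open>x\<close> and of \<open>y\<close> interleave.\<close>
 define M where "M = (%x. a x < b x)"
 have ab: "a x ~= b y" if "x:T" "y:T" for x y using Da[OF that(1)] Db[OF that(2)] by auto
 have aa: "a x ~= a y" and bb: "b x ~= b y" if "x:T" "y:T" "x ~= y" for x y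
  using Ga[OF that] Ga[of y x] Gb[OF that] Gb[of y x] that by auto
 note Dalt = no_alternationD[OF D]
 have Ealt: "~(w:{a x, b x} & w':{a y, b y} & w'':{a x, b x} & w''':{a y, b y} & w < w' & w' < w'' & w'' < w''')"
  if "x:T" "y:T" "x ~= y" for x y w w' w'' w'''
  using no_alternationD(2)[OF E[OF that(1,2)], of w w' w'' w'''] Ga[OF that] Gb[OF that] Ga[of y x] Gb[of y x] that
  by auto
 have same: "a p < a q \<longleftrightarrow> b q < b p" if T: "p:T" "q:T" "p ~= q" and M: "M p = M q" for p q
 proof -
  have no: "~(a x < a y & b x < b y)" if T: "x:T" "y:T" "x ~= y" and M: "M x = M y" for x y
  proof
   assume A: "a x < a y & b x < b y"
   show False
   proof (cases "M x")
    case True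
    hence m: "a x < b x" "a y < b y" using M by (auto simp: M_def)
    show False using Dalt(1)[of "a x" "b x" "a y" "b y"] Ealt[OF T, of "a x" "a y" "b x" "b y"] A m ab[of y x] T Da Db by force
   next
    case False
    hence m: "b x < a x" "b y < a y" using M ab[of x x] ab[of y y] T by (auto simp: M_def)
    show False using Dalt(2)[of "b x" "a x" "b y" "a y"] Ealt[OF T, of "b x" "b y" "a x" "a y"] A m ab[of x y] T Da Db by force
   qed
  qed
  show ?thesis using no[of p q] no[of q p] aa[of p q] bb[of p q] T M by force
 qed
 \<comment> \<open>Opposite orders leave four interleavings; two of them alternate for
   \<open>D\<close>, the other two for \<open>G p - G q\<close>.\<close>
 have cross: "a p < a q \<longleftrightarrow> b p < b q" if T: "p:T" "q:T" and M: "M p" "~M q" for p q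
 proof -
  have pq: "p ~= q" using M by auto
  have m: "a p < b p" "b q < a q" using M ab[of q q] T by (auto simp: M_def)
  have "~(a p < a q & b q < b p)"
  proof
   assume A: "a p < a q & b q < b p"
   consider "b q < a p" "a q < b p" | "b q < a p" "b p < a q" | "a p < b q" "a q < b p" | "a p < b q" "b p < a q"
    using ab[of p q] ab[of q p] aa[of p q] bb[of p q] T pq by linarith
   thus False
   proof cases
    case 1 thus False using Ealt[of q p "b q" "a p" "a q" "b p"] A T pq by auto
   next
    case 2 thus False using Dalt(2)[of "b q" "a p" "b p" "a q"] A m T Da Db by auto
   next
    case 3 thus False using Dalt(1)[of "a p" "b q" "a q" "b p"] A m T Da Db by auto
   next
    case 4 thus False using Ealt[of p q "a p" "b q" "b p" "a q"] A T pq by auto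
   qed
  qed
  thus ?thesis using m aa[of p q] bb[of p q] T pq by force
 qed
 \<comment> \<open>The two types do not interleave: one of them comes first entirely, and
   \<open>L\<close> names that one.\<close>
 show ?thesis
 proof (cases "ALL p:T. ALL q:T. M p --> ~M q --> a p < a q")
  case True
  thus ?thesis using that[of M] same cross by blast
 next
  case False
  then obtain p' q' where pq': "p':T" "q':T" "M p'" "~M q'" "~a p' < a q'" by auto
  have "a q < a p" if T: "p:T" "q:T" "M p" "~M q" for p q
  proof (rule ccontr)
   assume "~a q < a p"
   moreover have "p ~= q" using that by auto
   ultimately have 1: "a p < a q" "b p < b q" "a p < b p" "b q < a q"
    using aa[of p q] cross[OF that] that ab[of q q] by (auto simp: M_def)
   have "p' ~= q'" using pq' by auto
   hence 2: "a q' < a p'" "b q' < b p'" "b q' < a q'" "a p' < b p'"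
    using pq' aa[of p' q'] bb[of p' q'] cross[OF pq'(1-4)] ab[of q' q'] by (auto simp: M_def)
   consider "b q' < a p" | "a p < b q'" using ab[of p q'] T pq' by force
   thus False
   proof cases
    case 1
    thus False using Dalt(2)[of "b q'" "a p" "b p" "a q"] \<open>a p < b p\<close> \<open>b p < b q\<close> \<open>b q < a q\<close> T pq' Da Db by auto
   next
    case 2
    thus False using Dalt(1)[of "a p" "b q'" "a q'" "b p'"] \<open>b q' < a q'\<close> \<open>a q' < a p'\<close> \<open>a p' < b p'\<close> T pq' Da Db by auto
   qed
  qed
  note rev = this
  show ?thesis
  proof (rule that[of "%x. ~M x"])
   fix p q assume T: "p:T" "q:T" and M: "~M p" "~~M q"
   hence "a p < a q" "p ~= q" using rev[of q p] by auto
   thus "a p < a q & b p < b q" using cross[of q p] bb[of p q] T M by auto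
  next
   fix p q assume "p:T" "q:T" "p ~= q" "(~M p) = (~M q)"
   thus "a p < a q \<longleftrightarrow> b q < b p" by (intro same) auto
  qed
 qed
qed

lemma rank_less_iff:
 fixes u :: "'b => real"
 assumes "finite A" "x:A" "y:A"
 shows "card {z:A. u z < u x} < card {z:A. u z < u y} \<longleftrightarrow> u x < u y"
proof -
 have *: "card {z:A. u z < u v} < card {z:A. u z < u w}" if "v:A" "u v < u w" for v w
  using assms that by (intro psubset_card_mono) auto
 have "card {z:A. u z < u y} <= card {z:A. u z < u x}" if "u y <= u x"
  using assms that by (intro card_mono) auto
 thus ?thesis using *[of x y] assms by force
qed

lemma sum_swap3: "(SUM f:A. SUM f':A. SUM h:J. Q f f' h) = (SUM h:J. SUM f:A. SUM f':A. Q f f' h)"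
 by (rule trans[OF sum.cong[OF refl sum.swap] sum.swap])

text \<open>The signed vectors recording, at each dyadic height, the order of each list have a nonnegative Gram sum;
 lists sharing many entries would make it negative.\<close>

lemma packing_gram:
 fixes F :: "'a => real => real" and G :: "'b => real => real" and u :: "'a => 'b => real"
 assumes fin: "finite A" "finite B" "Lam <= A \<times> B" and n: "card A <= n" "card B <= n" "n <= 2^H" "n > 0"
  and S1: "!!f g g'. (f, g):Lam ==> (f, g'):Lam ==> g ~= g' ==> G g (u f g) < G g' (u f g)"
  and S2: "!!f f' g. (f, g):Lam ==> (f', g):Lam ==> f ~= f' ==> F f' (u f g) < F f (u f g)"
  and altF: "!!f f'. f:A ==> f':A ==> no_alternation (%x. F f x - F f' x)"
  and altG: "!!g g'. g:B ==> g':B ==> no_alternation (%x. G g x - G g' x)"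
 shows "((SUM g:B. rc {f:A. (f, g):Lam} ^ 2) - rc Lam)^2
  <= 4*real (H+1)^2*real n^2*((SUM g:B. rc {f:A. (f, g):Lam} ^ 2)
    + (SUM f:A. rc {g:B. (f, g):Lam} ^ 2) - rc Lam)"
proof -
 define I where "I = (%f g. if (f, g):Lam then 1 else (0::real))"
 define N where "N = (%f. {g:B. (f, g):Lam})"
 define rk where "rk = (%f g. card {g':N f. u f g' < u f g})"
 \<comment> \<open>The vector of \<open>f\<close> at height \<open>h\<close> is indexed by pairs of
   list entries and is 0 outside the list of \<open>f\<close>; so an inner product of two vectors
   only sees the common part of the lists.\<close>
 define s where "s = (%h f x y. I f x*I f y*block_sgn h (rk f x) (rk f y))"
 define t where "t = (%f f'. (SUM g:B. I f g*I f' g))"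
 define W where "W = {(f, f'):A \<times> A. f ~= f'}"
 have finN: "finite (N f)" for f using fin by (simp add: N_def)
 have finW: "finite W" using fin by (auto simp: W_def intro: finite_subset[of _ "A \<times> A"])
 have II: "I f g*I f g = I f g" for f g by (simp add: I_def)
 have NI: "rc {g:B. (f, g):Lam} = (SUM g:B. I f g)" for f
  using fin by (simp add: I_def sum.If_cases Int_def)
 have AI: "rc {f:A. (f, g):Lam} = (SUM f:A. I f g)" for g
  using fin by (simp add: I_def sum.If_cases Int_def)
 have E: "rc Lam = (SUM f:A. SUM g:B. I f g)"
 proof -
  have "(SUM f:A. SUM g:B. I f g) = (SUM p:A \<times> B. if p:Lam then 1 else 0)"
   by (simp add: sum.cartesian_product I_def case_prod_beta)
  also have "... = rc Lam" using fin by (simp add: sum.If_cases Int_absorb1)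
  finally show ?thesis by simp
 qed
 have tt: "t f f = (SUM g:B. I f g)" for f by (simp add: t_def II)
 have rk_iff: "rk f x < rk f y \<longleftrightarrow> u f x < u f y" if "(f, x):Lam" "(f, y):Lam" for f x y
  unfolding rk_def using that fin finN by (intro rank_less_iff) (auto simp: N_def)
 have u_inj: "u f x ~= u f y" if "(f, x):Lam" "(f, y):Lam" "x ~= y" for f x y
  using S1[OF that] S1[OF that(2,1)] that by force
 have rk_bound: "rk f x < 2^H" if "(f, x):Lam" for f x
 proof -
  have "rk f x < card (N f)" unfolding rk_def using that fin finN by (intro psubset_card_mono) (auto simp: N_def)
  also have "... <= card B" using fin by (intro card_mono) (auto simp: N_def)
  finally show ?thesis using n by simp
 qed
 have pair: "t f f'^2/(4*real (H+1)) - real (H+1)*t f f'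
   <= - (SUM h<=H. SUM x:B. SUM y:B. s h f x y * s h f' x y)" if ff: "f:A" "f':A" "f ~= f'" for f f'
 proof -
  define T where "T = {g:B. (f, g):Lam & (f', g):Lam}"
  have T: "finite T" "!!x. x:T ==> (f, x):Lam" "!!x. x:T ==> (f', x):Lam" "T <= B" using fin by (auto simp: T_def)
  have cT: "t f f' = rc T"
  proof -
   have "t f f' = (SUM g:B. if (f, g):Lam & (f', g):Lam then 1 else 0)"
    unfolding t_def I_def by (intro sum.cong) auto
   thus ?thesis using fin by (simp add: sum.If_cases Int_def T_def)
  qed
  obtain L where L: "!!p q. p:T ==> q:T ==> L p ==> ~L q ==> u f p < u f q & u f' p < u f' q"
   "!!p q. p:T ==> q:T ==> p ~= q ==> L p = L q ==> u f p < u f q \<longleftrightarrow> u f' q < u f' p"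
  proof (rule common_part_reversed[of "%x. F f x - F f' x" T G "u f" "u f'"])
   show "no_alternation (%x. F f x - F f' x)" using altF ff by auto
   show "no_alternation (%z. G x z - G y z)" if "x:T" "y:T" for x y using altG that T(4) by blast
   show "0 < F f (u f x) - F f' (u f x)" if "x:T" for x using S2[of f x f'] T that ff by auto
   show "F f (u f' x) - F f' (u f' x) < 0" if "x:T" for x using S2[of f' x f] T that ff by auto
   show "G x (u f x) < G y (u f x)" if "x:T" "y:T" "x ~= y" for x y using S1[of f x y] T that by auto
   show "G x (u f' x) < G y (u f' x)" if "x:T" "y:T" "x ~= y" for x y using S1[of f' x y] T that by auto
  qed blast
  have inj: "inj_on (rk f) T" "inj_on (rk f') T"
   using rk_iff u_inj T by (metis inj_onI less_irrefl linorder_neqE_linordered_idom)+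
  have "rc T^2/(4*real (H+1)) - real (H+1)*rc T
   <= - (SUM h<=H. SUM x:T. SUM y:T. block_sgn h (rk f x) (rk f y)*block_sgn h (rk f' x) (rk f' y))"
  proof (rule block_correlation[OF T(1) inj, of H L])
   show "rk f p < rk f q & rk f' p < rk f' q" if "p:T" "q:T" "L p" "~L q" for p q
    using L(1)[OF that] rk_iff T that by auto
   show "(rk f p < rk f q) = (rk f' q < rk f' p)" if "p:T" "q:T" "p ~= q" "L p = L q" for p q
    using L(2)[OF that] rk_iff T that by auto
  qed (use rk_bound T in auto)
  also have "(SUM h<=H. SUM x:T. SUM y:T. block_sgn h (rk f x) (rk f y)*block_sgn h (rk f' x) (rk f' y))
   = (SUM h<=H. SUM x:B. SUM y:B. s h f x y * s h f' x y)"
  proof (rule sum.cong[OF refl])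
   fix h
   have z: "s h f x y * s h f' x y = 0" if "x:B - T | y:B - T" for x y
    using that by (auto simp: s_def I_def T_def)
   have "(SUM x:B. SUM y:B. s h f x y * s h f' x y) = (SUM x:T. SUM y:B. s h f x y * s h f' x y)"
    using z by (intro sum.mono_neutral_right[OF fin(2) T(4)] ballI sum.neutral) blast
   also have "... = (SUM x:T. SUM y:T. s h f x y * s h f' x y)"
    using z by (intro sum.cong[OF refl] sum.mono_neutral_right[OF fin(2) T(4)]) blast
   also have "... = (SUM x:T. SUM y:T. block_sgn h (rk f x) (rk f y)*block_sgn h (rk f' x) (rk f' y))"
    using T(2,3) by (intro sum.cong[OF refl]) (simp add: s_def I_def)
   finally show "(SUM x:T. SUM y:T. block_sgn h (rk f x) (rk f y)*block_sgn h (rk f' x) (rk f' y))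
     = (SUM x:B. SUM y:B. s h f x y * s h f' x y)" by simp
  qed
  finally show ?thesis by (simp add: cT)
 qed
 have diag: "(SUM h<=H. SUM x:B. SUM y:B. s h f x y * s h f x y) <= real (H+1)*t f f^2" for f
 proof -
  have "(SUM x:B. SUM y:B. s h f x y * s h f x y) <= t f f^2" for h
  proof -
   have "(SUM x:B. SUM y:B. s h f x y * s h f x y) <= (SUM x:B. SUM y:B. I f x*I f y)"
    by (intro sum_mono) (auto simp: s_def I_def block_sgn_def)
   thus ?thesis by (simp add: tt power2_eq_square sum_product)
  qed
  hence "(SUM h<=H. SUM x:B. SUM y:B. s h f x y * s h f x y) <= (SUM h<=H. t f f^2)" by (intro sum_mono)
  thus ?thesis by simp
 qed
 have split: "(SUM f:A. SUM f':A. Q f f') = (SUM f:A. Q f f)+(SUM (f, f'):W. Q f f')" for Q :: "'a => 'a => real"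
 proof -
  have "A \<times> A = (%f. (f, f)) ` A \<union> W" by (auto simp: W_def)
  hence "(SUM f:A. SUM f':A. Q f f') = (SUM (f, f'):(%f. (f, f)) ` A \<union> W. Q f f')" by (simp add: sum.cartesian_product)
  also have "... = (SUM (f, f'):(%f. (f, f)) ` A. Q f f')+(SUM (f, f'):W. Q f f')"
   using fin finW by (intro sum.union_disjoint) (auto simp: W_def)
  also have "(SUM (f, f'):(%f. (f, f)) ` A. Q f f') = (SUM f:A. Q f f)"
   by (subst sum.reindex) (auto simp: inj_on_def)
  finally show ?thesis .
 qed
 have gram: "0 <= (SUM f:A. SUM f':A. SUM h<=H. SUM x:B. SUM y:B. s h f x y * s h f' x y)"
 proof -
  have "(SUM f:A. SUM f':A. SUM h<=H. SUM x:B. SUM y:B. s h f x y * s h f' x y)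
    = (SUM h<=H. SUM x:B. SUM y:B. SUM f:A. SUM f':A. s h f x y * s h f' x y)"
   by (subst sum_swap3, rule sum.cong[OF refl], subst sum_swap3, rule sum.cong[OF refl], rule sum_swap3)
  also have "... = (SUM h<=H. SUM x:B. SUM y:B. (SUM f:A. s h f x y)^2)"
   by (simp add: power2_eq_square sum_product)
  also have "... >= 0" by (intro sum_nonneg) auto
  finally show ?thesis .
 qed
 have St: "(SUM f:A. SUM f':A. t f f') = (SUM g:B. (SUM f:A. I f g)^2)"
 proof -
  have "(SUM f:A. SUM f':A. t f f') = (SUM g:B. SUM f:A. SUM f':A. I f g*I f' g)"
   unfolding t_def by (rule sum_swap3)
  thus ?thesis by (simp add: power2_eq_square sum_product)
 qed
 define S where "S = (SUM (f, f'):W. t f f')"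
 have S_eq: "S = (SUM g:B. (SUM f:A. I f g)^2) - rc Lam"
  using split[of t] by (simp add: St S_def E tt)
 have "(SUM (f, f'):W. t f f'^2/(4*real (H+1)) - real (H+1)*t f f')
   <= (SUM (f, f'):W. - (SUM h<=H. SUM x:B. SUM y:B. s h f x y * s h f' x y))"
  using pair by (intro sum_mono) (auto simp: W_def)
 also have "... <= (SUM f:A. SUM h<=H. SUM x:B. SUM y:B. s h f x y * s h f x y)"
  using gram unfolding split[of "%f f'. SUM h<=H. SUM x:B. SUM y:B. s h f x y * s h f' x y"]
  by (simp add: sum_negf case_prod_beta)
 also have "... <= (SUM f:A. real (H+1)*t f f^2)" by (intro sum_mono diag)
 also have "... = real (H+1)*(SUM f:A. (SUM g:B. I f g)^2)" by (simp add: sum_distrib_left tt)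
 finally have main: "(SUM (f, f'):W. t f f'^2)/(4*real (H+1))
   <= real (H+1)*(S+(SUM f:A. (SUM g:B. I f g)^2))"
  by (simp add: S_def sum_subtractf case_prod_beta sum_distrib_left sum_divide_distrib ring_distribs)
 \<comment> \<open>Cauchy-Schwarz over at most \<open>n^2\<close> ordered pairs: the second moment
   of the common parts, bounded by the diagonal of the Gram sum, controls their sum.\<close>
 have "S^2 = (SUM p:W. 1*(case p of (f, f') => t f f'))^2" by (simp add: S_def)
 also have "... <= (SUM p:W. 1^2)*(SUM p:W. (case p of (f, f') => t f f')^2)"
  by (rule Cauchy_Schwarz_ineq_sum)
 also have "... <= real n^2*(SUM (f, f'):W. t f f'^2)"
 proof -
  have "card W <= card (A \<times> A)" using fin by (intro card_mono) (auto simp: W_def)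
  also have "... <= n^2" using n by (simp add: card_cartesian_product power2_eq_square mult_le_mono)
  finally have "rc W <= real n^2" by (metis of_nat_le_iff of_nat_power)
  thus ?thesis by (simp add: case_prod_beta mult_right_mono sum_nonneg)
 qed
 finally have "S^2 <= real n^2*(SUM (f, f'):W. t f f'^2)" .
 also have "... <= real n^2*(4*real (H+1)*(real (H+1)*(S+(SUM f:A. (SUM g:B. I f g)^2))))"
  using main by (intro mult_left_mono) (auto simp: field_simps)
 finally have "S^2 <= 4*real (H+1)^2*real n^2*(S+(SUM f:A. (SUM g:B. I f g)^2))"
  by (simp add: power2_eq_square mult_ac)
 thus ?thesis unfolding S_eq AI NI by (simp add: algebra_simps)
qed

text \<open>The Gram estimate is used for \<open>Lam\<close> and for its transpose, with
  \<open>F\<close> and \<open>G\<close> exchanged and negated. The larger of the two second moments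
  \<open>X\<close>, \<open>Y\<close> of the degrees then bounds itself, and Cauchy-Schwarz leads
  back to the number of pairs.\<close>

lemma lens_packing:
 fixes F :: "'a => real => real" and G :: "'b => real => real" and u :: "'a => 'b => real"
 assumes fin: "finite A" "finite B" "Lam <= A \<times> B" and n: "card A <= n" "card B <= n" "n <= 2^H" "n > 0"
  and S1: "!!f g g'. (f, g):Lam ==> (f, g'):Lam ==> g ~= g' ==> G g (u f g) < G g' (u f g)"
  and S2: "!!f f' g. (f, g):Lam ==> (f', g):Lam ==> f ~= f' ==> F f' (u f g) < F f (u f g)"
  and altF: "!!f f'. f:A ==> f':A ==> no_alternation (%x. F f x - F f' x)"
  and altG: "!!g g'. g:B ==> g':B ==> no_alternation (%x. G g x - G g' x)"
 shows "rc Lam^2 <= 24*real (H+1)^2*real n^3"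
proof -
 define E where "E = rc Lam"
 define X where "X = (SUM g:B. rc {f:A. (f, g):Lam} ^ 2)"
 define Y where "Y = (SUM f:A. rc {g:B. (f, g):Lam} ^ 2)"
 have finL: "finite Lam" using fin finite_subset by blast
 have 1: "(X - E)^2 <= 4*real (H+1)^2*real n^2*(X+Y - E)"
  unfolding X_def Y_def E_def by (rule packing_gram[OF fin n S1 S2 altF altG])
 define Lam' where "Lam' = prod.swap ` Lam"
 have L': "(g, f):Lam' \<longleftrightarrow> (f, g):Lam" for f g by (force simp: Lam'_def)
 have "((SUM g:A. rc {f:B. (f, g):Lam'} ^ 2) - rc Lam')^2
  <= 4*real (H+1)^2*real n^2*((SUM g:A. rc {f:B. (f, g):Lam'} ^ 2)
    + (SUM f:B. rc {g:A. (f, g):Lam'} ^ 2) - rc Lam')"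
 proof (rule packing_gram[where F = "%g x. - G g x" and G = "%f x. - F f x" and u = "%g f. u f g"])
  show "Lam' <= B \<times> A" using fin by (auto simp: Lam'_def)
  show "no_alternation (%x. - G f x - - G f' x)" if "f:B" "f':B" for f f' using altG[OF that(2,1)] by simp
  show "no_alternation (%x. - F f x - - F f' x)" if "f:A" "f':A" for f f' using altF[OF that(2,1)] by simp
 qed (use fin n S1 S2 L' in auto)
 moreover have cL: "card Lam' = card Lam" unfolding Lam'_def by (intro card_image) (auto simp: inj_on_def)
 ultimately have 2: "(Y - E)^2 <= 4*real (H+1)^2*real n^2*(X+Y - E)"
  by (simp add: L' X_def Y_def E_def add.commute)
 have Es: "E = (SUM f:A. rc {g:B. (f, g):Lam})" "E = (SUM g:B. rc {f:A. (f, g):Lam})"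
 proof -
  have "Lam = (SIGMA f:A. {g:B. (f, g):Lam})" using fin by auto
  hence "card Lam = card (SIGMA f:A. {g:B. (f, g):Lam})" by simp
  also have "... = (SUM f:A. card {g:B. (f, g):Lam})" using fin by simp
  finally show "E = (SUM f:A. rc {g:B. (f, g):Lam})" by (simp add: E_def)
  have "Lam' = (SIGMA g:B. {f:A. (f, g):Lam})" using fin by (auto simp: Lam'_def)
  hence "card Lam' = card (SIGMA g:B. {f:A. (f, g):Lam})" by simp
  also have "... = (SUM g:B. card {f:A. (f, g):Lam})" using fin by simp
  finally show "E = (SUM g:B. rc {f:A. (f, g):Lam})" using cL by (simp add: E_def)
 qed
 have EX: "E^2 <= real n*X"
 proof -
  have "E^2 <= (SUM g:B. 1^2)*X"
   using Cauchy_Schwarz_ineq_sum[of "%_. 1" "%g. rc {f:A. (f, g):Lam}" B] Es(2) by (simp add: X_def)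
  also have "... <= real n*X" using n by (intro mult_right_mono) (auto simp: X_def sum_nonneg)
  finally show ?thesis .
 qed
 have EY: "E^2 <= real n*Y"
 proof -
  have "E^2 <= (SUM g:A. 1^2)*Y"
   using Cauchy_Schwarz_ineq_sum[of "%_. 1" "%f. rc {g:B. (f, g):Lam}" A] Es(1) by (simp add: Y_def)
  also have "... <= real n*Y" using n by (intro mult_right_mono) (auto simp: Y_def sum_nonneg)
  finally show ?thesis .
 qed
 define K where "K = 4*real (H+1)^2*real n^2"
 have K: "K >= 0" by (simp add: K_def)
 have n1: "real n >= 1" using n by simp
 have E0: "E >= 0" by (simp add: E_def)
 \<comment> \<open>If \<open>E > 2 n\<close>, then \<open>2 E <= Z\<close>, so
   \<open>S = Z - E\<close> is at least \<open>E\<close> and the quadratic inequality collapses to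
   \<open>S <= 3 K\<close>, hence \<open>Z <= 6 K\<close>. The 24 is this 6 times the 4 in
   \<open>K\<close>.\<close>
 have key: "E^2 <= 24*real (H+1)^2*real n^3"
  if Z: "E^2 <= real n*Z" "(Z - E)^2 <= K*(2*Z - E)" for Z
 proof (cases "E <= 2*real n")
  case True
  have "E^2 <= (2*real n)^2" using True E0 by (intro power_mono)
  also have "... = 4*1*real n^2*1" by (simp add: power2_eq_square)
  also have "... <= 24*real (H+1)^2*real n^2*real n"
   using n1 by (intro mult_mono) auto
  finally show ?thesis by (simp add: power3_eq_cube power2_eq_square)
 next
  case False
  define S where "S = Z - E"
  have "E*(2*real n) <= E*E" using False E0 by (intro mult_left_mono) auto
  hence "real n*(2*E) <= real n*Z" using Z(1) by (simp add: power2_eq_square mult_ac)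
  hence S: "E <= S" using n1 by (simp add: S_def)
  have "S^2 <= K*(2*S+E)" using Z(2) by (simp add: S_def)
  also have "... <= K*(3*S)" using S K by (intro mult_left_mono) auto
  finally have "S*S <= (3*K)*S" by (simp add: power2_eq_square)
  hence "S <= 3*K" using S False n1 by (intro mult_right_le_imp_le[of S S "3*K"]) auto
  hence "Z <= 6*K" using S by (simp add: S_def)
  hence "E^2 <= real n*(6*K)" using Z(1) n1 by (meson mult_left_mono order_trans of_nat_0_le_iff)
  thus ?thesis by (simp add: K_def power3_eq_cube power2_eq_square mult_ac)
 qed
 show ?thesis
 proof (cases "X <= Y")
  case True
  have "K*(X+Y - E) <= K*(2*Y - E)" using True K by (intro mult_left_mono) auto
  thus ?thesis using key[OF EY order_trans[OF 2[folded K_def]]] by (simp add: E_def)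
 next
  case False
  have "K*(X+Y - E) <= K*(2*X - E)" using False K by (intro mult_left_mono) auto
  thus ?thesis using key[OF EX order_trans[OF 1[folded K_def]]] by (simp add: E_def)
 qed
qed

section \<open>Polynomial partitioning\<close>

interpretation fun_space: vector_space "%(c::real) (f::'a => real) x. c*f x"
 by unfold_locales (auto simp: fun_eq_iff algebra_simps)

text \<open>A relation instead of a dimension operator, as the ambient space of all functions has
  infinite dimension; the spaces considered are cut out of a finite-dimensional one by point
  conditions.\<close>

definition has_dim :: "('a => real) set => nat => bool" where
 "has_dim W n \<longleftrightarrow> (EX B. finite B & card B = n & fun_space.independent B & fun_space.span B = W)"

definition vanishing :: "('a => real) set => 'a set => ('a => real) set" where
 "vanishing V T = {f:V. ALL x:T. f x = 0}"

lemma vanishing_insert: "vanishing V (insert x T) = {f:vanishing V T. f x = 0}"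
 by (auto simp: vanishing_def)

lemma has_dim_unique: "has_dim W n ==> has_dim W m ==> n = m"
 unfolding has_dim_def using fun_space.dim_span_eq_card_independent by metis

lemma has_dim_subspace: "has_dim W n ==> fun_space.subspace W"
 unfolding has_dim_def by auto

lemma has_dim_nonzero:
 assumes "has_dim W n" "n >= 1" shows "EX f:W. f ~= 0"
proof -
 obtain B where B: "finite B" "card B = n" "fun_space.independent B" "fun_space.span B = W"
  using assms by (auto simp: has_dim_def)
 then obtain b where "b:B" using assms by fastforce
 hence "b:W" "b ~= 0" using B fun_space.span_base fun_space.dependent_zero by blast+
 thus ?thesis by blast
qed

text \<open>Evaluation at \<open>x\<close> is a linear functional on \<open>W\<close>, nonzero
  because of \<open>f0\<close>; its kernel has codimension one.\<close>

lemma has_dim_kernel: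
 assumes W: "has_dim W n" and f0: "f0:W" "f0 x ~= 0"
 shows "n >= 1" "has_dim {f:W. f x = 0} (n - 1)"
proof -
 obtain B where B: "finite B" "card B = n" "fun_space.independent B" "fun_space.span B = W"
  using W by (auto simp: has_dim_def)
 define W0 where "W0 = {f:W. f x = 0}"
 have sW: "fun_space.subspace W" using has_dim_subspace W by blast
 have "fun_space.subspace W0"
  using sW by (auto simp: W0_def fun_space.subspace_def)
 then obtain B0 where B0: "B0 <= W0" "fun_space.independent B0" "fun_space.span B0 = W0"
  by (metis fun_space.basis_exists fun_space.span_minimal subset_antisym)
 have "B0 <= fun_space.span B" using B0 B by (auto simp: W0_def)
 hence finB0: "finite B0" using fun_space.independent_span_bound[OF B(1) B0(2)] by blast
 have notin: "f0 ~: fun_space.span B0" using B0 f0 by (auto simp: W0_def)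
 have ind: "fun_space.independent (insert f0 B0)"
  using B0 notin by (rule_tac fun_space.independent_insertI) auto
 have "fun_space.span (insert f0 B0) = W"
 proof
  show "fun_space.span (insert f0 B0) <= W"
   using B0 f0 sW by (intro fun_space.span_minimal) (auto simp: W0_def)
  show "W <= fun_space.span (insert f0 B0)"
  proof
   fix f assume f: "f:W"
   have "(%y. (f x/f0 x)*f0 y):W" using fun_space.subspace_scale[OF sW f0(1)] by blast
   hence "f - (%y. (f x/f0 x)*f0 y):W" using fun_space.subspace_diff[OF sW f] by blast
   hence "f - (%y. (f x/f0 x)*f0 y):fun_space.span B0" using f0 B0 by (auto simp: W0_def)
   thus "f:fun_space.span (insert f0 B0)" using fun_space.span_breakdown_eq by blast
  qed
 qed
 hence "has_dim W (card (insert f0 B0))" using ind finB0 by (auto simp: has_dim_def)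
 hence "n = card (insert f0 B0)" using has_dim_unique W by blast
 moreover have "f0 ~: B0" using notin fun_space.span_base by blast
 ultimately have n: "n = Suc (card B0)" using finB0 by simp
 show "n >= 1" using n by simp
 show "has_dim {f:W. f x = 0} (n - 1)" using n finB0 B0 by (auto simp: has_dim_def W0_def)
qed

lemma has_dim_2_span:
 assumes "has_dim W 2"
 obtains b1 b2 where "!!f. f:W ==> EX p q. ALL x. f x = p*b1 x+q*b2 x" "b1:W" "b2:W"
proof -
 obtain B where B: "card B = 2" "fun_space.span B = W" using assms by (auto simp: has_dim_def)
 then obtain b1 b2 where b: "B = {b1, b2}" "b1 ~= b2" by (auto simp: card_2_iff)
 have "EX p q. ALL x. f x = p*b1 x+q*b2 x" if "f:W" for f
 proof -
  have "f:fun_space.span {b1, b2}" using that B b by simp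
  then obtain p where "f - (%x. p*b1 x):fun_space.span {b2}" using fun_space.span_breakdown_eq by blast
  then obtain q where "f - (%x. p*b1 x) - (%x. q*b2 x):fun_space.span {}" using fun_space.span_breakdown_eq by blast
  hence "f - (%x. p*b1 x) - (%x. q*b2 x) = 0" by simp
  hence "f x = p*b1 x+q*b2 x" for x by (simp add: fun_eq_iff algebra_simps)
  thus ?thesis by blast
 qed
 thus ?thesis using that b B fun_space.span_base by blast
qed

text \<open>In a two-dimensional space the functions vanishing at \<open>a\<close> are the multiples of an antisymmetric kernel
 \<open>om(a, x)\<close>; so of three points at least one has a function separating the other two.\<close>

lemma two_dim_separation:
 assumes W: "has_dim W 2"
  and f: "fa:W" "fb:W" "fc:W" "fa a = 0" "fb b = 0" "fc c = 0"
  and nn: "EX g:W. g a ~= 0" "EX g:W. g b ~= 0" "EX g:W. g c ~= 0"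
 shows "fa b*fa c <= 0 | fb a*fb c <= 0 | fc a*fc b <= (0::real)"
proof -
 obtain b1 b2 where b: "!!f. f:W ==> EX p q. ALL x. f x = p*b1 x+q*b2 x" "b1:W" "b2:W"
  using has_dim_2_span[OF W] by blast
 define om where "om = (%s x. b2 s*b1 x - b1 s*b2 x)"
 have ker: "EX m. ALL x. g x = m * om s x" if g: "g:W" "g s = 0" and ex: "EX h:W. h s ~= 0" for g s
 proof -
  obtain p q where pq: "!!x. g x = p*b1 x+q*b2 x" using b(1)[OF g(1)] by blast
  have ne: "b1 s ~= 0 | b2 s ~= 0" using ex b(1) by fastforce
  have z: "p*b1 s+q*b2 s = 0" using pq[of s] g by simp
  show ?thesis
  proof (cases "b2 s = 0")
   case True
   hence "p = 0" "b1 s ~= 0" using ne z by auto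
   thus ?thesis using True by (intro exI[of _ "- q/b1 s"]) (simp add: pq om_def)
  next
   case False
   hence q: "q = - (p/b2 s)*b1 s" using z by (simp add: field_simps add_eq_0_iff)
   show ?thesis using False by (intro exI[of _ "p/b2 s"] allI) (simp add: pq om_def q right_diff_distrib)
  qed
 qed
 obtain ma mb mc where m: "!!x. fa x = ma * om a x" "!!x. fb x = mb * om b x" "!!x. fc x = mc * om c x"
  using ker f nn by metis
 show ?thesis
 proof (rule ccontr)
  assume "~?thesis"
  hence P: "fa b*fa c > 0" "fb a*fb c > 0" "fc a*fc b > 0" by auto
  have sq: "u * v > 0" if "(m*u)*(m * v) > 0" for m u v :: real
  proof -
   have "m^2*(u * v) > 0" using that by (simp add: power2_eq_square mult_ac)
   moreover have "m^2 >= 0" by simp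
   ultimately show ?thesis using zero_less_mult_iff by (metis not_less)
  qed
  \<comment> \<open>Rescaling leaves the signs of these products unchanged. With antisymmetry
    \<open>om a b\<close> has the sign of \<open>om a c\<close>, thus of \<open>om b c\<close>, thus
    of \<open>om b a\<close>, its own negative.\<close>
  have "om a b * om a c > 0" "om b a * om b c > 0" "om c a * om c b > 0"
   using P sq unfolding m by blast+
  moreover have "om b a = - om a b" "om c a = - om a c" "om c b = - om b c" by (auto simp: om_def)
  ultimately show False by (auto simp: zero_less_mult_iff mult_less_0_iff)
 qed
qed

text \<open>\<open>N a b c\<close> will say that the function attached to \<open>a\<close> does not
  put \<open>b\<close> and \<open>c\<close> strictly on the same side. Three relabelled copies of
  the good triples cover all of \<open>S x S x S\<close>.\<close>

lemma average_triples:
 fixes N :: "'a => 'a => 'a => bool"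
 assumes fin: "finite S" and tri: "!!a b c. a:S ==> b:S ==> c:S ==> N a b c | N b a c | N c a b"
 shows "card S^3 <= 3*(SUM a:S. card {(b, c):S \<times> S. N a b c})"
proof -
 define G where "G = {(a, b, c):S \<times> S \<times> S. N a b c}"
 have finG: "finite G" using fin by (auto simp: G_def intro: finite_subset[of _ "S \<times> S \<times> S"])
 have "G = (SIGMA a:S. {(b, c):S \<times> S. N a b c})" by (auto simp: G_def)
 hence cG: "card G = (SUM a:S. card {(b, c):S \<times> S. N a b c})"
  using fin by (subst card_SigmaI[symmetric]) (auto intro: finite_subset[of _ "S \<times> S"])
 have "S \<times> S \<times> S <= G \<union> (%(b, a, c). (a, b, c)) ` G \<union> (%(c, a, b). (a, b, c)) ` G"
 proof
  fix p assume "p:S \<times> S \<times> S"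
  then obtain a b c where p: "p = (a, b, c)" "a:S" "b:S" "c:S" by auto
  consider "(a, b, c):G" | "(b, a, c):G" | "(c, a, b):G" using tri[OF p(2-4)] p by (auto simp: G_def)
  thus "p:G \<union> (%(b, a, c). (a, b, c)) ` G \<union> (%(c, a, b). (a, b, c)) ` G"
   by cases (auto simp: p(1) image_iff, (force)+)
 qed
 hence "card (S \<times> S \<times> S) <= card (G \<union> (%(b, a, c). (a, b, c)) ` G \<union> (%(c, a, b). (a, b, c)) ` G)"
  using finG by (intro card_mono) auto
 also have "... <= card G+card ((%(b, a, c). (a, b, c)) ` G)+card ((%(c, a, b). (a, b, c)) ` G)"
  by (intro order_trans[OF card_Un_le] add_mono card_Un_le) auto
 also have "... <= 3*card G" using finG card_image_le[of G "%(b, a, c). (a, b, c)"] card_image_le[of G "%(c, a, b). (a, b, c)"] by simp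
 finally show ?thesis by (simp add: cG card_cartesian_product power3_eq_cube)
qed

text \<open>Resampling one coordinate preserves the uniform average: \<open>(y, t)\<close> and
  \<open>(y(i := t), y i)\<close> are exchanged by an involution.\<close>

lemma sum_PiE_update:
 fixes g :: "('i => 'a) => real"
 assumes "finite I" "i:I"
 shows "(SUM y:PiE I S. SUM t:S i. g (y(i := t))) = rc (S i)*(SUM y:PiE I S. g y)"
proof -
 have "(SUM y:PiE I S. SUM t:S i. g (y(i := t))) = (SUM (y, t):PiE I S \<times> S i. g (y(i := t)))"
  by (rule sum.cartesian_product)
 also have "... = (SUM (y, t):PiE I S \<times> S i. g y)"
  using assms(2)
  by (intro sum.reindex_bij_witness[where i = "%(y, t). (y(i := t), y i)" and j = "%(y, t). (y(i := t), y i)"])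
   (auto simp: PiE_def extensional_def Pi_def)
 also have "... = (SUM y:PiE I S. SUM t:S i. g y)" by (rule sum.cartesian_product[symmetric])
 also have "... = rc (S i)*(SUM y:PiE I S. g y)" by (simp add: sum_distrib_left)
 finally show ?thesis .
qed

text \<open>A weak polynomial ham sandwich without topology: choose one point in every set and a function vanishing at all of them,
 and average over the choices. Generic auxiliary points \<open>zs\<close> cut the remaining freedom down to one dimension.\<close>

lemma separating_function:
 fixes V :: "('a => real) set" and S :: "'i => 'a set" and w :: "'i => real"
 assumes I: "finite I" "!!i. i:I ==> finite (S i)" "!!i. i:I ==> S i ~= {}" "!!i. i:I ==> w i >= 0"
  and V: "has_dim V N" "card I < N"
  and gen: "!!Fs. finite Fs ==> Fs <= V ==> 0 ~: Fs ==> EX z. ALL f:Fs. f z ~= 0"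
 shows "EX f:V. f ~= 0 & (SUM i:I. w i*rc (S i)^2)
   <= 3*(SUM i:I. w i*rc {(x, z):S i \<times> S i. f x*f z <= 0})"
proof -
 define X where "X = (UN i:I. S i)"
 have finX: "finite X" using I by (auto simp: X_def)
 have dim_step: "EX n'. has_dim (vanishing V (insert x T)) n' & n' <= n & n <= n'+1" if "has_dim (vanishing V T) n" for x T n
 proof (cases "EX f:vanishing V T. f x ~= 0")
  case True
  thus ?thesis using has_dim_kernel[OF that] unfolding vanishing_insert by fastforce
 next
  case False
  hence "vanishing V (insert x T) = vanishing V T" unfolding vanishing_insert by auto
  thus ?thesis using that by auto
 qed
 have dim_ex: "EX n. has_dim (vanishing V T) n & N <= n+card T" if "finite T" for T
  using that
 proof (induction T)
  case empty
  thus ?case using V by (auto simp: vanishing_def)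
 next
  case (insert x T)
  then obtain n where "has_dim (vanishing V T) n" "N <= n+card T" by auto
  thus ?case using dim_step[of T n x] insert by force
 qed
 define d where "d = (%T. THE n. has_dim (vanishing V T) n)"
 have d: "has_dim (vanishing V T) (d T)" "N <= d T+card T" if T: "finite T" for T
 proof -
  obtain n where n: "has_dim (vanishing V T) n" "N <= n+card T" using dim_ex[OF T] by blast
  hence "d T = n" unfolding d_def using has_dim_unique by blast
  thus "has_dim (vanishing V T) (d T)" "N <= d T+card T" using n by auto
 qed
 \<comment> \<open>One sequence has to be generic for all subsets \<open>T\<close> of
   \<open>X\<close> simultaneously, so that different sample choices are cut down by a common prefix
   and stay comparable. The next point avoids the zeros of one nonzero function per
   \<open>T\<close>.\<close>
 have "EX zs. length zs = n & (ALL j<n. ALL T<=X. (EX f:vanishing V (T \<union> set (take j zs)). f ~= 0) -->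
   (EX f:vanishing V (T \<union> set (take j zs)). f (zs ! j) ~= 0))" for n
 proof (induction n)
  case (Suc n)
  then obtain zs where zs: "length zs = n" "ALL j<n. ALL T<=X. (EX f:vanishing V (T \<union> set (take j zs)). f ~= 0) -->
   (EX f:vanishing V (T \<union> set (take j zs)). f (zs ! j) ~= 0)" by (elim exE conjE)
  define P where "P = {T:Pow X. EX f:vanishing V (T \<union> set zs). f ~= 0}"
  have "ALL T:P. EX f:vanishing V (T \<union> set zs). f ~= 0" by (auto simp: P_def)
  then obtain F where F: "!!T. T:P ==> F T:vanishing V (T \<union> set zs)" "!!T. T:P ==> F T ~= 0" by metis
  have "finite P" using finX by (auto simp: P_def)
  then obtain z where z: "ALL f:F ` P. f z ~= 0" using gen[of "F ` P"] F by (auto simp: vanishing_def image_iff)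
  have "EX f:vanishing V (T \<union> set (take j (zs @ [z]))). f ((zs @ [z]) ! j) ~= 0"
   if "j < Suc n" "T <= X" "EX f:vanishing V (T \<union> set (take j (zs @ [z]))). f ~= 0" for j T
  proof (cases "j < n")
   case True
   thus ?thesis using zs(2)[rule_format, of j T] zs(1) that(2,3) by (simp add: nth_append)
  next
   case False
   hence "j = n" using that by simp
   hence "T:P" using that zs by (auto simp: P_def)
   hence "F T:vanishing V (T \<union> set zs)" "F T z ~= 0" using F(1) z by auto
   thus ?thesis using \<open>j = n\<close> zs(1) by (auto simp: nth_append)
  qed
  hence "ALL j<Suc n. ALL T<=X. (EX f:vanishing V (T \<union> set (take j (zs @ [z]))). f ~= 0) -->
   (EX f:vanishing V (T \<union> set (take j (zs @ [z]))). f ((zs @ [z]) ! j) ~= 0)" by blast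
  moreover have "length (zs @ [z]) = Suc n" using zs(1) by simp
  ultimately show ?case by blast
 qed auto
 from this[of N] obtain zs where zs: "length zs = N" "ALL j<N. ALL T<=X. (EX f:vanishing V (T \<union> set (take j zs)). f ~= 0) -->
   (EX f:vanishing V (T \<union> set (take j zs)). f (zs ! j) ~= 0)" by (elim exE conjE)
 have dz: "has_dim (vanishing V (T \<union> set (take j zs))) (d T - j)" if "T <= X" "j <= d T" "j <= N" for T j
  using that
 proof (induction j)
  case 0
  hence "finite T" using finX finite_subset by blast
  thus ?case using d(1)[of T] by simp
 next
  case (Suc j)
  hence hd: "has_dim (vanishing V (T \<union> set (take j zs))) (d T - j)" by simp
  have "EX f:vanishing V (T \<union> set (take j zs)). f ~= 0" using has_dim_nonzero[OF hd] Suc by simp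
  then obtain f where f: "f:vanishing V (T \<union> set (take j zs))" "f (zs ! j) ~= 0" using zs(2)[rule_format, of j T] Suc by auto
  have "T \<union> set (take (Suc j) zs) = insert (zs ! j) (T \<union> set (take j zs))"
   using Suc zs by (simp add: take_Suc_conv_app_nth)
  thus ?case using has_dim_kernel(2)[OF hd f] by (simp add: vanishing_insert)
 qed
 have dN: "d T <= N" if "finite T" for T
  using that
 proof (induction T)
  case empty
  have "vanishing V {} = V" by (auto simp: vanishing_def)
  thus ?case using d(1)[of "{}"] V has_dim_unique by fastforce
 next
  case (insert x T)
  thus ?case using dim_step[OF d(1), of T x] d(1)[of "insert x T"] has_dim_unique by fastforce
 qed
 define Y where "Y = PiE I S"
 have Y: "finite Y" "Y ~= {}" using I by (auto simp: Y_def PiE_eq_empty_iff intro: finite_PiE)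
 have yX: "y ` J <= X" "finite (y ` J)" if "y:Y" "J <= I" for y J
 proof -
  have "y x:S x" if "x:J" for x using that \<open>y:Y\<close> \<open>J <= I\<close> by (auto simp: Y_def)
  thus "y ` J <= X" using \<open>J <= I\<close> by (force simp: X_def)
  show "finite (y ` J)" using \<open>J <= I\<close> I(1) by (auto intro: finite_subset)
 qed
 have d1: "d (y ` I) >= 1" if "y:Y" for y
  using d(2)[OF yX(2)[OF that subset_refl]] V card_image_le[OF I(1), of y] by simp
 \<comment> \<open>A prefix of length one less than the dimension leaves a line of
   functions.\<close>
 have "EX f. f:vanishing V (y ` I \<union> set (take (d (y ` I) - 1) zs)) & f ~= 0" if "y:Y" for y
 proof -
  have "has_dim (vanishing V (y ` I \<union> set (take (d (y ` I) - 1) zs))) (d (y ` I) - (d (y ` I) - 1))"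
   using yX[OF that subset_refl] dN[of "y ` I"] by (intro dz) auto
  thus ?thesis using has_dim_nonzero d1[OF that] by fastforce
 qed
 then obtain ph where ph: "!!y. y:Y ==> ph y:vanishing V (y ` I \<union> set (take (d (y ` I) - 1) zs))"
  "!!y. y:Y ==> ph y ~= 0" by metis
 define Nf where "Nf = (%i f. {(x, z):S i \<times> S i. f x*f z <= (0::real)})"
 have local: "rc (S i)^3 <= 3*(SUM t:S i. rc (Nf i (ph (y(i := t)))))" if i: "i:I" and y: "y:Y" for i y
 proof -
  define T where "T = y ` (I - {i})"
  have T: "T <= X" "finite T" using yX[OF y, of "I - {i}"] by (auto simp: T_def)
  have yt: "y(i := t):Y" "y(i := t) ` I = insert t T" if "t:S i" for t
   using that i y by (auto simp: Y_def T_def PiE_def extensional_def Pi_def)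
  have "card T <= card I - 1" unfolding T_def using I(1) i card_image_le[of "I - {i}" y] by simp
  moreover have "card I >= 1" using I(1) i by (metis One_nat_def Suc_leI card_gt_0_iff empty_iff)
  ultimately have d2: "d T >= 2" using d(2)[OF T(2)] V by simp
  \<comment> \<open>\<open>W\<close> does not depend on the sample in \<open>S i\<close>. A new
    point \<open>t\<close> that lowers the dimension does so by one, so the function for
    \<open>y(i := t)\<close> uses the same prefix of length \<open>d T - 2\<close> and lies in this
    plane of functions.\<close>
  define W where "W = vanishing V (T \<union> set (take (d T - 2) zs))"
  have W: "has_dim W 2" using dz[OF T(1), of "d T - 2"] d2 dN[OF T(2)] by (simp add: W_def)
  \<comment> \<open>Degenerate sample points: if every function vanishing on \<open>T\<close> also
    vanishes at \<open>t\<close>, any product with a factor at \<open>t\<close> is zero, so the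
    separation is free.\<close>
  have null: "ph (y(i := s)) t = 0" if "s:S i" "ALL f:vanishing V T. f t = 0" for s t
  proof -
   have "ph (y(i := s)):vanishing V T" using ph(1)[OF yt(1)[OF that(1)]] yt(2)[OF that(1)] by (auto simp: vanishing_def)
   thus ?thesis using that by auto
  qed
  have nonnull: "ph (y(i := t)):W & ph (y(i := t)) t = 0 & (EX g:W. g t ~= 0)"
   if t: "t:S i" and ex: "EX f:vanishing V T. f t ~= 0" for t
  proof -
   obtain f where f: "f:vanishing V T" "f t ~= 0" using ex by blast
   have "has_dim (vanishing V (insert t T)) (d T - 1)"
    using has_dim_kernel(2)[OF d(1)[OF T(2)] f] by (simp add: vanishing_insert)
   hence dt: "d (insert t T) = d T - 1" using d(1)[of "insert t T"] T has_dim_unique by blast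
   have ph: "ph (y(i := t)):vanishing V (insert t T \<union> set (take (d T - 2) zs))"
    using ph(1)[OF yt(1)[OF t]] unfolding yt(2)[OF t] dt by (simp add: numeral_2_eq_2)
   have "insert t T <= X" using T t i by (auto simp: X_def)
   hence "has_dim (vanishing V (insert t T \<union> set (take (d T - 2) zs))) (d (insert t T) - (d T - 2))"
    using d2 dN[OF T(2)] by (intro dz) (auto simp: dt)
   hence h1: "has_dim {f:W. f t = 0} 1" using d2 by (simp add: dt W_def vanishing_insert[symmetric])
   have "EX g:W. g t ~= 0"
   proof (rule ccontr)
    assume "~?thesis"
    hence "{f:W. f t = 0} = W" by auto
    thus False using h1 W has_dim_unique by fastforce
   qed
   thus ?thesis using ph by (auto simp: W_def vanishing_def)
  qed
  have tri: "ph (y(i := a)) b*ph (y(i := a)) c <= 0 | ph (y(i := b)) a*ph (y(i := b)) c <= 0 | ph (y(i := c)) a*ph (y(i := c)) b <= 0"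
   if abc: "a:S i" "b:S i" "c:S i" for a b c
  proof (cases "(EX f:vanishing V T. f a ~= 0) & (EX f:vanishing V T. f b ~= 0) & (EX f:vanishing V T. f c ~= 0)")
   case True
   thus ?thesis using nonnull[OF abc(1)] nonnull[OF abc(2)] nonnull[OF abc(3)]
     two_dim_separation[OF W, of "ph (y(i := a))" "ph (y(i := b))" "ph (y(i := c))" a b c] by blast
  next
   case False
   then consider "ALL f:vanishing V T. f a = 0" | "ALL f:vanishing V T. f b = 0" | "ALL f:vanishing V T. f c = 0" by blast
   thus ?thesis using null abc by cases simp_all
  qed
  have "card (S i)^3 <= 3*(SUM t:S i. card (Nf i (ph (y(i := t)))))"
   unfolding Nf_def using average_triples[OF I(2)[OF i], of "%a b c. ph (y(i := a)) b*ph (y(i := a)) c <= 0"] tri by blast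
  hence "real (card (S i)^3) <= real (3*(SUM t:S i. card (Nf i (ph (y(i := t))))))" by (rule of_nat_mono)
  thus ?thesis by simp
 qed
 \<comment> \<open>Summing the local inequality over all samples and resampling coordinate
   \<open>i\<close> cancels one factor, the size of \<open>S i\<close>.\<close>
 have avg: "(SUM y:Y. rc (S i)^2) <= 3*(SUM y:Y. rc (Nf i (ph y)))" if i: "i:I" for i
 proof -
  have pos: "rc (S i) > 0" using I(2,3)[OF i] by (simp add: card_gt_0_iff)
  have "rc (S i)*(SUM y:Y. rc (S i)^2) = (SUM y:Y. rc (S i)^3)"
   by (simp add: power2_eq_square power3_eq_cube)
  also have "... <= (SUM y:Y. 3*(SUM t:S i. rc (Nf i (ph (y(i := t))))))" using local[OF i] by (intro sum_mono)
  also have "... = 3*(rc (S i)*(SUM y:Y. rc (Nf i (ph y))))"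
   using sum_PiE_update[OF I(1) i, of "%y. rc (Nf i (ph y))" S] unfolding Y_def by (simp add: sum_distrib_left[symmetric])
  finally show ?thesis using pos by simp
 qed
 have "EX y:Y. (SUM i:I. w i*rc (S i)^2) <= 3*(SUM i:I. w i*rc (Nf i (ph y)))"
 proof (rule ccontr)
  assume "~?thesis"
  hence "(SUM y:Y. 3*(SUM i:I. w i*rc (Nf i (ph y)))) < (SUM y:Y. (SUM i:I. w i*rc (S i)^2))"
   using Y by (intro sum_strict_mono) (auto simp: not_le)
  also have "... = (SUM i:I. w i*(SUM y:Y. rc (S i)^2))"
   by (subst sum.swap) (simp add: sum_distrib_left mult_ac)
  also have "... <= (SUM i:I. w i*(3*(SUM y:Y. rc (Nf i (ph y)))))"
   using avg I by (intro sum_mono mult_left_mono) auto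
  also have "... = (SUM i:I. SUM y:Y. 3*(w i*rc (Nf i (ph y))))"
   by (simp add: sum_distrib_left mult_ac)
  also have "... = (SUM y:Y. SUM i:I. 3*(w i*rc (Nf i (ph y))))" by (rule sum.swap)
  also have "... = (SUM y:Y. 3*(SUM i:I. w i*rc (Nf i (ph y))))" by (simp add: sum_distrib_left)
  finally show False by simp
 qed
 then obtain y where "y:Y" "(SUM i:I. w i*rc (S i)^2) <= 3*(SUM i:I. w i*rc (Nf i (ph y)))" by blast
 thus ?thesis using ph[of y] unfolding Nf_def by (intro bexI[of _ "ph y"]) (auto simp: vanishing_def)
qed

section \<open>Polynomials with bounded exponents\<close>

lemma sum_fun_apply: "(SUM i:I. f i) x = (SUM i:I. f i x)" for f :: "'i => 'a => real"
 by (induction I rule: infinite_finite_induct) auto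

text \<open>Induction over the variables: for fixed values of the others the sum is a univariate
  polynomial in the new variable, so its coefficients, which are sums of the same kind, vanish
  identically.\<close>

lemma monomials_independent:
 assumes "finite B" "!!x::'b => real. (SUM m:PiE B (%_. {..<t}). c m*(PROD b:B. x b^m b)) = 0"
  and "m:PiE B (%_. {..<t})"
 shows "c m = (0::real)"
 using assms
proof (induction B arbitrary: c m)
 case empty
 thus ?case by simp
next
 case (insert b B)
 define Q where "Q = (%k x. SUM m:PiE B (%_. {..<t}). c (m(b := k))*(PROD b:B. x b^m b))"
 have inj: "inj_on (%(y, g). g(b := y)) ({..<t} \<times> PiE B (%_. {..<t}))"
  using insert.hyps(2) by (rule inj_combinator)
 have expand: "(SUM m:PiE (insert b B) (%_. {..<t}). c m*(PROD b:insert b B. x b^m b)) = (SUM k<t. x b^k*Q k x)" for x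
 proof -
  define g where "g = (%m. c m*(PROD b:insert b B. x b^m b))"
  have "(SUM m:PiE (insert b B) (%_. {..<t}). g m) = (SUM p:{..<t} \<times> PiE B (%_. {..<t}). g (case p of (y, h) => h(b := y)))"
   unfolding PiE_insert_eq using sum.reindex[OF inj, of g] by (simp add: comp_def)
  also have "... = (SUM (k, m):{..<t} \<times> PiE B (%_. {..<t}). c (m(b := k))*(x b^k*(PROD b:B. x b^m b)))"
  proof (rule sum.cong[OF refl])
   fix p assume "p:{..<t} \<times> PiE B (%_. {..<t})"
   obtain k m where p: "p = (k, m)" by force
   have "(PROD b':B. x b'^(m(b := k)) b') = (PROD b:B. x b^m b)"
    using insert.hyps by (intro prod.cong) auto
   thus "g (case p of (y, h) => h(b := y)) = (case p of (k, m) => c (m(b := k))*(x b^k*(PROD b:B. x b^m b)))"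
    using insert.hyps by (simp add: p g_def)
  qed
  also have "... = (SUM k<t. x b^k*Q k x)"
   unfolding sum.cartesian_product[symmetric] Q_def sum_distrib_left by (intro sum.cong refl) (simp add: mult_ac)
  finally show ?thesis unfolding g_def .
 qed
 have "Q k x = 0" if "k < t" for k x
 proof -
  have Qupd: "Q k (x(b := s)) = Q k x" for k s
   unfolding Q_def using insert.hyps by (intro sum.cong refl arg_cong2[where f = times] prod.cong) auto
  have "(SUM k<t. Q k x * s^k) = 0" for s
   using expand[of "x(b := s)"] insert.prems(1)[of "x(b := s)"] by (simp add: Qupd mult.commute)
  hence "poly (SUM k<t. monom (Q k x) k) s = 0" for s by (simp add: poly_sum poly_monom)
  hence "(SUM k<t. monom (Q k x) k) = 0" using poly_all_0_iff_0 by blast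
  hence "coeff (SUM k<t. monom (Q k x) k) k = 0" by simp
  thus ?thesis using that by (simp add: coeff_sum)
 qed
 note Q0 = this
 obtain k m' where m: "m = m'(b := k)" "k < t" "m':PiE B (%_. {..<t})"
  using insert.prems(2) unfolding PiE_insert_eq by auto
 show ?case unfolding m(1)
  by (rule insert.IH[of "%m. c (m(b := k))"]) (use Q0[OF m(2)] m in \<open>auto simp: Q_def\<close>)
qed

text \<open>Bounding the exponent of each variable separately makes the dimension exactly a power of
  \<open>t\<close>; the total degree grows only by the factor \<open>DIM('a)\<close>.\<close>

lemma polynomial_space:
 obtains V :: "('a::euclidean_space => real) set" where "has_dim V (t^DIM('a))" "!!f. f:V ==> polyf (DIM('a)*t) f"
proof -
 define M where "M = PiE (Basis :: 'a set) (%_. {..<t})"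
 define mon :: "('a => nat) => 'a => real" where "mon = (%m x. PROD b:Basis. (x\<bullet>b)^m b)"
 have finM: "finite M" by (auto simp: M_def intro: finite_PiE)
 have lin: "c m = 0" if "!!x. (SUM m:M. c m*mon m x) = 0" "m:M" for c m
 proof (rule monomials_independent[where B = "Basis :: 'a set" and t = t and c = c and m = m])
  fix x :: "'a => real"
  have "(SUM b:Basis. x b *\<^sub>R b)\<bullet>b = x b" if "b:Basis" for b :: 'a
   using that by (rule inner_sum_left_Basis)
  thus "(SUM m:PiE Basis (%_. {..<t}). c m*(PROD b:Basis. x b^m b)) = 0"
   using that(1)[of "SUM b:Basis. x b *\<^sub>R b"] by (simp add: mon_def M_def)
 qed (use that in \<open>auto simp: M_def\<close>)
 have inj: "inj_on mon M"
 proof (rule inj_onI, rule ccontr)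
  fix m m' assume m: "m:M" "m':M" "mon m = mon m'" "m ~= m'"
  define c where "c = (%k. if k = m then 1 else if k = m' then -1 else (0::real))"
  have "(SUM k:M. c k*mon k x) = 0" for x
  proof -
   have "(SUM k:M. c k*mon k x) = (SUM k:{m, m'}. c k*mon k x)"
    using m finM by (intro sum.mono_neutral_right) (auto simp: c_def)
   thus ?thesis using m by (simp add: c_def)
  qed
  thus False using lin[of c m] m by (simp add: c_def)
 qed
 have "fun_space.independent (mon ` M)"
 proof
  assume "fun_space.dependent (mon ` M)"
  then obtain u v where u: "(SUM v:mon ` M. (%x. u v * v x)) = 0" "v:mon ` M" "u v ~= 0"
   using fun_space.dependent_finite[of "mon ` M"] finM by auto
  have "(SUM m:M. u (mon m)*mon m x) = 0" for x
  proof -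
   have "(SUM m:M. (%x. u (mon m)*mon m x)) = 0" using u(1) inj by (simp add: sum.reindex)
   thus ?thesis by (metis (no_types, lifting) sum_fun_apply sum.cong zero_fun_apply)
  qed
  thus False using lin[of "%m. u (mon m)"] u by auto
 qed
 moreover have "card (mon ` M) = t^DIM('a)"
  using inj by (simp add: card_image M_def card_PiE)
 ultimately have 1: "has_dim (fun_space.span (mon ` M)) (t^DIM('a))" using finM unfolding has_dim_def by blast
 have mon: "polyf (DIM('a)*t) (mon m)" if m: "m:M" for m
 proof -
  have "polyf (SUM b:(Basis::'a set). 1*m b) (mon m)" unfolding mon_def
   using polyf_inner[of 0] by (intro polyf_prod polyf_power) simp
  moreover have "(SUM b:(Basis::'a set). 1*m b) <= (SUM b:(Basis::'a set). t)"
   using m by (intro sum_mono) (auto simp: M_def PiE_def Pi_def intro: less_imp_le)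
  ultimately show ?thesis by (auto intro: polyf_mono)
 qed
 have "polyf (DIM('a)*t) f" if "f:fun_space.span (mon ` M)" for f
  using that
 proof (induction rule: fun_space.span_induct_alt)
  case base
  have "(0 :: 'a => real) = (%x. 0)" by auto
  thus ?case by (metis polyf_const)
 next
  case (step c x y)
  have "(%z. c*x z)+y = (%z. c*x z+y z)" by auto
  thus ?case using step mon by (metis imageE polyf_add polyf_cmult)
 qed
 thus ?thesis using that 1 by blast
qed

text \<open>The family \<open>\<S>\<close> consists of subsets of \<open>X\<close> on which no polynomial in \<open>fs\<close> changes sign; points on the zero set
 of some member of \<open>fs\<close> belong to no cell.\<close>

definition sign_cells :: "('a::euclidean_space => real) set => 'a set => 'a set set => bool" where
 "sign_cells fs X \<S> \<longleftrightarrow> finite fs & (ALL f:fs. EX d. polyf d f) & (EX x. ALL f:fs. f x ~= 0) &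
  \<S> <= Pow X & {} ~: \<S> & disjoint \<S> &
  (ALL x:X. ALL y:X. (ALL f:fs. f x*f y > 0) --> (EX S:\<S>. x:S & y:S))"

lemma sum_card_disjoint_le:
 assumes "finite X" "\<S> <= Pow X" "disjoint \<S>"
 shows "(SUM S:\<S>. card S) <= card X"
proof -
 have "(SUM S:\<S>. card S) = card (\<Union>\<S>)"
  using assms by (subst card_Union_disjoint) (auto intro: finite_subset simp: disjoint_def pairwise_def disjnt_def)
 also have "... <= card X" using assms by (intro card_mono) auto
 finally show ?thesis .
qed

text \<open>Only the at most \<open>k\<close> cells with at least \<open>|X| / k\<close> points are
  cut, weighted by their sizes. The light cells contribute at most \<open>|X|^3 / k^2\<close>, half
  of the total by \<open>big\<close>; of the other half one third is removed, which leaves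
  5/6.\<close>

lemma sign_cells_step:
 fixes X :: "'a::euclidean_space set"
 assumes fin: "finite X" "X ~= {}" and cells: "sign_cells fs X \<S>" and deg: "polyf d (prodf fs)"
  and k: "k >= 1" "k < t^DIM('a)" and big: "2*rc X^3 <= real k^2*cubes \<S>"
 obtains fs' \<S>' where "sign_cells fs' X \<S>'" "polyf (d+DIM('a)*t) (prodf fs')"
  "6*cubes \<S>' <= 5*cubes \<S>"
proof -
 have dis: "disjoint \<S>" "\<S> <= Pow X" "{} ~: \<S>" using cells by (auto simp: sign_cells_def)
 have finS: "finite \<S>" "!!S. S:\<S> ==> finite S" "!!S. S:\<S> ==> S ~= {}"
  using dis fin(1) finite_subset[of \<S> "Pow X"] finite_subset[of _ X] by auto
 have m: "rc X > 0" using fin by (simp add: card_gt_0_iff)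
 have sumS: "(SUM S:\<S>. rc S) <= rc X"
  using sum_card_disjoint_le[OF fin(1) dis(2,1)] by (metis of_nat_le_iff of_nat_sum)
 define I where "I = {S:\<S>. rc X <= real k*rc S}"
 have finI: "finite I" using finS by (simp add: I_def)
 have "rc I*rc X <= (SUM S:I. real k*rc S)"
  using sum_bounded_below[of I "rc X" "%S. real k*rc S"] by (simp add: I_def)
 also have "... <= real k*(SUM S:\<S>. rc S)"
  unfolding sum_distrib_left using finS by (intro sum_mono2) (auto simp: I_def)
 also have "... <= real k*rc X" using sumS by (intro mult_left_mono) auto
 finally have cardI: "card I <= k" using m by simp
 obtain V :: "('a => real) set" where V: "has_dim V (t^DIM('a))" "!!f. f:V ==> polyf (DIM('a)*t) f"
  using polynomial_space by blast
 have "EX f:V. f ~= 0 & (SUM S:I. rc S*rc S^2)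
   <= 3*(SUM S:I. rc S*rc {(x, z):S \<times> S. f x*f z <= 0})"
 proof (rule separating_function[OF finI])
  show "EX z. ALL f:Fs. f z ~= 0" if "finite Fs" "Fs <= V" "0 ~: Fs" for Fs
   using that V by (intro polyf_common_nonzero) (auto simp: fun_eq_iff, metis ext zero_fun_def)
 qed (use V cardI k finS in \<open>auto simp: I_def\<close>)
 moreover have "rc S*rc S^2 = rc S^3" for S :: "'a set"
  by (simp add: power2_eq_square power3_eq_cube)
 ultimately obtain f where f: "f:V" "f ~= 0" "cubes I
   <= 3*(SUM S:I. rc S*rc {(x, z):S \<times> S. f x*f z <= 0})"
  by auto
 define pos where "pos = (%S. {x:S. f x > 0})"
 define neg where "neg = (%S. {x:S. f x < 0})"
 define \<S>' where "\<S>' = (pos ` \<S> \<union> neg ` \<S>) - {{}}"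
 have sub: "pos S <= S" "neg S <= S" for S by (auto simp: pos_def neg_def)
 have cells': "sign_cells (insert f fs) X \<S>'"
  unfolding sign_cells_def
 proof (intro conjI)
  show "EX x. ALL g:insert f fs. g x ~= 0"
  proof (rule polyf_common_nonzero)
   show "(EX d. polyf d g) & (EX x. g x ~= 0)" if "g:insert f fs" for g
   proof (cases "g = f")
    case True
    moreover have "EX x. f x ~= 0" using f(2) by (auto simp: fun_eq_iff)
    ultimately show ?thesis using V(2)[OF f(1)] by blast
   next
    case False
    thus ?thesis using that cells by (auto simp: sign_cells_def)
   qed
  qed (use cells in \<open>auto simp: sign_cells_def\<close>)
  show "\<S>' <= Pow X" using dis sub by (fastforce simp: \<S>'_def)
  show "disjoint \<S>'"
  proof (rule disjointI)
   fix A B assume "A:\<S>'" "B:\<S>'" "A ~= B"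
   then obtain S T where ST: "S:\<S>" "T:\<S>" "A = pos S | A = neg S" "B = pos T | B = neg T" by (auto simp: \<S>'_def)
   show "A \<inter> B = {}"
   proof (cases "S = T")
    case True
    thus ?thesis using ST \<open>A ~= B\<close> by (auto simp: pos_def neg_def)
   next
    case False
    hence "S \<inter> T = {}" using disjointD[OF dis(1) ST(1,2)] by blast
    thus ?thesis using ST sub by blast
   qed
  qed
  show "ALL x:X. ALL y:X. (ALL g:insert f fs. g x*g y > 0) --> (EX S:\<S>'. x:S & y:S)"
  proof (intro ballI impI)
   fix x y assume xy: "x:X" "y:X" "ALL g:insert f fs. g x*g y > 0"
   hence "ALL g:fs. g x*g y > 0" by simp
   then obtain S where S: "S:\<S>" "x:S" "y:S" using cells xy(1,2) unfolding sign_cells_def by blast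
   have "f x*f y > 0" using xy by auto
   hence "x:pos S & y:pos S | x:neg S & y:neg S"
    using S by (auto simp: pos_def neg_def zero_less_mult_iff)
   thus "EX S:\<S>'. x:S & y:S" using S by (auto simp: \<S>'_def)
  qed
 qed (use cells V f in \<open>auto simp: sign_cells_def \<S>'_def\<close>)
 have deg': "polyf (d+DIM('a)*t) (%x. PROD g:insert f fs. g x)"
 proof (cases "f:fs")
  case True
  thus ?thesis using deg by (auto simp: insert_absorb intro: polyf_mono)
 next
  case False
  thus ?thesis using polyf_mult[OF V(2)[OF f(1)] deg] cells by (simp add: sign_cells_def add.commute)
 qed
 define N where "N = (%S. rc {(x, z):S \<times> S. f x*f z <= 0})"
 \<comment> \<open>The pairs inside either half and the pairs with \<open>f x * f z <= 0\<close>
   partition \<open>S x S\<close>; points on the zero set of \<open>f\<close> leave the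
   cells.\<close>
 have split: "rc (pos S)^3+rc (neg S)^3 <= rc S^3 - rc S*N S" if "S:\<S>" for S
 proof -
  have fS: "finite S" using finS that by auto
  have "card S^2 = card (S \<times> S)" by (simp add: card_cartesian_product power2_eq_square)
  also have "S \<times> S = (pos S \<times> pos S) \<union> (neg S \<times> neg S) \<union> {(x, z):S \<times> S. f x*f z <= 0}"
   by (auto simp: pos_def neg_def mult_le_0_iff not_le)
  also have "card ... = card (pos S)^2+card (neg S)^2+card {(x, z):S \<times> S. f x*f z <= 0}"
  proof (subst card_Un_disjoint)
   show "card ((pos S \<times> pos S) \<union> (neg S \<times> neg S))+card {(x, z):S \<times> S. f x*f z <= 0}
     = card (pos S)^2+card (neg S)^2+card {(x, z):S \<times> S. f x*f z <= 0}"
    using fS sub[of S] by (subst card_Un_disjoint) (auto simp: pos_def neg_def card_cartesian_product power2_eq_square)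
   show "finite ((pos S \<times> pos S) \<union> (neg S \<times> neg S))" using fS sub[of S] by (auto intro: finite_subset)
   show "finite {(x, z):S \<times> S. f x*f z <= 0}" using fS by (auto intro: finite_subset[of _ "S \<times> S"])
   show "((pos S \<times> pos S) \<union> (neg S \<times> neg S)) \<inter> {(x, z):S \<times> S. f x*f z <= 0} = {}"
   proof -
    have "f x*f z > 0" if "(x, z):(pos S \<times> pos S) \<union> (neg S \<times> neg S)" for x z
     using that by (auto simp: pos_def neg_def intro: mult_pos_pos mult_neg_neg)
    thus ?thesis by force
   qed
  qed
  finally have nat_eq: "card S^2 = card (pos S)^2+card (neg S)^2+card {(x, z):S \<times> S. f x*f z <= 0}" .
  have eq: "rc S^2 = rc (pos S)^2+rc (neg S)^2+N S"
  proof -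
   have "real (card S^2) = real (card (pos S)^2+card (neg S)^2+card {(x, z):S \<times> S. f x*f z <= 0})"
    by (rule arg_cong[OF nat_eq])
   thus ?thesis by (simp only: N_def of_nat_add of_nat_power)
  qed
  have le: "card (pos S) <= card S" "card (neg S) <= card S" using card_mono[OF fS sub(1)] card_mono[OF fS sub(2)] by simp_all
  have "rc (pos S)^3+rc (neg S)^3
    = rc (pos S)*rc (pos S)^2+rc (neg S)*rc (neg S)^2"
   by (simp add: power2_eq_square power3_eq_cube)
  also have "... <= rc S*rc (pos S)^2+rc S*rc (neg S)^2"
   using le by (intro add_mono mult_right_mono) auto
  also have "... = rc S*(rc S^2 - N S)" using eq by (simp add: algebra_simps)
  finally show ?thesis by (simp add: power2_eq_square power3_eq_cube algebra_simps)
 qed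
 define Ps where "Ps = cubes \<S>"
 have "cubes \<S>' <= (SUM S:pos ` \<S> \<union> neg ` \<S>. rc S^3)"
  using finS by (intro sum_mono2) (auto simp: \<S>'_def)
 also have "... <= (SUM S:pos ` \<S>. rc S^3)+(SUM S:neg ` \<S>. rc S^3)"
  using sum.union_inter[OF finite_imageI[OF finS(1)] finite_imageI[OF finS(1)], of "%S. rc S^3" pos neg]
   sum_nonneg[of "pos ` \<S> \<inter> neg ` \<S>" "%S. rc S^3"] by simp
 also have "... <= (SUM S:\<S>. rc (pos S)^3)+(SUM S:\<S>. rc (neg S)^3)"
  using finS by (intro add_mono order_trans[OF sum_image_le]) auto
 also have "... = (SUM S:\<S>. rc (pos S)^3+rc (neg S)^3)" by (simp add: sum.distrib)
 also have "... <= (SUM S:\<S>. rc S^3 - rc S*N S)" using split by (intro sum_mono)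
 also have "... = Ps - (SUM S:\<S>. rc S*N S)" by (simp add: sum_subtractf Ps_def)
 also have "... <= Ps - (SUM S:I. rc S*N S)"
  using finS by (intro diff_left_mono sum_mono2) (auto simp: I_def N_def)
 also have "... <= Ps - cubes I/3" using f(3) by (simp add: N_def)
 finally have A: "cubes \<S>' <= Ps - cubes I/3" .
 have "Ps = cubes I+(SUM S:\<S> - I. rc S^3)"
  unfolding Ps_def using finS by (intro sum.subset_diff[THEN trans[OF _ add.commute]]) (auto simp: I_def)
 moreover have "real k^2*(SUM S:\<S> - I. rc S^3) <= rc X^3"
 proof -
  have "real k^2*(SUM S:\<S> - I. rc S^3) = (SUM S:\<S> - I. (real k*rc S)^2*rc S)"
   by (simp add: sum_distrib_left power2_eq_square power3_eq_cube mult_ac)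
  also have "... <= (SUM S:\<S> - I. rc X^2*rc S)"
   by (intro sum_mono mult_right_mono power_mono) (auto simp: I_def)
  also have "... <= (SUM S:\<S>. rc X^2*rc S)" using finS by (intro sum_mono2) auto
  also have "... <= rc X^2*rc X"
   unfolding sum_distrib_left[symmetric] using sumS by (intro mult_left_mono) auto
  finally show ?thesis by (simp add: power2_eq_square power3_eq_cube)
 qed
 ultimately have "real k^2*Ps <= real k^2*cubes I+real k^2*Ps/2"
  using big by (simp add: Ps_def[symmetric] algebra_simps)
 hence "real k^2*(Ps/2) <= real k^2*cubes I" by simp
 hence "Ps/2 <= cubes I" using k by (simp add: mult_le_cancel_left_pos)
 thus ?thesis using that[OF cells' deg'] A by (simp add: Ps_def)
qed

text \<open>Either the cube sum reaches the threshold at which the step stops to apply, or each of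
  the \<open>L\<close> steps gains the factor 5/6.\<close>

lemma sign_cells_iterate:
 fixes X :: "'a::euclidean_space set"
 assumes fin: "finite X" "X ~= {}" and cells: "sign_cells fs X \<S>" "polyf d (prodf fs)"
  and k: "k >= 1" "k < t^DIM('a)"
 shows "EX fs' \<S>'. sign_cells fs' X \<S>' & polyf (d+L*(DIM('a)*t)) (prodf fs') &
  (real k^2*cubes \<S>' < 2*rc X^3 |
   6^L*cubes \<S>' <= 5^L*cubes \<S>)"
proof (induction L)
 case 0
 thus ?case using cells by auto
next
 case (Suc L)
 then obtain fs1 S1 where 1: "sign_cells fs1 X S1" "polyf (d+L*(DIM('a)*t)) (prodf fs1)"
  "real k^2*cubes S1 < 2*rc X^3 |
   6^L*cubes S1 <= 5^L*cubes \<S>" by blast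
 show ?case
 proof (cases "real k^2*cubes S1 < 2*rc X^3")
  case True
  moreover have "polyf (d+Suc L*(DIM('a)*t)) (prodf fs1)" using 1(2) by (rule polyf_mono) simp
  ultimately show ?thesis using 1(1) by blast
 next
  case False
  hence big: "2*rc X^3 <= real k^2*cubes S1" by simp
  obtain fs2 S2 where 2: "sign_cells fs2 X S2" "polyf (d+L*(DIM('a)*t)+DIM('a)*t) (prodf fs2)"
   "6*cubes S2 <= 5*cubes S1"
   using sign_cells_step[OF fin 1(1,2) k big] by blast
  have "6^Suc L*cubes S2 = 6^L*(6*cubes S2)" by simp
  also have "... <= 6^L*(5*cubes S1)" using 2(3) by (intro mult_left_mono) auto
  also have "... = 5*(6^L*cubes S1)" by simp
  also have "... <= 5*(5^L*cubes \<S>)" using 1(3) False by (intro mult_left_mono) auto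
  finally have "6^Suc L*cubes S2 <= 5^Suc L*cubes \<S>" by simp
  moreover have "polyf (d+Suc L*(DIM('a)*t)) (prodf fs2)" using 2(2) by (simp add: algebra_simps)
  ultimately show ?thesis using 2(1) by blast
 qed
qed

text \<open>Doubling the degree must lower the cube sum by \<open>2^(2 e)\<close>. A fixed number
  \<open>L\<close> of steps with factor 5/6 achieves this, each with a polynomial of degree
  proportional to the current one, so that the total degree is a geometric series.\<close>

theorem polynomial_partition:
 "EX C::nat. C >= 1 & (ALL (X :: 'a::euclidean_space set) D::nat. finite X --> D >= 1 -->
  (EX fs \<S>. sign_cells fs X \<S> & polyf (C*D) (prodf fs) &
   cubes \<S> * real D^(2*DIM('a)) <= real C*rc X^3))"
proof -
 define e where "e = DIM('a)"
 have e: "e >= 1" by (simp add: e_def DIM_positive Suc_leI)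
 obtain L :: nat where L: "2^(2*e) <= (6/5 :: real)^L"
  using real_arch_pow[of "6/5 :: real" "2^(2*e)"] by (auto intro: less_imp_le)
 have L2: "5^L*2^(2*e) <= (6::real)^L" using L by (simp add: power_divide field_simps)
 define c where "c = L*(e*6)"
 have dyadic: "EX fs \<S>. sign_cells fs X \<S> & polyf (c*2^j) (prodf fs) &
   cubes \<S> * (2^j)^(2*e) <= rc X^3"
  if X: "finite X" "X ~= {}" for X :: "'a set" and j
 proof (induction j)
  case 0
  have "sign_cells {} X {X}" using X by (auto simp: sign_cells_def disjoint_def)
  thus ?case by (intro exI[of _ "{}"] exI[of _ "{X}"]) (auto intro: polyf_const)
 next
  case (Suc j)
  then obtain fs \<S> where fs: "sign_cells fs X \<S>" "polyf (c*2^j) (prodf fs)"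
   "cubes \<S> * (2^j)^(2*e) <= rc X^3" by blast
  \<comment> \<open>With this \<open>k\<close> the threshold alternative of the iteration already
    meets the target. The 3 in \<open>t\<close> gives \<open>k < t^e\<close>, because
    \<open>2 < 3^e\<close>.\<close>
  define k :: nat where "k = 2*(2^Suc j)^e"
  define t :: nat where "t = 3*2^Suc j"
  have "(3::nat)^1 <= 3^e" using e by (intro power_increasing) auto
  hence "2*(2^Suc j)^e < (3::nat)^e*(2^Suc j)^e" by (intro mult_strict_right_mono) auto
  moreover have "t^DIM('a) = 3^e*(2^Suc j)^e" by (simp only: t_def e_def[symmetric] power_mult_distrib)
  ultimately have kt: "k < t^DIM('a)" "k >= 1" by (simp_all add: k_def del: power_Suc)
  obtain fs' \<S>' where fs': "sign_cells fs' X \<S>'" "polyf (c*2^j+L*(DIM('a)*t)) (prodf fs')"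
   "real k^2*cubes \<S>' < 2*rc X^3 |
    6^L*cubes \<S>' <= 5^L*cubes \<S>"
   using sign_cells_iterate[OF X fs(1,2) kt(2,1), of L] by blast
  define Ps where "Ps = cubes \<S>"
  define Ps' where "Ps' = cubes \<S>'"
  have "Ps'*(2^Suc j)^(2*e) <= rc X^3"
   using fs'(3)
  proof
   assume "real k^2*cubes \<S>' < 2*rc X^3"
   moreover have "real k^2 = 4*(2^Suc j)^(2*e)" by (simp add: k_def power_mult_distrib power_mult[symmetric] mult.commute)
   ultimately have "4*((2^Suc j)^(2*e)*Ps') < 2*rc X^3" by (simp add: Ps'_def)
   moreover have "0 <= (2^Suc j)^(2*e)*Ps'" by (simp add: Ps'_def sum_nonneg)
   ultimately have "(2^Suc j)^(2*e)*Ps' <= rc X^3" by linarith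
   thus ?thesis by (simp only: mult.commute)
  next
   assume A: "6^L*cubes \<S>' <= 5^L*cubes \<S>"
   have P0: "Ps >= 0" "Ps' >= 0" by (auto simp: Ps_def Ps'_def sum_nonneg)
   have "5^L*(Ps'*(2^Suc j)^(2*e)) = (5^L*2^(2*e))*(Ps'*(2^j)^(2*e))"
    by (simp add: power_mult_distrib)
   also have "... <= 6^L*(Ps'*(2^j)^(2*e))" using L2 P0 by (intro mult_right_mono) auto
   also have "... = (6^L*Ps')*(2^j)^(2*e)" by simp
   also have "... <= (5^L*Ps)*(2^j)^(2*e)" using A by (intro mult_right_mono) (auto simp: Ps_def Ps'_def)
   also have "... <= 5^L*rc X^3" using fs(3) by (simp add: Ps_def mult.assoc)
   finally show ?thesis by simp
  qed
  \<comment> \<open>\<open>c = 6 L e\<close> is the constant for which the \<open>L\<close> steps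
    cost exactly the degree \<open>c * 2^j\<close> spent so far.\<close>
  moreover have deq: "c*2^j+L*(DIM('a)*t) = c*2^Suc j"
   by (simp add: c_def t_def e_def[symmetric] algebra_simps)
  ultimately have "polyf (c*2^Suc j) (prodf fs')"
   "cubes \<S>'*(2^Suc j)^(2*e) <= rc X^3"
   using fs'(2) unfolding Ps'_def deq by (simp only:, blast)
  thus ?case using fs'(1) by blast
 qed
 define C where "C = max (max 1 c) (2^(2*e))"
 have "EX fs \<S>. sign_cells fs X \<S> & polyf (C*D) (prodf fs) &
   cubes \<S> * real D^(2*e) <= real C*rc X^3"
  if "finite X" "D >= 1" for X :: "'a set" and D :: nat
 proof (cases "X = {}")
  case True
  have "sign_cells {} X {}" using True by (auto simp: sign_cells_def)
  thus ?thesis by (intro exI[of _ "{}"] exI[of _ "{}"]) (auto intro: polyf_const)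
 next
  case False
  have "EX j. 2^j <= D & D < 2^(j+1)" by (rule ex_power_ivl1) (use that in simp_all)
  then obtain j where j: "2^j <= D" "D < 2^(j+1)" by (elim exE conjE)
  from dyadic[OF that(1) False, of j]
  obtain fs \<S> where fs: "sign_cells fs X \<S>" "polyf (c*2^j) (prodf fs)"
   "cubes \<S> * (2^j)^(2*e) <= rc X^3" by (elim exE conjE)
  have "c*2^j <= C*D" using j by (intro mult_le_mono) (auto simp: C_def)
  hence 1: "polyf (C*D) (prodf fs)" using fs(2) polyf_mono by blast
  have "real D <= 2*2^j" using j by (metis less_imp_le of_nat_le_iff of_nat_numeral of_nat_power power_Suc Suc_eq_plus1)
  hence "real D^(2*e) <= (2*2^j)^(2*e)" by (intro power_mono) auto
  hence "cubes \<S> * real D^(2*e) <= cubes \<S> * (2*2^j)^(2*e)"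
   by (intro mult_left_mono) (auto intro: sum_nonneg)
  also have "... = 2^(2*e)*(cubes \<S> * (2^j)^(2*e))" by (simp add: power_mult_distrib)
  also have "... <= 2^(2*e)*rc X^3" using fs(3) by (intro mult_left_mono) auto
  also have "... <= real C*rc X^3"
  proof (intro mult_right_mono)
   have "2^(2*e) <= C" by (simp add: C_def)
   thus "2^(2*e) <= real C" by (metis of_nat_le_iff of_nat_numeral of_nat_power)
  qed auto
  finally show ?thesis using fs(1) 1 by blast
 qed
 moreover have "C >= 1" by (simp add: C_def)
 ultimately show ?thesis unfolding e_def by blast
qed

section \<open>Curves and zero sets\<close>

text \<open>The Bezout property of a curve, isolated so that lines and circles can be treated
  alike.\<close>

definition zeros_le :: "nat => nat => 'a::euclidean_space set => bool" where
 "zeros_le B d Y \<longleftrightarrow> (ALL f. polyf d f --> (ALL y:Y. f y = 0) | finite {y:Y. f y = 0} & card {y:Y. f y = 0} <= B)"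

lemma zeros_leD:
 assumes "zeros_le B d Y" "polyf d f" "y:Y" "f y ~= 0"
 shows "finite {y:Y. f y = 0}" "card {y:Y. f y = 0} <= B"
 using assms unfolding zeros_le_def by blast+

text \<open>\<open>h x\<close> is the member of the derivative chain of \<open>F\<close> preceding the first one that does not vanish at \<open>x\<close>.\<close>

lemma smooth_representative:
 fixes F :: "'a::euclidean_space => real"
 assumes F: "polyf d F" "EX x. F x ~= 0"
 obtains h :: "'a => 'a => real" where "!!x. polyf d (h x)"
  "!!Y B. zeros_le B d Y ==> ALL y:Y. F y = 0 ==> EX E<=Y. finite E & card E <= B &
   (ALL x:Y - E. (ALL y:Y. h x y = 0) & (EX v. dd (h x) v x ~= 0) & (ALL x':Y - E. h x' = h x))"
proof -
 obtain g :: "nat => 'a => real" where g: "g 0 = F" "!!k. polyf d (g k)" "!!x. EX k. g k x ~= 0"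
  "!!k x. g k x = 0 ==> g (Suc k) x ~= 0 ==> EX v. dd (g k) v x ~= 0"
  using derivative_chain[OF F] by blast
 define ord where "ord = (%x. LEAST k. g k x ~= 0)"
 define h where "h = (%x. g (ord x - 1))"
 have "EX E<=Y. finite E & card E <= B &
   (ALL x:Y - E. (ALL y:Y. h x y = 0) & (EX v. dd (h x) v x ~= 0) & (ALL x':Y - E. h x' = h x))"
  if Y: "zeros_le B d Y" "ALL y:Y. F y = 0" for Y B
 proof (cases "Y = {}")
  case False
  then obtain y0 where "y0:Y" by blast
  \<comment> \<open>All members of the chain below \<open>j\<close> vanish on the whole of
    \<open>Y\<close>. Off the finitely many zeros of \<open>g j\<close> on \<open>Y\<close> the
    representative is therefore one and the same function \<open>g (j - 1)\<close>, and it is smooth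
    there.\<close>
  define j where "j = (LEAST k. EX y:Y. g k y ~= 0)"
  have "EX y:Y. g j y ~= 0"
   unfolding j_def by (rule LeastI_ex) (use g(3) \<open>y0:Y\<close> in blast)
  then obtain y1 where y1: "y1:Y" "g j y1 ~= 0" by blast
  have below: "g k y = 0" if "k < j" "y:Y" for k y
   using not_less_Least[of k "%k. EX y:Y. g k y ~= 0"] that unfolding j_def by blast
  have j: "j ~= 0" using y1 g(1) Y(2) by (cases j) auto
  define E where "E = {y:Y. g j y = 0}"
  have ord: "ord x = j" if "x:Y - E" for x
   unfolding ord_def using that below by (intro Least_equality) (auto simp: E_def not_less[symmetric])
  have "finite E" "card E <= B" unfolding E_def using zeros_leD[OF Y(1) g(2) y1] by auto
  moreover have "(ALL y:Y. h x y = 0) & (EX v. dd (h x) v x ~= 0) & (ALL x':Y - E. h x' = h x)" if x: "x:Y - E" for x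
  proof (intro conjI)
   show "ALL y:Y. h x y = 0" using below j by (auto simp: h_def ord[OF x])
   have "g (Suc (j - 1)) x ~= 0" "g (j - 1) x = 0" using x j below by (auto simp: E_def)
   thus "EX v. dd (h x) v x ~= 0" using g(4) by (auto simp: h_def ord[OF x])
   show "ALL x':Y - E. h x' = h x" using ord x by (auto simp: h_def)
  qed
  moreover have "E <= Y" by (auto simp: E_def)
  ultimately show ?thesis by blast
 qed auto
 thus ?thesis using that[of h] g(2) by (auto simp: h_def)
qed

lemma card_le_of_poly_roots:
 assumes "P ~= 0" "degree P <= d" "!!y. y:Y ==> EX t. c t = y & poly P t = (0::real)"
 shows "finite Y & card Y <= d"
proof -
 have "Y <= c ` {t. poly P t = 0}" using assms(3) by blast
 moreover have "finite {t. poly P t = 0}" using assms(1) by (rule poly_roots_finite)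
 moreover have "card {t. poly P t = 0} <= d" using card_poly_roots_bound[OF assms(1)] assms(2) by simp
 ultimately show ?thesis by (meson card_image_le card_mono finite_imageI finite_subset order_trans)
qed

lemma zeros_le_line: "zeros_le d d (range (%t. p+t *\<^sub>R v))"
 unfolding zeros_le_def
proof (intro allI impI)
 fix f :: "'a => real" assume "polyf d f"
 then obtain P where P: "degree P <= d" "!!t. f (p+t *\<^sub>R v) = poly P t" using polyf_line[of d f p v] by blast
 show "(ALL y:range (%t. p+t *\<^sub>R v). f y = 0) | finite {y:range (%t. p+t *\<^sub>R v). f y = 0} & card {y:range (%t. p+t *\<^sub>R v). f y = 0} <= d"
 proof (cases "P = 0")
  case True thus ?thesis using P by auto
 next
  case False
  thus ?thesis using P by (intro disjI2 card_le_of_poly_roots[of P d _ "%t. p+t *\<^sub>R v"]) auto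
 qed
qed

text \<open>An affine image of the unit circle; it is a circle if \<open>e\<close> and
  \<open>e'\<close> are orthogonal of equal length, which is left to the uses.\<close>

definition circ :: "'a::euclidean_space => 'a => 'a => 'a set" where
 "circ c e e' = {c+a *\<^sub>R e+b *\<^sub>R e' | a b. a^2+b^2 = 1}"

definition circ_param :: "'a::euclidean_space => 'a => 'a => real => 'a" where
 "circ_param c e e' t = c+((1 - t\<^sup>2)/(1+t^2)) *\<^sub>R e+(2*t/(1+t^2)) *\<^sub>R e'"

lemma one_plus_square_pos: "1+t^2 > (0::real)"
 by (simp add: add_pos_nonneg)

lemma circ_param_mem: "circ_param c e e' t:circ c e e'"
proof -
 have "((1 - t\<^sup>2)/(1+t^2))^2+(2*t/(1+t^2))^2 = ((1 - t\<^sup>2)^2+(2*t)^2)/(1+t^2)^2"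
  by (simp add: power_divide add_divide_distrib)
 also have "(1 - t\<^sup>2)^2+(2*t)^2 = (1+t^2)^2" by (simp add: power2_eq_square algebra_simps)
 finally show ?thesis using one_plus_square_pos[of t] unfolding circ_def circ_param_def by auto
qed

lemma circ_param_surj:
 assumes "y:circ c e e'" "y ~= c - e"
 shows "EX t. circ_param c e e' t = y"
proof -
 obtain a b where ab: "y = c+a *\<^sub>R e+b *\<^sub>R e'" "a^2+b^2 = 1" using assms by (auto simp: circ_def)
 have "a ~= -1" using ab assms(2) by auto
 define t where "t = b/(1+a)"
 have a1: "1+a ~= 0" using \<open>a ~= -1\<close> by linarith
 have "b^2 = (1 - a)*(1+a)" using ab(2) by (simp add: power2_eq_square algebra_simps)
 hence t2: "t^2 = (1 - a)/(1+a)" using a1 by (simp add: t_def power_divide power2_eq_square)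
 have s: "1+t^2 = 2/(1+a)" "1 - t\<^sup>2 = 2*a/(1+a)" using a1 by (simp_all add: t2 field_simps)
 have "(1 - t\<^sup>2)/(1+t^2) = a" "2*t/(1+t^2) = b" using a1 by (simp_all add: s) (simp add: t_def)
 thus ?thesis using ab by (intro exI[of _ t]) (simp add: circ_param_def)
qed

lemma polyf_circ_param:
 assumes "polyf d f"
 shows "EX P. degree P <= 2*d & (ALL t. f (circ_param c e e' t)*(1+t^2)^d = poly P t)"
proof -
 have "EX p. degree p <= 2 & (ALL t. (circ_param c e e' t\<bullet>b)*poly [:1, 0, 1:] t = poly p t)" for b
 proof (intro exI[of _ "[:c\<bullet>b+e\<bullet>b, 2*(e'\<bullet>b), c\<bullet>b - e\<bullet>b:]"] conjI allI)
  fix t :: real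
  define u where "u = (1 - t\<^sup>2)/(1+t^2)"
  define v where "v = 2*t/(1+t^2)"
  have uv: "u*(1+t^2) = 1 - t\<^sup>2" "v * (1+t^2) = 2*t"
   using one_plus_square_pos[of t] by (auto simp: u_def v_def)
  have "(circ_param c e e' t\<bullet>b)*(1+t^2) = (c\<bullet>b)*(1+t^2)+(u*(1+t^2))*(e\<bullet>b)+(v * (1+t^2))*(e'\<bullet>b)"
   unfolding circ_param_def u_def[symmetric] v_def[symmetric] by (simp add: inner_add_left algebra_simps)
  thus "(circ_param c e e' t\<bullet>b)*poly [:1, 0, 1:] t = poly [:c\<bullet>b+e\<bullet>b, 2*(e'\<bullet>b), c\<bullet>b - e\<bullet>b:] t"
   unfolding uv by (simp add: power2_eq_square algebra_simps)
 qed auto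
 moreover have "degree [:1, 0, 1::real:] <= 2" by simp
 ultimately obtain P where P: "degree P <= 2*d" "ALL t. f (circ_param c e e' t)*poly [:1, 0, 1:] t^d = poly P t"
  using polyf_curve[OF assms, where c = "circ_param c e e'" and s = 2 and Q = "[:1, 0, 1:]"] by metis
 have "poly [:1, 0, 1:] t = 1+t^2" for t :: real by (simp add: power2_eq_square)
 thus ?thesis using P by auto
qed

text \<open>The rational parametrisation misses the point \<open>c - e\<close>. It accounts for the
  \<open>+ 1\<close>, and if the restriction is identically zero, the value there is zero by letting
  the parameter tend to infinity.\<close>

lemma zeros_le_circ: "zeros_le (2*d+1) d (circ c e e')"
 unfolding zeros_le_def
proof (intro allI impI)
 fix f :: "'a => real" assume f: "polyf d f"
 obtain P where P: "degree P <= 2*d" "!!t. f (circ_param c e e' t)*(1+t^2)^d = poly P t"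
  using polyf_circ_param[OF f] by blast
 have iff: "f (circ_param c e e' t) = 0 \<longleftrightarrow> poly P t = 0" for t
  using P(2)[of t] one_plus_square_pos[of t] by (metis mult_eq_0_iff power_not_zero less_irrefl)
 show "(ALL y:circ c e e'. f y = 0) | finite {y:circ c e e'. f y = 0} & card {y:circ c e e'. f y = 0} <= 2*d+1"
 proof (cases "P = 0")
  case True
  hence z: "f (circ_param c e e' t) = 0" for t using iff by simp
  have "((%t. circ_param c e e' t) \<longlongrightarrow> c+(-1) *\<^sub>R e+0 *\<^sub>R e') at_top"
   unfolding circ_param_def by (intro tendsto_intros; real_asymp)
  moreover have "isCont f (c+(-1) *\<^sub>R e+0 *\<^sub>R e')"
   using polyf_differentiable[OF f] differentiable_imp_continuous_within by blast
  ultimately have "((%t. f (circ_param c e e' t)) \<longlongrightarrow> f (c+(-1) *\<^sub>R e+0 *\<^sub>R e')) at_top"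
   by (rule isCont_tendsto_compose[rotated])
  hence "((%t::real. 0) \<longlongrightarrow> f (c - e)) at_top" by (simp add: z)
  hence "f (c - e) = 0" by (metis tendsto_const tendsto_unique trivial_limit_at_top_linorder)
  thus ?thesis using z circ_param_surj[of _ c e e'] by metis
 next
  case False
  define Z where "Z = {y:circ c e e'. y ~= c - e & f y = 0}"
  have "EX t. circ_param c e e' t = y & poly P t = 0" if "y:Z" for y
   using circ_param_surj[of y c e e'] that iff unfolding Z_def by blast
  hence "finite Z & card Z <= 2*d" using card_le_of_poly_roots[OF False P(1), of Z] by blast
  moreover have "{y:circ c e e'. f y = 0} <= insert (c - e) Z" by (auto simp: Z_def)
  moreover have "card (insert (c - e) Z) <= card Z+1" using calculation(1) by (simp add: card_insert_if)
  ultimately have "finite (insert (c - e) Z)" "{y:circ c e e'. f y = 0} <= insert (c - e) Z" "card (insert (c - e) Z) <= 2*d+1" by auto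
  hence "finite {y:circ c e e'. f y = 0}" "card {y:circ c e e'. f y = 0} <= 2*d+1"
   by (metis finite_subset, metis card_mono le_trans)
  thus ?thesis by blast
 qed
qed

text \<open>A point \<open>z\<close> lies in at most \<open>w + 1\<close> windows, since such a
  window starts at most \<open>w\<close> positions before the rank of \<open>z\<close>; the last
  \<open>w\<close> positions start no window.\<close>

lemma sorted_gap_count:
 fixes A Z :: "real set"
 assumes "finite A" "finite Z"
 defines "xs \<equiv> sorted_list_of_set A"
 shows "card A <= w+(w+1)*card Z+card {i. i+w < card A & {xs ! i..xs ! (i+w)} \<inter> Z = {}}"
proof -
 define n where "n = card A"
 have xs: "length xs = n" "sorted xs" "distinct xs" "set xs = A" using assms by (auto simp: n_def)
 define J where "J = {i. i+w < n}"
 define G where "G = {i. i+w < n & {xs ! i..xs ! (i+w)} \<inter> Z = {}}"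
 have finJ: "finite J" "card J = n - w"
 proof -
  have "J = {..<n - w}" by (auto simp: J_def)
  thus "finite J" "card J = n - w" by auto
 qed
 define bad where "bad = (%z. {i:J. xs ! i <= z & z <= xs ! (i+w)})"
 have bad: "card (bad z) <= w+1" for z
 proof -
  define k where "k = card {x:A. x <= z}"
  have "k - 1 - w <= i & i <= k - 1" if "i:bad z" for i
  proof -
   have i: "i+w < n" "xs ! i <= z" "z <= xs ! (i+w)" using that by (auto simp: bad_def J_def)
   have inj: "inj_on (%j. xs ! j) {..<n}" using xs by (auto simp: inj_on_def nth_eq_iff_index_eq)
   have "(%j. xs ! j) ` {..i} <= {x:A. x <= z}"
    using i xs sorted_nth_mono[OF xs(2)] by (fastforce intro: order_trans)
   hence "card ((%j. xs ! j) ` {..i}) <= k" unfolding k_def using assms by (intro card_mono) auto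
   moreover have "card ((%j. xs ! j) ` {..i}) = Suc i" using inj i by (subst card_image) (auto intro: inj_on_subset)
   moreover have "{x:A. x <= z} <= (%j. xs ! j) ` {..i+w}"
   proof
    fix x assume x: "x:{x:A. x <= z}"
    then obtain j where j: "j < n" "x = xs ! j" using xs by (metis (mono_tags) in_set_conv_nth mem_Collect_eq)
    have "j <= i+w"
    proof (rule ccontr)
     assume "~j <= i+w"
     hence "xs ! (i+w) < xs ! j" using xs j strict_sorted_iff[of xs] sorted_wrt_nth_less[of "(<)" xs "i+w" j] by auto
     thus False using x j i by auto
    qed
    thus "x:(%j. xs ! j) ` {..i+w}" using j by auto
   qed
   hence "k <= card ((%j. xs ! j) ` {..i+w})" unfolding k_def by (intro card_mono) auto
   hence "k <= Suc (i+w)" using card_image_le[of "{..i+w}" "%j. xs ! j"] by simp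
   ultimately show ?thesis by auto
  qed
  hence "bad z <= {k - 1 - w..k - 1}" by auto
  hence "card (bad z) <= card {k - 1 - w..k - 1}" by (intro card_mono) auto
  thus ?thesis by simp
 qed
 have "J = G \<union> (UN z:Z. bad z)" by (auto simp: J_def G_def bad_def)
 hence "card J <= card G+card (UN z:Z. bad z)" by (metis card_Un_le)
 also have "card (UN z:Z. bad z) <= (SUM z:Z. card (bad z))" using assms by (intro card_UN_le) auto
 also have "... <= (SUM z:Z. w+1)" by (intro sum_mono bad)
 also have "... = (w+1)*card Z" by simp
 finally show ?thesis using finJ by (simp add: n_def G_def)
qed

lemma continuous_same_sign:
 fixes g :: "real => real"
 assumes "continuous_on {a..b} g" "!!t. t:{a..b} ==> g t ~= 0" "x:{a..b}" "y:{a..b}"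
 shows "g x*g y > 0"
proof (rule ccontr)
 assume neg: "~?thesis"
 have "connected (g ` {a..b})" using assms(1) by (intro connected_continuous_image) auto
 hence "is_interval (g ` {a..b})" by (simp add: is_interval_connected_1)
 moreover have "g x ~= 0" "g y ~= 0" using assms by auto
 hence "g x < 0 & g y > 0 | g y < 0 & g x > 0" using neg by (metis mult_neg_neg mult_pos_pos linorder_neqE_linordered_idom)
 moreover have "g x:g ` {a..b}" "g y:g ` {a..b}" using assms(3,4) by auto
 ultimately have "0:g ` {a..b}"
  using mem_is_interval_1_I[of "g ` {a..b}" "g x" "g y" 0] mem_is_interval_1_I[of "g ` {a..b}" "g y" "g x" 0] by linarith
 thus False using assms(2) by auto
qed

text \<open>Points on a curve that does not lie in the zero set of a partitioning polynomial: up to a multiple of the degree,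
 they are counted by the windows of \<open>w + 1\<close> consecutive points lying in one cell.\<close>

lemma curve_windows:
 fixes c :: "real => 'a::euclidean_space"
 assumes fs: "finite fs" "!!f. f:fs ==> EX d. polyf d f" and F: "polyf d (prodf fs)"
  and Y: "zeros_le B d Y" "y:Y" "(PROD f:fs. f y) ~= 0"
  and A: "finite A" "!!a b. a:A ==> b:A ==> continuous_on {a..b} c & inj_on c {a..b} & c ` {a..b} <= Y"
 defines "xs \<equiv> sorted_list_of_set A"
 shows "card A <= w+(w+1)*B+card {i. i+w < card A & (ALL j:{i..i+w}. ALL k:{i..i+w}. ALL f:fs. f (c (xs ! j))*f (c (xs ! k)) > 0)}"
proof (cases "A = {}")
 case False
 let ?I = "%i. {xs ! i..xs ! (i+w)}"
 let ?W = "{i. i+w < card A & (ALL j:{i..i+w}. ALL k:{i..i+w}. ALL f:fs. f (c (xs ! j))*f (c (xs ! k)) > 0)}"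
 define M where "M = {Min A..Max A}"
 have "Min A:A" "Max A:A" using A False by auto
 hence M: "continuous_on M c" "inj_on c M" "c ` M <= Y" "A <= M" using A by (auto simp: M_def)
 define Z where "Z = {t:M. (PROD f:fs. f (c t)) = 0}"
 have imgZ: "c ` Z <= {y:Y. (PROD f:fs. f y) = 0}" using M by (auto simp: Z_def)
 have zl: "finite {y:Y. (PROD f:fs. f y) = 0}" "card {y:Y. (PROD f:fs. f y) = 0} <= B"
  using zeros_leD[OF Y(1) F Y(2,3)] by auto
 have injZ: "inj_on c Z" using M by (auto intro: inj_on_subset simp: Z_def)
 have finZ: "finite Z" using imgZ zl injZ by (meson finite_imageD finite_subset)
 have cZ: "card Z <= B" using card_mono[OF zl(1) imgZ] card_image[OF injZ] zl(2) by linarith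
 have xs: "length xs = card A" "sorted xs" "set xs = A" using A by (auto simp: xs_def)
 have sub: "{i. i+w < card A & (?I i) \<inter> Z = {}} <=
   ?W"
 proof (rule subsetI)
  fix i assume "i:{i. i+w < card A & (?I i) \<inter> Z = {}}"
  hence i: "i+w < card A" "(?I i) \<inter> Z = {}" by auto
  have Mi: "(?I i) <= M"
  proof -
   have "xs ! i:A" "xs ! (i+w):A" using xs i by (metis nth_mem add_lessD1)+
   thus ?thesis using M(4) by (auto simp: M_def)
  qed
  show "i:?W"
  proof (intro CollectI conjI ballI)
   fix j k f assume jk: "j:{i..i+w}" "k:{i..i+w}" and f: "f:fs"
   obtain d' where "polyf d' f" using fs f by blast
   show "f (c (xs ! j))*f (c (xs ! k)) > 0"
   proof (rule continuous_same_sign[where g = "%t. f (c t)" and a = "xs ! i" and b = "xs ! (i+w)"])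
    show "continuous_on (?I i) (%t. f (c t))"
     using continuous_on_compose2[OF polyf_continuous_on[OF \<open>polyf d' f\<close>, of UNIV] continuous_on_subset[OF M(1) Mi]] by auto
    show "f (c t) ~= 0" if "t:(?I i)" for t
    proof -
     have "t:M" "t ~: Z" using that i(2) Mi by auto
     hence "(PROD f:fs. f (c t)) ~= 0" by (simp add: Z_def)
     thus ?thesis using f fs(1) by (metis prod_zero_iff)
    qed
    show "xs ! j:(?I i)" using jk i xs by (auto intro!: sorted_nth_mono)
    show "xs ! k:(?I i)" using jk i xs by (auto intro!: sorted_nth_mono)
   qed
  qed (rule i)
 qed
 have "card A <= w+(w+1)*card Z+card {i. i+w < card A & (?I i) \<inter> Z = {}}"
  unfolding xs_def by (rule sorted_gap_count[OF A(1) finZ])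
 also have "... <= w+(w+1)*B+card ?W"
  using cZ sub by (intro add_mono mult_le_mono order_refl card_mono) (auto intro: finite_subset[of _ "{..<card A}"])
 finally show ?thesis .
qed simp

section \<open>Lines in the plane\<close>

text \<open>Cauchy-Schwarz between first and third powers of the cell sizes. The squares are what is
  consumed when two points, rather than three, determine the object counted.\<close>

lemma sign_cells_squares:
 assumes "finite X" "sign_cells fs X \<S>" "cubes \<S> * real D^(2*e) <= real C*rc X^3" "C >= 1"
 shows "(SUM S:\<S>. rc S^2)*real D^e <= real C*rc X^2"
proof -
 have dis: "disjoint \<S>" "\<S> <= Pow X" using assms(2) by (auto simp: sign_cells_def)
 have s1: "(SUM S:\<S>. rc S) <= rc X"
  using sum_card_disjoint_le[OF assms(1) dis(2,1)] by (metis of_nat_le_iff of_nat_sum)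
 define s2 where "s2 = (SUM S:\<S>. rc S^2)"
 define s3 where "s3 = cubes \<S>"
 have nn: "s2 >= 0" "s3 >= 0" by (auto simp: s2_def s3_def sum_nonneg)
 have "s2 = (SUM S:\<S>. sqrt (rc S)*(sqrt (rc S)*rc S))"
  unfolding s2_def by (intro sum.cong refl) (simp add: power2_eq_square)
 hence "s2^2 <= (SUM S:\<S>. (sqrt (rc S))^2)*(SUM S:\<S>. (sqrt (rc S)*rc S)^2)"
  by (metis Cauchy_Schwarz_ineq_sum)
 also have "... = (SUM S:\<S>. rc S) * s3"
 proof -
  have "(sqrt (real k)*real k)^2 = real k^3" for k :: nat
  proof -
   have "(sqrt (real k)*real k)^2 = real k*(real k)^2" by (simp add: power_mult_distrib)
   thus ?thesis by (simp add: power2_eq_square power3_eq_cube)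
  qed
  thus ?thesis by (simp add: s3_def)
 qed
 also have "... <= rc X * s3" using s1 nn by (intro mult_right_mono)
 finally have a: "s2^2 <= rc X * s3" .
 have "(s2*real D^e)^2 = s2^2*real D^(2*e)" by (simp add: power_mult_distrib power_mult mult.commute power_even_eq)
 also have "... <= rc X * s3*real D^(2*e)" using a by (intro mult_right_mono) auto
 also have "... <= rc X*(real C*rc X^3)"
  using assms(3) unfolding s3_def mult.assoc by (intro mult_left_mono) auto
 also have "... <= (real C*rc X^2)\<^sup>2"
 proof -
  have "rc X*(real C*rc X^3) = real C*1*rc X^4"
   by (simp add: power3_eq_cube power4_eq_xxxx)
  also have "... <= real C*real C*rc X^4" using assms(4) by (intro mult_mono) auto
  also have "... = (real C*rc X^2)^2" by (simp add: power2_eq_square power4_eq_xxxx)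
  finally show ?thesis .
 qed
 finally show ?thesis unfolding s2_def by (rule power2_le_imp_le) auto
qed

text \<open>Curves off the zero set are charged to consecutive points in one cell. By
  \<open>unique\<close>, a smooth point of a polynomial lies on only one curve of the family inside
  its zero set; hence, apart from at most \<open>B\<close> points per curve, the incidences in the
  zero set inject into \<open>P\<close>.\<close>

lemma plane_reduction:
 fixes c :: "'g => real => 'a::euclidean_space" and A :: "'g => real set" and crv :: "'g => 'a set"
 assumes P: "finite P" and cells: "sign_cells fs P \<S>" and F: "polyf d (prodf fs)"
  and G: "finite G" and A: "!!g. g:G ==> finite (A g)" "!!g. g:G ==> c g ` A g <= P"
   "!!g a b. g:G ==> a:A g ==> b:A g ==> continuous_on {a..b} (c g) & inj_on (c g) {a..b} & c g ` {a..b} <= crv g"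
  and zeros: "!!g. g:G ==> zeros_le B d (crv g)"
  and unique: "!!f p g g'. polyf d f ==> EX v. dd f v p ~= 0 ==> g:G ==> g':G ==> p:crv g ==> p:crv g' ==>
   ALL y:crv g. f y = 0 ==> ALL y:crv g'. f y = 0 ==> g = g'"
 shows "(SUM g:G. card (A g)) <= card G*(2*B+1)+card P +
  (SUM g:G. card {i. Suc i < card (A g) & (EX S:\<S>. c g (sorted_list_of_set (A g) ! i):S & c g (sorted_list_of_set (A g) ! Suc i):S)})"
proof -
 define F where "F = (prodf fs)"
 define W where "W = (%g. {i. Suc i < card (A g) & (EX S:\<S>. c g (sorted_list_of_set (A g) ! i):S & c g (sorted_list_of_set (A g) ! Suc i):S)})"
 have F': "polyf d F" "EX x. F x ~= 0" using F cells by (auto simp: F_def sign_cells_def prod_zero_iff)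
 obtain h :: "'a => 'a => real" where h: "!!x. polyf d (h x)"
  "!!Y B. zeros_le B d Y ==> ALL y:Y. F y = 0 ==> EX E<=Y. finite E & card E <= B &
   (ALL x:Y - E. (ALL y:Y. h x y = 0) & (EX v. dd (h x) v x ~= 0) & (ALL x':Y - E. h x' = h x))"
  using smooth_representative[OF F'] by metis
 define Z where "Z = {g:G. ALL y:crv g. F y = 0}"
 have "ALL g:Z. EX E<=crv g. finite E & card E <= B & (ALL x:crv g - E. (ALL y:crv g. h x y = 0) & (EX v. dd (h x) v x ~= 0))"
 proof
  fix g assume "g:Z"
  hence "zeros_le B d (crv g)" "ALL y:crv g. F y = 0" using zeros by (auto simp: Z_def)
  from h(2)[OF this] show "EX E<=crv g. finite E & card E <= B & (ALL x:crv g - E. (ALL y:crv g. h x y = 0) & (EX v. dd (h x) v x ~= 0))"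
   by metis
 qed
 then obtain E where E: "!!g. g:Z ==> finite (E g) & card (E g) <= B"
  "!!g x. g:Z ==> x:crv g - E g ==> (ALL y:crv g. h x y = 0) & (EX v. dd (h x) v x ~= 0)" by metis
 have mem: "c g t:crv g" if "g:G" "t:A g" for g t using A(3)[OF that(1) that(2) that(2)] by auto
 have injA: "inj_on (c g) (A g)" if "g:G" for g
 proof (cases "A g = {}")
  case False
  hence "Min (A g):A g" "Max (A g):A g" using A(1)[OF that] by auto
  hence "inj_on (c g) {Min (A g)..Max (A g)}" using A(3)[OF that] by blast
  thus ?thesis using A(1)[OF that] by (auto intro: inj_on_subset)
 qed auto
 have off: "card (A g) <= 2*B+1+card (W g)" if g: "g:G - Z" for g
 proof -
  obtain y where y: "y:crv g" "F y ~= 0" using g by (auto simp: Z_def)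
  define xs where "xs = sorted_list_of_set (A g)"
  have len: "length xs = card (A g)" "set xs = A g" using A(1) g by (auto simp: xs_def)
  have "card (A g) <= 1+(1+1)*B+card {i. i+1 < card (A g) & (ALL j:{i..i+1}. ALL k:{i..i+1}. ALL f:fs. f (c g (xs ! j))*f (c g (xs ! k)) > 0)}"
   unfolding xs_def using cells F zeros g y A unfolding F_def sign_cells_def
   by (intro curve_windows[where d = d and Y = "crv g" and y = y]) auto
  also have "card {i. i+1 < card (A g) & (ALL j:{i..i+1}. ALL k:{i..i+1}. ALL f:fs. f (c g (xs ! j))*f (c g (xs ! k)) > 0)} <= card (W g)"
  proof (intro card_mono subsetI)
   show "finite (W g)" by (rule finite_subset[of _ "{..<card (A g)}"]) (auto simp: W_def)
   fix i assume "i:{i. i+1 < card (A g) & (ALL j:{i..i+1}. ALL k:{i..i+1}. ALL f:fs. f (c g (xs ! j))*f (c g (xs ! k)) > 0)}"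
   hence i: "Suc i < card (A g)" "ALL f:fs. f (c g (xs ! i))*f (c g (xs ! Suc i)) > 0" by auto
   have "xs ! i:A g" "xs ! Suc i:A g" using i len by (metis Suc_lessD nth_mem)+
   hence "c g (xs ! i):P" "c g (xs ! Suc i):P" using A(2) g by auto
   hence "EX S:\<S>. c g (xs ! i):S & c g (xs ! Suc i):S" using cells i(2) unfolding sign_cells_def by blast
   thus "i:W g" using i by (simp add: W_def xs_def)
  qed
  finally show ?thesis by simp
 qed
 define good where "good = (%g. {p:c g ` A g. p ~: E g})"
 have on: "card (A g) <= B+card (good g)" if g: "g:Z" for g
 proof -
  have gG: "g:G" using g by (simp add: Z_def)
  have "card (A g) = card (c g ` A g)" using card_image[OF injA[OF gG]] by simp
  also have "... <= card (E g \<union> good g)" using E(1)[OF g] A(1)[OF gG] by (intro card_mono) (auto simp: good_def)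
  also have "... <= card (E g)+card (good g)" by (rule card_Un_le)
  finally show ?thesis using E(1)[OF g] by simp
 qed
 have "(SUM g:Z. card (good g)) = card (SIGMA g:Z. good g)"
  using G A by (subst card_SigmaI) (auto simp: Z_def good_def)
 also have "... <= card P"
 proof (rule card_inj_on_le[where f = snd])
  show "inj_on snd (SIGMA g:Z. good g)"
  proof (rule inj_onI)
   fix a b assume a: "a:(SIGMA g:Z. good g)" and b: "b:(SIGMA g:Z. good g)" and ab: "snd a = snd b"
   obtain g p g' where gp: "a = (g, p)" "b = (g', p)" "g:Z" "g':Z" "p:good g" "p:good g'" using a b ab by auto
   have "p:crv g" "p:crv g'" using gp mem by (auto simp: good_def Z_def)
   hence "g = g'"
    using gp E(2)[of g p] E(2)[of g' p] mem unique[OF h(1), of p p g g'] by (auto simp: good_def Z_def)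
   thus "a = b" using gp by simp
  qed
  show "snd ` (SIGMA g:Z. good g) <= P" using A(2) by (fastforce simp: good_def Z_def)
 qed (rule P)
 finally have goodP: "(SUM g:Z. card (good g)) <= card P" .
 have "(SUM g:G. card (A g)) = (SUM g:G - Z. card (A g))+(SUM g:Z. card (A g))"
  using G by (intro sum.subset_diff) (auto simp: Z_def)
 also have "... <= (SUM g:G - Z. 2*B+1+card (W g))+(SUM g:Z. B+card (good g))"
  using off on by (intro add_mono sum_mono)
 also have "... <= (SUM g:G - Z. 2*B+1+card (W g))+((SUM g:Z. 2*B+1+card (W g))+card P)"
  using goodP sum_mono[of Z "%g. B" "%g. 2*B+1+card (W g)"] by (simp add: sum.distrib)
 also have "... = (SUM g:G. 2*B+1+card (W g))+card P"
  using G sum.subset_diff[of Z G "%g. 2*B+1+card (W g)"] by (simp add: Z_def)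
 also have "(SUM g:G. 2*B+1+card (W g)) = card G*(2*B+1)+(SUM g:G. card (W g))"
  using sum.distrib[of "%g. 2*B+1" "%g. card (W g)" G] by (simp only: sum_constant of_nat_id)
 finally show ?thesis unfolding W_def by (simp only: add_ac)
qed

section \<open>Lines and the Szemeredi-Trotter bound\<close>

definition affine_line :: "'a::real_vector => 'a => 'a set" where
 "affine_line p v = range (%t. p+t *\<^sub>R v)"

abbreviation is_line :: "'a::real_vector set => bool" where "is_line l == (EX p v. v ~= 0 & l = affine_line p v)"

lemma affine_line_eq:
 assumes "x:affine_line p v" "v = k *\<^sub>R w" "k ~= 0"
 shows "affine_line p v = affine_line x w"
proof -
 obtain t where t: "x = p+t *\<^sub>R v" using assms by (auto simp: affine_line_def)
 have "p+s *\<^sub>R v = x+((s - t) * k) *\<^sub>R w" for s using t assms by (simp add: algebra_simps)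
 moreover have "x+s *\<^sub>R w = p+(t+s/k) *\<^sub>R v" for s using t assms by (simp add: algebra_simps)
 ultimately show ?thesis unfolding affine_line_def by (metis (no_types, lifting) rangeE rangeI subsetI subset_antisym)
qed

lemma affine_line_through:
 assumes "x:affine_line p v" "y:affine_line p v" "x ~= y"
 shows "affine_line p v = affine_line x (y - x)"
proof -
 obtain s t where "x = p+s *\<^sub>R v" "y = p+t *\<^sub>R v" using assms by (auto simp: affine_line_def)
 hence yx: "y - x = (t - s) *\<^sub>R v" "t ~= s" using assms by (auto simp: algebra_simps)
 hence "v = (1/(t - s)) *\<^sub>R (y - x)" by simp
 thus ?thesis using affine_line_eq[OF assms(1), of "1/(t - s)" "y - x"] yx by simp
qed

lemma dd_zero_on_line:
 assumes "polyf d f" "!!t. f (p+t *\<^sub>R v) = 0"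
 shows "dd f v p = 0"
proof -
 have "(f has_derivative (%v. dd f v p)) (at (p+0 *\<^sub>R v))" using polyf_has_derivative[OF assms(1)] by simp
 hence "((%t. f (p+t *\<^sub>R v)) has_derivative (%t. dd f (t *\<^sub>R v) p)) (at 0)"
  by (rule has_derivative_compose[rotated]) (auto intro!: derivative_eq_intros)
 moreover have "((%t. f (p+t *\<^sub>R v)) has_derivative (%t. 0)) (at (0::real))" by (simp add: assms(2))
 ultimately have "(%t. dd f (t *\<^sub>R v) p) = (%t. 0)" by (rule has_derivative_unique)
 from fun_cong[OF this, of 1] show ?thesis by simp
qed

text \<open>By Cramer's rule two independent directions with zero derivative would make every
  directional derivative zero.\<close>

lemma plane_direction_unique:
 fixes v w :: "real \<times> real"
 assumes "polyf d f" "dd f v p = 0" "dd f w p = 0" "EX u. dd f u p ~= 0" "v ~= 0" "w ~= 0"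
 shows "EX k. k ~= 0 & v = k *\<^sub>R w"
proof -
 have lin: "linear (%v. dd f v p)" using assms(1) by (rule linear_dd)
 define D where "D = fst v * snd w - snd v * fst w"
 have "D = 0"
 proof (rule ccontr)
  assume D: "D ~= 0"
  have "dd f u p = 0" for u
  proof -
   have "D *\<^sub>R u = (fst u * snd w - snd u*fst w) *\<^sub>R v+(fst v * snd u - snd v * fst u) *\<^sub>R w"
    by (auto simp: prod_eq_iff D_def algebra_simps)
   hence "dd f (D *\<^sub>R u) p = 0" using assms linear_add[OF lin] linear_scale[OF lin] by simp
   thus ?thesis using D linear_scale[OF lin, of D u] by simp
  qed
  thus False using assms by blast
 qed
 show ?thesis
 proof (cases "fst w = 0")
  case True
  hence "snd w ~= 0" "fst v = 0" using assms(6) \<open>D = 0\<close> by (auto simp: prod_eq_iff D_def)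
  thus ?thesis using True assms(5) by (intro exI[of _ "snd v/snd w"]) (auto simp: prod_eq_iff)
 next
  case False
  have "fst v ~= 0" using False assms(5) \<open>D = 0\<close> by (auto simp: prod_eq_iff D_def)
  thus ?thesis using False \<open>D = 0\<close> by (intro exI[of _ "fst v/fst w"]) (auto simp: prod_eq_iff D_def field_simps)
 qed
qed

text \<open>The terms of \<open>u D + v / D^2\<close> agree at the cube root of
  \<open>v / u\<close>; rounding up costs the extra \<open>u\<close>.\<close>

lemma optimal_degree:
 fixes u v :: real
 assumes "u > 0" "v > 0"
 obtains D :: nat where "D >= 1" "u*real D <= u+u powr (2/3) * v powr (1/3)" "v/real D^2 <= u powr (2/3) * v powr (1/3)"
proof -
 define x where "x = (v/u) powr (1/3)"
 have x: "x > 0" using assms by (simp add: x_def)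
 define D where "D = nat \<lceil>x\<rceil>"
 have D: "D >= 1" "x <= real D" "real D <= x+1" using x by (auto simp: D_def) linarith+
 have ux: "u*x = u powr (2/3) * v powr (1/3)"
 proof -
  have "u*x = u powr 1*(v powr (1/3)/u powr (1/3))" using assms by (simp add: x_def powr_divide)
  also have "... = u powr (1 - 1/3) * v powr (1/3)" using assms by (subst powr_diff) simp
  finally show ?thesis by simp
 qed
 have vx: "v/x^2 = u powr (2/3) * v powr (1/3)"
 proof -
  have "x^2 = (v/u) powr (2/3)" using assms by (simp add: x_def powr_power)
  hence "v/x^2 = v powr 1/(v powr (2/3)/u powr (2/3))" using assms by (simp add: powr_divide)
  also have "... = v powr (1 - 2/3)*u powr (2/3)" using assms by (subst powr_diff) simp
  finally show ?thesis by simp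
 qed
 show ?thesis
 proof (rule that)
  show "D >= 1" by (rule D)
  have "u*real D <= u*(x+1)" using D assms by (intro mult_left_mono) auto
  thus "u*real D <= u+u powr (2/3) * v powr (1/3)" using ux by (simp add: algebra_simps)
  have "v/real D^2 <= v/x^2" using D x assms by (intro divide_left_mono power_mono mult_pos_pos) auto
  thus "v/real D^2 <= u powr (2/3) * v powr (1/3)" using vx by simp
 qed
qed

text \<open>Two consecutive points determine the line, so different lines charge different pairs,
  and the number of pairs in common cells is \<open>O(|Q|^2 / D^2)\<close>.\<close>

theorem szemeredi_trotter:
 "EX C::real. C >= 1 & (ALL (Q :: (real \<times> real) set) (Ls :: (real \<times> real) set set). finite Q --> finite Ls -->
  (ALL l:Ls. EX p v. v ~= 0 & l = affine_line p v) -->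
  real (SUM l:Ls. card (Q \<inter> l)) <= C*(rc Q powr (2/3)*rc Ls powr (2/3)+rc Q+rc Ls))"
proof -
 obtain C :: nat where C: "C >= 1" "!!(X :: (real \<times> real) set) D. finite X ==> D >= 1 ==>
  EX fs \<S>. sign_cells fs X \<S> & polyf (C*D) (prodf fs) &
   cubes \<S> * real D^(2*DIM(real \<times> real)) <= real C*rc X^3"
  using polynomial_partition[where 'a = "real \<times> real"] by blast
 have "real (SUM l:Ls. card (Q \<inter> l)) <= (3*real C+1)*(rc Q powr (2/3)*rc Ls powr (2/3)+rc Q+rc Ls)"
  if Q: "finite Q" and Ls: "finite Ls" and lines: "ALL l:Ls. EX p v. v ~= 0 & l = affine_line p v"
  for Q :: "(real \<times> real) set" and Ls :: "(real \<times> real) set set"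
 proof (cases "Q = {} | Ls = {}")
  case True
  hence "(SUM l:Ls. card (Q \<inter> l)) = 0" by auto
  thus ?thesis by simp
 next
  case False
  define n where "n = rc Q"
  define L where "L = rc Ls"
  have pos: "n > 0" "L > 0" using False Q Ls by (auto simp: n_def L_def card_gt_0_iff)
  obtain D :: nat where D: "D >= 1" "L*real D <= L+L powr (2/3)*(n^2) powr (1/3)" "n^2/real D^2 <= L powr (2/3)*(n^2) powr (1/3)"
   using optimal_degree[of L "n^2"] pos by auto
  have n23: "(n^2) powr (1/3) = n powr (2/3)"
   using pos by (simp add: powr_powr powr_numeral[symmetric] del: powr_numeral)
  obtain fs \<S> where part: "sign_cells fs Q \<S>" "polyf (C*D) (prodf fs)"
   "cubes \<S> * real D^(2*DIM(real \<times> real)) <= real C*rc Q^3"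
   using C(2)[OF Q D(1)] by blast
  have sq: "(SUM S:\<S>. rc S^2)*real D^2 <= real C*n^2"
   using sign_cells_squares[OF Q part(1,3) C(1)] by (simp add: n_def power2_eq_square)
  obtain pt dir where pd: "!!l. l:Ls ==> dir l ~= 0 & l = affine_line (pt l) (dir l)" using lines by metis
  define c where "c = (%l t. pt l+t *\<^sub>R dir l :: real \<times> real)"
  define A where "A = (%l. {t. c l t:Q})"
  have injc: "inj (c l)" if "l:Ls" for l using pd[OF that] by (auto simp: c_def inj_def)
  have rangec: "range (c l) = l" if "l:Ls" for l using pd[OF that] by (auto simp: c_def affine_line_def)
  have cA: "c l ` A l = Q \<inter> l" if "l:Ls" for l
  proof -
   have "c l ` {t. c l t:Q} = Q \<inter> range (c l)" by auto
   thus ?thesis by (simp add: A_def rangec[OF that])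
  qed
  have finA: "finite (A l)" if "l:Ls" for l
   using cA[OF that] Q injc[OF that] by (metis finite_Int finite_imageD inj_on_subset subset_UNIV)
  have cardA: "card (A l) = card (Q \<inter> l)" if "l:Ls" for l
   using cA[OF that] card_image[of "c l" "A l"] injc[OF that] by (metis inj_on_subset subset_UNIV)
  define xs where "xs = (%l. sorted_list_of_set (A l))"
  define W where "W = (%l. {i. Suc i < card (A l) & (EX S:\<S>. c l (xs l ! i):S & c l (xs l ! Suc i):S)})"
  have main: "(SUM l:Ls. card (A l)) <= card Ls*(2*(C*D)+1)+card Q+(SUM l:Ls. card (W l))"
   unfolding W_def xs_def
  proof (rule plane_reduction[OF Q part(1,2) Ls finA, where crv = "%l. l"])
   show "c l ` A l <= Q" if "l:Ls" for l using cA[OF that] by simp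
   show "continuous_on {a..b} (c l) & inj_on (c l) {a..b} & c l ` {a..b} <= l" if "l:Ls" for l a b
    using injc[OF that] rangec[OF that] by (auto simp: c_def intro!: continuous_intros intro: inj_on_subset)
   show "zeros_le (C*D) (C*D) l" if "l:Ls" for l
    using zeros_le_line[of "C*D" "pt l" "dir l"] pd[OF that] by (simp add: affine_line_def)
   show "l = l'" if f: "polyf (C*D) f" and v: "EX v. dd f v p ~= 0" and l: "l:Ls" "l':Ls" and p: "p:l" "p:l'"
    and z: "ALL y:l. f y = 0" "ALL y:l'. f y = 0" for f p l l'
   proof -
    have a: "l = affine_line p (dir l)" if "l:Ls" "p:l" for l
     using affine_line_eq[of p "pt l" "dir l" 1 "dir l"] pd[OF that(1)] that by simp
    have "dd f (dir l) p = 0" if "l:Ls" "p:l" "ALL y:l. f y = 0" for l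
     using a[OF that(1,2)] that by (intro dd_zero_on_line[OF f]) (auto simp: affine_line_def)
    then obtain k where "k ~= 0" "dir l = k *\<^sub>R dir l'"
     using plane_direction_unique[OF f _ _ v, of "dir l" "dir l'"] pd l p z by metis
    thus ?thesis using affine_line_eq[of p p "dir l" k "dir l'"] a[OF l(1) p(1)] a[OF l(2) p(2)] p by metis
   qed
  qed
  have finW: "finite (W l)" for l by (rule finite_subset[of _ "{..<card (A l)}"]) (auto simp: W_def)
  have "(SUM l:Ls. card (W l)) = card (SIGMA l:Ls. W l)"
   using Ls finW by simp
  also have "... <= card (UN S:\<S>. S \<times> S)"
  proof (rule card_inj_on_le[where f = "%(l, i). (c l (xs l ! i), c l (xs l ! Suc i))"])
   have fS: "finite \<S>" "!!S. S:\<S> ==> finite S"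
    using part(1) Q finite_subset unfolding sign_cells_def by (metis Pow_iff finite_Pow_iff subsetD)+
   thus "finite (UN S:\<S>. S \<times> S)" by auto
   show "(%(l, i). (c l (xs l ! i), c l (xs l ! Suc i))) ` (SIGMA l:Ls. W l) <= (UN S:\<S>. S \<times> S)"
    by (auto simp: W_def)
   show "inj_on (%(l, i). (c l (xs l ! i), c l (xs l ! Suc i))) (SIGMA l:Ls. W l)"
   proof (rule inj_onI)
    fix a b assume a: "a:(SIGMA l:Ls. W l)" and b: "b:(SIGMA l:Ls. W l)"
     and eq: "(case a of (l, i) => (c l (xs l ! i), c l (xs l ! Suc i))) = (case b of (l, i) => (c l (xs l ! i), c l (xs l ! Suc i)))"
    obtain l i l' i' where ab: "a = (l, i)" "b = (l', i')" by (metis surj_pair)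
    have l: "l:Ls" "l':Ls" "Suc i < card (A l)" "Suc i' < card (A l')" using a b by (auto simp: ab W_def)
    have e: "c l (xs l ! i) = c l' (xs l' ! i')" "c l (xs l ! Suc i) = c l' (xs l' ! Suc i')" using eq by (auto simp: ab)
    have dist: "distinct (xs l)" "length (xs l) = card (A l)" for l by (auto simp: xs_def)
    have "xs l ! i ~= xs l ! Suc i" using dist[of l] l by (auto simp: nth_eq_iff_index_eq)
    hence ne: "c l (xs l ! i) ~= c l (xs l ! Suc i)" using injc[OF l(1)] by (auto simp: inj_def)
    have "l = affine_line (c l (xs l ! i)) (c l (xs l ! Suc i) - c l (xs l ! i))"
     using affine_line_through[of "c l (xs l ! i)" "pt l" "dir l" "c l (xs l ! Suc i)"] pd[OF l(1)] ne by (auto simp: c_def affine_line_def)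
    moreover have "l' = affine_line (c l (xs l ! i)) (c l (xs l ! Suc i) - c l (xs l ! i))"
     using affine_line_through[of "c l (xs l ! i)" "pt l'" "dir l'" "c l (xs l ! Suc i)"] pd[OF l(2)] ne
     unfolding e by (auto simp: c_def affine_line_def)
    ultimately have "l = l'" by simp
    moreover have "xs l ! i = xs l ! i'" using e(1) injc[OF l(1)] \<open>l = l'\<close> by (auto simp: inj_def)
    hence "i = i'" using nth_eq_iff_index_eq[OF dist(1)[of l], of i i'] dist(2)[of l] l(3) l(4)[folded \<open>l = l'\<close>] by simp
    ultimately show "a = b" by (simp add: ab)
   qed
  qed
  also have "... <= (SUM S:\<S>. card (S \<times> S))"
  proof (rule card_UN_le)
   show "finite \<S>" using part(1) Q unfolding sign_cells_def by (metis finite_Pow_iff finite_subset)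
  qed
  finally have "real (SUM l:Ls. card (W l)) <= (SUM S:\<S>. rc (S \<times> S))" by (metis of_nat_le_iff of_nat_sum)
  also have "... = (SUM S:\<S>. rc S^2)" by (simp add: card_cartesian_product power2_eq_square)
  also have "... <= real C*n^2/real D^2" using sq D(1) by (simp add: field_simps)
  finally have W: "real (SUM l:Ls. card (W l)) <= real C*(n^2/real D^2)" by simp
  define R where "R = n powr (2/3)*L powr (2/3)"
  have R0: "R >= 0" by (simp add: R_def)
  have "real (SUM l:Ls. card (Q \<inter> l)) <= real (card Ls*(2*(C*D)+1)+card Q+(SUM l:Ls. card (W l)))"
   unfolding of_nat_le_iff using main sum.cong[OF refl cardA, of Ls "%l. l"] by simp
  also have "... = 2*real C*(L*real D)+L+n+real (SUM l:Ls. card (W l))" by (simp add: L_def n_def algebra_simps)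
  also have "... <= 2*real C*(L+R)+L+n+real C*R"
   using D(2,3) W unfolding n23 R_def by (intro add_mono mult_left_mono order_trans[OF W] order_refl) (auto simp: mult.commute)
  also have "... <= (3*real C+1)*(R+n+L)"
   using R0 pos C(1) by (simp add: algebra_simps)
  finally show ?thesis by (simp add: R_def n_def L_def)
 qed
 thus ?thesis by (intro exI[of _ "3*real C+1"]) auto
qed

section \<open>Flat points of surfaces\<close>

lemma dd_basis_sum:
 fixes f :: "'a::euclidean_space => real"
 assumes "polyf d f"
 shows "dd f v x = (SUM b:Basis. (v\<bullet>b)*dd f b x)"
proof -
 have lin: "linear (%v. dd f v x)" using assms by (rule linear_dd)
 have "dd f v x = dd f (SUM b:Basis. (v\<bullet>b) *\<^sub>R b) x" by (simp add: euclidean_representation)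
 also have "... = (SUM b:Basis. dd f ((v\<bullet>b) *\<^sub>R b) x)" using linear_sum[OF lin, of "%b. (v\<bullet>b) *\<^sub>R b" Basis] .
 also have "... = (SUM b:Basis. (v\<bullet>b)*dd f b x)" using linear_scale[OF lin] by (intro sum.cong refl) simp
 finally show ?thesis .
qed

definition grad :: "('a::euclidean_space => real) => 'a => 'a" where
 "grad f x = (SUM b:Basis. dd f b x *\<^sub>R b)"

definition quad :: "('a::euclidean_space => real) => 'a => 'a => real" where
 "quad f x u = dd (dd f u) u x"

lemma grad_inner: "polyf d f ==> grad f x\<bullet>v = dd f v x"
 using dd_basis_sum[of d f v x] by (simp add: grad_def inner_sum_left inner_commute[of v] mult.commute)

lemma dd_lincomb:
 assumes "polyf d f" shows "dd f (a *\<^sub>R u+b *\<^sub>R v) = (%x. a*dd f u x+b*dd f v x)"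
 using linear_add[OF linear_dd[OF assms]] linear_scale[OF linear_dd[OF assms]] by (intro ext) simp

lemma dd_cmult: "polyf d f ==> dd (%x. c*f x) v = (%x. c*dd f v x)"
 using dd_mult[OF polyf_const[of 0 c], of d f v] by (simp add: dd_const)

lemma dd_dd_lincomb:
 assumes "polyf d f"
 shows "dd (dd f (a *\<^sub>R u+b *\<^sub>R v)) w x = a*dd (dd f u) w x+b*dd (dd f v) w x"
proof -
 have p: "polyf d (dd f u)" "polyf d (dd f v)" using assms polyf_dd by auto
 show ?thesis
  unfolding dd_lincomb[OF assms] dd_add[OF polyf_cmult[OF p(1)] polyf_cmult[OF p(2)]] dd_cmult[OF p(1)] dd_cmult[OF p(2)] ..
qed

lemma quad_lincomb:
 assumes "polyf d f"
 shows "quad f x (a *\<^sub>R u+b *\<^sub>R v) = a^2*quad f x u+2*a*b*dd (dd f u) v x+b^2*quad f x v"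
proof -
 have p: "polyf d (dd f u)" "polyf d (dd f v)" using assms polyf_dd by auto
 have "quad f x (a *\<^sub>R u+b *\<^sub>R v) = a*(a*dd (dd f u) u x+b*dd (dd f u) v x)+b*(a*dd (dd f v) u x+b*dd (dd f v) v x)"
  unfolding quad_def dd_dd_lincomb[OF assms] dd_lincomb[OF p(1)] dd_lincomb[OF p(2)] ..
 thus ?thesis using dd_commute[OF assms, of u v x] by (simp add: quad_def power2_eq_square algebra_simps)
qed

text \<open>Expansion of the Hessian form in coordinates; a polynomial field of tangent vectors then
  turns conditions on the second fundamental form into polynomial equations.\<close>

lemma polyf_quad_field:
 assumes f: "polyf d f" and U: "!!w. polyf e (%x. U x\<bullet>w)"
 shows "polyf (d+2*e) (%x. quad f x (U x))"
proof -
 have expand: "quad f x u = (SUM b:Basis. SUM b':Basis. (u\<bullet>b)*((u\<bullet>b')*dd (dd f b) b' x))" for x u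
 proof -
  have p: "polyf d (dd f b)" for b using f polyf_dd by auto
  note A = dd_basis_sum[where v = u]
  have "quad f x u = dd (dd f u) u x" by (simp add: quad_def)
  also have "... = (SUM b':Basis. (u\<bullet>b')*dd (dd f u) b' x)" using A[OF p] by simp
  also have "... = (SUM b':Basis. (u\<bullet>b')*dd (dd f b') u x)" using dd_commute[OF f] by simp
  also have "... = (SUM b':Basis. (u\<bullet>b')*(SUM b:Basis. (u\<bullet>b)*dd (dd f b') b x))" using A[OF p] by simp
  finally show ?thesis by (simp add: sum_distrib_left)
 qed
 have "polyf (e+(e+d)) (%x. (U x\<bullet>b)*((U x\<bullet>b')*dd (dd f b) b' x))" for b b'
  using f U by (intro polyf_mult polyf_dd)
 hence "polyf (e+(e+d)) (%x. quad f x (U x))" unfolding expand by (intro polyf_sum)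
 thus ?thesis by (rule polyf_mono) simp
qed

lemma cross3_inner_swap: "cross3 a b\<bullet>c = a\<bullet>cross3 b c"
 by (simp add: cross3_def inner_vec_def sum_3 algebra_simps)

lemma polyf_grad_cross:
 assumes "polyf d (f :: real^3 => real)" shows "polyf d (%x. cross3 (grad f x) z\<bullet>w)"
 unfolding cross3_inner_swap grad_inner[OF assms] by (rule polyf_dd[OF assms])

lemma tangent_is_cross:
 fixes N u :: "real^3"
 assumes "N ~= 0" "N\<bullet>u = 0" shows "EX z. u = cross3 N z"
proof -
 have "cross3 N (cross3 u N) = (N\<bullet>N) *\<^sub>R u - (N\<bullet>u) *\<^sub>R N" by (simp add: Lagrange)
 hence "cross3 N ((1/(N\<bullet>N)) *\<^sub>R cross3 u N) = u" using assms by (simp add: cross_mult_right)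
 thus ?thesis by metis
qed

text \<open>Where the gradient is nonzero, the vectors \<open>cross3 (grad f x) z\<close> are all
  tangent vectors, and they depend polynomially on \<open>x\<close>.\<close>

definition flat_at :: "(real^3 => real) => real^3 => bool" where
 "flat_at f x \<longleftrightarrow> (ALL z. quad f x (cross3 (grad f x) z) = 0)"

lemma chain_line:
 fixes f :: "'a::euclidean_space => real"
 assumes "polyf d f"
 shows "((%t. f (p+t *\<^sub>R v)) has_real_derivative dd f v (p+t *\<^sub>R v)) (at t)"
proof -
 have "(f has_derivative (%w. dd f w (p+t *\<^sub>R v))) (at (p+t *\<^sub>R v))" using polyf_has_derivative[OF assms] by blast
 hence "((%t. f (p+t *\<^sub>R v)) has_derivative (%s. dd f (s *\<^sub>R v) (p+t *\<^sub>R v))) (at t)"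
  by (rule has_derivative_compose[rotated]) (auto intro!: derivative_eq_intros)
 thus ?thesis using linear_scale[OF linear_dd[OF assms]] by (simp add: has_field_derivative_def mult_commute_abs)
qed

lemma quad_zero_on_line:
 assumes "polyf d f" "!!t. f (p+t *\<^sub>R v) = 0"
 shows "dd f v (p+t *\<^sub>R v) = 0" "quad f (p+t *\<^sub>R v) v = 0"
proof -
 have z: "dd f v (p+t *\<^sub>R v) = 0" for t
  using DERIV_unique[OF chain_line[OF assms(1)]] assms(2) by (metis (no_types, lifting) DERIV_const DERIV_cong ext)
 thus "dd f v (p+t *\<^sub>R v) = 0" .
 show "quad f (p+t *\<^sub>R v) v = 0" unfolding quad_def
  using DERIV_unique[OF chain_line[OF polyf_dd[OF assms(1)]]] z by (metis (no_types, lifting) DERIV_const DERIV_cong ext)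
qed

text \<open>At a flat point the Hessian form vanishes on tangent vectors, so its polar form does on
  \<open>v\<close> and \<open>(dd f b) a - (dd f a) b\<close>. This is the Wronskian relation for
  \<open>dd f a\<close> and \<open>dd f b\<close> along the line; hence the direction of the
  gradient is constant.\<close>

lemma flat_line_normals:
 fixes f :: "real^3 => real"
 assumes f: "polyf d f" and line: "!!t. f (p+t *\<^sub>R v) = 0" and flat: "!!t. flat_at f (p+t *\<^sub>R v)"
 shows "dd f a (p+s *\<^sub>R v)*dd f b (p+t *\<^sub>R v) = dd f a (p+t *\<^sub>R v)*dd f b (p+s *\<^sub>R v)"
proof -
 obtain X where X: "!!t. dd f a (p+t *\<^sub>R v) = poly X t" using polyf_line[OF polyf_dd[OF f, of a], of p v] by metis
 obtain Y where Y: "!!t. dd f b (p+t *\<^sub>R v) = poly Y t" using polyf_line[OF polyf_dd[OF f, of b], of p v] by metis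
 have dX: "poly (pderiv X) t = dd (dd f a) v (p+t *\<^sub>R v)" for t
  using DERIV_unique[OF poly_DERIV[of X t]] chain_line[OF polyf_dd[OF f, of a], of p v t] unfolding X by auto
 have dY: "poly (pderiv Y) t = dd (dd f b) v (p+t *\<^sub>R v)" for t
  using DERIV_unique[OF poly_DERIV[of Y t]] chain_line[OF polyf_dd[OF f, of b], of p v t] unfolding Y by auto
 have "poly (pderiv X*Y) t = poly (X*pderiv Y) t" for t
 proof (cases "grad f (p+t *\<^sub>R v) = 0")
  case True
  hence "dd f a (p+t *\<^sub>R v) = 0" "dd f b (p+t *\<^sub>R v) = 0" using grad_inner[OF f] by (metis inner_zero_left)+
  thus ?thesis using X Y by simp
 next
  case False
  define q where "q = p+t *\<^sub>R v"
  define u where "u = (dd f b q) *\<^sub>R a+(- dd f a q) *\<^sub>R b"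
  have Q0: "quad f q w = 0" if "grad f q\<bullet>w = 0" for w
   using tangent_is_cross[OF False that[unfolded q_def]] flat[of t] unfolding flat_at_def q_def by auto
  have tv: "grad f q\<bullet>v = 0" using quad_zero_on_line(1)[OF f line] grad_inner[OF f] by (simp add: q_def)
  have tu: "grad f q\<bullet>u = 0" by (simp add: u_def inner_add_right grad_inner[OF f] inner_diff_right)
  have "quad f q (1 *\<^sub>R u+1 *\<^sub>R v) = 0" using tu tv by (intro Q0) (simp add: inner_add_right)
  hence "dd (dd f u) v q = 0" using quad_lincomb[OF f, of q 1 u 1 v] Q0[OF tu] Q0[OF tv] by simp
  hence "dd f b q*dd (dd f a) v q - dd f a q*dd (dd f b) v q = 0"
   unfolding u_def dd_dd_lincomb[OF f] by simp
  thus ?thesis using X[of t] Y[of t] dX[of t] dY[of t] by (simp add: q_def algebra_simps)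
 qed
 hence "pderiv X*Y = X*pderiv Y" using poly_eq_poly_eq_iff by blast
 from wronskian_zero_proportional[OF this, of s t] show ?thesis unfolding X Y .
qed

text \<open>A quadratic form in two variables with three pairwise independent isotropic vectors is
  zero.\<close>

lemma not_flat_two_directions:
 fixes f :: "real^3 => real"
 assumes f: "polyf d f" and nz: "grad f x ~= 0" and nf: "~flat_at f x"
  and t: "grad f x\<bullet>u = 0" "grad f x\<bullet>v = 0" "grad f x\<bullet>w = 0" and q: "quad f x u = 0" "quad f x v = 0" "quad f x w = 0"
  and ind: "cross3 u v ~= 0" "cross3 u w ~= 0" "cross3 v w ~= 0"
 shows False
proof -
 have span: "EX a b. y = a *\<^sub>R u+b *\<^sub>R v" if y: "grad f x\<bullet>y = 0" for y
 proof -
  define N where "N = cross3 u v"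
  have par: "EX k. grad f x = k *\<^sub>R N"
  proof -
   have "cross3 (grad f x) N = 0" using t by (simp add: N_def Lagrange)
   moreover have "cross3 N (cross3 (grad f x) N) = (N\<bullet>N) *\<^sub>R grad f x - (N\<bullet>grad f x) *\<^sub>R N" by (simp add: Lagrange)
   ultimately have "(N\<bullet>N) *\<^sub>R grad f x = (N\<bullet>grad f x) *\<^sub>R N" by (simp add: cross_zero_right)
   moreover have "N\<bullet>N ~= 0" using ind by (simp add: N_def)
   ultimately have "grad f x = ((N\<bullet>grad f x)/(N\<bullet>N)) *\<^sub>R N"
    by (metis (no_types, lifting) eq_vector_fraction_iff scaleR_scaleR times_divide_eq_left)
   thus ?thesis by blast
  qed
  then obtain k where k: "grad f x = k *\<^sub>R N" by blast
  hence "k ~= 0" using nz by auto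
  hence yN: "y\<bullet>N = 0" using y k by (simp add: inner_commute)
  have NN: "N\<bullet>N ~= 0" using ind by (simp add: N_def)
  have "(N\<bullet>N) *\<^sub>R y = (cross3 y v\<bullet>N) *\<^sub>R u+(cross3 u y\<bullet>N) *\<^sub>R v+(y\<bullet>N) *\<^sub>R N"
   unfolding N_def by (simp add: cross3_def inner_vec_def sum_3 vec_eq_iff forall_3) algebra
  hence "(N\<bullet>N) *\<^sub>R y = (cross3 y v\<bullet>N) *\<^sub>R u+(cross3 u y\<bullet>N) *\<^sub>R v" using yN by simp
  hence "y = ((cross3 y v\<bullet>N)/(N\<bullet>N)) *\<^sub>R u+((cross3 u y\<bullet>N)/(N\<bullet>N)) *\<^sub>R v"
   using NN by (metis (no_types, lifting) divide_inverse_commute scaleR_add_right scaleR_one scaleR_scaleR left_inverse)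
  thus ?thesis by blast
 qed
 obtain a b where w: "w = a *\<^sub>R u+b *\<^sub>R v" using span[OF t(3)] by blast
 have "a ~= 0" "b ~= 0" using ind(2,3) by (auto simp: w cross_add_right cross_mult_right cross_refl)
 moreover have "2*a*b*dd (dd f u) v x = 0" using q quad_lincomb[OF f, of x a u b v] by (simp add: w)
 ultimately have B: "dd (dd f u) v x = 0" by simp
 have "quad f x y = 0" if "grad f x\<bullet>y = 0" for y
  using span[OF that] quad_lincomb[OF f] q B by auto
 moreover have "grad f x\<bullet>cross3 (grad f x) z = 0" for z by (simp add: dot_cross_self)
 ultimately show False using nf by (simp add: flat_at_def)
qed

section \<open>Arcs of circles in the plane\<close>

text \<open>The end tangents keep the function concave on the whole line, so differences of arcs are
  defined everywhere and can be tested for alternation.\<close>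

definition cap :: "real => real" where
 "cap s = (if s\<^sup>2 <= 1/2 then sqrt (1 - s\<^sup>2) else sqrt 2 - \<bar>s\<bar>)"

lemma cap_le: "cap s <= sqrt 2 - \<bar>s\<bar>"
proof (cases "s^2 <= 1/2")
 case True
 have "\<bar>s\<bar>\<^sup>2 <= (sqrt 2)\<^sup>2" using True by simp
 hence "\<bar>s\<bar> <= sqrt 2" by (rule power2_le_imp_le) simp
 moreover have "1 - s\<^sup>2 <= (sqrt 2 - \<bar>s\<bar>)\<^sup>2"
 proof -
  have "0 <= (1 - sqrt 2*\<bar>s\<bar>)\<^sup>2" by simp
  also have "... = 1 - 2 * sqrt 2*\<bar>s\<bar> + 2 * s^2" by (simp add: power2_diff power_mult_distrib)
  finally show ?thesis by (simp add: power2_diff)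
 qed
 ultimately show ?thesis using True by (simp add: cap_def real_le_lsqrt)
qed (simp add: cap_def)

text \<open>Concavity by supporting lines, which avoids differentiating a function given by
  cases.\<close>

lemma cap_support: "EX m. ALL t. cap t <= cap s+m*(t - s)"
proof (cases "s^2 <= 1/2")
 case True
 define w where "w = sqrt (1 - s\<^sup>2)"
 have w: "w^2 = 1 - s\<^sup>2" "w > 0" using True by (auto simp: w_def)
 have "cap t * w <= 1 - s*t" for t
 proof (cases "t^2 <= 1/2")
  case t: True
  define v where "v = sqrt (1 - t\<^sup>2)"
  have v: "v^2 = 1 - t\<^sup>2" using t by (auto simp: v_def)
  have "0 <= (v - w)\<^sup>2" "0 <= (s - t)\<^sup>2" by simp_all
  hence "v * w <= 1 - s*t" using v w(1) by (simp add: power2_diff)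
  thus ?thesis using t by (simp add: cap_def v_def)
 next
  case False
  have "\<bar>s\<bar>\<^sup>2 <= w\<^sup>2" using True w by simp
  hence sw: "\<bar>s\<bar> <= w" by (rule power2_le_imp_le) (use w(2) in auto)
  have "(sqrt 2/2)^2 <= \<bar>t\<bar>\<^sup>2" using False by (simp add: power_divide)
  hence t: "sqrt 2/2 <= \<bar>t\<bar>" by (rule power2_le_imp_le) simp
  have "0 <= (w - \<bar>s\<bar>)\<^sup>2" by simp
  hence "(w+\<bar>s\<bar>)^2 <= (sqrt 2)\<^sup>2" using w(1) by (simp add: power2_diff power2_sum)
  hence "w+\<bar>s\<bar> <= sqrt 2" by (rule power2_le_imp_le) simp
  hence "sqrt 2/2*(w+\<bar>s\<bar>) <= sqrt 2/2 * sqrt 2" by (intro mult_left_mono) auto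
  hence a: "sqrt 2/2*(w+\<bar>s\<bar>) <= 1" by simp
  have "sqrt 2/2*(w - \<bar>s\<bar>) <= \<bar>t\<bar> * (w - \<bar>s\<bar>)" using t sw by (intro mult_right_mono) auto
  moreover have "s*t <= \<bar>s\<bar> * \<bar>t\<bar>" by (metis abs_ge_self abs_mult)
  ultimately have "(sqrt 2 - \<bar>t\<bar>) * w <= 1 - s*t" using a by (simp add: algebra_simps)
  thus ?thesis using False by (simp add: cap_def)
 qed
 hence "cap t <= (1 - s*t)/w" for t using pos_le_divide_eq[OF w(2)] by blast
 moreover have "(1 - s*t)/w = cap s+(- s/w)*(t - s)" for t
 proof -
  have "1 - s*t = w * w - s*(t - s)" using w(1) by (simp add: power2_eq_square algebra_simps)
  hence "(1 - s*t)/w = w - s*(t - s)/w" using w(2) by (simp add: diff_divide_distrib)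
  thus ?thesis using True by (simp add: cap_def w_def)
 qed
 ultimately show ?thesis by metis
next
 case False
 hence s: "cap s = sqrt 2 - \<bar>s\<bar>" by (simp add: cap_def)
 show ?thesis
 proof (intro exI allI)
  fix t show "cap t <= cap s+(if s > 0 then -1 else 1)*(t - s)" using cap_le[of t] unfolding s by auto
 qed
qed

text \<open>Chord slopes of a concave function decrease when both end points move to the
  right.\<close>

lemma cap_slope:
 assumes "u < v" "u' < v'" "u <= u'" "v <= v'"
 shows "(cap v' - cap u')*(v - u) <= (cap v - cap u)*(v' - u')"
proof -
 have A: "(cap c - cap a)*(b - a) <= (cap b - cap a)*(c - a)" "(cap c - cap b)*(c - a) <= (cap c - cap a)*(c - b)"
  if "a <= b" "b <= c" for a b c
 proof -
  have *: "(c - a)*cap b >= (c - b)*cap a+(b - a)*cap c"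
  proof -
   obtain m where m: "!!t. cap t <= cap b+m*(t - b)" using cap_support by blast
   have "(c - b)*cap a+(b - a)*cap c <= (c - b)*(cap b+m*(a - b))+(b - a)*(cap b+m*(c - b))"
    using m that by (intro add_mono mult_left_mono) auto
   also have "... = (c - a)*cap b" by (simp add: algebra_simps)
   finally show ?thesis .
  qed
  show "(cap c - cap a)*(b - a) <= (cap b - cap a)*(c - a)" "(cap c - cap b)*(c - a) <= (cap c - cap a)*(c - b)"
   using * by (simp_all add: algebra_simps)
 qed
 have 1: "(cap v' - cap u)*(v - u) <= (cap v - cap u)*(v' - u)" using A(1)[of u v v'] assms by simp
 have 2: "(cap v' - cap u')*(v' - u) <= (cap v' - cap u)*(v' - u')" using A(2)[of u u' v'] assms by simp
 have "(cap v' - cap u')*(v - u)*(v' - u) <= (cap v' - cap u)*(v' - u')*(v - u)"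
  using mult_right_mono[OF 2, of "v - u"] assms by (simp add: mult_ac)
 also have "... <= (cap v - cap u)*(v' - u)*(v' - u')"
  using mult_right_mono[OF 1, of "v' - u'"] assms by (simp add: mult_ac)
 finally have "((cap v' - cap u')*(v - u))*(v' - u) <= ((cap v - cap u)*(v' - u'))*(v' - u)" by (simp add: mult_ac)
 thus ?thesis using assms by (simp add: mult_le_cancel_right)
qed

text \<open>A circle with centre \<open>(a, b)\<close> and radius \<open>r\<close> is encoded as \<open>(a, b, r)\<close>. Its top arc is the quarter between the
 directions of slope \<open>1\<close> and \<open>-1\<close>, and \<open>top_y\<close> prolongs this arc by its end tangents to a concave function.\<close>

definition on_circle :: "real \<times> real \<times> real => real \<times> real => bool" where
 "on_circle ga p = (case ga of (a, b, r) => (fst p - a)\<^sup>2+(snd p - b)^2 = r^2)"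

definition on_top :: "real \<times> real \<times> real => real \<times> real => bool" where
 "on_top ga p = (on_circle ga p & \<bar>fst p - fst ga\<bar> <= snd p - fst (snd ga))"

definition top_y :: "real \<times> real \<times> real => real => real" where
 "top_y ga x = (case ga of (a, b, r) => b+r*cap ((x - a)/r))"

lemma top_y_eq:
 assumes "r > 0" "2*(x - a)^2 <= r\<^sup>2"
 shows "top_y (a, b, r) x = b+sqrt (r^2 - (x - a)\<^sup>2)"
proof -
 have "((x - a)/r)^2 <= 1/2" using assms by (simp add: power_divide field_simps)
 hence "top_y (a, b, r) x = b+r * sqrt (1 - ((x - a)/r)\<^sup>2)" by (simp add: top_y_def cap_def)
 also have "r * sqrt (1 - ((x - a)/r)\<^sup>2) = sqrt (r^2*(1 - ((x - a)/r)\<^sup>2))" using assms by (simp add: real_sqrt_mult)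
 also have "r^2*(1 - ((x - a)/r)\<^sup>2) = r^2 - (x - a)\<^sup>2" using assms by (simp add: power_divide right_diff_distrib)
 finally show ?thesis .
qed

lemma on_top_iff:
 assumes "r > 0"
 shows "on_top (a, b, r) (x, y) \<longleftrightarrow> 2*(x - a)^2 <= r\<^sup>2 & y = top_y (a, b, r) x"
proof
 assume t: "on_top (a, b, r) (x, y)"
 hence e: "(x - a)^2+(y - b)^2 = r^2" "\<bar>x - a\<bar> <= y - b" by (auto simp: on_top_def on_circle_def)
 have "(x - a)^2 <= (y - b)\<^sup>2" using e(2) by (metis abs_ge_zero power2_abs power_mono)
 hence le: "2*(x - a)^2 <= r\<^sup>2" using e by simp
 have "sqrt (r^2 - (x - a)\<^sup>2) = y - b" using e by (intro real_sqrt_unique) auto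
 thus "2*(x - a)^2 <= r\<^sup>2 & y = top_y (a, b, r) x" using le top_y_eq[OF assms le] by simp
next
 assume t: "2*(x - a)^2 <= r\<^sup>2 & y = top_y (a, b, r) x"
 hence y: "y - b = sqrt (r^2 - (x - a)\<^sup>2)" using top_y_eq[OF assms] by simp
 have "r^2 - (x - a)\<^sup>2 >= 0" using t zero_le_power2[of "x - a"] by linarith
 hence "(y - b)^2 = r^2 - (x - a)\<^sup>2" "y - b >= 0" using y by auto
 moreover have "\<bar>x - a\<bar>\<^sup>2 <= (y - b)\<^sup>2" using t calculation by simp
 hence "\<bar>x - a\<bar> <= y - b" by (rule power2_le_imp_le) (rule calculation)
 ultimately show "on_top (a, b, r) (x, y)" by (simp add: on_top_def on_circle_def)
qed

text \<open>The slopes of the two graphs are those of \<open>cap\<close> at the normalised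
  coordinates \<open>s\<close> and \<open>s'\<close>. As \<open>r <= r'\<close>, the difference
  \<open>s - s'\<close> is nondecreasing; so \<open>D\<close> rises while \<open>s <= s'\<close> and
  falls afterwards.\<close>

lemma top_difference_quasiconcave:
 fixes a b r a' b' r' :: real
 assumes r: "0 < r" "r <= r'" and xyz: "x < y" "y < z"
 defines "D \<equiv> %x. top_y (a, b, r) x - top_y (a', b', r') x"
 shows "D x <= D y | D z <= D y"
proof -
 define s where "s = (%t. (t - a)/r)"
 define s' where "s' = (%t. (t - a')/r')"
 have D: "D t = b+r*cap (s t) - (b'+r'*cap (s' t))" for t by (simp add: D_def top_y_def s_def s'_def)
 have d: "s v - s u = (v - u)/r" "s' v - s' u = (v - u)/r'" for u v
  by (simp_all add: s_def s'_def diff_divide_distrib)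
 have le: "s' v - s' u <= s v - s u" "s u < s v" "s' u < s' v" if "u < v" for u v
 proof -
  show "s' v - s' u <= s v - s u" unfolding d using that r by (intro divide_left_mono) auto
  show "s u < s v" "s' u < s' v" using r that by (simp_all add: s_def s'_def divide_strict_right_mono)
 qed
 have slope: "r'*P <= r*Q" if "P*((v - u)/r) <= Q*((v - u)/r')" "u < v" for P Q u v
 proof -
  have "P*((v - u)/r)*(r*r'/(v - u)) <= Q*((v - u)/r')*(r*r'/(v - u))"
   using that r by (intro mult_right_mono) auto
  thus ?thesis using that r by (simp add: mult_ac)
 qed
 show ?thesis
 proof (cases "s y <= s' y")
  case True
  have "s x <= s' x" using True le(1)[OF xyz(1)] by linarith
  hence "(cap (s' y) - cap (s' x))*(s y - s x) <= (cap (s y) - cap (s x))*(s' y - s' x)"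
   using True le[OF xyz(1)] by (intro cap_slope) auto
  from slope[OF this[unfolded d] xyz(1)] show ?thesis by (simp add: D algebra_simps)
 next
  case False
  have "s' z <= s z" using False le(1)[OF xyz(2)] by linarith
  hence "(cap (s z) - cap (s y))*(s' z - s' y) <= (cap (s' z) - cap (s' y))*(s z - s y)"
   using False le[OF xyz(2)] by (intro cap_slope) auto
  hence "(- (cap (s' z) - cap (s' y)))*(s z - s y) <= (- (cap (s z) - cap (s y)))*(s' z - s' y)"
   unfolding mult_minus_left by (rule le_imp_neg_le)
  from slope[OF this[unfolded d] xyz(2)] show ?thesis by (simp add: D algebra_simps)
 qed
qed

lemma quasiconcave_no_alternation:
 fixes D :: "real => real"
 assumes "!!x y z. x < y ==> y < z ==> D x <= D y | D z <= D y"
 shows "no_alternation D" "no_alternation (%x. - D x)"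
proof -
 have A: "~(D a > 0 & D b < 0 & D c > 0)" if "a < b" "b < c" for a b c
  using assms[OF that] by linarith
 have B: "~(D a > 0 & D b < 0 & D c > 0 & D d < 0)" "~(D a < 0 & D b > 0 & D c < 0 & D d > 0)"
  if "a < b" "b < c" "c < d" for a b c d using A[OF that(1,2)] A[OF that(2,3)] by blast+
 show "no_alternation D" "no_alternation (%x. - D x)"
  unfolding no_alternation_def neg_0_less_iff_less neg_less_0_iff_less by (intro allI impI conjI B; assumption)+
qed

lemma top_no_alternation:
 assumes "snd (snd ga) > 0" "snd (snd ga') > 0"
 shows "no_alternation (%x. top_y ga x - top_y ga' x)"
proof -
 obtain a b r a' b' r' where g: "ga = (a, b, r)" "ga' = (a', b', r')" by (metis surj_pair)
 have r: "r > 0" "r' > 0" using assms by (auto simp: g)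
 show ?thesis
 proof (cases "r <= r'")
  case True
  define D where "D = (%x. top_y (a, b, r) x - top_y (a', b', r') x)"
  have "D x <= D y | D z <= D y" if "x < y" "y < z" for x y z
   unfolding D_def by (rule top_difference_quasiconcave[OF r(1) True that])
  hence "no_alternation D" by (rule quasiconcave_no_alternation(1))
  thus ?thesis by (simp add: g D_def)
 next
  case False
  hence F: "r' <= r" by simp
  define D where "D = (%x. top_y (a', b', r') x - top_y (a, b, r) x)"
  have "D x <= D y | D z <= D y" if "x < y" "y < z" for x y z
   unfolding D_def by (rule top_difference_quasiconcave[OF r(2) F that])
  hence "no_alternation (%x. - D x)" by (rule quasiconcave_no_alternation(2))
  thus ?thesis by (simp add: g D_def)
 qed
qed

lemma circle_three_points:
 assumes on: "on_circle ga p" "on_circle ga q" "on_circle ga s" "on_circle ga' p" "on_circle ga' q" "on_circle ga' s"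
  and dist: "p ~= q" "p ~= s" "q ~= s" and r: "snd (snd ga) > 0" "snd (snd ga') > 0"
 shows "ga = ga'"
proof -
 obtain a b r a' b' r' where g: "ga = (a, b, r)" "ga' = (a', b', r')" by (metis surj_pair)
 obtain x y x1 y1 x2 y2 where pt: "p = (x, y)" "q = (x1, y1)" "s = (x2, y2)" by (metis surj_pair)
 define u1 u2 v1 v2 where uv: "u1 = x1 - x" "u2 = y1 - y" "v1 = x2 - x" "v2 = y2 - y"
 have eu: "2*(u1*(al - x)+u2*(be - y)) = u1^2+u2^2" if "on_circle (al, be, rh) p" "on_circle (al, be, rh) q" for al be rh
  using that by (simp add: on_circle_def pt uv power2_eq_square algebra_simps)
 have ev: "2*(v1*(al - x)+v2*(be - y)) = v1^2+v2^2" if "on_circle (al, be, rh) p" "on_circle (al, be, rh) s" for al be rh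
  using that by (simp add: on_circle_def pt uv power2_eq_square algebra_simps)
 have nz: "u1 ~= 0 | u2 ~= 0" "v1 ~= 0 | v2 ~= 0" "u1 ~= v1 | u2 ~= v2" using dist by (auto simp: pt uv)
 have det: "u1 * v2 - u2 * v1 ~= 0"
 proof
  assume z: "u1 * v2 - u2 * v1 = 0"
  define U V where "U = u1^2+u2^2" "V = v1^2+v2^2"
  have U: "U > 0" "V > 0" using nz by (auto simp: U_V_def sum_power2_gt_zero_iff)
  have e: "U = 2*(u1*(a - x)+u2*(b - y))" "V = 2*(v1*(a - x)+v2*(b - y))"
   using eu ev on unfolding g U_V_def by auto
  have 1: "u1*V = v1*U" "u2*V = v2*U" unfolding e using z by algebra+
  hence "U*V*V = U*V*U" using U_V_def by algebra
  hence "U = V" using U by simp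
  thus False using 1 U nz by auto
 qed
 have E: "u1*(a - a')+u2*(b - b') = 0" "v1*(a - a')+v2*(b - b') = 0"
  using eu[of a b r] eu[of a' b' r'] ev[of a b r] ev[of a' b' r'] on unfolding g by (auto simp: algebra_simps)
 have "(u1 * v2 - u2 * v1)*(a - a') = 0" "(u1 * v2 - u2 * v1)*(b - b') = 0" using E by algebra+
 hence c: "a = a'" "b = b'" using det by auto
 have "r^2 = r'^2" using on c by (simp add: g on_circle_def)
 hence "r = r'" using r by (simp add: g power2_eq_iff)
 thus ?thesis using c by (simp add: g)
qed

text \<open>The difference of the graphs is quasiconcave and zero at both common points; a zero at
  the midpoint would give a third common point. Thus \<open>(a, b, r)\<close> is above inside and
  not above outside.\<close>

lemma lens:
 assumes r: "0 < r" "r <= r'" and ne: "(a, b, r) ~= (a', b', r')"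
  and on: "on_top (a, b, r) p" "on_top (a', b', r') p" "on_top (a, b, r) q" "on_top (a', b', r') q" and pq: "fst p < fst q"
 shows "top_y (a', b', r') ((fst p+fst q)/2) < top_y (a, b, r) ((fst p+fst q)/2)"
  and "x <= fst p | fst q <= x ==> top_y (a, b, r) x <= top_y (a', b', r') x"
proof -
 obtain x1 y1 x2 y2 where pt: "p = (x1, y1)" "q = (x2, y2)" by (metis surj_pair)
 have r': "r' > 0" using r by simp
 define u where "u = (x1+x2)/2"
 define D where "D = (%x. top_y (a, b, r) x - top_y (a', b', r') x)"
 have u: "x1 < u" "u < x2" using pq by (auto simp: u_def pt)
 have D0: "D x1 = 0" "D x2 = 0" using on r r' by (auto simp: D_def pt on_top_iff)
 have q: "D x <= D y | D z <= D y" if "x < y" "y < z" for x y z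
  unfolding D_def by (rule top_difference_quasiconcave[OF r that])
 have mid: "2*(u - al)^2 <= rh\<^sup>2" if "2*(x1 - al)^2 <= rh\<^sup>2" "2*(x2 - al)^2 <= rh\<^sup>2" for al rh
 proof -
  define A B where "A = x1 - al" "B = x2 - al"
  have "u - al = (A+B)/2" by (simp add: u_def A_B_def field_simps)
  hence e: "(u - al)^2 = (A^2+B^2+2*A*B)/4" by (simp only: power_divide power2_sum) simp
  have "0 <= A\<^sup>2+B^2 - 2*A*B" using zero_le_power2[of "A - B"] unfolding power2_diff .
  thus ?thesis using that unfolding A_B_def[symmetric] e by (simp add: field_simps)
 qed
 have Du: "D u ~= 0"
 proof
  assume "D u = 0"
  hence "on_top (a, b, r) (u, top_y (a, b, r) u)" "on_top (a', b', r') (u, top_y (a, b, r) u)"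
   using on mid r r' by (auto simp: D_def pt on_top_iff)
  hence "(a, b, r) = (a', b', r')"
   using circle_three_points[of "(a, b, r)" p q "(u, top_y (a, b, r) u)" "(a', b', r')"] on u r r' by (auto simp: on_top_def pt)
  thus False using ne by simp
 qed
 have Dpos: "D u > 0" using q[OF u] D0 Du by auto
 thus "top_y (a', b', r') ((fst p+fst q)/2) < top_y (a, b, r) ((fst p+fst q)/2)" by (simp add: D_def u_def pt)
 show "top_y (a, b, r) x <= top_y (a', b', r') x" if "x <= fst p | fst q <= x"
 proof -
  have "D x <= 0"
  proof (rule ccontr)
   assume "~D x <= 0"
   hence "x < x1 | x2 < x" using that D0 by (cases "x = x1"; cases "x = x2") (auto simp: pt)
   thus False using q[of x x1 u] q[of u x2 x] u D0 Dpos \<open>~D x <= 0\<close> by auto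
  qed
  thus ?thesis by (simp add: D_def)
 qed
qed

section \<open>Circles as points of three-space\<close>

definition dual_circle :: "real \<times> real \<times> real => real^3" where
 "dual_circle ga = (case ga of (a, b, r) => vector [a, b, r^2 - a\<^sup>2 - b\<^sup>2])"

definition dual_point :: "real \<times> real => real^3" where
 "dual_point p = vector [2*fst p, 2 * snd p, 1]"

text \<open>Half the cross product of the two dual points, i.e. the direction of the line formed by
  the circles through \<open>p\<close> and \<open>q\<close>. Its second coordinate is nonzero for
  \<open>fst p < fst q\<close>, so the height of the centre parametrises the pencil.\<close>

definition pencil_direction :: "real \<times> real => real \<times> real => real^3" where
 "pencil_direction p q = vector [snd p - snd q, fst q - fst p, 2*(fst p * snd q - snd p*fst q)]"

text \<open>With \<open>w = r^2 - a^2 - b^2\<close> the equation of a circle is linear in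
  \<open>(a, b, w)\<close>: circles through a point form a plane with normal
  \<open>dual_point p\<close>.\<close>

lemma on_circle_dual: "on_circle ga p \<longleftrightarrow> dual_point p\<bullet>dual_circle ga = (fst p)^2+(snd p)^2"
proof -
 obtain a b r where g: "ga = (a, b, r)" by (metis surj_pair)
 have "dual_point p\<bullet>dual_circle ga = 2*(fst p*a)+2*(snd p*b)+(r^2 - a\<^sup>2 - b\<^sup>2)"
  by (simp add: g dual_point_def dual_circle_def inner_vec_def sum_3)
 moreover have "(fst p - a)^2+(snd p - b)^2 = (fst p)^2+(snd p)^2+a^2+b^2 - 2*(fst p*a) - 2*(snd p*b)"
  by (simp add: power2_diff)
 ultimately show ?thesis unfolding on_circle_def g prod.case by linarith
qed

lemma dual_circle_inj:
 assumes "snd (snd ga) > 0" "snd (snd ga') > 0" "dual_circle ga = dual_circle ga'"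
 shows "ga = ga'"
proof -
 obtain a b r a' b' r' where g: "ga = (a, b, r)" "ga' = (a', b', r')" by (metis surj_pair)
 have "a = a'" "b = b'" "r^2 = r'^2" using assms(3) by (auto simp: g dual_circle_def vec_eq_iff forall_3)
 thus ?thesis using assms(1,2) by (simp add: g power2_eq_iff)
qed

lemma pencil_line:
 assumes "on_circle ga p" "on_circle ga q" "on_circle ga' p" "on_circle ga' q" "fst p < fst q"
 shows "dual_circle ga' = dual_circle ga+((fst (snd ga') - fst (snd ga))/(fst q - fst p)) *\<^sub>R pencil_direction p q"
proof -
 obtain a b r a' b' r' where g: "ga = (a, b, r)" "ga' = (a', b', r')" by (metis surj_pair)
 obtain x y x1 y1 where pt: "p = (x, y)" "q = (x1, y1)" by (metis surj_pair)
 define w w' where w: "w = r^2 - a\<^sup>2 - b\<^sup>2" "w' = r'^2 - a'\<^sup>2 - b'\<^sup>2"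
 have e: "2*x*a+2*y*b+w = x^2+y^2" "2*x1*a+2*y1*b+w = x1^2+y1^2"
  "2*x*a'+2*y*b'+w' = x^2+y^2" "2*x1*a'+2*y1*b'+w' = x1^2+y1^2"
  using assms unfolding w by (simp_all add: g pt on_circle_def power2_eq_square algebra_simps)
 have X: "x1 - x ~= 0" using assms(5) by (simp add: pt)
 have 1: "(a' - a)*(x1 - x) = (b' - b)*(y - y1)" using e by algebra
 have "2*((w' - w)*(x1 - x)) = 2*((b' - b)*(2*(x*y1 - y*x1)))" using e by algebra
 hence 2: "(w' - w)*(x1 - x) = (b' - b)*(2*(x*y1 - y*x1))" by simp
 have A: "a' = a+(b' - b)/(x1 - x)*(y - y1)" and W: "w' = w+(b' - b)/(x1 - x)*(2*(x*y1 - y*x1))"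
  unfolding times_divide_eq_left 1[symmetric] 2[symmetric] using X by simp_all
 have B: "b' = b+(b' - b)/(x1 - x)*(x1 - x)" using X by simp
 show ?thesis
  unfolding g pt dual_circle_def pencil_direction_def prod.case fst_conv snd_conv w[symmetric]
  unfolding vec_eq_iff forall_3 vector_add_component vector_scaleR_component vector_3 real_scaleR_def
  by (intro conjI A B W)
qed

text \<open>A chord of a top arc has slope at most 1 in absolute value, so along its bisector the
  centre moves with \<open>|a' - a| <= b' - b\<close>. As \<open>p\<close> lies in the upper quarter
  seen from the centre, raising the centre brings it closer to \<open>p\<close>.\<close>

lemma pencil_radius_decreasing:
 assumes on: "on_top ga p" "on_top ga q" "on_top ga' p" "on_top ga' q" and pq: "fst p < fst q"
  and r: "snd (snd ga) > 0" "snd (snd ga') > 0" and b: "fst (snd ga) < fst (snd ga')"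
 shows "snd (snd ga') < snd (snd ga)"
proof -
 obtain a b r a' b' r' where g: "ga = (a, b, r)" "ga' = (a', b', r')" by (metis surj_pair)
 obtain x y x1 y1 where pt: "p = (x, y)" "q = (x1, y1)" by (metis surj_pair)
 have e: "(x - a)^2+(y - b)^2 = r^2" "(x1 - a)^2+(y1 - b)^2 = r^2" "(x - a')^2+(y - b')^2 = r'^2" "(x1 - a')^2+(y1 - b')^2 = r'^2"
  "\<bar>x - a\<bar> <= y - b" "\<bar>x1 - a\<bar> <= y1 - b" "\<bar>x - a'\<bar> <= y - b'"
  using on by (simp_all add: g pt on_top_def on_circle_def)
 have X: "x1 - x > 0" "b' - b > 0" "r > 0" "r' > 0" using pq r b by (simp_all add: g pt)
 define S where "S = (y1 - b)+(y - b)"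
 have S: "S > 0"
 proof (rule ccontr)
  assume "~S > 0"
  hence "y - b = 0" "x - a = 0" using e(5,6) unfolding S_def by linarith+
  thus False using e(1) X by simp
 qed
 have "(y1 - y)*S = (x - x1)*((x - a)+(x1 - a))" using e(1,2) unfolding S_def by algebra
 hence "\<bar>y1 - y\<bar> * S = (x1 - x)*\<bar>(x - a)+(x1 - a)\<bar>" using S X by (metis abs_minus_commute abs_mult abs_of_pos)
 also have "... <= (x1 - x)*S" using X e(5,6) abs_triangle_ineq[of "x - a" "x1 - a"] unfolding S_def by (intro mult_left_mono) auto
 finally have m: "\<bar>y1 - y\<bar> <= x1 - x" using S by simp
 have 1: "(a' - a)*(x1 - x) = (b' - b)*(y - y1)" using e(1-4) by algebra
 have "\<bar>a' - a\<bar> * (x1 - x) = (b' - b)*\<bar>y1 - y\<bar>" using 1 X by (metis abs_minus_commute abs_mult abs_of_pos)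
 also have "... <= (b' - b)*(x1 - x)" using m X by (intro mult_left_mono) auto
 finally have da: "\<bar>a' - a\<bar> <= b' - b" using X by simp
 have "- ((x - a')*(a' - a)) <= \<bar>x - a'\<bar> * \<bar>a' - a\<bar>" by (metis abs_ge_minus_self abs_mult)
 also have "... <= (y - b')*(b' - b)" using e(7) da by (intro mult_mono) auto
 finally have "- ((x - a')*(a' - a)) <= (y - b')*(b' - b)" .
 moreover define Q where "Q = (x - a')*(a' - a)+(y - b')*(b' - b)"
 ultimately have "Q >= 0" by simp
 moreover have "r^2 = r'^2+2*Q+(a' - a)^2+(b' - b)^2"
  unfolding e(1)[symmetric] e(3)[symmetric] Q_def by (simp add: power2_eq_square algebra_simps)
 moreover have "(b' - b)^2 > 0" using X by simp
 ultimately have "r'^2 < r\<^sup>2" using zero_le_power2[of "a' - a"] by linarith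
 hence "r' < r" by (rule power_less_imp_less_base) (use X in simp)
 thus ?thesis by (simp add: g)
qed

section \<open>Lines in a plane of three-space\<close>

text \<open>Power mean inequality, from Young's inequality for each term against the mean
  \<open>A\<close>.\<close>

lemma sum_powr_le_card:
 fixes a :: "'i => real"
 assumes S: "finite S" and a: "!!i. i:S ==> a i >= 0" and th: "0 < th" "th < 1"
 shows "(SUM i:S. a i powr th) <= rc S powr (1 - th)*(SUM i:S. a i) powr th"
proof (cases "(SUM i:S. a i) = 0")
 case True
 hence "ALL i:S. a i = 0" using sum_nonneg_eq_0_iff[OF S a] by simp
 thus ?thesis by simp
next
 case False
 define s where "s = (SUM i:S. a i)"
 define c where "c = rc S"
 have s: "s > 0" using False sum_nonneg[of S a] a by (simp add: s_def less_le)
 have c: "c > 0" using False S by (cases "S = {}") (auto simp: c_def card_gt_0_iff)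
 define A where "A = s/c"
 have A: "A > 0" using s c by (simp add: A_def)
 have "a i powr th*A powr (1 - th) <= th*a i+(1 - th)*A" if "i:S" for i
 proof (cases "a i = 0")
  case True thus ?thesis using A th by simp
 next
  case False
  hence "a i > 0" using a[OF that] by simp
  thus ?thesis using Youngs_inequality_0[of th "1 - th" "a i" A] th A by simp
 qed
 hence "(SUM i:S. a i powr th*A powr (1 - th)) <= (SUM i:S. th*a i+(1 - th)*A)" by (rule sum_mono)
 also have "... = th * s+c*((1 - th)*A)" by (simp add: sum.distrib s_def c_def sum_distrib_left)
 also have "... = s" using c by (simp add: A_def algebra_simps)
 finally have 1: "(SUM i:S. a i powr th)*A powr (1 - th) <= s" by (simp add: sum_distrib_right)
 have "A powr (1 - th)*(c powr (1 - th) * s powr th) = s powr (1 - th) * s powr th"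
  using s c by (simp add: A_def powr_divide)
 also have "... = s" using s by (simp add: powr_add[symmetric])
 finally have 2: "(c powr (1 - th) * s powr th)*A powr (1 - th) = s" by (simp add: mult.commute)
 have "A powr (1 - th) > 0" using A by simp
 thus ?thesis using 1 2 unfolding s_def c_def by (metis mult_le_cancel_right_pos)
qed

lemma sum_card_fibres_le:
 assumes "finite X" "finite K"
 shows "(SUM k:K. card {x:X. ta x = k}) <= card X"
proof -
 have "(SUM k:K. card {x:X. ta x = k}) = card (UN k:K. {x:X. ta x = k})"
  using assms by (subst card_UN_disjoint) auto
 also have "... <= card X" using assms by (intro card_mono) auto
 finally show ?thesis .
qed

text \<open>A line through a point off the zero set, in a generic direction, meets the hyperplanes
  in distinct points, all of them roots of the restriction.\<close>

lemma hyperplanes_in_zero_set: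
 fixes F :: "'a::euclidean_space => real"
 assumes F: "polyf d F" "EX x. F x ~= 0" and fin: "finite \<H>" and hyp: "!!H. H:\<H> ==> EX N e. H = {x. N\<bullet>x = e}"
  and zero: "!!H x. H:\<H> ==> x:H ==> F x = 0"
  and nonempty: "{} ~: \<H>"
 shows "card \<H> <= d"
proof -
 obtain y where y: "F y ~= 0" using F(2) by blast
 have "EX M. M ~= 0 & H = {x. M\<bullet>(x - y) = 1}" if H: "H:\<H>" for H
 proof -
  obtain N e where Ne: "H = {x. N\<bullet>x = e}" using hyp[OF H] by blast
  define s where "s = e - N\<bullet>y"
  have s: "s ~= 0" using zero[OF H, of y] y Ne by (auto simp: s_def)
  have "(1/s) *\<^sub>R N\<bullet>(x - y) = 1 \<longleftrightarrow> N\<bullet>x = e" for x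
   using s by (simp add: field_simps inner_diff_right) (auto simp: s_def)
  hence "H = {x. (1/s) *\<^sub>R N\<bullet>(x - y) = 1}" by (simp add: Ne)
  moreover have "N ~= 0"
   using nonempty H Ne s by (auto simp: s_def)
  ultimately show ?thesis using s by (intro exI[of _ "(1/s) *\<^sub>R N"]) auto
 qed
 then obtain M where M: "!!H. H:\<H> ==> M H ~= 0" "!!H. H:\<H> ==> H = {x. M H\<bullet>(x - y) = 1}" by metis
 have Minj: "M H ~= M H'" if "H:\<H>" "H':\<H>" "H ~= H'" for H H' using M(2)[OF that(1)] M(2)[OF that(2)] that(3) by metis
 \<comment> \<open>The direction must be orthogonal to no normal, in order to meet every hyperplane,
   and to no difference of normals, so that the parameters of the intersection points are
   distinct.\<close>
 define V where "V = M ` \<H> \<union> ((%(H, H'). M H - M H') ` {(H, H'). H:\<H> & H':\<H> & H ~= H'})"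
 have "finite {(H, H'). H:\<H> & H':\<H> & H ~= H'}" by (rule finite_subset[of _ "\<H> \<times> \<H>"]) (use fin in auto)
 hence finV: "finite V" using fin by (simp add: V_def)
 have V0: "w ~= 0" if "w:V" for w
 proof -
  have "(EX H:\<H>. w = M H) | (EX H H'. H:\<H> & H':\<H> & H ~= H' & w = M H - M H')" using that unfolding V_def by (elim UnE imageE) auto
  thus ?thesis
  proof (elim disjE bexE exE conjE)
   fix H assume "H:\<H>" "w = M H" thus ?thesis using M(1) by simp
  next
   fix H H' assume "H:\<H>" "H':\<H>" "H ~= H'" "w = M H - M H'" thus ?thesis using Minj[of H H'] by simp
  qed
 qed
 have "EX v. ALL f:(%w v. v\<bullet>w) ` V. f v ~= 0"
 proof (rule polyf_common_nonzero)
  fix f assume "f:(%w v. v\<bullet>w) ` V"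
  then obtain w where w: "w:V" "f = (%v. v\<bullet>w)" by blast
  hence "polyf (Suc 0) f" "f w ~= 0" using V0 by (auto intro: polyf_inner)
  thus "(EX d. polyf d f) & (EX x. f x ~= 0)" by blast
 qed (use finV in simp)
 then obtain v where v: "!!w. w:V ==> v\<bullet>w ~= 0" by auto
 have vM: "v\<bullet>M H ~= 0" if "H:\<H>" for H using v that by (auto simp: V_def)
 have vMM: "v\<bullet>M H ~= v\<bullet>M H'" if "H:\<H>" "H':\<H>" "H ~= H'" for H H'
 proof -
  have "M H - M H':V" using that by (auto simp: V_def)
  thus ?thesis using v by (force simp: inner_diff_right)
 qed
 obtain p where p: "degree p <= d" "!!t. F (y+t *\<^sub>R v) = poly p t" using polyf_line[OF F(1), of y v] by metis
 define t where "t = (%H. 1/(v\<bullet>M H))"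
 have "p ~= 0" using p(2)[of 0] y by auto
 have "inj_on t \<H>" unfolding t_def using vM vMM by (intro inj_onI) (metis divide_cancel_left one_neq_zero)
 hence "card \<H> = card (t ` \<H>)" by (simp add: card_image)
 also have "... <= card {s. poly p s = 0}"
 proof (rule card_mono)
  show "finite {s. poly p s = 0}" using \<open>p ~= 0\<close> by (rule poly_roots_finite)
  show "t ` \<H> <= {s. poly p s = 0}"
  proof
   fix s assume "s:t ` \<H>"
   then obtain H where H: "H:\<H>" "s = t H" by blast
   have "M H\<bullet>((y+s *\<^sub>R v) - y) = 1" using vM[OF H(1)] H(2) by (simp add: t_def inner_commute)
   hence "y+s *\<^sub>R v:H" using M(2)[OF H(1)] by blast
   thus "s:{s. poly p s = 0}" using zero[OF H(1)] p(2)[of s] by auto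
  qed
 qed
 also have "... <= d" using card_poly_roots_bound[OF \<open>p ~= 0\<close>] p(1) by simp
 finally show ?thesis .
qed

lemma polyf_compose:
 fixes g :: "'b::euclidean_space => 'a::euclidean_space"
 assumes "polyf d f" "!!b. polyf 1 (%x. g x\<bullet>b)"
 shows "polyf d (%x. f (g x))"
 using assms(1)
proof (induction rule: polyf.induct)
 case (polyf_inner d b)
 show ?case by (rule polyf_mono[OF assms(2)]) simp
qed (auto intro: polyf_const polyf_add polyf_mult)

text \<open>Cramer's rule with the denominator cleared.\<close>

lemma cross3_basis:
 "(cross3 u v\<bullet>cross3 u v) *\<^sub>R y = (cross3 y v\<bullet>cross3 u v) *\<^sub>R u+(cross3 u y\<bullet>cross3 u v) *\<^sub>R v+(y\<bullet>cross3 u v) *\<^sub>R cross3 u v"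
 by (simp add: cross3_def inner_vec_def sum_3 vec_eq_iff forall_3) algebra

text \<open>An affine chart from an orthogonal frame. The third property is affinity in the form
  that carries lines to lines.\<close>

lemma plane_chart:
 fixes N :: "real^3"
 assumes "N ~= 0"
 obtains ph :: "real \<times> real => real^3" where "inj ph" "range ph = {x. N\<bullet>x = e}"
  "!!x v t. ph (x+t *\<^sub>R v) = ph x+t *\<^sub>R (ph (x+v) - ph x)" "!!b. polyf 1 (%x. ph x\<bullet>b)"
proof -
 obtain u where u: "cross3 N u ~= 0"
 proof (cases "N $ 1 = 0 & N $ 2 = 0")
  case True
  hence "N $ 3 ~= 0" using assms by (auto simp: vec_eq_iff forall_3)
  hence "cross3 N (axis 1 1) ~= 0" by (auto simp: cross3_def vec_eq_iff forall_3 axis_def)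
  thus ?thesis by (rule that)
 next
  case False
  hence "cross3 N (axis 3 1) ~= 0" by (auto simp: cross3_def vec_eq_iff forall_3 axis_def)
  thus ?thesis by (rule that)
 qed
 define e1 where "e1 = cross3 N u"
 define e2 where "e2 = cross3 N e1"
 define p where "p = (e/(N\<bullet>N)) *\<^sub>R N"
 define ph where "ph = (%x :: real \<times> real. p+fst x *\<^sub>R e1+snd x *\<^sub>R e2)"
 have perp: "N\<bullet>e1 = 0" "N\<bullet>e2 = 0" "e1\<bullet>e2 = 0" by (simp_all add: e1_def e2_def dot_cross_self)
 have NN: "N\<bullet>N ~= 0" "e1\<bullet>e1 ~= 0" using assms u by (simp_all add: e1_def)
 have c12: "cross3 e1 e2 = (e1\<bullet>e1) *\<^sub>R N" using perp by (simp add: e2_def Lagrange inner_commute)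
 have "inj ph"
 proof (rule injI)
  fix x y assume "ph x = ph y"
  hence z: "(fst x - fst y) *\<^sub>R e1+(snd x - snd y) *\<^sub>R e2 = 0" by (simp add: ph_def algebra_simps)
  have "e2\<bullet>e2 ~= 0" using c12 NN assms by auto
  thus "x = y"
   using arg_cong[OF z, of "%w. w\<bullet>e1"] arg_cong[OF z, of "%w. w\<bullet>e2"] perp NN
   by (simp add: inner_add_left prod_eq_iff inner_commute[of e2 e1])
 qed
 moreover have "range ph = {x. N\<bullet>x = e}"
 proof (intro subset_antisym subsetI)
  fix x assume "x:range ph"
  thus "x:{x. N\<bullet>x = e}" using perp NN by (auto simp: ph_def p_def inner_add_right)
 next
  fix x assume "x:{x. N\<bullet>x = e}"
  define w where "w = x - p"
  define k where "k = cross3 e1 e2\<bullet>cross3 e1 e2"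
  have k: "k ~= 0" using NN c12 by (simp add: k_def)
  have "N\<bullet>w = 0" using \<open>x:_\<close> NN by (simp add: w_def p_def inner_diff_right)
  hence "w\<bullet>cross3 e1 e2 = 0" by (simp add: c12 inner_commute[of w N])
  then obtain al be where "k *\<^sub>R w = al *\<^sub>R e1+be *\<^sub>R e2"
   using cross3_basis[of e1 e2 w] by (simp add: k_def)
  hence "(1/k) *\<^sub>R (k *\<^sub>R w) = (1/k) *\<^sub>R (al *\<^sub>R e1+be *\<^sub>R e2)" by (rule arg_cong)
  hence "w = (al/k) *\<^sub>R e1+(be/k) *\<^sub>R e2" using k by (simp add: scaleR_add_right)
  hence "x = p+(al/k) *\<^sub>R e1+(be/k) *\<^sub>R e2" by (simp add: w_def algebra_simps)
  hence "x = ph (al/k, be/k)" by (simp add: ph_def)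
  thus "x:range ph" by blast
 qed
 moreover have "ph (x+t *\<^sub>R v) = ph x+t *\<^sub>R (ph (x+v) - ph x)" for x v t by (simp add: ph_def algebra_simps)
 moreover have "polyf 1 (%x. ph x\<bullet>b)" for b
 proof -
  have "polyf 1 (%x :: real \<times> real. p\<bullet>b+((e1\<bullet>b)*(x\<bullet>(1, 0))+(e2\<bullet>b)*(x\<bullet>(0, 1))))"
   unfolding One_nat_def by (intro polyf_add polyf_const polyf_cmult polyf_inner)
  moreover have "(%x. ph x\<bullet>b) = (%x. p\<bullet>b+((e1\<bullet>b)*(x\<bullet>(1, 0))+(e2\<bullet>b)*(x\<bullet>(0, 1))))"
   by (rule ext) (simp add: ph_def inner_add_left inner_prod_def mult.commute)
  ultimately show ?thesis by simp
 qed
 ultimately show ?thesis by (rule that)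
qed

lemma chart_line:
 fixes ph :: "real \<times> real => real^3"
 assumes inj: "inj ph" and range: "range ph = T"
  and aff: "!!x v t. ph (x+t *\<^sub>R v) = ph x+t *\<^sub>R (ph (x+v) - ph x)"
  and l: "affine_line p v <= T" "v ~= 0"
 shows "EX q w. w ~= 0 & ph -` affine_line p v = affine_line q w"
proof -
 have "p:affine_line p v" "p+v:affine_line p v"
  unfolding affine_line_def by (rule range_eqI[of _ _ 0], simp) (rule range_eqI[of _ _ 1], simp)
 then obtain q q' where q: "ph q = p" "ph q' = p+v" using l range by (metis (no_types, lifting) imageE subsetD)
 have *: "ph (q+t *\<^sub>R (q' - q)) = p+t *\<^sub>R v" for t unfolding aff q by (simp add: q)
 have "ph -` affine_line p v = affine_line q (q' - q)"
 proof (intro subset_antisym subsetI)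
  fix x assume "x:ph -` affine_line p v"
  then obtain t where "ph x = p+t *\<^sub>R v" by (auto simp: affine_line_def)
  hence "x = q+t *\<^sub>R (q' - q)" using * inj by (metis injD)
  thus "x:affine_line q (q' - q)" by (auto simp: affine_line_def)
 next
  fix x assume "x:affine_line q (q' - q)"
  thus "x:ph -` affine_line p v" using * by (auto simp: affine_line_def)
 qed
 moreover have "q' - q ~= 0" using q l(2) by auto
 ultimately show ?thesis by blast
qed

lemma line_is_hyperplane:
 fixes q w :: "real \<times> real"
 assumes "w ~= 0"
 shows "affine_line q w = {x. (- snd w, fst w)\<bullet>x = (- snd w, fst w)\<bullet>q}"
proof (intro subset_antisym subsetI)
 fix x assume x: "x:{x. (- snd w, fst w)\<bullet>x = (- snd w, fst w)\<bullet>q}"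
 define y where "y = x - q"
 have y: "fst w * snd y = snd w*fst y" using x by (simp add: y_def inner_prod_def algebra_simps)
 have "EX t. y = t *\<^sub>R w"
 proof (cases "fst w = 0")
  case True
  hence "snd w ~= 0" using assms by (auto simp: prod_eq_iff)
  thus ?thesis using True y by (intro exI[of _ "snd y/snd w"]) (auto simp: prod_eq_iff)
 next
  case False
  thus ?thesis using y by (intro exI[of _ "fst y/fst w"]) (auto simp: prod_eq_iff field_simps)
 qed
 then obtain t where "x = q+t *\<^sub>R w" by (auto simp: y_def algebra_simps)
 thus "x:affine_line q w" by (auto simp: affine_line_def)
qed (auto simp: affine_line_def inner_prod_def algebra_simps)

text \<open>In a chart of the plane the lines become hyperplanes of dimension one; more than
  \<open>d\<close> of them force the restricted polynomial to vanish.\<close>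

lemma many_lines_in_plane:
 fixes F :: "real^3 => real"
 assumes F: "polyf d F" and N: "N ~= 0" and Ls: "finite Ls" "d < card Ls"
  and lines: "!!l. l:Ls ==> EX p v. v ~= 0 & l = affine_line p v" "!!l. l:Ls ==> l <= {x. N\<bullet>x = e}"
  and zero: "!!l x. l:Ls ==> x:l ==> F x = 0" and x: "N\<bullet>x = e"
 shows "F x = 0"
proof (rule ccontr)
 assume nz: "F x ~= 0"
 obtain ph :: "real \<times> real => real^3" where ph: "inj ph" "range ph = {x. N\<bullet>x = e}"
  "!!x v t. ph (x+t *\<^sub>R v) = ph x+t *\<^sub>R (ph (x+v) - ph x)" "!!b. polyf 1 (%x. ph x\<bullet>b)"
  using plane_chart[OF N] by metis
 have hyp: "EX q w. w ~= 0 & ph -` l = affine_line q w" if "l:Ls" for l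
  using lines(1)[OF that] lines(2)[OF that] chart_line[OF ph(1,2,3)] by blast
 have "card ((%l. ph -` l) ` Ls) <= d"
 proof (rule hyperplanes_in_zero_set[of d "%y. F (ph y)"])
  show "polyf d (%y. F (ph y))" by (rule polyf_compose[OF F ph(4)])
  have "x:range ph" using x ph(2) by simp
  thus "EX y. F (ph y) ~= 0" using nz by auto
  show "finite ((%l. ph -` l) ` Ls)" using Ls by simp
  show "EX N e. H = {x. N\<bullet>x = e}" if "H:(%l. ph -` l) ` Ls" for H
  proof -
   obtain q w where "w ~= 0" "H = affine_line q w" using hyp \<open>H:_\<close> by blast
   thus ?thesis using line_is_hyperplane by blast
  qed
  show "F (ph y) = 0" if "H:(%l. ph -` l) ` Ls" "y:H" for H y using zero that by auto
  show "{} ~: (%l. ph -` l) ` Ls"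
  proof
   assume "{}:(%l. ph -` l) ` Ls"
   then obtain q w where "{} = affine_line q (w :: real \<times> real)" using hyp by (metis (no_types, lifting) imageE)
   thus False by (simp add: affine_line_def)
  qed
 qed
 moreover have "inj_on (%l. ph -` l) Ls"
 proof (rule inj_onI)
  fix l l' assume l: "l:Ls" "l':Ls" "ph -` l = ph -` l'"
  have "l = ph ` (ph -` l)" "l' = ph ` (ph -` l')" using lines(2)[OF l(1)] lines(2)[OF l(2)] ph(2) by (simp_all add: Int_absorb2)
  thus "l = l'" using l(3) by simp
 qed
 ultimately show False using Ls(2) by (simp add: card_image)
qed

lemma szemeredi_trotter_plane:
 "EX C::real. C >= 1 & (ALL N e (Q :: (real^3) set) Ls. N ~= 0 --> finite Q --> finite Ls --> Q <= {x. N\<bullet>x = e} -->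
  (ALL l:Ls. is_line l & l <= {x. N\<bullet>x = e}) -->
  real (SUM l:Ls. card (Q \<inter> l)) <= C*(rc Q powr (2/3)*rc Ls powr (2/3)+rc Q+rc Ls))"
proof -
 obtain C :: real where C: "C >= 1" "!!(Q :: (real \<times> real) set) Ls. finite Q ==> finite Ls ==> ALL l:Ls. EX p v. v ~= 0 & l = affine_line p v ==>
  real (SUM l:Ls. card (Q \<inter> l)) <= C*(rc Q powr (2/3)*rc Ls powr (2/3)+rc Q+rc Ls)"
  using szemeredi_trotter by metis
 have "real (SUM l:Ls. card (Q \<inter> l)) <= C*(rc Q powr (2/3)*rc Ls powr (2/3)+rc Q+rc Ls)"
  if N: "N ~= 0" and fin: "finite Q" "finite Ls" and Q: "Q <= {x. N\<bullet>x = e}"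
   and lines: "ALL l:Ls. is_line l & l <= {x. N\<bullet>x = e}" for N e and Q :: "(real^3) set" and Ls
 proof -
  obtain ph :: "real \<times> real => real^3" where ph: "inj ph" "range ph = {x. N\<bullet>x = e}"
   "!!x v t. ph (x+t *\<^sub>R v) = ph x+t *\<^sub>R (ph (x+v) - ph x)" "!!b. polyf 1 (%x. ph x\<bullet>b)"
   using plane_chart[OF N] by metis
  have hyp: "EX q w. w ~= 0 & ph -` l = affine_line q w" if "l:Ls" for l
  proof -
   obtain p v where "v ~= 0" "l = affine_line p v" "l <= {x. N\<bullet>x = e}" using bspec[OF lines \<open>l:Ls\<close>] by metis
   thus ?thesis using chart_line[OF ph(1,2,3), of p v] by simp
  qed
  have img: "S = ph ` (ph -` S)" if "S <= {x. N\<bullet>x = e}" for S using that ph(2) by (simp add: Int_absorb2)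
  have card: "card (ph -` S) = card S" if "S <= {x. N\<bullet>x = e}" for S
   using img[OF that] ph(1) by (metis card_image inj_on_subset subset_UNIV)
  have inj: "inj_on (%l. ph -` l) Ls"
  proof (rule inj_onI)
   fix l l' assume l: "l:Ls" "l':Ls" "ph -` l = ph -` l'"
   have "l = ph ` (ph -` l)" by (rule img) (use bspec[OF lines l(1)] in simp)
   moreover have "l' = ph ` (ph -` l')" by (rule img) (use bspec[OF lines l(2)] in simp)
   ultimately show "l = l'" using l(3) by simp
  qed
  have "real (SUM l:(%l. ph -` l) ` Ls. card (ph -` Q \<inter> l)) <=
   C*(rc (ph -` Q) powr (2/3)*rc ((%l. ph -` l) ` Ls) powr (2/3)+rc (ph -` Q)+rc ((%l. ph -` l) ` Ls))"
  proof (rule C(2))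
   show "finite (ph -` Q)" using fin(1) ph(1) by (rule finite_vimageI)
  qed (use fin hyp in auto)
  moreover have "(SUM l:(%l. ph -` l) ` Ls. card (ph -` Q \<inter> l)) = (SUM l:Ls. card (Q \<inter> l))"
  proof -
   have "card (ph -` Q \<inter> ph -` l) = card (Q \<inter> l)" for l
    unfolding vimage_Int[symmetric] by (rule card) (use Q in blast)
   thus ?thesis by (simp add: sum.reindex[OF inj])
  qed
  ultimately show ?thesis by (simp add: card[OF Q] card_image[OF inj])
 qed
 note main = this
 show ?thesis by (rule exI[of _ C], intro conjI C(1) allI impI) (rule main; assumption)
qed

section \<open>Lines in a surface\<close>

lemma lines_parallel_eq:
 fixes v w :: "real^3"
 assumes "v ~= 0" "w ~= 0" "cross3 v w = 0"
 shows "affine_line x v = affine_line x w"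
proof -
 have "cross3 w (cross3 v w) = (w\<bullet>w) *\<^sub>R v - (w\<bullet>v) *\<^sub>R w" by (simp add: Lagrange)
 hence *: "(w\<bullet>w) *\<^sub>R v = (w\<bullet>v) *\<^sub>R w" using assms(3) by simp
 have ww: "w\<bullet>w ~= 0" using assms(2) by simp
 have "(1/(w\<bullet>w)) *\<^sub>R ((w\<bullet>w) *\<^sub>R v) = (1/(w\<bullet>w)) *\<^sub>R ((w\<bullet>v) *\<^sub>R w)" unfolding * ..
 hence v: "v = ((w\<bullet>v)/(w\<bullet>w)) *\<^sub>R w" using ww by simp
 hence "(w\<bullet>v)/(w\<bullet>w) ~= 0" using assms(1) by auto
 moreover have "x:affine_line x v" unfolding affine_line_def by (rule range_eqI[of _ _ 0]) simp
 ultimately show ?thesis using affine_line_eq[OF _ v] by blast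
qed

lemma powr_third_square: "x >= 0 ==> (x^2) powr (1/3) = x powr (2/3)" for x :: real
 by (cases "x = 0") (simp_all add: powr_powr powr_numeral[symmetric] del: powr_numeral)

text \<open>Incidences with lines of a surface: at a smooth point that is not flat there are at most two lines, and along a line
 consisting of flat points the tangent plane is constant, so the remaining incidences split into planar problems.\<close>

lemma lines_in_surface:
 "EX C::real. C >= 1 & (ALL (X :: (real^3) set) Ls F d M. finite X --> finite Ls --> polyf d F --> (EX x. F x ~= 0) -->
  (ALL l:Ls. is_line l & (ALL x:l. F x = 0)) -->
  (ALL N e. N ~= 0 --> card {l:Ls. l <= {x. N\<bullet>x = e}} <= M) -->
  real (SUM l:Ls. card (X \<inter> l)) <= C*(real (d+1)*rc Ls+rc X
   + real M powr (2/3)*real d powr (1/3)*rc X powr (2/3)))"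
proof -
 obtain C :: real where C: "C >= 1" "!!N e (Q :: (real^3) set) Ls. N ~= 0 ==> finite Q ==> finite Ls ==> Q <= {x. N\<bullet>x = e} ==>
  (ALL l:Ls. is_line l & l <= {x. N\<bullet>x = e}) ==>
  real (SUM l:Ls. card (Q \<inter> l)) <= C*(rc Q powr (2/3)*rc Ls powr (2/3)+rc Q+rc Ls)"
  using szemeredi_trotter_plane by metis
 have "real (SUM l:Ls. card (X \<inter> l)) <= (4*C+4)*(real (d+1)*rc Ls+rc X
   + real M powr (2/3)*real d powr (1/3)*rc X powr (2/3))"
  if fin: "finite X" "finite Ls" and F: "polyf d F" "EX x. F x ~= 0"
   and lines: "ALL l:Ls. is_line l & (ALL x:l. F x = 0)"
   and M: "ALL N e. N ~= 0 --> card {l:Ls. l <= {x. N\<bullet>x = e}} <= M" for X :: "(real^3) set" and Ls F d M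
 proof -
  obtain pt dir where pd: "!!l. l:Ls ==> dir l ~= 0" "!!l. l:Ls ==> l = affine_line (pt l) (dir l)" using lines by metis
  have zl: "zeros_le d' d' l" if "l:Ls" for d' l
   using zeros_le_line[of d' "pt l" "dir l"] pd(2)[OF that] by (simp add: affine_line_def)
  have through: "l = affine_line x (dir l)" if "l:Ls" "x:l" for l x
   using affine_line_eq[of x "pt l" "dir l" 1 "dir l"] pd(2)[OF that(1)] that(2) by simp
  have inf: "infinite l" if "l:Ls" for l
  proof -
   have "inj (%t::real. pt l+t *\<^sub>R dir l)" using pd(1)[OF that] by (simp add: inj_def)
   hence "infinite (range (%t::real. pt l+t *\<^sub>R dir l))" using finite_imageD infinite_UNIV_char_0 by blast
   thus ?thesis using pd(2)[OF that] by (simp add: affine_line_def)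
  qed
  obtain h :: "real^3 => real^3 => real" where h: "!!x. polyf d (h x)"
   "!!Y B. zeros_le B d Y ==> ALL y:Y. F y = 0 ==> EX E<=Y. finite E & card E <= B &
    (ALL x:Y - E. (ALL y:Y. h x y = 0) & (EX v. dd (h x) v x ~= 0) & (ALL x':Y - E. h x' = h x))"
   by (rule smooth_representative[OF F]) (rule that; assumption)
  have "ALL l:Ls. EX E<=l. finite E & card E <= d &
    (ALL x:l - E. (ALL y:l. h x y = 0) & (EX v. dd (h x) v x ~= 0) & (ALL x':l - E. h x' = h x))"
  proof
   fix l assume l: "l:Ls"
   show "EX E<=l. finite E & card E <= d &
    (ALL x:l - E. (ALL y:l. h x y = 0) & (EX v. dd (h x) v x ~= 0) & (ALL x':l - E. h x' = h x))"
    by (rule h(2)[OF zl[OF l]]) (use bspec[OF lines l] in simp)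
  qed
  from bchoice[OF this] obtain E where E0: "ALL l:Ls. E l <= l & finite (E l) & card (E l) <= d &
    (ALL x:l - E l. (ALL y:l. h x y = 0) & (EX v. dd (h x) v x ~= 0) & (ALL x':l - E l. h x' = h x))" ..
  have E: "finite (E l)" "card (E l) <= d" if "l:Ls" for l using E0 that by auto
  have zero: "h x y = 0" if "l:Ls" "x:l - E l" "y:l" for l x y using bspec[OF E0 that(1)] that(2,3) by metis
  have smooth: "EX v. dd (h x) v x ~= 0" if "l:Ls" "x:l - E l" for l x using bspec[OF E0 that(1)] that(2) by metis
  have const: "h x' = h x" if "l:Ls" "x:l - E l" "x':l - E l" for l x x' using bspec[OF E0 that(1)] that(2,3) by metis
  have nz: "grad (h x) x ~= 0" if l: "l:Ls" "x:l - E l" for l x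
  proof
   assume "grad (h x) x = 0"
   hence "dd (h x) v x = 0" for v using grad_inner[OF h(1), of x x v] by simp
   thus False using smooth[OF l] by blast
  qed
  have tangent: "dd (h x) (dir l) y = 0" "quad (h x) y (dir l) = 0" if l: "l:Ls" "x:l - E l" "y:l" for l x y
  proof -
   have z: "h x (y+t *\<^sub>R dir l) = 0" for t
    using zero[OF l(1,2)] through[OF l(1,3)] by (auto simp: affine_line_def)
   show "dd (h x) (dir l) y = 0" "quad (h x) y (dir l) = 0" using quad_zero_on_line[OF h(1) z, of 0] by simp_all
  qed
  define rep where "rep = (%l. SOME x. x:l - E l)"
  have rep: "rep l:l - E l" if "l:Ls" for l
  proof -
   have "l - E l ~= {}" using inf[OF that] E(1)[OF that] by (metis Diff_eq_empty_iff finite_subset)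
   thus ?thesis unfolding rep_def by (metis ex_in_conv someI_ex)
  qed
  define flat where "flat = (%x. flat_at (h x) x)"
  \<comment> \<open>Flatness is demanded at every point of the line, exceptional ones included,
    because constancy of the normal is a polynomial identity along the entire line.\<close>
  define full where "full = {l:Ls. ALL x:l. flat_at (h (rep l)) x}"
  define T where "T = (%x. {y. grad (h x) x\<bullet>y = grad (h x) x\<bullet>x})"
  define TT where "TT = (%l. T (rep l))"
  let ?X = "%l. X \<inter> l - E l"
  let ?L = "%S. {l:full. TT l = S}"
  let ?N = "%l. {x:X \<inter> l - E l. ~flat x}"
  have fullLs: "full <= Ls" "finite full" using fin(2) by (auto simp: full_def)
  \<comment> \<open>For some fixed \<open>z\<close> the flatness polynomial, of degree
    \<open>3 d\<close>, is not identically zero on the line, and all flat points counted are among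
    its zeros.\<close>
  have not_full: "card {x:X \<inter> l - E l. flat x} <= 3*d" if l: "l:Ls - full" for l
  proof -
   have lL: "l:Ls" using l by simp
   obtain x0 where x0: "x0:l" "~flat_at (h (rep l)) x0" using l by (auto simp: full_def)
   then obtain z where z: "quad (h (rep l)) x0 (cross3 (grad (h (rep l)) x0) z) ~= 0" by (auto simp: flat_at_def)
   have pf: "polyf (d+2*d) (%x. quad (h (rep l)) x (cross3 (grad (h (rep l)) x) z))"
    by (rule polyf_quad_field[OF h(1) polyf_grad_cross[OF h(1)]])
   note ZZ = zeros_leD[OF zl[OF lL, of "d+2*d"] pf x0(1) z]
   have "card {x:X \<inter> l - E l. flat x} <= card {y:l. quad (h (rep l)) y (cross3 (grad (h (rep l)) y) z) = 0}"
   proof (rule card_mono[OF ZZ(1)], rule subsetI)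
    fix x assume "x:{x:X \<inter> l - E l. flat x}"
    hence "x:l - E l" "flat_at (h x) x" by (auto simp: flat_def)
    hence "flat_at (h (rep l)) x" "x:l" using const[OF lL rep[OF lL]] by auto
    thus "x:{y:l. quad (h (rep l)) y (cross3 (grad (h (rep l)) y) z) = 0}" by (simp add: flat_at_def)
   qed
   thus ?thesis using ZZ(2) by simp
  qed
  have full_flat: "flat x" if "l:full" "x:l - E l" for l x
  proof -
   have "l:Ls" using that(1) fullLs by blast
   hence "h x = h (rep l)" using const[OF _ rep that(2)] by blast
   thus ?thesis using that by (simp add: flat_def full_def)
  qed
  \<comment> \<open>Lines inside a surface have tangent directions that are isotropic for the
    Hessian form, so three of them force flatness.\<close>
  have nonflat: "(SUM l:Ls. card (?N l)) <= 2*card X"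
  proof -
   have "(SUM l:Ls. card (?N l)) = card (SIGMA l:Ls. (?N l))"
    using fin by simp
   also have "... = card (SIGMA x:X. {l:Ls. x:l - E l & ~flat x})"
    by (rule bij_betw_same_card[of prod.swap], rule bij_betw_byWitness[where f' = prod.swap]) auto
   also have "... = (SUM x:X. card {l:Ls. x:l - E l & ~flat x})" using fin by simp
   also have "... <= (SUM x:X. 2)"
   proof (rule sum_mono)
    fix x assume "x:X"
    show "card {l:Ls. x:l - E l & ~flat x} <= 2"
    proof (rule ccontr)
     assume "~?thesis"
     hence "3 <= card {l:Ls. x:l - E l & ~flat x}" by simp
     then obtain S where S: "S <= {l:Ls. x:l - E l & ~flat x}" "card S = 3" "finite S" by (rule obtain_subset_with_card_n)
     obtain l1 l2 l3 where l: "S = {l1, l2, l3}" "l1 ~= l2" "l2 ~= l3" "l1 ~= l3" using S(2) by (auto simp: card_3_iff)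
     have L: "l1:Ls" "l2:Ls" "l3:Ls" "x:l1 - E l1" "x:l2 - E l2" "x:l3 - E l3" "~flat_at (h x) x"
      using S(1) unfolding l(1) flat_def by auto
     have cr: "cross3 (dir l) (dir l') ~= 0" if "l:Ls" "l':Ls" "x:l - E l" "x:l' - E l'" "l ~= l'" for l l'
      using lines_parallel_eq[OF pd(1)[OF that(1)] pd(1)[OF that(2)], of x] through[of l x] through[of l' x] that by auto
     have tg: "grad (h x) x\<bullet>dir l = 0" "quad (h x) x (dir l) = 0" if "l:Ls" "x:l - E l" for l
      using tangent[OF that, of x] that grad_inner[OF h(1), of x x "dir l"] by auto
     show False
      using not_flat_two_directions[OF h(1) nz[OF L(1,4)] L(7) tg(1)[OF L(1,4)] tg(1)[OF L(2,5)] tg(1)[OF L(3,6)]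
       tg(2)[OF L(1,4)] tg(2)[OF L(2,5)] tg(2)[OF L(3,6)] cr[OF L(1,2,4,5) l(2)] cr[OF L(1,3,4,6) l(4)] cr[OF L(2,3,5,6) l(3)]] .
    qed
   qed
   finally show ?thesis by simp
  qed
  have T_const: "T x = TT l" "l <= T x" if l: "l:full" "x:l - E l" for l x
  proof -
   have lL: "l:Ls" using l(1) fullLs by blast
   note r = rep[OF lL]
   define f where "f = h (rep l)"
   have hx: "h x = f" using const[OF lL r l(2)] by (simp add: f_def)
   have pf: "polyf d f" using h(1) by (simp add: f_def)
   obtain s where s: "x = rep l+s *\<^sub>R dir l" using through[OF lL, of "rep l"] r l(2) by (auto simp: affine_line_def)
   have line: "rep l+t *\<^sub>R dir l:l" for t
    using through[OF lL, of "rep l"] r unfolding affine_line_def by blast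
   have z: "f (rep l+t *\<^sub>R dir l) = 0" for t using zero[OF lL r line] by (simp add: f_def)
   have fl: "flat_at f (rep l+t *\<^sub>R dir l)" for t using l(1) line by (auto simp: full_def f_def)
   have parl: "(grad f x\<bullet>a)*(grad f (rep l)\<bullet>b) = (grad f (rep l)\<bullet>a)*(grad f x\<bullet>b)" for a b
    using flat_line_normals[OF pf z fl, of a s b 0] unfolding grad_inner[OF pf] s[symmetric] by simp
   define N N' where "N = grad f (rep l)" "N' = grad f x"
   have N: "N ~= 0" "N' ~= 0" using nz[OF lL r] nz[OF lL l(2)] hx by (simp_all add: N_N'_def f_def)
   have "(N'\<bullet>N')*(N\<bullet>b) = (N\<bullet>N')*(N'\<bullet>b)" for b using parl[of N' b] by (simp add: N_N'_def)
   hence "((N'\<bullet>N') *\<^sub>R N - (N\<bullet>N') *\<^sub>R N')\<bullet>b = 0" for b by (simp add: inner_diff_left)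
   hence eq: "(N'\<bullet>N') *\<^sub>R N = (N\<bullet>N') *\<^sub>R N'" by (metis inner_eq_zero_iff right_minus_eq)
   have NN: "N'\<bullet>N' ~= 0" using N by simp
   have "N\<bullet>N' ~= 0"
   proof
    assume "N\<bullet>N' = 0"
    hence "(N'\<bullet>N') *\<^sub>R N = 0" using eq by simp
    thus False using N NN by simp
   qed
   have iff: "N\<bullet>w = 0 \<longleftrightarrow> N'\<bullet>w = 0" for w
   proof -
    have "(N'\<bullet>N')*(N\<bullet>w) = (N\<bullet>N')*(N'\<bullet>w)" using arg_cong[OF eq, of "%u. u\<bullet>w"] by simp
    thus ?thesis using NN \<open>N\<bullet>N' ~= 0\<close> by auto
   qed
   have tg: "N\<bullet>dir l = 0" using tangent(1)[OF lL r, of "rep l"] r grad_inner[OF pf, of "rep l" "dir l"] by (simp add: N_N'_def f_def)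
   have Tx: "y:T x \<longleftrightarrow> N'\<bullet>(y - x) = 0" "y:TT l \<longleftrightarrow> N\<bullet>(y - rep l) = 0" for y
    by (auto simp: T_def TT_def hx N_N'_def f_def inner_diff_right)
   have sh: "N\<bullet>(y - x) = N\<bullet>(y - rep l)" for y using tg by (simp add: s inner_diff_right inner_add_right)
   show "T x = TT l" by (rule set_eqI) (simp only: Tx sh iff[symmetric])
   show "l <= T x"
   proof
    fix y assume "y:l"
    then obtain t where "y = x+t *\<^sub>R dir l" using through[OF lL, of x] l(2) by (auto simp: affine_line_def)
    thus "y:T x" using tg iff[of "dir l"] unfolding Tx by simp
   qed
  qed
  define \<T> where "\<T> = TT ` full"
  define nT where "nT = (%S. rc {x:X. T x = S})"
  define LT where "LT = (%S. rc (?L S))"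
  have fT: "finite \<T>" using fullLs by (simp add: \<T>_def)
  have sum_n: "(SUM S:\<T>. nT S) <= rc X"
   unfolding nT_def of_nat_sum[symmetric] of_nat_le_iff by (rule sum_card_fibres_le[OF fin(1) fT])
  have sum_L: "(SUM S:\<T>. LT S) <= rc Ls"
  proof -
   have "(SUM S:\<T>. card (?L S)) <= card full" by (rule sum_card_fibres_le[OF fullLs(2) fT])
   also have "... <= card Ls" using fullLs fin by (intro card_mono)
   finally show ?thesis unfolding LT_def of_nat_sum[symmetric] of_nat_le_iff .
  qed
  have plane: "EX N e. N ~= 0 & S = {y. N\<bullet>y = e}" if S: "S:\<T>" for S
  proof -
   obtain l where l: "l:full" "S = TT l" using S by (auto simp: \<T>_def)
   hence "l:Ls" using fullLs by blast
   thus ?thesis using nz[OF \<open>l:Ls\<close> rep[OF \<open>l:Ls\<close>]] l(2) unfolding TT_def T_def by blast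
  qed
  define IT where "IT = (%S. real (SUM l:(?L S). card ({x:X. T x = S} \<inter> l)))"
  have ST: "IT S <= C*(nT S powr (2/3)*LT S powr (2/3)+nT S+LT S)" if S: "S:\<T>" for S
  proof -
   obtain N e where Ne: "N ~= 0" "S = {y. N\<bullet>y = e}" using plane[OF S] by blast
   show ?thesis unfolding IT_def nT_def LT_def
   proof (rule C(2)[OF Ne(1)])
    show "finite {x:X. T x = S}" "finite (?L S)" using fin fullLs by auto
    show "{x:X. T x = S} <= {x. N\<bullet>x = e}" unfolding Ne(2)[symmetric] by (auto simp: T_def)
    show "ALL l:(?L S). is_line l & l <= {x. N\<bullet>x = e}"
    proof
     fix l assume "l:(?L S)"
     hence l: "l:full" "TT l = S" "l:Ls" using fullLs by auto
     thus "is_line l & l <= {x. N\<bullet>x = e}"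
      using lines T_const[OF l(1) rep[OF l(3)]] unfolding Ne(2)[symmetric] by simp
    qed
   qed
  qed
  \<comment> \<open>A plane with more than \<open>d\<close> of the lines lies in the zero set, so at
    most \<open>d\<close> planes are big; the power mean inequality over them gives
    \<open>d^(1/3)\<close>. In the other planes Young's inequality makes the planar bound
    linear.\<close>
  define big where "big = {S:\<T>. real d < LT S}"
  have card_big: "card big <= d"
  proof (rule hyperplanes_in_zero_set[OF F])
   show "finite big" using fT by (simp add: big_def)
   show "EX N e. S = {x. N\<bullet>x = e}" if "S:big" for S using plane[of S] that unfolding big_def by blast
   show "{} ~: big"
   proof
    assume "{}:big"
    then obtain l where "l:full" "TT l = {}" by (auto simp: big_def \<T>_def)
    thus False unfolding TT_def T_def by blast
   qed
   show "F x = 0" if S: "S:big" "x:S" for S x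
   proof -
    obtain N e where Ne: "N ~= 0" "S = {y. N\<bullet>y = e}" using plane[of S] S unfolding big_def by blast
    show ?thesis
    proof (rule many_lines_in_plane[OF F(1) Ne(1), of "(?L S)" e])
     show "finite (?L S)" using fullLs by auto
     show "d < card (?L S)" using S(1) by (simp add: big_def LT_def)
     show "N\<bullet>x = e" using S(2) Ne(2) by simp
     fix l assume "l:(?L S)"
     hence l: "l:full" "TT l = S" "l:Ls" using fullLs by auto
     show "is_line l" using lines l(3) by simp
     show "l <= {x. N\<bullet>x = e}" using T_const[OF l(1) rep[OF l(3)]] l(2) unfolding Ne(2)[symmetric] by simp
     show "F x = 0" if "x:l" for x using lines l(3) that by simp
    qed
   qed
  qed
  have LM: "LT S <= real M" if S: "S:\<T>" for S
  proof -
   obtain N e where Ne: "N ~= 0" "S = {y. N\<bullet>y = e}" using plane[OF S] by blast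
   have "card (?L S) <= card {l:Ls. l <= {x. N\<bullet>x = e}}"
   proof (rule card_mono)
    show "finite {l:Ls. l <= {x. N\<bullet>x = e}}" using fin by simp
    show "(?L S) <= {l:Ls. l <= {x. N\<bullet>x = e}}"
    proof
     fix l assume "l:(?L S)"
     hence l: "l:full" "TT l = S" "l:Ls" using fullLs by auto
     thus "l:{l:Ls. l <= {x. N\<bullet>x = e}}" using T_const[OF l(1) rep[OF l(3)]] unfolding Ne(2)[symmetric] by simp
    qed
   qed
   also have "... <= M" using M Ne(1) by blast
   finally show ?thesis by (simp add: LT_def)
  qed
  have nn: "nT S >= 0" "LT S >= 0" for S by (simp_all add: nT_def LT_def)
  have small: "nT S powr (2/3)*LT S powr (2/3) <= nT S+real d*LT S" if "S:\<T> - big" for S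
  proof (cases "nT S = 0 | LT S = 0")
   case True thus ?thesis using nn by auto
  next
   case False
   hence pos: "nT S > 0" "LT S > 0" using nn[of S] by auto
   have "nT S powr (2/3)*((LT S)^2) powr (1/3) <= (2/3)*nT S+(1/3)*(LT S)^2"
    using pos by (intro Youngs_inequality_0) auto
   also have "(LT S)^2 <= real d*LT S" using that pos by (auto simp: big_def power2_eq_square)
   finally have "nT S powr (2/3)*LT S powr (2/3) <= (2/3)*nT S+(1/3)*(real d*LT S)"
    using powr_third_square[OF less_imp_le[OF pos(2)]] by simp
   moreover have "0 <= real d*LT S" using pos by simp
   ultimately show ?thesis using pos by linarith
  qed
  have IT_sum: "(SUM S:\<T>. IT S) <= C*(2*rc X+real (d+1)*rc Ls
   + real M powr (2/3)*real d powr (1/3)*rc X powr (2/3))"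
  proof -
   define W where "W = (%S. nT S powr (2/3)*LT S powr (2/3))"
   have bigs: "(SUM S:big. W S) <= real M powr (2/3)*(real d powr (1/3)*rc X powr (2/3))"
   proof -
    have "(SUM S:big. W S) <= (SUM S:big. nT S powr (2/3)*real M powr (2/3))"
     unfolding W_def using LM nn by (intro sum_mono mult_left_mono powr_mono2) (auto simp: big_def)
    also have "... = real M powr (2/3)*(SUM S:big. nT S powr (2/3))" by (simp add: sum_distrib_left mult.commute)
    also have "(SUM S:big. nT S powr (2/3)) <= rc big powr (1 - 2/3)*(SUM S:big. nT S) powr (2/3)"
     using fT nn by (intro sum_powr_le_card) (auto simp: big_def)
    also have "... <= real d powr (1/3)*rc X powr (2/3)"
    proof (rule mult_mono)
     show "rc big powr (1 - 2/3) <= real d powr (1/3)" using card_big by (simp add: powr_mono2)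
     have "(SUM S:big. nT S) <= (SUM S:\<T>. nT S)" using fT nn by (intro sum_mono2) (auto simp: big_def)
     thus "(SUM S:big. nT S) powr (2/3) <= rc X powr (2/3)"
      using sum_n nn by (intro powr_mono2) (auto intro: sum_nonneg)
    qed auto
    finally show ?thesis by (simp add: mult_left_mono)
   qed
   have "(SUM S:\<T> - big. W S) <= (SUM S:\<T> - big. nT S+real d*LT S)" using small unfolding W_def by (rule sum_mono)
   also have "... <= (SUM S:\<T>. nT S+real d*LT S)" using fT nn by (intro sum_mono2) auto
   also have "... = (SUM S:\<T>. nT S)+real d*(SUM S:\<T>. LT S)" by (simp add: sum.distrib sum_distrib_left)
   also have "... <= rc X+real d*rc Ls" using sum_n sum_L by (intro add_mono mult_left_mono) auto
   finally have smalls: "(SUM S:\<T> - big. W S) <= rc X+real d*rc Ls" .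
   have "(SUM S:\<T>. W S) = (SUM S:\<T> - big. W S)+(SUM S:big. W S)" using fT by (intro sum.subset_diff) (auto simp: big_def)
   hence Wsum: "(SUM S:\<T>. W S) <= rc X+real d*rc Ls+real M powr (2/3)*(real d powr (1/3)*rc X powr (2/3))"
    using smalls bigs by linarith
   have "(SUM S:\<T>. IT S) <= (SUM S:\<T>. C*(W S+nT S+LT S))" using ST unfolding W_def by (rule sum_mono)
   also have "... = C*((SUM S:\<T>. W S)+(SUM S:\<T>. nT S)+(SUM S:\<T>. LT S))" by (simp only: sum.distrib sum_distrib_left[symmetric])
   also have "... <= C*(2*rc X+real (d+1)*rc Ls
    + real M powr (2/3)*real d powr (1/3)*rc X powr (2/3))"
    using Wsum sum_n sum_L C(1) by (intro mult_left_mono) (auto simp: algebra_simps)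
   finally show ?thesis .
  qed
  have fulls: "real (SUM l:full. card (?X l)) <= (SUM S:\<T>. IT S)"
  proof -
   have "(SUM l:full. card (?X l)) <= (SUM l:full. card ({x:X. T x = TT l} \<inter> l))"
   proof (rule sum_mono)
    fix l assume l: "l:full"
    show "card (?X l) <= card ({x:X. T x = TT l} \<inter> l)"
     using T_const(1)[OF l] fin by (intro card_mono) auto
   qed
   also have "... = (SUM S:\<T>. SUM l:(?L S). card ({x:X. T x = TT l} \<inter> l))"
    unfolding \<T>_def by (rule sum.image_gen[OF fullLs(2)])
   also have "... = (SUM S:\<T>. SUM l:(?L S). card ({x:X. T x = S} \<inter> l))"
    by (rule sum.cong[OF refl], rule sum.cong[OF refl]) simp
   finally have "real (SUM l:full. card (?X l)) <= real (SUM S:\<T>. SUM l:(?L S). card ({x:X. T x = S} \<inter> l))"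
    by (simp only: of_nat_le_iff)
   thus ?thesis unfolding IT_def by (simp only: of_nat_sum)
  qed
  have split: "card (X \<inter> l) <= 4*d+card (?N l)+(if l:full then card (?X l) else 0)" if l: "l:Ls" for l
  proof -
   have "card (X \<inter> l) <= card (E l \<union> ({x:X \<inter> l - E l. flat x} \<union> (?N l)))"
    using fin E(1)[OF l] by (intro card_mono) auto
   also have "... <= card (E l)+(card {x:X \<inter> l - E l. flat x} + card (?N l))"
    by (meson add_left_mono card_Un_le order_trans)
   finally have 1: "card (X \<inter> l) <= d+(card {x:X \<inter> l - E l. flat x} + card (?N l))"
    using E(2)[OF l] by linarith
   show ?thesis
   proof (cases "l:full")
    case True
    have "card {x:X \<inter> l - E l. flat x} <= card (?X l)" using fin by (intro card_mono) auto
    thus ?thesis using 1 True by simp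
   next
    case False
    thus ?thesis using 1 not_full[of l] l by simp
   qed
  qed
  have "(SUM l:Ls. card (X \<inter> l)) <= (SUM l:Ls. 4*d+card (?N l)+(if l:full then card (?X l) else 0))"
   by (rule sum_mono[OF split])
  also have "... = (SUM l:Ls. 4*d)+(SUM l:Ls. card (?N l))+(SUM l:Ls. if l:full then card (?X l) else 0)"
   by (simp only: sum.distrib)
  also have "(SUM l:Ls. if l:full then card (?X l) else 0) = (SUM l:full. card (?X l))"
   using fullLs fin by (intro sum.mono_neutral_cong_right) auto
  finally have "(SUM l:Ls. card (X \<inter> l)) <= card Ls*(4*d)+2*card X+(SUM l:full. card (?X l))"
   using nonflat by simp
  hence "real (SUM l:Ls. card (X \<inter> l)) <= real (card Ls*(4*d)+2*card X+(SUM l:full. card (?X l)))"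
   by (simp only: of_nat_le_iff)
  also have "... = 4*real d*rc Ls+2*rc X+real (SUM l:full. card (?X l))" by simp
  also have "... <= 4*real d*rc Ls+2*rc X+C*(2*rc X+real (d+1)*rc Ls
   + real M powr (2/3)*real d powr (1/3)*rc X powr (2/3))" using fulls IT_sum by linarith
  also have "... <= (4*C+4)*(real (d+1)*rc Ls+rc X
   + real M powr (2/3)*real d powr (1/3)*rc X powr (2/3))"
  proof -
   define a b c where "a = real d*rc Ls" "b = rc X" "c = real M powr (2/3)*real d powr (1/3)*rc X powr (2/3)"
   define e where "e = rc Ls"
   have "a >= 0" "b >= 0" "c >= 0" "e >= 0" by (auto simp: a_b_c_def e_def)
   moreover have "C*a >= 0" "C*b >= 0" "C*c >= 0" "C*e >= 0" using C(1) calculation by auto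
   moreover have "4*a+2*b+C*(2*b+(a+e)+c) <= (4*C+4)*((a+e)+b+c)"
    using calculation by (simp add: algebra_simps)
   ultimately show ?thesis by (simp add: a_b_c_def e_def algebra_simps)
  qed
  finally show ?thesis .
 qed
 thus ?thesis using C(1) by (intro exI[of _ "4*C+4"] conjI allI impI) auto
qed

section \<open>Pencils of planar circles\<close>

lemma circle_chain:
 fixes g :: "'a::euclidean_space => real"
 assumes "polyf d g"
 shows "((%t. g (c+cos t *\<^sub>R e+sin t *\<^sub>R e')) has_real_derivative
  - sin t*dd g e (c+cos t *\<^sub>R e+sin t *\<^sub>R e')+cos t*dd g e' (c+cos t *\<^sub>R e+sin t *\<^sub>R e')) (at t)"
proof -
 define x where "x = c+cos t *\<^sub>R e+sin t *\<^sub>R e'"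
 have lin: "linear (%v. dd g v x)" using assms by (rule linear_dd)
 have "(g has_derivative (%w. dd g w x)) (at (c+cos t *\<^sub>R e+sin t *\<^sub>R e'))"
  using polyf_has_derivative[OF assms] by (simp add: x_def)
 hence "((%t. g (c+cos t *\<^sub>R e+sin t *\<^sub>R e')) has_derivative (%s. dd g ((s * - sin t) *\<^sub>R e+(s*cos t) *\<^sub>R e') x)) (at t)"
  by (rule has_derivative_compose[rotated]) (auto intro!: derivative_eq_intros)
 moreover have "dd g ((s * - sin t) *\<^sub>R e+(s*cos t) *\<^sub>R e') x = s*(- sin t*dd g e x+cos t*dd g e' x)" for s
  using linear_add[OF lin, of "(s * - sin t) *\<^sub>R e" "(s*cos t) *\<^sub>R e'"] linear_scale[OF lin, of "s * - sin t" e] linear_scale[OF lin, of "s*cos t" e']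
  by (simp add: algebra_simps)
 ultimately show ?thesis by (simp add: has_field_derivative_def x_def[symmetric] mult_commute_abs)
qed

text \<open>The first four derivatives of \<open>f\<close> along a parametrised circle contained in its zero set.\<close>

lemma circle_expansion:
 fixes f :: "'a::euclidean_space => real"
 assumes f: "polyf d f" and zero: "!!y. y:circ c e e' ==> f y = 0"
 defines "x \<equiv> c+e"
 shows "dd f e' x = 0" "dd (dd f e') e' x = dd f e x"
  "dd (dd (dd f e') e') e' x = 3*dd (dd f e) e' x"
  "dd (dd (dd (dd f e') e') e') e' x - 6*dd (dd (dd f e) e') e' x+3*dd (dd f e) e x = 3*dd f e x"
proof -
 define ga where "ga = (%t. c+cos t *\<^sub>R e+sin t *\<^sub>R e')"
 have g0: "ga 0 = x" by (simp add: ga_def x_def)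
 have chain: "((%t. g (ga t)) has_real_derivative - sin t*dd g e (ga t)+cos t*dd g e' (ga t)) (at t)" if "polyf d g" for g t
  unfolding ga_def by (rule circle_chain[OF that])
 note pd = polyf_dd[OF f] polyf_dd[OF polyf_dd[OF f]] polyf_dd[OF polyf_dd[OF polyf_dd[OF f]]]
 have z0: "f (ga t) = 0" for t
  using zero unfolding circ_def ga_def by (metis (mono_tags, lifting) mem_Collect_eq sin_cos_squared_add2)
 have swap: "dd (dd f e') e = dd (dd f e) e'" by (rule ext) (rule dd_commute[OF f])
 have swap2: "dd (dd (dd f e) e') e = dd (dd (dd f e) e) e'" "dd (dd (dd f e') e') e = dd (dd (dd f e) e') e'"
  using dd_commute[OF pd(1)] swap by (metis ext)+
 define fE fF fEE fEF fFF fEEE fEEF fEFF fFFF where F: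
  "fE = dd f e" "fF = dd f e'" "fEE = dd fE e" "fEF = dd fE e'" "fFF = dd fF e'"
  "fEEE = dd fEE e" "fEEF = dd fEE e'" "fEFF = dd fEF e'" "fFFF = dd fFF e'"
 have S: "dd fF e = fEF" "dd fEF e = fEEF" "dd fFF e = fEFF" using swap swap2 by (simp_all add: F)
 have P: "polyf d fE" "polyf d fF" "polyf d fEE" "polyf d fEF" "polyf d fFF" "polyf d fEEE" "polyf d fEEF" "polyf d fEFF" "polyf d fFFF"
  unfolding F using pd by auto
 note ch = chain[OF f, folded F] chain[OF P(1), folded F] chain[OF P(2), folded F, unfolded S]
  chain[OF P(3), folded F] chain[OF P(4), folded F, unfolded S] chain[OF P(5), folded F, unfolded S]
 have zero_deriv: "D' = 0" if "(g has_real_derivative D') (at t)" "!!t. g t = 0" for g D' and t :: real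
 proof -
  have "g = (%t. 0)" using that(2) by auto
  hence "(g has_real_derivative 0) (at t)" by simp
  thus ?thesis using that(1) DERIV_unique by blast
 qed
 have z1: "- sin t*fE (ga t)+cos t*fF (ga t) = 0" for t using zero_deriv[OF ch(1) z0] .
 have z2: "- cos t*fE (ga t) - sin t*fF (ga t)+(sin t)^2*fEE (ga t) - 2 * sin t*cos t*fEF (ga t)+(cos t)^2*fFF (ga t) = 0" for t
 proof (rule zero_deriv[OF _ z1])
  show "((%t. - sin t*fE (ga t)+cos t*fF (ga t)) has_real_derivative
   - cos t*fE (ga t) - sin t*fF (ga t)+(sin t)^2*fEE (ga t) - 2 * sin t*cos t*fEF (ga t)+(cos t)^2*fFF (ga t)) (at t)"
   by (rule derivative_eq_intros ch refl)+ (simp add: power2_eq_square algebra_simps)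
 qed
 have z3: "sin t*fE (ga t) - cos t*fF (ga t)+3 * sin t*cos t*fEE (ga t)+(3*(sin t)^2 - 3*(cos t)^2)*fEF (ga t)
   - 3 * sin t*cos t*fFF (ga t) - (sin t)^3*fEEE (ga t)+3*(sin t)^2*cos t*fEEF (ga t)
   - 3 * sin t*(cos t)^2*fEFF (ga t)+(cos t)^3*fFFF (ga t) = 0" for t
 proof (rule zero_deriv[OF _ z2])
  show "((%t. - cos t*fE (ga t) - sin t*fF (ga t)+(sin t)^2*fEE (ga t) - 2 * sin t*cos t*fEF (ga t)+(cos t)^2*fFF (ga t)) has_real_derivative
   sin t*fE (ga t) - cos t*fF (ga t)+3 * sin t*cos t*fEE (ga t)+(3*(sin t)^2 - 3*(cos t)^2)*fEF (ga t)
   - 3 * sin t*cos t*fFF (ga t) - (sin t)^3*fEEE (ga t)+3*(sin t)^2*cos t*fEEF (ga t)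
   - 3 * sin t*(cos t)^2*fEFF (ga t)+(cos t)^3*fFFF (ga t)) (at t)"
   by (rule derivative_eq_intros ch refl)+ (simp add: power2_eq_square power3_eq_cube algebra_simps)
 qed
 have ch3: "((%t. fEEE (ga t)) has_real_derivative dd fEEE e' x) (at 0)" "((%t. fEEF (ga t)) has_real_derivative dd fEEF e' x) (at 0)"
  "((%t. fEFF (ga t)) has_real_derivative dd fEFF e' x) (at 0)" "((%t. fFFF (ga t)) has_real_derivative dd fFFF e' x) (at 0)"
  using chain[OF P(6), of 0] chain[OF P(7), of 0] chain[OF P(8), of 0] chain[OF P(9), of 0] by (simp_all add: g0)
 have ch2: "((%t. fE (ga t)) has_real_derivative fEF x) (at 0)" "((%t. fF (ga t)) has_real_derivative fFF x) (at 0)"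
  "((%t. fEE (ga t)) has_real_derivative fEEF x) (at 0)" "((%t. fEF (ga t)) has_real_derivative fEFF x) (at 0)"
  "((%t. fFF (ga t)) has_real_derivative fFFF x) (at 0)"
  using ch(2-6)[of 0] by (simp_all add: g0)
 have z4: "fE x - 4*fFF x+3*fEE x - 6*fEFF x+dd fFFF e' x = 0"
 proof (rule zero_deriv[OF _ z3, where t = 0])
  show "((%t. sin t*fE (ga t) - cos t*fF (ga t)+3 * sin t*cos t*fEE (ga t)+(3*(sin t)^2 - 3*(cos t)^2)*fEF (ga t)
   - 3 * sin t*cos t*fFF (ga t) - (sin t)^3*fEEE (ga t)+3*(sin t)^2*cos t*fEEF (ga t)
   - 3 * sin t*(cos t)^2*fEFF (ga t)+(cos t)^3*fFFF (ga t)) has_real_derivative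
   fE x - 4*fFF x+3*fEE x - 6*fEFF x+dd fFFF e' x) (at 0)"
   by (rule derivative_eq_intros ch2 ch3 refl)+ (simp add: g0)
 qed
 have a: "fF x = 0" "fFF x = fE x" "fFFF x = 3*fEF x" using z1[of 0] z2[of 0] z3[of 0] by (simp_all add: g0)
 thus "dd f e' x = 0" "dd (dd f e') e' x = dd f e x" "dd (dd (dd f e') e') e' x = 3*dd (dd f e) e' x"
  by (simp_all add: F)
 show "dd (dd (dd (dd f e') e') e') e' x - 6*dd (dd (dd f e) e') e' x+3*dd (dd f e) e x = 3*dd f e x"
  using z4 a(2) unfolding F by simp
qed

lemma circle_on_circ:
 assumes "r > 0"
 shows "{p. on_circle (a, b, r) p} = circ (a, b) (r, 0) (0, r)"
proof (intro subset_antisym subsetI)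
 fix p assume "p:{p. on_circle (a, b, r) p}"
 hence "((fst p - a)/r)^2+((snd p - b)/r)^2 = 1"
  using assms by (simp add: on_circle_def power_divide add_divide_distrib[symmetric])
 moreover have "p = (a, b)+((fst p - a)/r) *\<^sub>R (r, 0)+((snd p - b)/r) *\<^sub>R (0, r)" using assms by (simp add: prod_eq_iff)
 ultimately show "p:circ (a, b) (r, 0) (0, r)" unfolding circ_def by blast
next
 fix p assume "p:circ (a, b) (r, 0) (0, r)"
 then obtain s t where "p = (a+s*r, b+t*r)" "s^2+t^2 = 1" by (auto simp: circ_def)
 thus "p:{p. on_circle (a, b, r) p}" by (simp add: on_circle_def power_mult_distrib distrib_right[symmetric])
qed

text \<open>The curvature of the zero set at a smooth point fixes the circle: the centre is on the
  normal, and the second derivative in the tangent direction \<open>J N\<close> gives the signed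
  distance through \<open>k * quad f p (J N) = N . N\<close>.\<close>

lemma planar_circle_unique:
 fixes f :: "real \<times> real => real"
 assumes f: "polyf d f" and smooth: "EX v. dd f v p ~= 0" and r: "r > 0" "r' > 0"
  and on: "on_circle (a, b, r) p" "on_circle (a', b', r') p"
  and zero: "!!y. on_circle (a, b, r) y ==> f y = 0" "!!y. on_circle (a', b', r') y ==> f y = 0"
 shows "(a, b, r) = (a', b', r')"
proof -
 define J where "J = (%v :: real \<times> real. (- snd v, fst v))"
 define N where "N = grad f p"
 have N: "N ~= 0"
 proof
  assume "N = 0"
  hence "dd f v p = 0" for v using grad_inner[OF f, of p v] by (simp add: N_def)
  thus False using smooth by blast
 qed
 have NN: "N\<bullet>N ~= 0" using N by simp
 have key: "EX k. p - (al, be) = k *\<^sub>R N & k*quad f p (J N) = N\<bullet>N"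
  if rh: "rh > 0" and on: "on_circle (al, be, rh) p" and z: "!!y. on_circle (al, be, rh) y ==> f y = 0" for al be rh
 proof -
  define e where "e = p - (al, be)"
  have sq: "(fst e)^2+(snd e)^2 = rh^2" using on by (simp add: on_circle_def e_def)
  have "f y = 0" if "y:circ (al, be) e (J e)" for y
  proof -
   obtain s t where y: "y = (al, be)+s *\<^sub>R e+t *\<^sub>R J e" "s^2+t^2 = 1" using \<open>y:circ _ _ _\<close> unfolding circ_def by blast
   have "(s*fst e - t * snd e)^2+(s * snd e+t*fst e)^2 = (s^2+t^2)*((fst e)^2+(snd e)^2)"
    by (simp add: power2_eq_square algebra_simps)
   hence "on_circle (al, be, rh) y" using y sq by (simp add: on_circle_def J_def)
   thus ?thesis by (rule z)
  qed
  note ex = circle_expansion[where c = "(al, be)" and e = e and e' = "J e", OF f this]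
  have p: "(al, be)+e = p" by (simp add: e_def)
  have t: "N\<bullet>J e = 0" using ex(1) grad_inner[OF f, of p "J e"] unfolding p N_def by simp
  define k where "k = (N\<bullet>e)/(N\<bullet>N)"
  have e: "e = k *\<^sub>R N"
  proof -
   have "(N\<bullet>N)*fst e = (N\<bullet>e)*fst N" "(N\<bullet>N) * snd e = (N\<bullet>e) * snd N"
    using t by (simp_all add: inner_prod_def J_def) algebra+
   thus ?thesis using NN by (simp add: k_def prod_eq_iff field_simps)
  qed
  have "k ~= 0" using e sq rh by auto
  have Je: "J e = k *\<^sub>R J N" by (simp add: e J_def)
  have "quad f p (J e) = dd f e p" using ex(2) unfolding p quad_def .
  also have "dd f e p = N\<bullet>e" using grad_inner[OF f, of p e] by (simp add: N_def)
  also have "... = k*(N\<bullet>N)" by (simp add: e)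
  also have "quad f p (J e) = k*(k*quad f p (J N))"
   using quad_lincomb[OF f, of p k "J N" 0 "J N"] by (simp add: Je power2_eq_square)
  finally have "k*quad f p (J N) = N\<bullet>N" using \<open>k ~= 0\<close> by simp
  thus ?thesis using e e_def by metis
 qed
 obtain k where k: "p - (a, b) = k *\<^sub>R N" "k*quad f p (J N) = N\<bullet>N" using key[OF r(1) on(1) zero(1)] by blast
 obtain k' where k': "p - (a', b') = k' *\<^sub>R N" "k'*quad f p (J N) = N\<bullet>N" using key[OF r(2) on(2) zero(2)] by blast
 have "k = k'" using k(2) k'(2) NN by (metis mult_cancel_right mult_zero_right)
 hence "p - (a, b) = p - (a', b')" using k k' by simp
 hence c: "a = a'" "b = b'" by (simp_all add: prod_eq_iff)
 hence "r^2 = r'^2" using on by (simp add: on_circle_def)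
 thus ?thesis using c r by (simp add: power2_eq_iff)
qed

lemma pencil_direction_perp:
 "dual_point p\<bullet>pencil_direction p q = 0" "dual_point q\<bullet>pencil_direction p q = 0"
 by (simp_all add: dual_point_def pencil_direction_def inner_vec_def sum_3 algebra_simps)

lemma pencil_direction_nonzero: "fst p < fst q ==> pencil_direction p q ~= 0"
 by (auto simp: pencil_direction_def vec_eq_iff forall_3)

lemma common_pair_unique:
 assumes "ga ~= ga'" "snd (snd ga) > 0" "snd (snd ga') > 0" "fst p < fst q" "fst p' < fst q'"
  and "on_circle ga p" "on_circle ga q" "on_circle ga p'" "on_circle ga q'" "on_circle ga' p" "on_circle ga' q" "on_circle ga' p'" "on_circle ga' q'"
 shows "p = p' & q = q'"
proof -
 have "p ~= q" using assms by auto
 hence "x = p | x = q" if "on_circle ga x" "on_circle ga' x" for x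
  using circle_three_points[of ga p q x ga'] assms that by metis
 hence "p' = p | p' = q" "q' = p | q' = q" using assms by blast+
 thus ?thesis using assms(4,5) by auto
qed

lemma perp_parallel_cross:
 fixes N M w :: "real^3"
 assumes "w\<bullet>N = 0" "w\<bullet>M = 0" "cross3 N M ~= 0"
 shows "EX k. w = k *\<^sub>R cross3 N M"
proof -
 define D where "D = cross3 N M"
 have D: "D\<bullet>D ~= 0" using assms(3) by (simp add: D_def)
 have a: "cross3 w M\<bullet>D = 0" "cross3 N w\<bullet>D = 0" using assms(1,2) by (simp_all add: D_def dot_cross inner_commute)
 have "(D\<bullet>D) *\<^sub>R w = (w\<bullet>D) *\<^sub>R D" using cross3_basis[of N M w] a unfolding D_def by simp
 hence "(1/(D\<bullet>D)) *\<^sub>R ((D\<bullet>D) *\<^sub>R w) = (1/(D\<bullet>D)) *\<^sub>R ((w\<bullet>D) *\<^sub>R D)" by (rule arg_cong)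
 hence "w = ((w\<bullet>D)/(D\<bullet>D)) *\<^sub>R D" using D by simp
 thus ?thesis unfolding D_def by blast
qed

text \<open>Each plane in the space of circles contains the pencils of at most \<open>2 |P|\<close> pairs of points: unless the plane consists of the
 circles through a fixed point, it determines for every point \<open>p\<close> the second base point of the pencil.\<close>

lemma pencils_in_plane:
 assumes P: "finite P" and S: "S <= P \<times> P" and N: "N ~= 0"
  and lt: "!!p q. (p, q):S ==> fst p < fst q"
  and two: "!!p q. (p, q):S ==> EX ga ga'. ga ~= ga' & snd (snd ga) > 0 & snd (snd ga') > 0 & on_circle ga p & on_circle ga q &
   on_circle ga' p & on_circle ga' q & N\<bullet>dual_circle ga = e & N\<bullet>dual_circle ga' = e"
 shows "card S <= 2*card P"
proof (cases "inj_on fst S")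
 case True
 hence "card S <= card P" using S P by (intro card_inj_on_le[of fst]) auto
 thus ?thesis by simp
next
 case False
 then obtain s t where "s:S" "t:S" "fst s = fst t" "s ~= t" unfolding inj_on_def by blast
 then obtain p p' p'' where pp: "(p, p'):S" "(p, p''):S" "p' ~= p''" by (metis prod.collapse)
 obtain ga1 ga2 where 1: "ga1 ~= ga2" "snd (snd ga1) > 0" "snd (snd ga2) > 0" "on_circle ga1 p" "on_circle ga1 p'"
  "on_circle ga2 p" "on_circle ga2 p'" "N\<bullet>dual_circle ga1 = e" "N\<bullet>dual_circle ga2 = e" using two[OF pp(1)] by (elim exE conjE) (rule that)
 obtain ga3 ga4 where 3: "ga3 ~= ga4" "snd (snd ga3) > 0" "snd (snd ga4) > 0" "on_circle ga3 p" "on_circle ga3 p''"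
  "on_circle ga4 p" "on_circle ga4 p''" "N\<bullet>dual_circle ga3 = e" "N\<bullet>dual_circle ga4 = e" using two[OF pp(2)] by (elim exE conjE) (rule that)
 define ph where "ph = dual_point p"
 \<comment> \<open>Otherwise the plane meets the plane of circles through \<open>p\<close> in a
   line, which carries both pencils with base point \<open>p\<close>; then two different circles
   share \<open>p\<close>, \<open>p'\<close> and \<open>p''\<close>.\<close>
 have C0: "cross3 N ph = 0"
 proof (rule ccontr)
  assume C: "cross3 N ph ~= 0"
  have line: "EX k. dual_circle ga - dual_circle ga1 = k *\<^sub>R cross3 N ph" if "on_circle ga p" "N\<bullet>dual_circle ga = e" for ga
  proof (rule perp_parallel_cross[OF _ _ C])
   show "(dual_circle ga - dual_circle ga1)\<bullet>N = 0" using that 1(8) by (simp add: inner_commute[of _ N] inner_diff_right)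
   show "(dual_circle ga - dual_circle ga1)\<bullet>ph = 0"
    using that 1(4) by (simp add: on_circle_dual ph_def[symmetric] inner_commute[of _ ph] inner_diff_right)
  qed
  obtain k where k: "dual_circle ga2 - dual_circle ga1 = k *\<^sub>R cross3 N ph" using line[OF 1(6,9)] by blast
  have "k ~= 0" using k dual_circle_inj[OF 1(3,2)] 1(1) by auto
  have "dual_point p'\<bullet>(dual_circle ga2 - dual_circle ga1) = 0" using 1(5,7) by (simp add: on_circle_dual inner_diff_right)
  hence z: "dual_point p'\<bullet>cross3 N ph = 0" using \<open>k ~= 0\<close> unfolding k by simp
  have on: "on_circle ga p'" if c: "on_circle ga p" "N\<bullet>dual_circle ga = e" for ga
  proof -
   obtain k where "dual_circle ga - dual_circle ga1 = k *\<^sub>R cross3 N ph" using line[OF c] by blast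
   hence "dual_point p'\<bullet>(dual_circle ga - dual_circle ga1) = 0" using z by simp
   thus ?thesis using 1(5) by (simp add: on_circle_dual inner_diff_right)
  qed
  have "p ~= p'" "p ~= p''" using lt pp by fastforce+
  hence "ga3 = ga4"
   using circle_three_points[of ga3 p p' p'' ga4] on[OF 3(4,8)] on[OF 3(6,9)] 3 pp(3) by metis
  thus False using 3(1) by simp
 qed
 \<comment> \<open>The plane is parallel to the plane of circles through \<open>p\<close> and has a
   point in common with it. So \<open>p\<close> is on all its circles and belongs to every base
   pair.\<close>
 have through: "on_circle ga p" if "N\<bullet>dual_circle ga = e" for ga
 proof -
  have "cross3 N (cross3 N ph) = (N\<bullet>ph) *\<^sub>R N - (N\<bullet>N) *\<^sub>R ph" by (simp add: Lagrange)
  hence *: "(N\<bullet>N) *\<^sub>R ph = (N\<bullet>ph) *\<^sub>R N" using C0 by simp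
  have "(N\<bullet>N)*(ph\<bullet>(dual_circle ga - dual_circle ga1)) = (N\<bullet>ph)*(N\<bullet>(dual_circle ga - dual_circle ga1))"
   using arg_cong[OF *, of "%u. u\<bullet>(dual_circle ga - dual_circle ga1)"] by simp
  hence "ph\<bullet>(dual_circle ga - dual_circle ga1) = 0" using N that 1(8) by (simp add: inner_diff_right)
  thus ?thesis using 1(4) by (simp add: ph_def on_circle_dual inner_diff_right)
 qed
 have "S <= ({p} \<times> P) \<union> (P \<times> {p})"
 proof
  fix s assume s: "s:S"
  obtain q q' where qq: "s = (q, q')" by (metis surj_pair)
  obtain ga ga' where g: "ga ~= ga'" "snd (snd ga) > 0" "snd (snd ga') > 0" "on_circle ga q" "on_circle ga q'"
   "on_circle ga' q" "on_circle ga' q'" "N\<bullet>dual_circle ga = e" "N\<bullet>dual_circle ga' = e" using two[of q q'] s qq by metis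
  have "q ~= q'" using lt[of q q'] s qq by auto
  hence "p = q | p = q'"
   using circle_three_points[of ga q q' p ga'] g through by metis
  thus "s:({p} \<times> P) \<union> (P \<times> {p})" using s S qq by auto
 qed
 hence "card S <= card (({p} \<times> P) \<union> (P \<times> {p}))" using P by (intro card_mono) auto
 also have "... <= card ({p} \<times> P)+card (P \<times> {p})" by (rule card_Un_le)
 finally show ?thesis by (simp add: card_cartesian_product)
qed

text \<open>Replaces the lens bound for a cell of size \<open>x\<close> by a combination of
  \<open>x\<close> and \<open>x^2\<close>, whose sums over the cells are under control. The two
  terms agree at \<open>x = mu\<close>, the typical cell size.\<close>

lemma lens_sum_weight:
 fixes x mu :: real
 assumes "x >= 1" "mu >= 1"
 shows "x * sqrt x*(1+ln x) <= 2 * sqrt mu*(1+ln mu)*(x+x^2/mu)"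
proof -
 define y where "y = x/mu"
 have y: "y > 0" "x = mu*y" using assms by (auto simp: y_def)
 have lx: "ln x = ln mu+ln y" using assms y by (simp add: ln_mult)
 have l0: "ln mu >= 0" using assms by simp
 have 1: "sqrt y*(1+ln x) <= 2*(1+ln mu)*(1+y)"
 proof (cases "y <= 1")
  case True
  hence "1+ln x <= 1+ln mu" using y lx by simp
  moreover have "0 <= 1+ln x" using assms by simp
  ultimately have "sqrt y*(1+ln x) <= 1*(1+ln mu)" using True y by (intro mult_mono) auto
  also have "... <= (1+ln mu)*(2*(1+y))" using l0 y by (simp add: mult_le_cancel_left1)
  finally show ?thesis by (simp only: mult_ac)
 next
  case False
  hence sy: "sqrt y >= 1" by simp
  have "ln y = 2*ln (sqrt y)" using y by (simp add: ln_sqrt)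
  also have "ln (sqrt y) <= sqrt y - 1" using y by (intro ln_le_minus_one) simp
  finally have ly: "1+ln y <= 2 * sqrt y" by simp
  have ln0: "ln y >= 0" using False by simp
  have "1+ln x <= (1+ln mu)*(1+ln y)" using lx l0 ln0 by (simp add: algebra_simps)
  also have "... <= (1+ln mu)*(2 * sqrt y)" using ly l0 by (intro mult_left_mono) auto
  finally have "sqrt y*(1+ln x) <= sqrt y*((1+ln mu)*(2 * sqrt y))" using y by (intro mult_left_mono) auto
  also have "... = 2*(1+ln mu)*(sqrt y * sqrt y)" by (simp only: mult_ac)
  also have "... = 2*(1+ln mu)*y" using y(1) by simp
  also have "... <= 2*(1+ln mu)*(1+y)" using l0 by (intro mult_left_mono) auto
  finally show ?thesis .
 qed
 have "x * sqrt x*(1+ln x) = x * sqrt mu*(sqrt y*(1+ln x))" using assms by (simp add: y real_sqrt_mult mult_ac)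
 also have "... <= x * sqrt mu*(2*(1+ln mu)*(1+y))" using 1 assms by (intro mult_left_mono) auto
 also have "... = 2 * sqrt mu*(1+ln mu)*(x+x^2/mu)" using assms by (simp add: y_def power2_eq_square algebra_simps)
 finally show ?thesis .
qed

section \<open>Lens counting\<close>

lemma lens_pair:
 assumes "0 < snd (snd f)" "snd (snd f) <= snd (snd g)" "f ~= g" "on_top f p" "on_top g p" "on_top f q" "on_top g q" "fst p < fst q"
 shows "top_y g ((fst p+fst q)/2) < top_y f ((fst p+fst q)/2)"
  and "x <= fst p | fst q <= x ==> top_y f x <= top_y g x"
proof -
 obtain a b r a' b' r' where g: "f = (a, b, r)" "g = (a', b', r')" by (metis surj_pair)
 note l = lens[of r r' a b a' b' p q, folded g]
 show "top_y g ((fst p+fst q)/2) < top_y f ((fst p+fst q)/2)" using assms by (intro l(1)) (auto simp: g)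
 show "x <= fst p | fst q <= x ==> top_y f x <= top_y g x" using assms by (intro l(2)) (auto simp: g)
qed

text \<open>\<open>lens f g om\<close> says that the circles \<open>f\<close> and \<open>g\<close> have the pair \<open>om\<close> as an edge and are consecutive among the circles with that edge.\<close>

lemma lenses_bound:
 fixes G :: "(real \<times> real \<times> real) set" and E :: "(real \<times> real \<times> real) => (real \<times> real) \<times> (real \<times> real) => bool"
 assumes G: "finite G" "G ~= {}" and r: "!!g. g:G ==> snd (snd g) > 0"
  and E: "!!g p q. E g (p, q) ==> on_top g p & on_top g q & fst p < fst q"
  and disj: "!!g p q p' q'. E g (p, q) ==> E g (p', q') ==> (p, q) ~= (p', q') ==> fst q <= fst p' | fst q' <= fst p"
  and lens: "!!f g om. lens f g om ==> E f om & E g om & fst (snd g) < fst (snd f)"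
  and next1: "!!f g g' om. lens f g om ==> lens f g' om ==> g = g'"
  and next2: "!!f f' g om. lens f g om ==> lens f' g om ==> f = f'"
 shows "rc {(f, g). f:G & g:G & (EX om. lens f g om)} <= 10*(rc G * sqrt (rc G)*(1+ln (rc G)))"
proof -
 define Lam where "Lam = {(f, g). f:G & g:G & (EX om. lens f g om)}"
 define w where "w = (%f g. SOME om. lens f g om)"
 have w: "lens f g (w f g)" if "(f, g):Lam" for f g
  using that unfolding Lam_def w_def by (auto intro: someI)
 \<comment> \<open>The midpoint of the edge serves as the position of a lens: there \<open>f\<close>
   is above \<open>g\<close>. Edges of one circle do not overlap, so this point is outside the other
   edges of \<open>f\<close> and of \<open>g\<close>, where the order of the circles of those lenses
   is reversed.\<close>
 define u where "u = (%f g. (fst (fst (w f g))+fst (snd (w f g)))/2)"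
 define n where "n = card G"
 have n: "n > 0" using G by (simp add: n_def card_gt_0_iff)
 define H where "H = nat \<lceil>log 2 (real n)\<rceil>"
 have H1: "log 2 (real n) <= real H" "real H <= log 2 (real n)+1" using n by (auto simp: H_def)
 have "real n = 2 powr (log 2 (real n))" using n by simp
 also have "... <= 2 powr (real H)" using H1 by (intro powr_mono) auto
 also have "... = real (2^H)" by (simp add: powr_realpow)
 finally have nH: "n <= 2^H" by (simp only: of_nat_le_iff)
 have E': "on_top g (fst om)" "on_top g (snd om)" "fst (fst om) < fst (snd om)" if "E g om" for g om
  using E[of g "fst om" "snd om"] that by auto
 have disj': "fst (snd om) <= fst (fst om') | fst (snd om') <= fst (fst om)" if "E g om" "E g om'" "om ~= om'" for g om om'
  using disj[of g "fst om" "snd om" "fst om'" "snd om'"] that by auto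
 have L: "0 < snd (snd f)" "snd (snd f) <= snd (snd g)" "f ~= g" "E f (w f g)" "E g (w f g)" if "(f, g):Lam" for f g
 proof -
  note l = lens[OF w[OF that]]
  show e: "E f (w f g)" "E g (w f g)" "f ~= g" using l by auto
  have "f:G" "g:G" using that by (auto simp: Lam_def)
  hence rr: "0 < snd (snd f)" "0 < snd (snd g)" using r by auto
  thus "0 < snd (snd f)" by simp
  show "snd (snd f) <= snd (snd g)"
   using pencil_radius_decreasing[of g "fst (w f g)" "snd (w f g)" f] E'[OF e(1)] E'[OF e(2)] rr l by simp
 qed
 have lt: "top_y g (u f g) < top_y f (u f g)" if "(f, g):Lam" for f g
  unfolding u_def by (rule lens_pair(1)[OF L(1-3)[OF that]]) (use E' L(4,5)[OF that] in auto)
 have le: "top_y f x <= top_y g x" if "(f, g):Lam" "x <= fst (fst (w f g)) | fst (snd (w f g)) <= x" for f g x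
  by (rule lens_pair(2)[OF L(1-3)[OF that(1)] _ _ _ _ _ that(2)]) (use E' L(4,5)[OF that(1)] in auto)
 have out: "u f g <= fst (fst om) | fst (snd om) <= u f g" if "(f, g):Lam" "E h (w f g)" "E h om" "w f g ~= om" for f g h om
  using disj'[OF that(2-4)] E'(3)[OF that(2)] by (auto simp: u_def)
 have "rc Lam^2 <= 24*real (H+1)^2*real n^3"
 proof (rule lens_packing[where A = G and B = G and F = top_y and G = top_y and u = u])
  show "Lam <= G \<times> G" by (auto simp: Lam_def)
  show "top_y g (u f g) < top_y g' (u f g)" if a: "(f, g):Lam" "(f, g'):Lam" "g ~= g'" for f g g'
  proof -
   have "w f g ~= w f g'" using next1[OF w[OF a(1)]] w[OF a(2)] a(3) by metis
   hence "top_y f (u f g) <= top_y g' (u f g)" by (rule le[OF a(2) out[OF a(1) L(4)[OF a(1)] L(4)[OF a(2)]]])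
   thus ?thesis using lt[OF a(1)] by simp
  qed
  show "top_y f' (u f g) < top_y f (u f g)" if a: "(f, g):Lam" "(f', g):Lam" "f ~= f'" for f f' g
  proof -
   have "w f g ~= w f' g" using next2[OF w[OF a(1)]] w[OF a(2)] a(3) by metis
   hence "top_y f' (u f g) <= top_y g (u f g)" by (rule le[OF a(2) out[OF a(1) L(5)[OF a(1)] L(5)[OF a(2)]]])
   thus ?thesis using lt[OF a(1)] by simp
  qed
  show "no_alternation (%x. top_y f x - top_y f' x)" if "f:G" "f':G" for f f'
   using top_no_alternation r that by blast
  thus "no_alternation (%x. top_y f x - top_y f' x)" if "f:G" "f':G" for f f' using that .
 qed (use G n nH in \<open>auto simp: n_def\<close>)
 also have "... <= (5*real (H+1)*(real n * sqrt (real n)))\<^sup>2"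
 proof -
  have "(5*real (H+1)*(real n * sqrt (real n)))^2 = 25*real (H+1)^2*real n^3"
   by (simp only: power_mult_distrib real_sqrt_pow2[OF of_nat_0_le_iff]) (simp add: power2_eq_square power3_eq_cube)
  thus ?thesis by simp
 qed
 finally have "rc Lam <= 5*real (H+1)*(real n * sqrt (real n))" by (rule power2_le_imp_le) simp
 also have "... <= 5*(2+2*ln (real n))*(real n * sqrt (real n))"
 proof -
  have "ln (2::real) >= 1/2" using ln2_ge_two_thirds by simp
  hence "ln (real n)/ln 2 <= ln (real n)/(1/2)" using n by (intro divide_left_mono) auto
  hence "real (H+1) <= 2+2*ln (real n)" using H1(2) by (simp add: log_def)
  thus ?thesis by (intro mult_right_mono) auto
 qed
 finally show ?thesis unfolding Lam_def n_def by (simp add: algebra_simps)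
qed

text \<open>\<open>E g (p, q)\<close>: the points \<open>p\<close> and \<open>q\<close> are joined by an edge on the top arc of \<open>g\<close>. The circles are dualised to points of
 three-space, where the circles through \<open>p\<close> and \<open>q\<close> lie on a line, and these points are partitioned by a polynomial of degree \<open>k\<close>.\<close>

lemma edges_bound:
 "EX K::real. K >= 1 & (ALL P G (R :: ((real \<times> real) \<times> (real \<times> real)) set) E k. finite P --> finite G --> G ~= {} --> (ALL g:G. snd (snd g) > 0) --> R <= P \<times> P --> k >= 1 -->
  (ALL g p q. E g (p, q) --> g:G & (p, q):R & on_top g p & on_top g q & fst p < fst q) -->
  (ALL g p q p' q'. E g (p, q) --> E g (p', q') --> (p, q) ~= (p', q') --> fst q <= fst p' | fst q' <= fst p) -->
  rc {(g, om). E g om} <= K*(real k*rc R+rc G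
   + rc P powr (2/3)*real k powr (1/3)*rc G powr (2/3)
   + rc G*(sqrt (max 1 (rc G/real k^3))*(1+ln (max 1 (rc G/real k^3))))))"
proof -
 obtain C :: nat where C: "C >= 1" "!!(X :: (real^3) set) D. finite X ==> D >= 1 ==>
  EX fs \<S>. sign_cells fs X \<S> & polyf (C*D) (prodf fs) &
   cubes \<S> * real D^(2*DIM(real^3)) <= real C*rc X^3"
  using polynomial_partition[where 'a = "real^3"] by blast
 obtain C' :: real where C': "C' >= 1" "!!(X :: (real^3) set) Ls F d M. finite X ==> finite Ls ==> polyf d F ==> (EX x. F x ~= 0) ==>
  (ALL l:Ls. is_line l & (ALL x:l. F x = 0)) ==>
  (ALL N e. N ~= 0 --> card {l:Ls. l <= {x. N\<bullet>x = e}} <= M) ==>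
  real (SUM l:Ls. card (X \<inter> l)) <= C'*(real (d+1)*rc Ls+rc X
   + real M powr (2/3)*real d powr (1/3)*rc X powr (2/3))"
  using lines_in_surface by iprover
 define c where "c = real C"
 have c1: "c >= 1" using C(1) by (simp add: c_def)
 define K where "K = 2+2*c+20*(1+c)+C'*(4*c+2)"
 have "rc {(g, om). E g om} <= K*(real k*rc R+rc G
   + rc P powr (2/3)*real k powr (1/3)*rc G powr (2/3)
   + rc G*(sqrt (max 1 (rc G/real k^3))*(1+ln (max 1 (rc G/real k^3)))))"
  if P: "finite P" and G: "finite G" "G ~= {}" and r0: "ALL g:G. snd (snd g) > 0" and R: "R <= P \<times> P" and k: "k >= 1"
   and E0: "ALL g p q. E g (p, q) --> g:G & (p, q):R & on_top g p & on_top g q & fst p < fst q"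
   and disj0: "ALL g p q p' q'. E g (p, q) --> E g (p', q') --> (p, q) ~= (p', q') --> fst q <= fst p' | fst q' <= fst p"
  for P G k E and R :: "((real \<times> real) \<times> (real \<times> real)) set"
 proof -
  have r: "snd (snd g) > 0" if "g:G" for g using r0 that by blast
  have E: "g:G" "om:R" "on_top g (fst om)" "on_top g (snd om)" "fst (fst om) < fst (snd om)" if "E g om" for g om
   using E0[rule_format, of g "fst om" "snd om"] that by auto
  have Eon: "on_circle g (fst om)" "on_circle g (snd om)" if "E g om" for g om using E(3,4)[OF that] by (auto simp: on_top_def)
  have finR: "finite R" using R P by (meson finite_SigmaI finite_subset)
  define n where "n = rc G"
  have n: "n >= 1" using G by (simp add: n_def Suc_leI card_gt_0_iff)
  define X where "X = dual_circle ` G"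
  have inj: "inj_on dual_circle G" using dual_circle_inj r by (intro inj_onI) blast
  have X: "finite X" "card X = card G" using G inj by (auto simp: X_def card_image)
  obtain fs \<Q> where part: "sign_cells fs X \<Q>" "polyf (C * k) (prodf fs)"
   "cubes \<Q> * real k^(2*DIM(real^3)) <= real C*rc X^3"
   using C(2)[OF X(1) k] by blast
  define d where "d = C * k"
  have dk: "real d = c*real k" by (simp add: d_def c_def)
  have sq: "(SUM S:\<Q>. rc S^2)*real k^3 <= c*n^2"
   using sign_cells_squares[OF X(1) part(1,3) C(1)] by (simp add: n_def X c_def)
  have cells: "\<Q> <= Pow X" "disjoint \<Q>" "{} ~: \<Q>" "finite fs" "!!f. f:fs ==> EX d. polyf d f" "EX x. ALL f:fs. f x ~= 0"
   "!!x y. x:X ==> y:X ==> ALL f:fs. f x*f y > 0 ==> EX S:\<Q>. x:S & y:S"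
   using part(1) unfolding sign_cells_def by blast+
  have finQ: "finite \<Q>" using cells(1) X(1) by (meson finite_Pow_iff finite_subset)
  define F where "F = (prodf fs)"
  have F: "polyf d F" "EX x. F x ~= 0" using part(2) cells(4,6) by (auto simp: F_def d_def prod_zero_iff)
  define M where "M = (%om. {g. E g om})"
  have M: "M om <= G" "finite (M om)" for om
  proof -
   show "M om <= G" using E(1) unfolding M_def by blast
   thus "finite (M om)" using G(1) by (rule finite_subset)
  qed
  have "card {(g, om). E g om} = card (SIGMA om:R. M om)"
   by (rule bij_betw_same_card[of prod.swap], rule bij_betw_byWitness[where f' = prod.swap]) (auto simp: M_def E)
  also have "... = (SUM om:R. card (M om))" using finR M(2) by simp
  finally have count: "card {(g, om). E g om} = (SUM om:R. card (M om))" .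
  define g0 where "g0 = (%om. SOME g. g:M om)"
  define pd where "pd = (%om. pencil_direction (fst om) (snd om))"
  define pl where "pl = (%om. affine_line (dual_circle (g0 om)) (pd om))"
  have g0: "E (g0 om) om" if "E g om" for g om unfolding g0_def M_def using that by (auto intro: someI)
  \<comment> \<open>The pencil of an edge as a line in the dual space, with the height of the centre
    as parameter and one member \<open>g0\<close> as base point.\<close>
  define cv where "cv = (%om t. dual_circle (g0 om)+((t - fst (snd (g0 om)))/(fst (snd om) - fst (fst om))) *\<^sub>R pd om)"
  have cvM: "cv om (fst (snd g)) = dual_circle g" if "E g om" for g om
   using pencil_line[of "g0 om" "fst om" "snd om" g] Eon[OF g0[OF that]] Eon[OF that] E(5)[OF that] by (simp add: cv_def pd_def)
  have cvl: "cv om t:pl om" for om t by (auto simp: cv_def pl_def affine_line_def)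
  have Ml: "dual_circle ` M om <= X \<inter> pl om" for om
  proof (rule image_subsetI)
   fix g assume "g:M om"
   hence e: "E g om" by (simp add: M_def)
   show "dual_circle g:X \<inter> pl om" using cvM[OF e] cvl[of om "fst (snd g)"] E(1)[OF e] by (simp add: X_def)
  qed
  have cardM: "card (M om) <= card (X \<inter> pl om)" for om
   using card_mono[OF _ Ml[of om]] X(1) card_image[OF inj_on_subset[OF inj M(1)[of om]]] by simp
  have l_on: "on_circle g (fst om)" "on_circle g (snd om)" if dl: "dual_circle g:pl om" "E h om" for g om h
  proof -
   obtain t where t: "dual_circle g = dual_circle (g0 om)+t *\<^sub>R pd om" using dl(1) unfolding pl_def affine_line_def by blast
   show "on_circle g (fst om)" "on_circle g (snd om)"
    using Eon[OF g0[OF dl(2)]] unfolding on_circle_dual t by (simp_all add: inner_add_right pd_def pencil_direction_perp)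
  qed
  \<comment> \<open>Edges that occur on one circle only cost \<open>|R|\<close> altogether.
    \<open>R2b\<close> collects the pencils inside the zero set of the partitioning polynomial,
    \<open>R2a\<close> the pencils that leave it.\<close>
  define R2 where "R2 = {om:R. 2 <= card (M om)}"
  define R2a where "R2a = {om:R2. EX y:pl om. F y ~= 0}"
  define R2b where "R2b = R2 - R2a"
  have fin2: "finite R2" "finite R2a" "finite R2b" "R2 <= R" "R2a <= R" "R2b <= R" using finR by (auto simp: R2_def R2a_def R2b_def)
  have two: "EX g g'. g ~= g' & E g om & E g' om" if "om:R2" for om
  proof -
   have "2 <= card (M om)" using that by (simp add: R2_def)
   from obtain_subset_with_card_n[OF this] obtain S where S: "S <= M om" "card S = 2" by metis
   obtain x y where "S = {x, y}" "x ~= y" using S(2) by (meson card_2_iff)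
   hence "x ~= y & E x om & E y om" using S(1) by (simp add: M_def)
   thus ?thesis by blast
  qed
  have split: "(SUM om:R. card (M om)) <= card R+(SUM om:R2a. card (M om))+(SUM om:R2b. card (M om))"
  proof -
   have "(SUM om:R. card (M om)) = (SUM om:R - R2. card (M om))+(SUM om:R2. card (M om))"
    using finR fin2 by (intro sum.subset_diff) auto
   also have "(SUM om:R - R2. card (M om)) <= (SUM om:R - R2. 1)" by (intro sum_mono) (auto simp: R2_def)
   also have "... <= card R" using finR by (simp add: card_mono)
   also have "(SUM om:R2. card (M om)) = (SUM om:R2b. card (M om))+(SUM om:R2a. card (M om))"
    unfolding R2b_def using fin2 by (intro sum.subset_diff) (auto simp: R2a_def)
   finally show ?thesis by simp
  qed
  \<comment> \<open>At most \<open>2 |P|\<close> of these pencils lie in a plane; this is the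
    parameter \<open>M\<close> of the bound for lines in a surface.\<close>
  have partb: "real (SUM om:R2b. card (M om)) <= C'*(real (d+1)*rc R+n
   + real (2*card P) powr (2/3)*real d powr (1/3)*n powr (2/3))"
  proof -
   have injl: "inj_on pl R2b"
   proof (rule inj_onI)
    fix om om' assume o: "om:R2b" "om':R2b" "pl om = pl om'"
    hence o2: "om:R2" "om':R2" by (auto simp: R2b_def)
    obtain g g' where g: "g ~= g'" "E g om" "E g' om" using two[OF o2(1)] by blast
    obtain h where h: "E h om'" using two[OF o2(2)] by blast
    have "dual_circle g:pl om'" "dual_circle g':pl om'" using Ml[of om] g o(3) by (auto simp: M_def)
    note on = l_on[OF this(1) h] l_on[OF this(2) h]
    have "fst om = fst om' & snd om = snd om'"
     using g on by (intro common_pair_unique[of g g'] r E(1)[OF g(2)] E(1)[OF g(3)] E(5)[OF g(2)] E(5)[OF h] Eon[OF g(2)] Eon[OF g(3)]) auto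
    thus "om = om'" by (simp add: prod_eq_iff)
   qed
   have "(SUM om:R2b. card (M om)) <= (SUM om:R2b. card (X \<inter> pl om))" by (rule sum_mono[OF cardM])
   also have "... = (SUM l:pl ` R2b. card (X \<inter> l))" by (simp add: sum.reindex[OF injl])
   finally have "real (SUM om:R2b. card (M om)) <= real (SUM l:pl ` R2b. card (X \<inter> l))" by (simp only: of_nat_le_iff)
   also have "... <= C'*(real (d+1)*rc (pl ` R2b)+rc X
    + real (2*card P) powr (2/3)*real d powr (1/3)*rc X powr (2/3))"
   proof (rule C'(2)[OF X(1) _ F])
    show "finite (pl ` R2b)" using fin2 by simp
    show "ALL l:pl ` R2b. is_line l & (ALL x:l. F x = 0)"
    proof
     fix l assume "l:pl ` R2b"
     then obtain om where o: "om:R2b" "l = pl om" by blast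
     hence "om:R2" "om ~: R2a" by (auto simp: R2b_def)
     hence "ALL x:l. F x = 0" by (auto simp: R2a_def o)
     moreover obtain g where "E g om" using two[OF \<open>om:R2\<close>] by blast
     hence "pd om ~= 0" using E(5) pencil_direction_nonzero by (simp add: pd_def)
     ultimately show "is_line l & (ALL x:l. F x = 0)" unfolding o(2) pl_def by blast
    qed
    show "ALL N e. N ~= 0 --> card {l:pl ` R2b. l <= {x. N\<bullet>x = e}} <= 2*card P"
    proof (intro allI impI)
     fix N :: "real^3" and e assume N: "N ~= 0"
     define S where "S = {om:R2b. pl om <= {x. N\<bullet>x = e}}"
     have "{l:pl ` R2b. l <= {x. N\<bullet>x = e}} = pl ` S" by (auto simp: S_def)
     hence "card {l:pl ` R2b. l <= {x. N\<bullet>x = e}} <= card S" using fin2 by (simp add: S_def card_image_le)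
     also have "card S <= 2*card P"
     proof (rule pencils_in_plane[OF P _ N])
      show "S <= P \<times> P" using fin2(6) R by (auto simp: S_def)
      fix p q assume pq: "(p, q):S"
      hence "(p, q):R2" by (auto simp: S_def R2b_def)
      then obtain g g' where g: "g ~= g'" "E g (p, q)" "E g' (p, q)" using two by blast
      show "fst p < fst q" using E(5)[OF g(2)] by simp
      have "dual_circle g:pl (p, q)" "dual_circle g':pl (p, q)" using Ml[of "(p, q)"] g by (auto simp: M_def)
      hence "N\<bullet>dual_circle g = e" "N\<bullet>dual_circle g' = e" using pq by (auto simp: S_def)
      hence "g ~= g' & snd (snd g) > 0 & snd (snd g') > 0 & on_circle g p & on_circle g q &
       on_circle g' p & on_circle g' q & N\<bullet>dual_circle g = e & N\<bullet>dual_circle g' = e"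
       using g(1) r[OF E(1)[OF g(2)]] r[OF E(1)[OF g(3)]] Eon[OF g(2)] Eon[OF g(3)] by simp
      thus "EX ga ga'. ga ~= ga' & snd (snd ga) > 0 & snd (snd ga') > 0 & on_circle ga p & on_circle ga q &
       on_circle ga' p & on_circle ga' q & N\<bullet>dual_circle ga = e & N\<bullet>dual_circle ga' = e" by (intro exI)
     qed
     finally show "card {l:pl ` R2b. l <= {x. N\<bullet>x = e}} <= 2*card P" .
    qed
   qed
   also have "... <= C'*(real (d+1)*rc R+n
    + real (2*card P) powr (2/3)*real d powr (1/3)*n powr (2/3))"
   proof -
    have "card (pl ` R2b) <= card R" using card_image_le[OF fin2(3), of pl] card_mono[OF finR fin2(6)] by simp
    thus ?thesis using C'(1) unfolding X(2) n_def by (intro mult_left_mono add_mono order_refl) auto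
   qed
   finally show ?thesis .
  qed
  \<comment> \<open>Consecutive in the pencil by height of the centre, with the higher and therefore
    smaller circle first. Consecutiveness is what lets one circle and the edge determine the other
    circle.\<close>
  define lens where "lens = (%f g om. om:R2a & E f om & E g om & fst (snd g) < fst (snd f) &
   (ALL h. E h om --> ~(fst (snd g) < fst (snd h) & fst (snd h) < fst (snd f))))"
  have Minj: "g = g'" if "E g om" "E g' om" "fst (snd g) = fst (snd g')" for g g' om
   using cvM[OF that(1)] cvM[OF that(2)] that(3) inj E(1)[OF that(1)] E(1)[OF that(2)] by (metis inj_onD)
  define Lam where "Lam = (%Q. {(f, g). f:{g:G. dual_circle g:Q} & g:{g:G. dual_circle g:Q} & (EX om. lens f g om)})"
  define L where "L = (%om. {(f, g). lens f g om & (EX Q:\<Q>. dual_circle f:Q & dual_circle g:Q)})"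
  have finL: "finite (L om)" for om
   by (rule finite_subset[of _ "G \<times> G"]) (use G E(1) in \<open>unfold L_def lens_def, blast+\<close>)
  have finLam: "finite (Lam Q)" for Q by (rule finite_subset[of _ "G \<times> G"]) (use G in \<open>auto simp: Lam_def\<close>)
  have window: "card (M om) <= 1+2*d+card (L om)" if o: "om:R2a" for om
  proof -
   have o2: "om:R2" using o by (simp add: R2a_def)
   obtain h where h: "E h om" using two[OF o2] by blast
   obtain y where y: "y:pl om" "F y ~= 0" using o by (auto simp: R2a_def)
   define A where "A = (%g. fst (snd g)) ` M om"
   have injA: "inj_on (%g. fst (snd g)) (M om)" using Minj by (intro inj_onI) (auto simp: M_def)
   have A: "finite A" "card A = card (M om)" using M(2) injA by (auto simp: A_def card_image)
   have slope: "fst (snd om) - fst (fst om) > 0" "pd om ~= 0"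
    using E(5)[OF h] pencil_direction_nonzero by (auto simp: pd_def)
   define xs where "xs = sorted_list_of_set A"
   have xs: "set xs = A" "length xs = card A" "sorted xs" "distinct xs" using A(1) by (auto simp: xs_def)
   define W where "W = {i. i+1 < card A & (ALL j:{i..i+1}. ALL k:{i..i+1}. ALL f:fs. f (cv om (xs ! j))*f (cv om (xs ! k)) > 0)}"
   have "card A <= 1+(1+1)*d+card W"
    unfolding W_def xs_def
   proof (rule curve_windows[OF cells(4) cells(5) F(1)[unfolded F_def] _ y(1) y(2)[unfolded F_def] A(1)])
    show "zeros_le d d (pl om)" unfolding pl_def affine_line_def by (rule zeros_le_line)
    show "continuous_on {a..b} (cv om) & inj_on (cv om) {a..b} & cv om ` {a..b} <= pl om" for a b
    proof (intro conjI)
     show "continuous_on {a..b} (cv om)" unfolding cv_def using slope by (intro continuous_intros) auto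
     show "inj_on (cv om) {a..b}" using slope by (auto simp: cv_def inj_on_def)
     show "cv om ` {a..b} <= pl om" using cvl by blast
    qed
   qed
   also have "card W <= card (L om)"
   proof -
    define G' where "G' = (%t. SOME g. E g om & fst (snd g) = t)"
    have G': "E (G' t) om & fst (snd (G' t)) = t" if "t:A" for t
     unfolding G'_def by (rule someI_ex) (use that in \<open>unfold A_def M_def, blast\<close>)
    show ?thesis
    proof (rule card_inj_on_le[where f = "%i. (G' (xs ! Suc i), G' (xs ! i))"])
     show "inj_on (%i. (G' (xs ! Suc i), G' (xs ! i))) W"
     proof (rule inj_onI)
      fix i j assume ij: "i:W" "j:W" "(G' (xs ! Suc i), G' (xs ! i)) = (G' (xs ! Suc j), G' (xs ! j))"
      hence l: "i < length xs" "j < length xs" using xs(2) by (auto simp: W_def)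
      hence "xs ! i:A" "xs ! j:A" using xs(1) nth_mem by blast+
      hence "xs ! i = xs ! j" using G' ij(3) by (metis prod.inject)
      thus "i = j" using nth_eq_iff_index_eq[OF xs(4) l] by simp
     qed
     show "(%i. (G' (xs ! Suc i), G' (xs ! i))) ` W <= L om"
     proof (rule image_subsetI)
      fix i assume i: "i:W"
      hence l: "Suc i < length xs" "i < length xs" using xs(2) by (auto simp: W_def)
      hence mem: "xs ! i:A" "xs ! Suc i:A" using xs(1) nth_mem by blast+
      have lt: "xs ! i < xs ! Suc i"
       using sorted_wrt_nth_less[of "(<)" xs i "Suc i"] xs(3,4) l by (simp add: strict_sorted_iff)
      have none: "~(xs ! i < t & t < xs ! Suc i)" if "t:A" for t
      proof
       assume t: "xs ! i < t & t < xs ! Suc i"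
       obtain j where j: "j < length xs" "t = xs ! j" using \<open>t:A\<close> xs(1) by (metis in_set_conv_nth)
       have "~j <= i" using t j sorted_nth_mono[OF xs(3), of j i] l by auto
       moreover have "~Suc i <= j" using t j sorted_nth_mono[OF xs(3), of "Suc i" j] by auto
       ultimately show False by simp
      qed
      have a: "lens (G' (xs ! Suc i)) (G' (xs ! i)) om"
       unfolding lens_def using o G'[OF mem(1)] G'[OF mem(2)] lt none by (auto simp: A_def M_def)
      have "EX Q:\<Q>. dual_circle (G' (xs ! Suc i)):Q & dual_circle (G' (xs ! i)):Q"
      proof (rule cells(7))
       have eq: "dual_circle (G' (xs ! i)) = cv om (xs ! i)" "dual_circle (G' (xs ! Suc i)) = cv om (xs ! Suc i)"
        using cvM[of "G' (xs ! i)" om] cvM[of "G' (xs ! Suc i)" om] G'[OF mem(1)] G'[OF mem(2)] by auto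
       show "dual_circle (G' (xs ! Suc i)):X" "dual_circle (G' (xs ! i)):X"
        using G'[OF mem(1)] G'[OF mem(2)] E(1) unfolding X_def by blast+
       show "ALL f:fs. f (dual_circle (G' (xs ! Suc i)))*f (dual_circle (G' (xs ! i))) > 0"
        unfolding eq using i by (auto simp: W_def)
      qed
      thus "(G' (xs ! Suc i), G' (xs ! i)):L om" using a by (simp add: L_def)
     qed
    qed (rule finL)
   qed
   finally show ?thesis by (simp add: A(2))
  qed
  \<comment> \<open>Two distinct circles have only one pair of common points with increasing
    abscissas, so a lens is not charged by two pencils.\<close>
  have lens_unique: "om = om'" if "lens f g om" "lens f g om'" for f g om om'
  proof -
   have e: "E f om" "E g om" "E f om'" "E g om'" "f ~= g" using that by (auto simp: lens_def)
   have "fst om = fst om' & snd om = snd om'"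
    by (intro common_pair_unique[of f g] r E(1)[OF e(1)] E(1)[OF e(2)] E(5)[OF e(1)] E(5)[OF e(3)]
     Eon[OF e(1)] Eon[OF e(2)] Eon[OF e(3)] Eon[OF e(4)] e(5))
   thus ?thesis by (simp add: prod_eq_iff)
  qed
  have sumL: "(SUM om:R2a. card (L om)) <= (SUM Q:\<Q>. card (Lam Q))"
  proof -
   have "(SUM om:R2a. card (L om)) = card (SIGMA om:R2a. L om)" using fin2 finL by simp
   also have "... <= card (UN Q:\<Q>. Lam Q)"
   proof (rule card_inj_on_le[where f = snd])
    show "inj_on snd (SIGMA om:R2a. L om)" using lens_unique by (intro inj_onI) (auto simp: L_def)
    show "snd ` (SIGMA om:R2a. L om) <= (UN Q:\<Q>. Lam Q)"
    proof
     fix x assume "x:snd ` (SIGMA om:R2a. L om)"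
     then obtain om f g Q where x: "x = (f, g)" "lens f g om" "Q:\<Q>" "dual_circle f:Q" "dual_circle g:Q"
      unfolding L_def by auto
     hence "E f om" "E g om" by (simp_all add: lens_def)
     hence "f:G" "g:G" using E(1) by blast+
     hence "x:Lam Q" unfolding Lam_def x(1) using x by blast
     thus "x:(UN Q:\<Q>. Lam Q)" using x(3) by blast
    qed
    show "finite (UN Q:\<Q>. Lam Q)" using finQ finLam by blast
   qed
   also have "... <= (SUM Q:\<Q>. card (Lam Q))" by (rule card_UN_le[OF finQ])
   finally show ?thesis .
  qed
  \<comment> \<open>The average cell size \<open>n / k^3\<close>, kept at least 1 for the
    logarithm.\<close>
  define mu where "mu = max 1 (n/real k^3)"
  define w where "w = sqrt mu*(1+ln mu)"
  have mu: "mu >= 1" "w >= 0" by (auto simp: mu_def w_def)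
  have cell: "rc (Lam Q) <= 20 * w*(rc Q+rc Q^2/mu)" if Q: "Q:\<Q>" for Q
  proof -
   define GQ where "GQ = {g:G. dual_circle g:Q}"
   have "Q = dual_circle ` GQ" using cells(1) Q by (auto simp: GQ_def X_def)
   moreover have "inj_on dual_circle GQ" using inj by (rule inj_on_subset) (auto simp: GQ_def)
   ultimately have cQ: "card Q = card GQ" by (metis card_image)
   have ne: "GQ ~= {}" using \<open>Q = dual_circle ` GQ\<close> cells(3) Q by (metis image_is_empty)
   have fGQ: "finite GQ" using G by (simp add: GQ_def)
   hence q1: "rc GQ >= 1" using fGQ ne by (simp add: Suc_leI card_gt_0_iff)
   have "rc (Lam Q) <= 10*(rc GQ * sqrt (rc GQ)*(1+ln (rc GQ)))"
    unfolding Lam_def GQ_def[symmetric]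
   proof (rule lenses_bound[of GQ E lens])
    show "finite GQ" "GQ ~= {}" by (fact fGQ, fact ne)
    show "snd (snd g) > 0" if "g:GQ" for g using r that by (simp add: GQ_def)
    show "on_top g p & on_top g q & fst p < fst q" if "E g (p, q)" for g p q using E0 that by blast
    show "fst q <= fst p' | fst q' <= fst p" if "E g (p, q)" "E g (p', q')" "(p, q) ~= (p', q')" for g p q p' q'
     using disj0 that by blast
    show "E f om & E g om & fst (snd g) < fst (snd f)" if "lens f g om" for f g om using that by (simp add: lens_def)
    show "g = g'" if "lens f g om" "lens f g' om" for f g g' om
     using that Minj[of g om g'] unfolding lens_def by (metis linorder_neqE_linordered_idom)
    show "f = f'" if "lens f g om" "lens f' g om" for f f' g om
     using that Minj[of f om f'] unfolding lens_def by (metis linorder_neqE_linordered_idom)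
   qed
   also have "... <= 10*(2 * sqrt mu*(1+ln mu)*(rc GQ+(rc GQ)^2/mu))"
    by (rule mult_left_mono[OF lens_sum_weight[OF q1 mu(1)]]) simp
   finally show ?thesis by (simp add: cQ w_def algebra_simps)
  qed
  have lens_total: "(SUM Q:\<Q>. rc (Lam Q)) <= 20*(1+c)*(n * w)"
  proof -
   have "(SUM Q:\<Q>. card Q) <= card X" by (rule sum_card_disjoint_le[OF X(1) cells(1,2)])
   hence s1: "(SUM Q:\<Q>. rc Q) <= n" unfolding n_def X(2) by (metis of_nat_le_iff of_nat_sum)
   have "(SUM Q:\<Q>. rc Q^2) <= c*n^2/real k^3" using sq k by (simp add: field_simps)
   also have "... = c*n*(n/real k^3)" by (simp add: power2_eq_square)
   also have "... <= c*n*mu" using c1 n by (intro mult_left_mono) (auto simp: mu_def)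
   finally have s2: "(SUM Q:\<Q>. rc Q^2)/mu <= c*n" using mu by (simp add: field_simps)
   have "(SUM Q:\<Q>. rc (Lam Q)) <= (SUM Q:\<Q>. 20 * w*(rc Q+rc Q^2/mu))" by (rule sum_mono[OF cell])
   also have "... = 20 * w*((SUM Q:\<Q>. rc Q)+(SUM Q:\<Q>. rc Q^2)/mu)"
    by (simp add: sum_distrib_left[symmetric] sum.distrib sum_divide_distrib)
   also have "... <= 20 * w*(n+c*n)" using s1 s2 mu by (intro mult_left_mono add_mono) auto
   finally show ?thesis by (simp add: algebra_simps)
  qed
  have parta: "real (SUM om:R2a. card (M om)) <= (1+2*real d)*rc R+20*(1+c)*(n * w)"
  proof -
   have "(SUM om:R2a. card (M om)) <= (SUM om:R2a. 1+2*d+card (L om))" by (rule sum_mono[OF window])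
   also have "... = (SUM om:R2a. 1+2*d)+(SUM om:R2a. card (L om))" by (simp only: sum.distrib)
   also have "... <= card R*(1+2*d)+(SUM Q:\<Q>. card (Lam Q))"
    using sumL card_mono[OF finR fin2(5)] by (intro add_mono) (simp_all only: sum_constant of_nat_id mult_le_mono1)
   finally have "real (SUM om:R2a. card (M om)) <= real (card R*(1+2*d)+(SUM Q:\<Q>. card (Lam Q)))" by (simp only: of_nat_le_iff)
   also have "... = (1+2*real d)*rc R+(SUM Q:\<Q>. rc (Lam Q))" by (simp add: algebra_simps)
   finally show ?thesis using lens_total by linarith
  qed
  define kR where "kR = real k*rc R"
  define pw where "pw = rc P powr (2/3)*real k powr (1/3)*n powr (2/3)"
  have Rk: "rc R <= kR" using k by (simp add: kR_def mult_le_cancel_right1)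
  have dR: "real d*rc R = c * kR" by (simp add: dk kR_def)
  have nn: "kR >= 0" "pw >= 0" "n * w >= 0" using n mu by (auto simp: kR_def pw_def)
  have pwb: "real (2*card P) powr (2/3)*real d powr (1/3)*n powr (2/3) <= 4*c*pw"
  proof -
   have "2 powr (2/3) <= (2::real) powr 1" by (intro powr_mono) auto
   moreover have "c powr (1/3) <= c powr 1" using c1 by (intro powr_mono) auto
   ultimately have "2 powr (2/3)*c powr (1/3) <= 2*c" using c1 by (intro mult_mono) auto
   hence "2 powr (2/3)*c powr (1/3) <= 4*c" using c1 by linarith
   have "real (2*card P) powr (2/3)*real d powr (1/3)*n powr (2/3) = 2 powr (2/3)*c powr (1/3)*pw"
    using c1 by (simp add: dk powr_mult pw_def mult_ac)
   also have "... <= 4*c*pw" using \<open>_ <= 4*c\<close> nn(2) by (rule mult_right_mono)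
   finally show ?thesis .
  qed
  have pb: "real (SUM om:R2b. card (M om)) <= C'*(real (d+1)*rc R+n+4*c*pw)"
  proof (rule order_trans[OF partb])
   show "C'*(real (d+1)*rc R+n+real (2*card P) powr (2/3)*real d powr (1/3)*n powr (2/3))
    <= C'*(real (d+1)*rc R+n+4*c*pw)"
    using C'(1) pwb by (intro mult_left_mono add_left_mono) auto
  qed
  have "rc {(g, om). E g om} <= rc R+real (SUM om:R2a. card (M om))+real (SUM om:R2b. card (M om))"
   using split count by (metis of_nat_add of_nat_le_iff)
  also have "... <= rc R+((1+2*real d)*rc R+20*(1+c)*(n * w))
   + C'*(real (d+1)*rc R+n+4*c*pw)"
   using add_mono[OF parta pb] by linarith
  also have "... <= K*(kR+n+pw+n * w)"
  proof -
   have a: "rc R+(1+2*real d)*rc R <= (2+2*c) * kR"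
    using Rk dR by (simp add: algebra_simps)
   have b: "real (d+1)*rc R <= (1+c) * kR" using Rk dR by (simp add: algebra_simps)
   have cn: "0 <= c * kR" "0 <= c*n" "0 <= c*pw" "0 <= c*(n * w)" using c1 n nn by auto
   have "real (d+1)*rc R+n+4*c*pw <= (4*c+2)*(kR+n+pw+n * w)"
    using b cn nn n by (simp add: algebra_simps)
   hence "C'*(real (d+1)*rc R+n+4*c*pw) <= C'*((4*c+2)*(kR+n+pw+n * w))"
    using C'(1) by (intro mult_left_mono) auto
   moreover have "(2+2*c) * kR <= (2+2*c)*(kR+n+pw+n * w)" using c1 n nn by (intro mult_left_mono) auto
   moreover have "20*(1+c)*(n * w) <= 20*(1+c)*(kR+n+pw+n * w)" using c1 n nn by (intro mult_left_mono) auto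
   ultimately show ?thesis using a unfolding K_def by (simp add: algebra_simps)
  qed
  finally show ?thesis unfolding kR_def pw_def w_def mu_def n_def .
 qed
 note main = this
 have K: "K >= 1" using c1 C'(1) by (simp add: K_def)
 show ?thesis by (rule exI[of _ K], intro conjI K allI impI) (rule main; assumption)
qed

section \<open>Circles in the plane\<close>

lemma top_arc_between:
 assumes r: "snd (snd g) > 0" and on: "on_top g (s, top_y g s)" "on_top g (t, top_y g t)" and x: "s <= x" "x <= t"
 shows "on_top g (x, top_y g x)"
proof -
 obtain a b r where g: "g = (a, b, r)" by (metis surj_pair)
 have r0: "r > 0" using r by (simp add: g)
 have st: "2*(s - a)^2 <= r\<^sup>2" "2*(t - a)^2 <= r\<^sup>2" using on on_top_iff[OF r0] by (auto simp: g)
 have "\<bar>x - a\<bar> <= max \<bar>s - a\<bar> \<bar>t - a\<bar>" using x by linarith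
 hence "\<bar>x - a\<bar>\<^sup>2 <= (max \<bar>s - a\<bar> \<bar>t - a\<bar>)\<^sup>2" by (rule power_mono) simp
 hence "2*(x - a)^2 <= r\<^sup>2" using st by (cases "\<bar>s - a\<bar> <= \<bar>t - a\<bar>") (auto simp: max_def)
 thus ?thesis using on_top_iff[OF r0] by (simp add: g)
qed

lemma top_y_continuous:
 assumes r: "snd (snd g) > 0" and on: "on_top g (s, top_y g s)" "on_top g (t, top_y g t)"
 shows "continuous_on {s..t} (top_y g)"
proof -
 obtain a b r where g: "g = (a, b, r)" by (metis surj_pair)
 have r0: "r > 0" using r by (simp add: g)
 have "continuous_on {s..t} (%x. b+sqrt (r^2 - (x - a)\<^sup>2))" by (intro continuous_intros)
 moreover have "top_y g x = b+sqrt (r^2 - (x - a)\<^sup>2)" if "x:{s..t}" for x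
  using top_arc_between[OF assms, of x] that on_top_iff[OF r0] top_y_eq[OF r0] by (auto simp: g)
 ultimately show ?thesis using continuous_on_cong by (metis (no_types, lifting))
qed

text \<open>Edges join consecutive points of a top arc in one planar cell, and \<open>R\<close>
  consists of the pairs in a common cell. The degree \<open>D\<close> balances \<open>n D\<close>
  against \<open>k |R|\<close>, of order \<open>k m^2 / D^2\<close>; this reproduces the power term
  that comes from the lines in the dual surface.\<close>

lemma top_incidences:
 "EX K::real. K >= 1 & (ALL P G k. finite P --> finite G --> P ~= {} --> G ~= {} --> (ALL g:G. snd (snd g) > 0) --> k >= 1 -->
  real (SUM g:G. card {p:P. on_top g p}) <= K*(rc P+rc G
   + rc P powr (2/3)*real k powr (1/3)*rc G powr (2/3)
   + rc G*(sqrt (max 1 (rc G/real k^3))*(1+ln (max 1 (rc G/real k^3))))))"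
proof -
 obtain C :: nat where C: "C >= 1" "!!(X :: (real \<times> real) set) D. finite X ==> D >= 1 ==>
  EX fs \<S>. sign_cells fs X \<S> & polyf (C*D) (prodf fs) &
   cubes \<S> * real D^(2*DIM(real \<times> real)) <= real C*rc X^3"
  using polynomial_partition[where 'a = "real \<times> real"] by blast
 define c where "c = real C"
 have c1: "c >= 1" using C(1) by (simp add: c_def)
 obtain K :: real where K: "K >= 1" "!!P G (R :: ((real \<times> real) \<times> (real \<times> real)) set) E k. finite P ==> finite G ==> G ~= {} ==> (ALL g:G. snd (snd g) > 0) ==> R <= P \<times> P ==> k >= 1 ==>
  (ALL g p q. E g (p, q) --> g:G & (p, q):R & on_top g p & on_top g q & fst p < fst q) ==>
  (ALL g p q p' q'. E g (p, q) --> E g (p', q') --> (p, q) ~= (p', q') --> fst q <= fst p' | fst q' <= fst p) ==>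
  rc {(g, om). E g om} <= K*(real k*rc R+rc G
   + rc P powr (2/3)*real k powr (1/3)*rc G powr (2/3)
   + rc G*(sqrt (max 1 (rc G/real k^3))*(1+ln (max 1 (rc G/real k^3)))))"
  using edges_bound by iprover
 have main: "real (SUM g:G. card {p:P. on_top g p}) <= (7*c+K*(c+1))*(rc P+rc G
   + rc P powr (2/3)*real k powr (1/3)*rc G powr (2/3)
   + rc G*(sqrt (max 1 (rc G/real k^3))*(1+ln (max 1 (rc G/real k^3)))))"
  if P: "finite P" and G: "finite G" and ne: "P ~= {}" "G ~= {}" and r0: "ALL g:G. snd (snd g) > 0" and k: "k >= 1"
  for P G and k :: nat
 proof -
  have r: "snd (snd g) > 0" if "g:G" for g using r0 that by blast
  define n m where "n = rc G" and "m = rc P"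
  have nm: "n > 0" "m > 0" using P G ne by (auto simp: n_def m_def card_gt_0_iff)
  have k0: "real k > 0" using k by simp
  define pw where "pw = m powr (2/3)*real k powr (1/3)*n powr (2/3)"
  have pw: "n powr (2/3)*(real k*m^2) powr (1/3) = pw"
   using nm by (simp add: pw_def powr_mult powr_third_square mult_ac)
  obtain D :: nat where D: "D >= 1" "n*real D <= n+pw" "real k*m^2/real D^2 <= pw"
   using optimal_degree[of n "real k*m^2"] nm k0 unfolding pw by auto
  obtain fs \<S> where part: "sign_cells fs P \<S>" "polyf (C*D) (prodf fs)"
   "cubes \<S> * real D^(2*DIM(real \<times> real)) <= real C*rc P^3"
   using C(2)[OF P D(1)] by blast
  have sq: "(SUM S:\<S>. rc S^2)*real D^2 <= c*m^2"
   using sign_cells_squares[OF P part(1,3) C(1)] by (simp add: m_def c_def power2_eq_square)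
  have cells: "\<S> <= Pow P" using part(1) unfolding sign_cells_def by blast
  have finS: "finite \<S>" using cells P by (meson finite_Pow_iff finite_subset)
  define A where "A = (%g. {t. (t, top_y g t):P & on_top g (t, top_y g t)})"
  define cv where "cv = (%g t. (t, top_y g t))"
  have onA: "cv g t:P" "on_top g (cv g t)" if "t:A g" for g t using that by (auto simp: A_def cv_def)
  have cvA: "cv g ` A g = {p:P. on_top g p}" if "g:G" for g
  proof (intro subset_antisym subsetI)
   fix p assume "p:{p:P. on_top g p}"
   moreover obtain a b rh where "g = (a, b, rh)" by (metis surj_pair)
   moreover obtain x y where "p = (x, y)" by (metis surj_pair)
   ultimately have "p = cv g x" "x:A g" using on_top_iff[of rh a b x y] r[OF that] by (auto simp: A_def cv_def)
   thus "p:cv g ` A g" by blast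
  qed (use onA in blast)
  have injcv: "inj_on (cv g) S" for g S by (auto simp: cv_def inj_on_def)
  have cardA: "card (A g) = card {p:P. on_top g p}" if "g:G" for g
   using card_image[OF injcv, of g "A g"] cvA[OF that] by simp
  have finA: "finite (A g)" if "g:G" for g
   by (rule finite_imageD[OF _ injcv[of g "A g"]]) (use cvA[OF that] P in simp)
  define xs where "xs = (%g. sorted_list_of_set (A g))"
  have xs: "set (xs g) = A g" "length (xs g) = card (A g)" "sorted (xs g)" "distinct (xs g)" if "g:G" for g
   using finA[OF that] by (auto simp: xs_def)
  define W where "W = (%g. {i. Suc i < card (A g) & (EX S:\<S>. cv g (xs g ! i):S & cv g (xs g ! Suc i):S)})"
  have main: "(SUM g:G. card (A g)) <= card G*(2*(2*(C*D)+1)+1)+card P+(SUM g:G. card (W g))"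
   unfolding W_def xs_def
  proof (rule plane_reduction[OF P part(1,2) G finA, where crv = "%g. {p. on_circle g p}"])
   show "cv g ` A g <= P" if "g:G" for g using cvA[OF that] by auto
   show "continuous_on {a..b} (cv g) & inj_on (cv g) {a..b} & cv g ` {a..b} <= {p. on_circle g p}"
    if g: "g:G" and ab: "a:A g" "b:A g" for g a b
   proof (intro conjI injcv)
    have on: "on_top g (a, top_y g a)" "on_top g (b, top_y g b)" using ab by (auto simp: A_def)
    show "continuous_on {a..b} (cv g)" unfolding cv_def
     by (intro continuous_on_Pair continuous_on_id top_y_continuous[OF r[OF g] on])
    show "cv g ` {a..b} <= {p. on_circle g p}"
     using top_arc_between[OF r[OF g] on] by (auto simp: cv_def on_top_def)
   qed
   show "zeros_le (2*(C*D)+1) (C*D) {p. on_circle g p}" if "g:G" for g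
   proof -
    obtain a b rh where g: "g = (a, b, rh)" by (metis surj_pair)
    hence "rh > 0" using r[OF that] by simp
    thus ?thesis unfolding g circle_on_circ[OF \<open>rh > 0\<close>] by (intro zeros_le_circ)
   qed
   show "g = g'" if f: "polyf (C*D) f" and v: "EX v. dd f v p ~= 0" and g: "g:G" "g':G"
    and p: "p:{p. on_circle g p}" "p:{p. on_circle g' p}"
    and z: "ALL y:{p. on_circle g p}. f y = 0" "ALL y:{p. on_circle g' p}. f y = 0" for f p g g'
   proof -
    obtain a b rh a' b' rh' where gg: "g = (a, b, rh)" "g' = (a', b', rh')" by (metis surj_pair)
    show ?thesis unfolding gg
     by (rule planar_circle_unique[OF f v]) (use r[OF g(1)] r[OF g(2)] p z in \<open>auto simp: gg\<close>)
   qed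
  qed
  define E where "E = (%g om. g:G & (EX i:W g. om = (cv g (xs g ! i), cv g (xs g ! Suc i))))"
  define R where "R = (UN S:\<S>. S \<times> S)"
  have W: "xs g ! i:A g" "xs g ! Suc i:A g" "xs g ! i < xs g ! Suc i" "i < length (xs g)" "Suc i < length (xs g)"
   if g: "g:G" and i: "i:W g" for g i
  proof -
   show l: "i < length (xs g)" "Suc i < length (xs g)" using i xs(2)[OF g] by (auto simp: W_def)
   thus "xs g ! i:A g" "xs g ! Suc i:A g" using xs(1)[OF g] nth_mem by blast+
   show "xs g ! i < xs g ! Suc i"
    using sorted_wrt_nth_less[of "(<)" "xs g" i "Suc i"] xs(3,4)[OF g] l by (simp add: strict_sorted_iff)
  qed
  have RP: "R <= P \<times> P" using cells by (auto simp: R_def)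
  have E1: "g:G" "(p, q):R" "on_top g p" "on_top g q" "fst p < fst q" if e: "E g (p, q)" for g p q
  proof -
   obtain i where i: "g:G" "i:W g" "p = cv g (xs g ! i)" "q = cv g (xs g ! Suc i)" using e by (auto simp: E_def)
   show "g:G" by (rule i)
   show "on_top g p" "on_top g q" using onA(2) W(1,2)[OF i(1,2)] i(3,4) by auto
   show "fst p < fst q" using W(3)[OF i(1,2)] i(3,4) by (simp add: cv_def)
   show "(p, q):R" using i(2) unfolding R_def W_def i(3,4) by blast
  qed
  have E2: "fst q <= fst p' | fst q' <= fst p" if e: "E g (p, q)" "E g (p', q')" "(p, q) ~= (p', q')" for g p q p' q'
  proof -
   obtain i where i: "g:G" "i:W g" "p = cv g (xs g ! i)" "q = cv g (xs g ! Suc i)" using e(1) by (auto simp: E_def)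
   obtain j where j: "j:W g" "p' = cv g (xs g ! j)" "q' = cv g (xs g ! Suc j)" using e(2) by (auto simp: E_def)
   have "i ~= j" using e(3) i j by auto
   then consider "Suc i <= j" | "Suc j <= i" by linarith
   thus ?thesis
   proof cases
    case 1
    hence "xs g ! Suc i <= xs g ! j" using sorted_nth_mono[OF xs(3)[OF i(1)] 1] W(4)[OF i(1) j(1)] by simp
    thus ?thesis by (simp add: i j cv_def)
   next
    case 2
    hence "xs g ! Suc j <= xs g ! i" using sorted_nth_mono[OF xs(3)[OF i(1)] 2] W(4)[OF i(1,2)] by simp
    thus ?thesis by (simp add: i j cv_def)
   qed
  qed
  have finW: "finite (W g)" for g by (rule finite_subset[of _ "{..<card (A g)}"]) (auto simp: W_def)
  have countW: "(SUM g:G. card (W g)) <= card {(g, om). E g om}"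
  proof -
   have "(SUM g:G. card (W g)) = card (SIGMA g:G. W g)" using G finW by simp
   also have "... <= card {(g, om). E g om}"
   proof (rule card_inj_on_le[where f = "%(g, i). (g, (cv g (xs g ! i), cv g (xs g ! Suc i)))"])
    show "inj_on (%(g, i). (g, (cv g (xs g ! i), cv g (xs g ! Suc i)))) (SIGMA g:G. W g)"
    proof (rule inj_onI)
     fix x y assume x: "x:(SIGMA g:G. W g)" and y: "y:(SIGMA g:G. W g)"
      and eq: "(case x of (g, i) => (g, (cv g (xs g ! i), cv g (xs g ! Suc i)))) = (case y of (g, i) => (g, (cv g (xs g ! i), cv g (xs g ! Suc i))))"
     obtain g i g' j where xy: "x = (g, i)" "y = (g', j)" by (metis surj_pair)
     have g: "g:G" "g' = g" "i:W g" "j:W g" using x y eq by (auto simp: xy)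
     have "xs g ! i = xs g ! j" using eq g(2) by (simp add: xy cv_def)
     hence "i = j" using nth_eq_iff_index_eq[OF xs(4)[OF g(1)] W(4)[OF g(1,3)] W(4)[OF g(1,4)]] by simp
     thus "x = y" using g(2) by (simp add: xy)
    qed
    show "(%(g, i). (g, (cv g (xs g ! i), cv g (xs g ! Suc i)))) ` (SIGMA g:G. W g) <= {(g, om). E g om}"
     by (auto simp: E_def)
    show "finite {(g, om). E g om}"
    proof (rule finite_subset)
     show "{(g, om). E g om} <= G \<times> (P \<times> P)"
     proof
      fix x assume "x:{(g, om). E g om}"
      then obtain g p q where "x = (g, (p, q))" "E g (p, q)" by auto
      thus "x:G \<times> (P \<times> P)" using E1(1,2) RP by blast
     qed
     show "finite (G \<times> (P \<times> P))" using G P by simp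
    qed
   qed
   finally show ?thesis .
  qed
  have cardR: "real k*rc R <= c*pw"
  proof -
   have "card R <= (SUM S:\<S>. card (S \<times> S))" unfolding R_def by (rule card_UN_le[OF finS])
   hence "rc R <= (SUM S:\<S>. rc (S \<times> S))" unfolding of_nat_sum[symmetric] of_nat_le_iff .
   also have "... = (SUM S:\<S>. rc S^2)" by (simp add: card_cartesian_product power2_eq_square)
   also have "... <= c*m^2/real D^2" using sq D(1) by (simp add: field_simps)
   finally have "real k*rc R <= real k*(c*m^2/real D^2)" using k0 by (intro mult_left_mono) auto
   also have "... = c*(real k*m^2/real D^2)" by simp
   also have "... <= c*pw" using D(3) c1 by (intro mult_left_mono) auto
   finally show ?thesis .
  qed
  define w where "w = n*(sqrt (max 1 (n/real k^3))*(1+ln (max 1 (n/real k^3))))"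
  have w: "w >= 0" using nm by (simp add: w_def)
  have pw0: "pw >= 0" by (simp add: pw_def)
  have edges: "rc {(g, om). E g om} <= K*(real k*rc R+n+pw+w)"
   unfolding pw_def w_def n_def m_def
  proof (rule K(2)[OF P G ne(2) r0 RP k])
   show "ALL g p q. E g (p, q) --> g:G & (p, q):R & on_top g p & on_top g q & fst p < fst q" using E1 by blast
   show "ALL g p q p' q'. E g (p, q) --> E g (p', q') --> (p, q) ~= (p', q') --> fst q <= fst p' | fst q' <= fst p"
    using E2 by blast
  qed
  have "real (SUM g:G. card {p:P. on_top g p}) = real (SUM g:G. card (A g))" using cardA by simp
  also have "... <= real (card G*(2*(2*(C*D)+1)+1)+card P+card {(g, om). E g om})"
   unfolding of_nat_le_iff using main countW by simp
  also have "... = 4*c*(n*real D)+3*n+m+rc {(g, om). E g om}"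
   by (simp add: c_def n_def m_def algebra_simps)
  also have "... <= 4*c*(n+pw)+3*n+m+K*(c*pw+n+pw+w)"
  proof -
   have "4*c*(n*real D) <= 4*c*(n+pw)" using D(2) c1 by (intro mult_left_mono) auto
   moreover have "K*(real k*rc R+n+pw+w) <= K*(c*pw+n+pw+w)"
    using cardR K(1) by (intro mult_left_mono add_mono) auto
   ultimately show ?thesis using edges by linarith
  qed
  also have "... <= (7*c+K*(c+1))*(m+n+pw+w)"
  proof -
   have "4*c*(n+pw)+3*n+m <= 7*c*(m+n+pw+w)"
   proof -
    have "3*n <= 3*c*n" "m <= c*m" using c1 nm by auto
    moreover have "0 <= c*m" "0 <= c*pw" "0 <= c * w" "0 <= c*n" using c1 nm pw0 w by auto
    ultimately show ?thesis by (simp add: algebra_simps)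
   qed
   moreover have "K*(c*pw+n+pw+w) <= K*((c+1)*(m+n+pw+w))"
   proof (rule mult_left_mono)
    have "0 <= c*m" "0 <= c*n" "0 <= c * w" using c1 nm w by auto
    thus "c*pw+n+pw+w <= (c+1)*(m+n+pw+w)" using nm by (simp add: algebra_simps)
   qed (use K(1) in simp)
   ultimately show ?thesis by (simp add: algebra_simps)
  qed
  finally show ?thesis unfolding pw_def w_def n_def m_def .
 qed
 have K': "7*c+K*(c+1) >= 1" using c1 K(1) by (intro add_increasing2) auto
 show ?thesis by (rule exI[of _ "7*c+K*(c+1)"], intro conjI K' allI impI) (rule main; assumption)
qed

text \<open>The degree of the dual partition balances the two terms of the bound above.\<close>

lemma planar_degree:
 fixes m n :: real
 assumes mn: "m >= 1" "n >= 1"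
 defines "L \<equiv> max 1 (ln (m^3/n))"
 shows "EX k::nat. k >= 1 & m powr (2/3)*real k powr (1/3)*n powr (2/3)+n*(sqrt (max 1 (n/real k^3))*(1+ln (max 1 (n/real k^3))))
  <= 4*(m powr (2/3)*n powr (2/3)+m powr (6/11)*n powr (9/11)*L powr (2/11)+n)"
proof -
 define a b l where "a = ln m" and "b = ln n" and "l = ln L"
 have L: "L >= 1" "3*a - b <= L" using mn by (auto simp: L_def a_def b_def ln_div ln_realpow)
 have ab: "a >= 0" "b >= 0" "l >= 0" using mn L by (auto simp: a_def b_def l_def)
 have e: "m = exp a" "n = exp b" "L = exp l" using mn L by (auto simp: a_def b_def l_def)
 \<comment> \<open>The real balance point \<open>n^(5/11) m^(-4/11) L^(6/11)\<close>: it makes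
   \<open>m^(2/3) k^(1/3) n^(2/3)\<close> equal to \<open>n (n / k^3)^(1/2) L\<close>, and the
   common value is \<open>M2\<close>. In exponential form the comparisons are linear.\<close>
 define ka where "ka = exp ((5*b - 4*a+6*l)/11)"
 define M1 M2 where "M1 = m powr (2/3)*n powr (2/3)" and "M2 = m powr (6/11)*n powr (9/11)*L powr (2/11)"
 have M1: "M1 = exp (2/3*(a+b))" unfolding M1_def e by (simp add: powr_def exp_add[symmetric] algebra_simps)
 have M2: "M2 = exp ((6*a+9*b+2*l)/11)" unfolding M2_def e by (simp add: powr_def exp_add[symmetric] field_simps)
 have M0: "M1 > 0" "M2 > 0" by (simp_all add: M1 M2)
 have sqrt_exp: "sqrt (exp x) = exp (x/2)" for x :: real
  by (rule real_sqrt_unique) (simp_all add: exp_double[symmetric] power2_eq_square exp_add[symmetric])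
 show ?thesis
 proof (cases "5*b - 4*a+6*l <= 0")
  case True
  \<comment> \<open>The balance point is at most 1, so \<open>k = 1\<close> is taken. Then
    \<open>n\<close> is small against \<open>m\<close> and \<open>ln n\<close> is covered by
    \<open>L\<close>.\<close>
  have "b <= 3*a - b" using True ab by linarith
  hence bL: "1+ln n <= 2*L" using L by (simp add: b_def)
  have "n * sqrt n*L = exp (b+b/2+l)" unfolding e by (simp only: sqrt_exp exp_add)
  also have "... <= M1" unfolding M1 using True by simp
  finally have "n * sqrt n*L <= M1" .
  moreover have "n*(sqrt n*(1+ln n)) <= n*(sqrt n*(2*L))" using bL mn by (intro mult_left_mono) auto
  ultimately have "n*(sqrt n*(1+ln n)) <= 2*M1" by simp
  hence "m powr (2/3)*real 1 powr (1/3)*n powr (2/3)+n*(sqrt (max 1 (n/real 1^3))*(1+ln (max 1 (n/real 1^3)))) <= 4*(M1+M2+n)"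
   using mn M0 by (simp add: M1_def[symmetric] max_def)
  thus ?thesis unfolding M1_def M2_def by (intro exI[of _ 1]) simp
 next
  case False
  hence k1: "ka > 1" by (simp add: ka_def)
  define k where "k = nat \<lceil>ka\<rceil>"
  have k: "ka <= real k" "real k <= 2 * ka" "k >= 1" using k1 unfolding k_def by linarith+
  have "real k powr (1/3) <= (2 * ka) powr (1/3)" using k by (intro powr_mono2) auto
  also have "... = 2 powr (1/3) * ka powr (1/3)" using k1 by (simp add: powr_mult)
  also have "... <= 2 * ka powr (1/3)"
  proof -
   have "2 powr (1/3) <= (2::real) powr 1" by (intro powr_mono) auto
   thus ?thesis using mult_right_mono[of "2 powr (1/3)" 2 "ka powr (1/3)"] by simp
  qed
  finally have "M1*real k powr (1/3) <= M1*(2 * ka powr (1/3))" using M0 by (intro mult_left_mono) auto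
  also have "... = 2*(M1 * ka powr (1/3))" by simp
  also have "M1 * ka powr (1/3) = M2" unfolding M1 M2 ka_def by (simp add: powr_def exp_add[symmetric] field_simps)
  finally have t1: "m powr (2/3)*real k powr (1/3)*n powr (2/3) <= 2*M2" by (simp add: M1_def mult_ac)
  define nu where "nu = max 1 (n/real k^3)"
  have t2: "n*(sqrt nu*(1+ln nu)) <= 2*M2+n"
  proof (cases "nu = 1")
   case True thus ?thesis using M0 by simp
  next
   case False
   hence "1 < n/real k^3" unfolding nu_def by (metis max.absorb1 not_le)
   hence v1: "nu > 1" "nu = n/real k^3" unfolding nu_def by linarith+
   have "nu <= n/ka^3" unfolding v1(2) using k k1 mn by (intro divide_left_mono power_mono mult_pos_pos zero_less_power) auto
   also have "... = exp ((12*a - 4*b - 18*l)/11)"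
   proof -
    have "ka^3 = exp (3*((5*b - 4*a+6*l)/11))" unfolding ka_def by (metis exp_of_nat_mult of_nat_numeral)
    thus ?thesis unfolding e by (simp add: exp_diff[symmetric] field_simps)
   qed
   finally have v: "nu <= exp ((12*a - 4*b - 18*l)/11)" .
   have "ln nu <= ln (exp ((12*a - 4*b - 18*l)/11))" using v v1 by (subst ln_le_cancel_iff) auto
   hence "ln nu <= (12*a - 4*b - 18*l)/11" by simp
   \<comment> \<open>Origin of the quotient in the logarithm: \<open>nu\<close> is at most the power
     4/11 of \<open>m^3 / n\<close>.\<close>
   also have "12*a - 4*b - 18*l <= 4*L" using L ab by linarith
   finally have "ln nu <= 4*L/11" by simp
   hence "1+ln nu <= 2*L" using L by linarith
   moreover have "sqrt nu <= exp ((12*a - 4*b - 18*l)/11/2)" using v by (metis real_sqrt_le_mono sqrt_exp)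
   ultimately have "sqrt nu*(1+ln nu) <= exp ((12*a - 4*b - 18*l)/11/2)*(2*L)" using v1 by (intro mult_mono) auto
   hence "n*(sqrt nu*(1+ln nu)) <= n*(exp ((12*a - 4*b - 18*l)/11/2)*(2*L))" using mn by (intro mult_left_mono) auto
   also have "... = 2*(exp b*exp ((12*a - 4*b - 18*l)/11/2)*exp l)" unfolding e by simp
   also have "exp b*exp ((12*a - 4*b - 18*l)/11/2)*exp l = M2" unfolding M2 exp_add[symmetric] by (simp add: field_simps)
   finally show ?thesis using mn by simp
  qed
  show ?thesis unfolding M1_def[symmetric] M2_def[symmetric]
  proof (intro exI[of _ k] conjI k(3))
   show "m powr (2/3)*real k powr (1/3)*n powr (2/3)+n*(sqrt (max 1 (n/real k^3))*(1+ln (max 1 (n/real k^3))))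
    <= 4*(M1+M2+n)" by (rule order_trans[OF add_mono[OF t1 t2[unfolded nu_def]]]) (use M0 mn in simp)
  qed
 qed
qed

definition planar_bound :: "real => real => real" where
 "planar_bound m n = m powr (2/3)*n powr (2/3)+m powr (6/11)*n powr (9/11)*max 1 (ln (m^3/n)) powr (2/11)+m+n"

lemma five_times_bound:
 fixes m n :: real
 assumes "T+W <= 4*(U+V+n)" "0 <= U" "0 <= V" "0 <= m" "0 <= n"
 shows "m+n+T+W <= 5*(U+V+m+n)"
 using assms by (simp add: algebra_simps)

text \<open>A circle is the union of four quarter arcs, and rotations by multiples of a right angle
  carry each of them to a top arc; hence four copies of the bound.\<close>

theorem planar_incidences:
 "EX K::real. K >= 1 & (ALL P G. finite P --> finite G --> (ALL g:G. snd (snd g) > 0) -->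
  real (SUM g:G. card {p:P. on_circle g p}) <= K*planar_bound (rc P) (rc G))"
proof -
 obtain K :: real where K: "K >= 1" "!!P G k. finite P ==> finite G ==> P ~= {} ==> G ~= {} ==> (ALL g:G. snd (snd g) > 0) ==> k >= 1 ==>
  real (SUM g:G. card {p:P. on_top g p}) <= K*(rc P+rc G
   + rc P powr (2/3)*real k powr (1/3)*rc G powr (2/3)
   + rc G*(sqrt (max 1 (rc G/real k^3))*(1+ln (max 1 (rc G/real k^3)))))"
  using top_incidences by iprover
 have top: "real (SUM g:G. card {p:P. on_top g p}) <= 5*K*planar_bound (rc P) (rc G)"
  if fin: "finite P" "finite G" and r: "ALL g:G. snd (snd g) > 0" and ne: "P ~= {}" "G ~= {}" for P G
 proof -
  define m n where "m = rc P" and "n = rc G"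
  have mn: "m >= 1" "n >= 1" using fin ne by (auto simp: m_def n_def Suc_le_eq card_gt_0_iff)
  obtain k :: nat where k: "k >= 1" "m powr (2/3)*real k powr (1/3)*n powr (2/3)+n*(sqrt (max 1 (n/real k^3))*(1+ln (max 1 (n/real k^3))))
   <= 4*(m powr (2/3)*n powr (2/3)+m powr (6/11)*n powr (9/11)*max 1 (ln (m^3/n)) powr (2/11)+n)"
   using planar_degree[OF mn] by blast
  have "real (SUM g:G. card {p:P. on_top g p}) <= K*(m+n
   + m powr (2/3)*real k powr (1/3)*n powr (2/3)+n*(sqrt (max 1 (n/real k^3))*(1+ln (max 1 (n/real k^3)))))"
   unfolding m_def n_def by (rule K(2)[OF fin ne r k(1)])
  also have "... <= K*(5*planar_bound m n)"
  proof (rule mult_left_mono)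
   show "m+n+m powr (2/3)*real k powr (1/3)*n powr (2/3)+n*(sqrt (max 1 (n/real k^3))*(1+ln (max 1 (n/real k^3))))
    <= 5*planar_bound m n" unfolding planar_bound_def by (rule five_times_bound[OF k(2)]) (use mn in auto)
  qed (use K(1) in simp)
  finally show ?thesis unfolding m_def n_def by simp
 qed
 have moved: "real (SUM g:G. card {p:P. on_top (ps g) (ph p)}) <= 5*K*planar_bound (rc P) (rc G)"
  if fin: "finite P" "finite G" and r: "ALL g:G. snd (snd g) > 0" and ne: "P ~= {}" "G ~= {}"
   and inj: "inj ph" "inj ps" and rr: "!!g. snd (snd (ps g)) = snd (snd g)" for P G ph ps
 proof -
  have i: "inj_on ph P" "inj_on ps G" using inj by (auto intro: inj_on_subset)
  have "real (SUM g:ps ` G. card {p:ph ` P. on_top g p}) <= 5*K*planar_bound (rc (ph ` P)) (rc (ps ` G))"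
   using fin r ne rr by (intro top) auto
  moreover have "card {p:ph ` P. on_top g p} = card {p:P. on_top g (ph p)}" for g
  proof -
   have "{p:ph ` P. on_top g p} = ph ` {p:P. on_top g (ph p)}" by auto
   thus ?thesis by (simp add: card_image inj_on_subset[OF inj(1)])
  qed
  ultimately show ?thesis by (simp add: sum.reindex[OF i(2)] card_image[OF i(1)] card_image[OF i(2)])
 qed
 define ph1 ph2 ph3 where "ph1 = (%p :: real \<times> real. (- snd p, fst p))" and "ph2 = (%p :: real \<times> real. (- fst p, - snd p))"
  and "ph3 = (%p :: real \<times> real. (snd p, - fst p))"
 define ps1 ps2 ps3 where "ps1 = (%g :: real \<times> real \<times> real. (- fst (snd g), fst g, snd (snd g)))"
  and "ps2 = (%g :: real \<times> real \<times> real. (- fst g, - fst (snd g), snd (snd g)))"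
  and "ps3 = (%g :: real \<times> real \<times> real. (fst (snd g), - fst g, snd (snd g)))"
 have inj: "inj ph1" "inj ph2" "inj ph3" "inj ps1" "inj ps2" "inj ps3"
  by (auto simp: inj_def ph1_def ph2_def ph3_def ps1_def ps2_def ps3_def)
 have cover: "on_top g p | on_top (ps1 g) (ph1 p) | on_top (ps2 g) (ph2 p) | on_top (ps3 g) (ph3 p)" if on: "on_circle g p" for g p
 proof -
  obtain a b rh where g: "g = (a, b, rh)" by (metis surj_pair)
  obtain x y where p: "p = (x, y)" by (metis surj_pair)
  have e: "(x - a)^2+(y - b)^2 = rh^2" using on by (simp add: g p on_circle_def)
  have "(- y - - b)^2+(x - a)^2 = rh^2" "(- x - - a)^2+(- y - - b)^2 = rh^2" "(y - b)^2+(- x - - a)^2 = rh^2"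
   using e by (simp_all add: power2_eq_square algebra_simps)
  moreover have "\<bar>x - a\<bar> <= y - b | \<bar>- y - - b\<bar> <= x - a | \<bar>- x - - a\<bar> <= - y - - b | \<bar>y - b\<bar> <= - x - - a" by linarith
  ultimately show ?thesis using e
   unfolding on_top_def on_circle_def g p ph1_def ph2_def ph3_def ps1_def ps2_def ps3_def prod.case fst_conv snd_conv by blast
 qed
 have main: "real (SUM g:G. card {p:P. on_circle g p}) <= 20*K*planar_bound (rc P) (rc G)"
  if fin: "finite P" "finite G" and r: "ALL g:G. snd (snd g) > 0" for P G
 proof (cases "P = {} | G = {}")
  case True
  hence "(SUM g:G. card {p:P. on_circle g p}) = 0" by auto
  moreover have "0 <= planar_bound (rc P) (rc G)" unfolding planar_bound_def by (intro add_nonneg_nonneg mult_nonneg_nonneg) auto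
  ultimately show ?thesis using K(1) by simp
 next
  case False
  hence ne: "P ~= {}" "G ~= {}" by auto
  define S where "S = (%ph ps. SUM g:G. card {p:P. on_top (ps g) (ph p)})"
  have "(SUM g:G. card {p:P. on_circle g p}) <= (SUM g:G. card {p:P. on_top g p} + card {p:P. on_top (ps1 g) (ph1 p)}
   + card {p:P. on_top (ps2 g) (ph2 p)} + card {p:P. on_top (ps3 g) (ph3 p)})"
  proof (rule sum_mono)
   fix g assume "g:G"
   have "card {p:P. on_circle g p} <= card ((({p:P. on_top g p} \<union> {p:P. on_top (ps1 g) (ph1 p)})
    \<union> {p:P. on_top (ps2 g) (ph2 p)}) \<union> {p:P. on_top (ps3 g) (ph3 p)})"
    by (rule card_mono) (use fin(1) in simp, use cover in blast)
   also have "... <= card {p:P. on_top g p} + card {p:P. on_top (ps1 g) (ph1 p)}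
    + card {p:P. on_top (ps2 g) (ph2 p)} + card {p:P. on_top (ps3 g) (ph3 p)}"
    by (intro order_trans[OF card_Un_le] add_mono order_refl)
   finally show "card {p:P. on_circle g p} <= card {p:P. on_top g p} + card {p:P. on_top (ps1 g) (ph1 p)}
    + card {p:P. on_top (ps2 g) (ph2 p)} + card {p:P. on_top (ps3 g) (ph3 p)}" .
  qed
  also have "... = S (%p. p) (%g. g)+S ph1 ps1+S ph2 ps2+S ph3 ps3" unfolding S_def by (simp only: sum.distrib)
  finally have "real (SUM g:G. card {p:P. on_circle g p}) <= real (S (%p. p) (%g. g)+S ph1 ps1+S ph2 ps2+S ph3 ps3)"
   by (simp only: of_nat_le_iff)
  also have "... = real (S (%p. p) (%g. g))+real (S ph1 ps1)+real (S ph2 ps2)+real (S ph3 ps3)" by simp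
  finally have 1: "real (SUM g:G. card {p:P. on_circle g p}) <= real (S (%p. p) (%g. g))+real (S ph1 ps1)+real (S ph2 ps2)+real (S ph3 ps3)" .
  have "real (S (%p. p) (%g. g)) <= 5*K*planar_bound (rc P) (rc G)"
   unfolding S_def by (rule top[OF fin r ne])
  moreover have "real (S ph1 ps1) <= 5*K*planar_bound (rc P) (rc G)"
   unfolding S_def by (rule moved[OF fin r ne inj(1,4)]) (simp add: ps1_def)
  moreover have "real (S ph2 ps2) <= 5*K*planar_bound (rc P) (rc G)"
   unfolding S_def by (rule moved[OF fin r ne inj(2,5)]) (simp add: ps2_def)
  moreover have "real (S ph3 ps3) <= 5*K*planar_bound (rc P) (rc G)"
   unfolding S_def by (rule moved[OF fin r ne inj(3,6)]) (simp add: ps3_def)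
  ultimately show ?thesis using 1 by linarith
 qed
 have K': "20*K >= 1" using K(1) by simp
 show ?thesis by (rule exI[of _ "20*K"], intro conjI K' allI impI) (rule main; assumption)
qed

section \<open>Circles through a point of a surface\<close>

lemma orthonormal_expansion:
 fixes n e1 :: "real^3"
 assumes "norm n = 1" "norm e1 = 1" "n\<bullet>e1 = 0"
 shows "y = (y\<bullet>e1) *\<^sub>R e1+(y\<bullet>cross3 n e1) *\<^sub>R cross3 n e1+(y\<bullet>n) *\<^sub>R n"
  and "cross3 n e1\<bullet>cross3 n e1 = 1" "e1\<bullet>e1 = 1" "n\<bullet>n = 1" "cross3 n e1\<bullet>e1 = 0" "cross3 n e1\<bullet>n = 0"
proof -
 define e2 where "e2 = cross3 n e1"
 have o: "e1\<bullet>e1 = 1" "n\<bullet>n = 1" using assms by (simp_all add: norm_eq_sqrt_inner)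
 have e2: "e2\<bullet>e2 = 1" "e2\<bullet>e1 = 0" "e2\<bullet>n = 0"
  using o assms(3) by (simp_all add: e2_def dot_cross dot_cross_self inner_commute)
 thus "cross3 n e1\<bullet>cross3 n e1 = 1" "e1\<bullet>e1 = 1" "n\<bullet>n = 1" "cross3 n e1\<bullet>e1 = 0" "cross3 n e1\<bullet>n = 0"
  using o by (simp_all add: e2_def)
 have c: "cross3 e1 e2 = n" using o assms(3) by (simp add: e2_def Lagrange inner_commute)
 obtain al be where "y = al *\<^sub>R e1+be *\<^sub>R e2+(y\<bullet>n) *\<^sub>R n"
  using cross3_basis[of e1 e2 y] o(2) unfolding c by (metis scaleR_one)
 note y = this
 have "y\<bullet>e1 = al"
  using arg_cong[OF y, of "%w. w\<bullet>e1"] o e2 assms(3) by (simp add: inner_add_left)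
 moreover have "y\<bullet>e2 = be"
  using arg_cong[OF y, of "%w. w\<bullet>e2"] o e2 by (simp add: inner_add_left inner_commute[of e1 e2] inner_commute[of n e2])
 ultimately show "y = (y\<bullet>e1) *\<^sub>R e1+(y\<bullet>cross3 n e1) *\<^sub>R cross3 n e1+(y\<bullet>n) *\<^sub>R n"
  using y unfolding e2_def by simp
qed

lemma unit_perp_exists:
 fixes n :: "real^3"
 obtains e where "norm e = 1" "n\<bullet>e = 0"
proof (cases "n = 0")
 case True
 thus ?thesis using that[of "axis 1 1"] by simp
next
 case False
 obtain u where u: "cross3 n u ~= 0"
 proof (cases "n $ 1 = 0 & n $ 2 = 0")
  case True
  hence "n $ 3 ~= 0" using False by (auto simp: vec_eq_iff forall_3)
  hence "cross3 n (axis 1 1) ~= 0" by (auto simp: cross3_def vec_eq_iff forall_3 axis_def)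
  thus ?thesis by (rule that)
 next
  case False
  hence "cross3 n (axis 3 1) ~= 0" by (auto simp: cross3_def vec_eq_iff forall_3 axis_def)
  thus ?thesis by (rule that)
 qed
 show ?thesis
 proof (rule that)
  show "norm ((1/norm (cross3 n u)) *\<^sub>R cross3 n u) = 1" using u by simp
  show "n\<bullet>(1/norm (cross3 n u)) *\<^sub>R cross3 n u = 0" by (simp add: dot_cross_self)
 qed
qed

lemma is_circleE:
 assumes "is_circle ga"
 obtains c u r where "norm u = 1" "r > 0" "ga = {x. dist x c = r & u\<bullet>(x - c) = 0}"
proof -
 obtain c u r where c: "u ~= 0" "r > 0" "ga = {x. dist x c = r & u\<bullet>(x - c) = 0}" using assms unfolding is_circle_def by blast
 show ?thesis by (rule that[of "(1/norm u) *\<^sub>R u" r c]) (use c in auto)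
qed

lemma circle_is_circ:
 fixes u e :: "real^3"
 assumes u: "norm u = 1" and e: "norm e = r" "r > 0" "u\<bullet>e = 0"
 shows "{x. dist x c = r & u\<bullet>(x - c) = 0} = circ c e (cross3 u e)"
proof -
 define e1 where "e1 = (1/r) *\<^sub>R e"
 have e1: "norm e1 = 1" "u\<bullet>e1 = 0" "e = r *\<^sub>R e1" "cross3 u e = r *\<^sub>R cross3 u e1"
  using e by (simp_all add: e1_def cross_mult_right)
 note ex = orthonormal_expansion[OF u e1(1,2)]
 have comm: "e1\<bullet>cross3 u e1 = 0" "u\<bullet>cross3 u e1 = 0" using ex(5,6) by (simp_all add: inner_commute)
 show ?thesis
 proof (intro subset_antisym subsetI)
  fix x assume "x:{x. dist x c = r & u\<bullet>(x - c) = 0}"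
  hence x: "dist x c = r" "u\<bullet>(x - c) = 0" by auto
  define y where "y = x - c"
  define s t where "s = (y\<bullet>e1)/r" "t = (y\<bullet>cross3 u e1)/r"
  have y: "y = (r * s) *\<^sub>R e1+(r*t) *\<^sub>R cross3 u e1"
   using ex(1)[of y] x e(2) by (simp add: y_def s_t_def inner_commute)
  have "y\<bullet>y = r^2" using x by (metis dist_norm power2_norm_eq_inner y_def)
  moreover have "y\<bullet>y = (r * s)^2+(r*t)^2"
   unfolding y using ex(2,3,5) comm by (simp add: inner_add_left inner_add_right power2_eq_square)
  ultimately have "r^2*(s^2+t^2) = r^2*1" by (simp add: power_mult_distrib algebra_simps)
  hence "s^2+t^2 = 1" using e(2) by (subst (asm) mult_cancel_left) simp
  moreover have "x = c+s *\<^sub>R e+t *\<^sub>R cross3 u e" using y by (simp add: e1(3) cross_mult_right y_def algebra_simps)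
  ultimately show "x:circ c e (cross3 u e)" unfolding circ_def by blast
 next
  fix x assume "x:circ c e (cross3 u e)"
  then obtain s t where x: "x = c+s *\<^sub>R e+t *\<^sub>R cross3 u e" "s^2+t^2 = 1" unfolding circ_def by blast
  define y where "y = x - c"
  have y: "y = (r * s) *\<^sub>R e1+(r*t) *\<^sub>R cross3 u e1" by (simp add: y_def x(1) e1(3) cross_mult_right mult.commute)
  have "y\<bullet>y = (r * s)^2+(r*t)^2"
   unfolding y using ex(2,3,5) comm by (simp add: inner_add_left inner_add_right power2_eq_square)
  also have "... = r^2*(s^2+t^2)" by (simp add: power_mult_distrib algebra_simps)
  finally have "norm y = r" using e(2) x(2) by (simp add: norm_eq_sqrt_inner)
  moreover have "u\<bullet>y = 0" unfolding y using e1(2) comm by (simp add: inner_add_right)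
  ultimately show "x:{x. dist x c = r & u\<bullet>(x - c) = 0}" by (simp add: y_def dist_norm)
 qed
qed

text \<open>The Hessian form is proportional to the squared length on tangent vectors.
  Cross-multiplied, this is a polynomial equation in \<open>x\<close> for every fixed
  \<open>z\<close> and \<open>w\<close>.\<close>

definition umbilic_at :: "(real^3 => real) => real^3 => bool" where
 "umbilic_at f x \<longleftrightarrow> (ALL z w. quad f x (cross3 (grad f x) z)*(cross3 (grad f x) w\<bullet>cross3 (grad f x) w)
   = quad f x (cross3 (grad f x) w)*(cross3 (grad f x) z\<bullet>cross3 (grad f x) z))"

text \<open>Families of functions depending polynomially, with degree \<open>k\<close>, on a parameter in the plane.\<close>

inductive pfam :: "nat => nat => (real \<times> real => real^3 => real) => bool" for d where
 pfam_base: "polyf k c ==> polyf d g ==> pfam d k (%v x. c v * g x)"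
| pfam_add: "pfam d k g ==> pfam d k h ==> pfam d k (%v x. g v x+h v x)"

lemma pfam_const: "polyf d f ==> pfam d 0 (%v. f)"
 using pfam_base[OF polyf_const[of 0 1], of d f] by simp

lemma pfam_polyf: "pfam d k g ==> polyf d (g v)"
 by (induction rule: pfam.induct) (auto intro: polyf_cmult polyf_add)

lemma pfam_param: "pfam d k g ==> polyf k (%v. g v x)"
proof (induction rule: pfam.induct)
 case (pfam_base k c g)
 thus ?case using polyf_mult[OF pfam_base(1) polyf_const[of 0 "g x"]] by simp
qed (auto intro: polyf_add)

lemma pfam_dd: "pfam d k g ==> pfam d k (%v. dd (g v) w)"
proof (induction rule: pfam.induct)
 case (pfam_base k c g)
 thus ?case by (simp add: dd_cmult pfam.pfam_base polyf_dd)
next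
 case (pfam_add k g h)
 thus ?case by (simp add: dd_add[OF pfam_polyf pfam_polyf] pfam.pfam_add)
qed

text \<open>The direction is linear in the parameter and constant in \<open>x\<close>: the parameter
  degree rises by one, and no derivative of the direction appears.\<close>

lemma pfam_dd_direction:
 assumes "!!v. b v = l1 v *\<^sub>R w1+l2 v *\<^sub>R w2" "polyf 1 l1" "polyf 1 l2"
 shows "pfam d k g ==> pfam d (Suc k) (%v. dd (g v) (b v))"
proof (induction rule: pfam.induct)
 case (pfam_base k c g)
 have "pfam d (k+1) (%v x. (c v * l1 v)*dd g w1 x+(c v * l2 v)*dd g w2 x)"
  using pfam_base assms(2,3) by (intro pfam.intros polyf_mult polyf_dd)
 moreover have "dd (%x. c v * g x) (b v) = (%x. (c v * l1 v)*dd g w1 x+(c v * l2 v)*dd g w2 x)" for v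
  by (simp add: dd_cmult[OF pfam_base(2)] assms(1) dd_lincomb[OF pfam_base(2)] algebra_simps)
 ultimately show ?case by simp
next
 case (pfam_add k g h)
 thus ?case by (simp add: dd_add[OF pfam_polyf pfam_polyf] pfam.pfam_add)
qed

lemma dd_scaled:
 assumes "polyf d g" shows "dd (%x. k*g x) (m *\<^sub>R v) = (%x. k*m*dd g v x)"
 by (rule ext) (simp add: dd_cmult[OF assms] linear_scale[OF linear_dd[OF assms]])

text \<open>Evaluation at a root of \<open>1 + t^2\<close>, that is, in the isotropic direction
  \<open>(1, i)\<close>.\<close>

definition eval_ii :: "real poly => complex" where
 "eval_ii p = poly (map_poly complex_of_real p) \<i>"

lemma eval_ii_simps: "eval_ii 0 = 0" "eval_ii (pCons a p) = of_real a+\<i> * eval_ii p"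
 by (simp_all add: eval_ii_def map_poly_pCons)

lemma eval_ii_add: "eval_ii (p+q) = eval_ii p+eval_ii q"
proof (induction p arbitrary: q)
 case (pCons a p)
 obtain b q' where "q = pCons b q'" by (cases q) (rule that)
 thus ?case by (simp add: eval_ii_simps pCons.IH algebra_simps)
qed (simp add: eval_ii_simps)

lemma eval_ii_smult: "eval_ii (smult a p) = of_real a*eval_ii p"
 by (induction p) (auto simp: eval_ii_simps algebra_simps)

lemma eval_ii_mult: "eval_ii (p*q) = eval_ii p*eval_ii q"
 by (induction p) (auto simp: eval_ii_simps eval_ii_add eval_ii_smult algebra_simps)

lemma card_quadratic_roots:
 fixes a0 a1 a2 :: real
 assumes "a2 ~= 0"
 shows "finite {t. a0+a1*t+a2*t^2 = 0} & card {t. a0+a1*t+a2*t^2 = 0} <= 2"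
proof -
 have "[:a0, a1, a2:] ~= 0" using assms by simp
 from card_poly_roots_bound[OF this] poly_roots_finite[OF this]
 show ?thesis using assms by (simp add: power2_eq_square algebra_simps)
qed

text \<open>The expansion of \<open>f\<close> along a circle through \<open>p\<close>, with unit tangent \<open>b\<close> and curvature vector \<open>- a\<close> at \<open>p\<close>.\<close>

lemma circle_expansion_unit:
 fixes f :: "real^3 => real"
 assumes f: "polyf d f" and ga: "is_circle ga" "p:ga" and zero: "ALL y:ga. f y = 0"
 obtains a b where "norm b = 1" "a\<bullet>b = 0" "a ~= 0"
  "ga = circ (p - (1/(a\<bullet>a)) *\<^sub>R a) ((1/(a\<bullet>a)) *\<^sub>R a) ((1/norm a) *\<^sub>R b)"
  "dd f b p = 0" "quad f p b = dd f a p"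
  "dd (dd (dd f b) b) b p = 3*dd (dd f a) b p"
  "dd (dd (dd (dd f b) b) b) b p - 6*dd (dd (dd f a) b) b p+3*quad f p a = 3*(a\<bullet>a)*quad f p b"
proof -
 obtain c u r where c: "norm u = 1" "r > 0" "ga = {x. dist x c = r & u\<bullet>(x - c) = 0}" using ga(1) by (rule is_circleE)
 define e where "e = p - c"
 have e: "norm e = r" "u\<bullet>e = 0" using ga(2) c(3) by (auto simp: e_def dist_norm)
 have gac: "ga = circ c e (cross3 u e)" unfolding c(3) by (rule circle_is_circ[OF c(1) e(1) c(2) e(2)])
 define a where "a = (1/r^2) *\<^sub>R e"
 define b where "b = (1/r) *\<^sub>R cross3 u e"
 have uu: "u\<bullet>u = 1" "e\<bullet>e = r^2" using c(1) e(1) by (metis one_power2 power2_norm_eq_inner)+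
 have "cross3 u e\<bullet>cross3 u e = r^2" using uu e(2) by (simp add: dot_cross inner_commute)
 hence nb: "norm (cross3 u e) = r" using c(2) by (simp add: norm_eq_sqrt_inner)
 have aa: "a\<bullet>a = 1/r^2" using uu c(2) by (simp add: a_def power2_eq_square)
 have na: "norm a = 1/r" using e(1) c(2) by (simp add: a_def power2_eq_square)
 have ea: "e = r^2 *\<^sub>R a" "cross3 u e = r *\<^sub>R b" using c(2) by (simp_all add: a_def b_def)
 have z: "f y = 0" if "y:circ c e (cross3 u e)" for y using zero that gac by simp
 note ex = circle_expansion[where c = c and e = e and e' = "cross3 u e", OF f z]
 have cp: "c+e = p" by (simp add: e_def)
 note pd = polyf_dd[OF f] polyf_dd[OF polyf_dd[OF f]] polyf_dd[OF polyf_dd[OF polyf_dd[OF f]]]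
 have E1: "dd f (k *\<^sub>R v) = (%x. k*dd f v x)" for k v using dd_scaled[OF f, of 1 k v] by simp
 have E2: "dd (%x. k*dd f v x) (m *\<^sub>R w) = (%x. k*m*dd (dd f v) w x)" for k v m w by (rule dd_scaled[OF pd(1)])
 have E3: "dd (%x. k*dd (dd f v) w x) (m *\<^sub>R y) = (%x. k*m*dd (dd (dd f v) w) y x)" for k v m w y by (rule dd_scaled[OF pd(2)])
 have E4: "dd (%x. k*dd (dd (dd f v) w) y x) (m *\<^sub>R z) = (%x. k*m*dd (dd (dd (dd f v) w) y) z x)" for k v m w y z
  by (rule dd_scaled[OF pd(3)])
 show ?thesis
 proof (rule that)
  show "norm b = 1" using nb c(2) by (simp add: b_def)
  show "a\<bullet>b = 0" by (simp add: a_def b_def dot_cross_self)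
  show "a ~= 0" using na c(2) by auto
  have "p - (1/(a\<bullet>a)) *\<^sub>R a = c" using cp ea(1) c(2) by (simp add: aa algebra_simps)
  moreover have "(1/(a\<bullet>a)) *\<^sub>R a = e" using ea(1) by (simp add: aa)
  moreover have "(1/norm a) *\<^sub>R b = cross3 u e" using ea(2) by (simp add: na)
  ultimately show "ga = circ (p - (1/(a\<bullet>a)) *\<^sub>R a) ((1/(a\<bullet>a)) *\<^sub>R a) ((1/norm a) *\<^sub>R b)" using gac by simp
  have x1: "r*dd f b p = 0" using ex(1) unfolding cp ea(2) unfolding ea(1) unfolding E1 .
  thus "dd f b p = 0" using c(2) by simp
  have "r*r*dd (dd f b) b p = r^2*dd f a p" using ex(2) unfolding cp ea(2) unfolding ea(1) unfolding E1 E2 .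
  thus q: "quad f p b = dd f a p" using c(2) by (simp add: quad_def power2_eq_square)
  have "r*r*r*dd (dd (dd f b) b) b p = 3*(r^2*r*dd (dd f a) b p)"
   using ex(3) unfolding cp ea(2) unfolding ea(1) unfolding E1 E2 E3 .
  hence "r^3*dd (dd (dd f b) b) b p = r^3*(3*dd (dd f a) b p)" by (simp add: power3_eq_cube power2_eq_square)
  thus "dd (dd (dd f b) b) b p = 3*dd (dd f a) b p" using c(2) by simp
  have x4: "r*r*r*r*dd (dd (dd (dd f b) b) b) b p - 6*(r^2*r*r*dd (dd (dd f a) b) b p)+3*(r^2*r^2*dd (dd f a) a p) = 3*(r^2*dd f a p)"
   using ex(4) unfolding cp ea(2) unfolding ea(1) unfolding E1 E2 E3 E4 .
  have "r^4*(dd (dd (dd (dd f b) b) b) b p - 6*dd (dd (dd f a) b) b p+3*quad f p a) = r^4*(3*(a\<bullet>a)*quad f p b)"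
  proof -
   have r4: "r*r*r*r = r^4" "r^2*r*r = r^4" "r^2*r^2 = r^4" "r^4*(3*(1/r^2)*dd f a p) = 3*(r^2*dd f a p)"
    using c(2) by (simp_all add: power4_eq_xxxx power2_eq_square)
   show ?thesis unfolding q aa r4(4) unfolding quad_def x4[symmetric] r4(1-3) by (simp add: algebra_simps)
  qed
  thus "dd (dd (dd (dd f b) b) b) b p - 6*dd (dd (dd f a) b) b p+3*quad f p a = 3*(a\<bullet>a)*quad f p b"
   using c(2) by simp
 qed
qed

text \<open>A circle through \<open>p\<close> has a unit tangent \<open>b v\<close> with
  \<open>v\<close> on the unit circle \<open>U\<close>, and a curvature vector whose normal part is
  fixed at second order; let \<open>et\<close> be the tangential part. Orders three and four read
  \<open>3 M et = H\<close> and \<open>A0 + A1 et + A2 et^2 = 0\<close>. Eliminating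
  \<open>et\<close> gives \<open>R - T = 0\<close>, of degree 10, with at most 21 solutions on
  \<open>U\<close>. In the at most 5 directions with \<open>M = 0\<close> the quadratic leaves two
  values each: 21 + 10 = 31.\<close>

lemma circles_through_nonumbilic_point:
 fixes f :: "real^3 => real"
 assumes f: "polyf d f" and smooth: "grad f p ~= 0" and nonumb: "~umbilic_at f p" and fin: "finite \<C>"
  and circ: "!!ga. ga:\<C> ==> is_circle ga & p:ga & (ALL y:ga. f y = 0)"
 shows "card \<C> <= 31"
proof -
 define nu where "nu = norm (grad f p)"
 have nu: "nu > 0" using smooth by (simp add: nu_def)
 define n where "n = (1/nu) *\<^sub>R grad f p"
 have n: "norm n = 1" "grad f p = nu *\<^sub>R n" using nu by (simp_all add: n_def nu_def)
 obtain e1 where e1: "norm e1 = 1" "n\<bullet>e1 = 0" by (rule unit_perp_exists)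
 define e2 where "e2 = cross3 n e1"
 note ex = orthonormal_expansion[OF n(1) e1, folded e2_def]
 have ex': "e1\<bullet>e2 = 0" "n\<bullet>e2 = 0" "e1\<bullet>n = 0" using ex(5,6) e1(2) by (simp_all add: inner_commute)
 define b where "b = (%v :: real \<times> real. fst v *\<^sub>R e1+snd v *\<^sub>R e2)"
 define bp where "bp = (%v :: real \<times> real. (- snd v) *\<^sub>R e1+fst v *\<^sub>R e2)"
 define q11 q12 q22 where "q11 = quad f p e1" and "q12 = dd (dd f e1) e2 p" and "q22 = quad f p e2"
 note pd = polyf_dd[OF f] polyf_dd[OF polyf_dd[OF f]] polyf_dd[OF polyf_dd[OF polyf_dd[OF f]]]
 have q21: "dd (dd f e2) e1 p = q12" unfolding q12_def by (rule dd_commute[OF f])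
 have q: "dd (dd f e1) e1 p = q11" "dd (dd f e2) e2 p = q22" by (simp_all add: q11_def q22_def quad_def)
 have Bf: "dd (dd f (x1 *\<^sub>R e1+y1 *\<^sub>R e2)) (x2 *\<^sub>R e1+y2 *\<^sub>R e2) p = x1*x2*q11+(x1*y2+x2*y1)*q12+y1*y2*q22" for x1 y1 x2 y2
  unfolding dd_dd_lincomb[OF f] dd_lincomb[OF pd(1)] q q21 q12_def[symmetric] by (simp add: algebra_simps)
 define Q M Q' where "Q = (%v. quad f p (b v))" and "M = (%v. dd (dd f (bp v)) (b v) p)" and "Q' = (%v. quad f p (bp v))"
 have Qv: "Q v = (fst v)^2*q11+2*fst v * snd v * q12+(snd v)^2*q22" for v
  unfolding Q_def quad_def b_def Bf by (simp add: power2_eq_square algebra_simps)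
 have Q'v: "Q' v = (snd v)^2*q11 - 2*fst v * snd v * q12+(fst v)^2*q22" for v
  unfolding Q'_def quad_def bp_def Bf by (simp add: power2_eq_square algebra_simps)
 have Mv: "M v = ((fst v)^2 - (snd v)\<^sup>2)*q12+fst v * snd v * (q22 - q11)" for v
  unfolding M_def b_def bp_def Bf by (simp add: power2_eq_square algebra_simps)
 have nq: "q12 ~= 0 | q11 ~= q22"
 proof (rule ccontr)
  assume "~?thesis"
  hence eq: "q12 = 0" "q22 = q11" by auto
  have "quad f p w = q11*(w\<bullet>w)" if "n\<bullet>w = 0" for w
  proof -
   have wn: "w\<bullet>n = 0" using that by (simp add: inner_commute)
   define s t where "s = w\<bullet>e1" and "t = w\<bullet>e2"
   have w: "w = s *\<^sub>R e1+t *\<^sub>R e2" using ex(1)[of w] unfolding wn scale_zero_left add_0_right s_def t_def .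
   show ?thesis unfolding w quad_def Bf eq using ex ex' by (simp add: inner_add_left inner_add_right algebra_simps)
  qed
  moreover have "n\<bullet>cross3 (grad f p) z = 0" for z by (simp add: n(2) cross_mult_left dot_cross_self)
  ultimately have "umbilic_at f p" unfolding umbilic_at_def by simp
  thus False using nonumb by simp
 qed
 have lin: "polyf 1 (%v :: real \<times> real. fst v)" "polyf 1 (%v :: real \<times> real. snd v)" "polyf 1 (%v :: real \<times> real. - snd v)"
  using polyf_inner[of 0 "(1, 0) :: real \<times> real"] polyf_inner[of 0 "(0, 1) :: real \<times> real"] polyf_inner[of 0 "(0, - 1) :: real \<times> real"]
  by (simp_all add: inner_prod_def)
 note db = pfam_dd_direction[of b "%v. fst v" e1 "%v. snd v" e2, OF _ lin(1,2)]
 have bb: "b v = fst v *\<^sub>R e1+snd v *\<^sub>R e2" "bp v = (- snd v) *\<^sub>R e1+fst v *\<^sub>R e2" for v by (simp_all add: b_def bp_def)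
 note db = pfam_dd_direction[OF bb(1) lin(1,2)] and dbp = pfam_dd_direction[OF bb(2) lin(3,1)]
 note f0 = pfam_const[OF f]
 define g3 where "g3 = (%v. dd (dd (dd f (b v)) (b v)) (b v) p)"
 define g4 where "g4 = (%v. dd (dd (dd (dd f (b v)) (b v)) (b v)) (b v) p)"
 define m1 where "m1 = (%v. dd (dd f n) (b v) p)"
 define m2 where "m2 = (%v. dd (dd (dd f n) (b v)) (b v) p)"
 define m3 where "m3 = (%v. dd (dd (dd f (bp v)) (b v)) (b v) p)"
 define m4 where "m4 = (%v. dd (dd f n) (bp v) p)"
 define k where "k = quad f p n"
 have poly: "polyf 2 Q" "polyf 2 M" "polyf 2 Q'" "polyf 3 g3" "polyf 4 g4" "polyf 1 m1" "polyf 2 m2" "polyf 3 m3" "polyf 1 m4"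
  unfolding Q_def M_def Q'_def quad_def g3_def g4_def m1_def m2_def m3_def m4_def
  using pfam_param[OF db[OF db[OF f0]]] pfam_param[OF db[OF dbp[OF f0]]] pfam_param[OF dbp[OF dbp[OF f0]]]
   pfam_param[OF db[OF db[OF db[OF f0]]]] pfam_param[OF db[OF db[OF db[OF db[OF f0]]]]] pfam_param[OF db[OF pfam_dd[OF f0]]]
   pfam_param[OF db[OF db[OF pfam_dd[OF f0]]]] pfam_param[OF db[OF db[OF dbp[OF f0]]]] pfam_param[OF dbp[OF pfam_dd[OF f0]]]
  by (simp_all add: numeral_2_eq_2 numeral_3_eq_3 eval_nat_numeral)
 define H where "H = (%v. g3 v - 3/nu*(Q v * m1 v))"
 define A2 where "A2 = (%v. 3*Q' v - 3*Q v)"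
 define A1 where "A1 = (%v. 6/nu*(Q v * m4 v) - 6*m3 v)"
 define B0 where "B0 = (%v. g4 v - 6/nu*(Q v * m2 v)+3 * k/nu^2*(Q v * Q v))"
 define A0 where "A0 = (%v. B0 v - 3/nu^2*(Q v * Q v * Q v))"
 define R where "R = (%v. 9*(M v * M v * B0 v)+3*(M v * H v * A1 v)+H v * H v * A2 v)"
 define T where "T = (%v. 27/nu^2*(M v * M v * (Q v * Q v * Q v)))"
 have pH: "polyf 3 H" unfolding H_def using polyf_mult[OF poly(1,6)] poly(4) by (intro polyf_diff polyf_cmult) simp_all
 have pA2: "polyf 2 A2" unfolding A2_def using poly by (intro polyf_diff polyf_cmult)
 have pA1: "polyf 3 A1" unfolding A1_def using polyf_mult[OF poly(1,9)] poly(8) by (intro polyf_diff polyf_cmult) simp_all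
 have pB0: "polyf 4 B0" unfolding B0_def using polyf_mult[OF poly(1,7)] polyf_mult[OF poly(1,1)] poly(5)
  by (intro polyf_add polyf_diff polyf_cmult) simp_all
 have pR: "polyf 8 R" unfolding R_def
  using polyf_mult[OF polyf_mult[OF poly(2,2)] pB0] polyf_mult[OF polyf_mult[OF poly(2) pH] pA1] polyf_mult[OF polyf_mult[OF pH pH] pA2]
  by (intro polyf_add polyf_cmult) simp_all
 have pT: "polyf 10 T" unfolding T_def
  using polyf_mult[OF polyf_mult[OF poly(2,2)] polyf_mult[OF polyf_mult[OF poly(1,1)] poly(1)]] by (intro polyf_cmult) simp
 have pRT: "polyf 10 (%v. R v - T v)" using polyf_mono[OF pR] pT by (intro polyf_diff) auto
 define U where "U = circ (0::real \<times> real) (1, 0) (0, 1)"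
 have U: "v:U \<longleftrightarrow> (fst v)\<^sup>2+(snd v)^2 = 1" for v by (cases v) (auto simp: U_def circ_def)
 \<comment> \<open>The two sides have different degrees, 8 and 10. On \<open>U\<close> this is
   invisible; on the line \<open>(1, t)\<close> it reappears as a factor
   \<open>1 + t^2\<close>.\<close>
 have hom: "R (s *\<^sub>R v) = s^8*R v" "T (s *\<^sub>R v) = s^10*T v" for s v
 proof -
  have bs: "b (s *\<^sub>R v) = s *\<^sub>R b v" "bp (s *\<^sub>R v) = s *\<^sub>R bp v" by (simp_all add: b_def bp_def algebra_simps)
  have D1: "dd f (s *\<^sub>R w) = (%x. s*dd f w x)" for w using dd_scaled[OF f, of 1 s w] by simp
  have D2: "dd (dd f w) (s *\<^sub>R w') = (%x. s*dd (dd f w) w' x)" for w w' using dd_scaled[OF pd(1), where k = 1 and m = s and v = w'] by simp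
  have D2': "dd (%x. l*dd f w x) (s *\<^sub>R w') = (%x. l * s*dd (dd f w) w' x)" for l w w' by (rule dd_scaled[OF pd(1)])
  have D3': "dd (%x. l*dd (dd f w) w' x) (s *\<^sub>R w'') = (%x. l * s*dd (dd (dd f w) w') w'' x)" for l w w' w'' by (rule dd_scaled[OF pd(2)])
  have D4': "dd (%x. l*dd (dd (dd f w) w') w'' x) (s *\<^sub>R z) = (%x. l * s*dd (dd (dd (dd f w) w') w'') z x)" for l w w' w'' z by (rule dd_scaled[OF pd(3)])
  have h: "Q (s *\<^sub>R v) = s^2*Q v" "M (s *\<^sub>R v) = s^2*M v" "Q' (s *\<^sub>R v) = s^2*Q' v" "g3 (s *\<^sub>R v) = s^3*g3 v" "g4 (s *\<^sub>R v) = s^4*g4 v"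
   "m1 (s *\<^sub>R v) = s*m1 v" "m2 (s *\<^sub>R v) = s^2*m2 v" "m3 (s *\<^sub>R v) = s^3*m3 v" "m4 (s *\<^sub>R v) = s*m4 v"
   unfolding Q_def M_def Q'_def quad_def g3_def g4_def m1_def m2_def m3_def m4_def bs D1 D2 D2' D3' D4'
   by (simp_all add: power2_eq_square power3_eq_cube power4_eq_xxxx)
  have H: "H (s *\<^sub>R v) = s^3*H v" "A2 (s *\<^sub>R v) = s^2*A2 v" "A1 (s *\<^sub>R v) = s^3*A1 v" "B0 (s *\<^sub>R v) = s^4*B0 v"
   unfolding H_def A2_def A1_def B0_def h by (simp_all add: algebra_simps power2_eq_square power3_eq_cube power4_eq_xxxx)
  have s8: "s^2 * s^2 * s^4 = s^8" "s^2 * s^3 * s^3 = s^8" "s^3 * s^3 * s^2 = s^8" by (simp_all add: power_add[symmetric])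
  have mm: "(p*x)*(q*y)*(r*z) = (p*q*r)*(x*y*z)" for p q r x y z :: real by (simp only: mult_ac)
  show "R (s *\<^sub>R v) = s^8*R v" unfolding R_def H h mm s8 by (simp add: algebra_simps)
  have "s^10 = s^2 * s^2*(s^2 * s^2 * s^2)" by (simp add: power_add[symmetric])
  thus "T (s *\<^sub>R v) = s^10*T v" unfolding T_def h by (simp add: mult_ac)
 qed
 \<comment> \<open>If \<open>R = T\<close> on \<open>U\<close>, then
   \<open>(1 + t^2) R (1, t) = T (1, t)\<close> as polynomials, and at \<open>t = i\<close> the left
   side is zero. But \<open>M (1, i) = 2 q12 + i (q22 - q11)\<close> and
   \<open>Q (1, i) = i M (1, i)\<close> are nonzero, since \<open>p\<close> is not umbilic.\<close>
 have notzero: "EX v:U. R v - T v ~= 0"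
 proof (rule ccontr)
  assume "~?thesis"
  hence z: "R v = T v" if "v:U" for v using that by auto
  have id: "(1+t^2)*R (1, t) = T (1, t)" for t
  proof -
   define w where "w = sqrt (1+t^2)"
   have w: "w > 0" "w^2 = 1+t^2" using one_plus_square_pos[of t] by (simp_all add: w_def)
   have "(1/w)^2+(t/w)^2 = (1+t^2)/w^2" by (simp add: power_divide add_divide_distrib)
   also have "... = 1" unfolding w(2) using one_plus_square_pos[of t] by (intro divide_self) simp
   finally have "(1/w) *\<^sub>R (1, t):U" by (simp add: U)
   from z[OF this] have "(1/w)^8*R (1, t) = (1/w)^10*T (1, t)" by (simp only: hom)
   hence "w^10*((1/w)^8*R (1, t)) = w^10*((1/w)^10*T (1, t))" by simp
   moreover have "w^10*(1/w)^8 = w^2" "w^10*(1/w)^10 = 1" using w(1) by (simp_all add: power_divide field_simps)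
   ultimately show ?thesis using w(2) by (metis mult.assoc mult_1)
  qed
  obtain pr where pr: "!!t. R (1, t) = poly pr t"
  proof -
   obtain P where "degree P <= 8" "!!t. R ((1, 0)+t *\<^sub>R (0, 1)) = poly P t" using polyf_line[OF pR, of "(1, 0)" "(0, 1)"] by metis
   thus ?thesis using that[of P] by simp
  qed
  define pm where "pm = [:q12, q22 - q11, - q12:]"
  define pq where "pq = [:q11, 2*q12, q22:]"
  have "poly ([:1, 0, 1:]*pr) t = poly (smult (27/nu^2) (pm*pm*(pq*pq*pq))) t" for t
  proof -
   have "M (1, t) = poly pm t" "Q (1, t) = poly pq t" by (simp_all add: Mv Qv pm_def pq_def power2_eq_square algebra_simps)
   hence "poly (smult (27/nu^2) (pm*pm*(pq*pq*pq))) t = T (1, t)" by (simp add: T_def)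
   moreover have "poly ([:1, 0, 1:]*pr) t = (1+t^2)*R (1, t)" by (simp add: pr power2_eq_square algebra_simps)
   ultimately show ?thesis using id[of t] by simp
  qed
  hence "[:1, 0, 1:]*pr = smult (27/nu^2) (pm*pm*(pq*pq*pq))" using poly_eq_poly_eq_iff by blast
  hence "eval_ii ([:1, 0, 1:]*pr) = eval_ii (smult (27/nu^2) (pm*pm*(pq*pq*pq)))" by (rule arg_cong)
  hence "0 = of_real (27/nu^2)*(eval_ii pm*eval_ii pm*(eval_ii pq*eval_ii pq*eval_ii pq))"
   by (simp only: eval_ii_mult eval_ii_smult) (simp add: eval_ii_simps)
  hence "eval_ii pm = 0 | eval_ii pq = 0" using nu by auto
  moreover have "eval_ii pm = Complex (2*q12) (q22 - q11)" by (simp add: pm_def eval_ii_simps complex_eq_iff)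
  moreover have "eval_ii pq = Complex (q11 - q22) (2*q12)" by (simp add: pq_def eval_ii_simps complex_eq_iff)
  ultimately show False using nq by (auto simp: complex_eq_iff)
 qed
 define V1 where "V1 = {v:U. R v - T v = 0}"
 define V2 where "V2 = {v:U. M v = 0}"
 have V1: "finite V1" "card V1 <= 21"
 proof -
  have zl: "zeros_le (2*10+1) 10 U" unfolding U_def by (rule zeros_le_circ)
  obtain v where "v:U" "R v - T v ~= 0" using notzero by blast
  from zeros_leD[OF zl pRT this] show "finite V1" "card V1 <= 21" by (simp_all add: V1_def)
 qed
 have V2: "finite V2" "card V2 <= 5"
 proof -
  have zl: "zeros_le (2*2+1) 2 U" unfolding U_def by (rule zeros_le_circ)
  have "EX v:U. M v ~= 0"
  proof (cases "q12 = 0")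
   case False thus ?thesis by (intro bexI[of _ "(1, 0)"]) (auto simp: Mv U)
  next
   case True thus ?thesis using nq by (intro bexI[of _ "(sqrt (1/2), sqrt (1/2))"]) (auto simp: Mv U)
  qed
  then obtain v where "v:U" "M v ~= 0" by blast
  from zeros_leD[OF zl poly(2) this] show "finite V2" "card V2 <= 5" by (simp_all add: V2_def)
 qed
 \<comment> \<open>Where \<open>M\<close> vanishes the direction is principal, and \<open>Q\<close>,
   \<open>Q'\<close> are the two principal values of the Hessian form, distinct at
   \<open>p\<close>.\<close>
 have A2nz: "A2 v ~= 0" if "v:V2" for v
 proof
  assume "A2 v = 0"
  have v: "(fst v)^2+(snd v)^2 = 1" "M v = 0" using that by (auto simp: V2_def U)
  define x y where "x = fst v" and "y = snd v"
  have 1: "x^2+y^2 = 1" "(x^2 - y\<^sup>2)*q12+x*y*(q22 - q11) = 0" "(x^2 - y\<^sup>2)*(q22 - q11) - 4*x*y*q12 = 0"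
   using v \<open>A2 v = 0\<close> by (simp_all add: Mv x_def y_def A2_def Qv Q'v algebra_simps)
  have i: "(x^2 - y\<^sup>2)^2+4*(x*y)^2 = 1"
  proof -
   have "(x^2 - y\<^sup>2)^2+4*(x*y)^2 = (x^2+y^2)^2" by (simp add: power2_eq_square algebra_simps)
   thus ?thesis using 1(1) by simp
  qed
  have "((x^2 - y\<^sup>2)^2+4*(x*y)^2)*q12 = 0" "((x^2 - y\<^sup>2)^2+4*(x*y)^2)*(q22 - q11) = 0"
   using 1(2,3) by algebra+
  thus False using nq i by auto
 qed
 let ?R = "%v. {et. A0 v+A1 v * et+A2 v * et^2 = 0}"
 \<comment> \<open>Pairs of a direction and a tangential curvature, each of which determines the
   circle. Off the principal directions the third order gives the curvature, on them the quadratic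
   does.\<close>
 define S where "S = (%v. (v, H v/(3*M v))) ` V1 \<union> (SIGMA v:V2. (?R v))"
 have quadr: "finite (?R v)" "card (?R v) <= 2" if "v:V2" for v
  using card_quadratic_roots[OF A2nz[OF that]] by auto
 have finS: "finite S" unfolding S_def using V1 V2 quadr by auto
 have cardS: "card S <= 31"
 proof -
  have "card (SIGMA v:V2. (?R v)) = (SUM v:V2. card (?R v))"
   using V2 quadr by (intro card_SigmaI) auto
  also have "... <= (SUM v:V2. 2)" by (intro sum_mono quadr(2))
  also have "... <= 10" using V2 by simp
  finally have "card (SIGMA v:V2. (?R v)) <= 10" .
  moreover have "card ((%v. (v, H v/(3*M v))) ` V1) <= 21" using card_image_le[OF V1(1)] V1(2) order_trans by blast
  ultimately show ?thesis 
   unfolding S_def using card_Un_le[of "(%v. (v, H v/(3*M v))) ` V1" "SIGMA v:V2. (?R v)"] by linarith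
 qed
 define av where "av = (%(v, et). (Q v/nu) *\<^sub>R n+et *\<^sub>R bp v)"
 define Ps where "Ps = (%s. circ (p - (1/(av s\<bullet>av s)) *\<^sub>R av s) ((1/(av s\<bullet>av s)) *\<^sub>R av s) ((1/norm (av s)) *\<^sub>R b (fst s)))"
 have "\<C> <= Ps ` S"
 proof
  fix ga assume g: "ga:\<C>"
  hence gc: "is_circle ga" "p:ga" "ALL y:ga. f y = 0" using circ by auto
  obtain a b' where ab: "norm b' = 1" "a\<bullet>b' = 0" "a ~= 0"
   "ga = circ (p - (1/(a\<bullet>a)) *\<^sub>R a) ((1/(a\<bullet>a)) *\<^sub>R a) ((1/norm a) *\<^sub>R b')"
   "dd f b' p = 0" "quad f p b' = dd f a p"
   "dd (dd (dd f b') b') b' p = 3*dd (dd f a) b' p"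
   "dd (dd (dd (dd f b') b') b') b' p - 6*dd (dd (dd f a) b') b' p+3*quad f p a = 3*(a\<bullet>a)*quad f p b'"
   by (rule circle_expansion_unit[OF f gc])
  define v where "v = (b'\<bullet>e1, b'\<bullet>e2)"
  have "nu*(n\<bullet>b') = 0" using ab(5) grad_inner[OF f, of p b'] by (simp add: n(2))
  hence nb: "b'\<bullet>n = 0" using nu by (simp add: inner_commute)
  have bv: "b' = b v" using ex(1)[of b'] unfolding nb scale_zero_left add_0_right b_def v_def fst_conv snd_conv .
  have "b v\<bullet>b v = 1" using ab(1) by (simp add: bv[symmetric] norm_eq_sqrt_inner)
  hence vU: "v:U" using ex ex' by (simp add: U b_def inner_add_left inner_add_right power2_eq_square)
  have bpbp: "bp v\<bullet>bp v = 1" "n\<bullet>bp v = 0"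
   using vU ex ex' e1(2) by (simp_all add: U bp_def inner_add_left inner_add_right power2_eq_square inner_diff_left inner_diff_right)
  define et where "et = a\<bullet>bp v"
  have an: "a\<bullet>n = Q v/nu"
  proof -
   have "nu*(n\<bullet>a) = Q v" using ab(6) grad_inner[OF f, of p a] by (simp add: n(2) Q_def bv)
   thus ?thesis using nu by (simp add: field_simps inner_commute)
  qed
  have a: "a = (Q v/nu) *\<^sub>R n+et *\<^sub>R bp v"
  proof -
   define x y where "x = fst v" and "y = snd v"
   have xy: "x*x+y*y = 1" using vU by (simp add: U x_def y_def power2_eq_square)
   define s t where "s = a\<bullet>e1" and "t = a\<bullet>e2"
   have 0: "x * s+y*t = 0" using ab(2) by (simp add: bv b_def inner_add_right x_def y_def s_def t_def)
   have eta: "et = x*t - y * s" by (simp add: et_def bp_def inner_add_right x_def y_def s_def t_def inner_diff_right)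
   have "s = et * - y" "t = et*x" using 0 xy unfolding eta by algebra+
   hence "et *\<^sub>R bp v = s *\<^sub>R e1+t *\<^sub>R e2" by (simp add: bp_def x_def y_def scaleR_add_right scaleR_diff_right)
   thus ?thesis using ex(1)[of a] unfolding an s_def[symmetric] t_def[symmetric] by (metis add.commute)
  qed
  define al where "al = Q v/nu"
  have a': "a = al *\<^sub>R n+et *\<^sub>R bp v" using a by (simp add: al_def)
  have aa: "a\<bullet>a = al^2+et^2"
   unfolding a' using bpbp ex(4) by (simp add: inner_add_left inner_add_right power2_eq_square inner_commute[of "bp v" n])
  have fa: "dd f a = (%x. al*dd f n x+et*dd f (bp v) x)" unfolding a' by (rule dd_lincomb[OF f])
  have dlin: "dd (%x. al*g x+et*h x) w = (%x. al*dd g w x+et*dd h w x)" if "polyf d g" "polyf d h" for g h w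
   using dd_add[OF polyf_cmult[OF that(1)] polyf_cmult[OF that(2)]] by (simp add: dd_cmult[OF that(1)] dd_cmult[OF that(2)])
  have fab: "dd (dd f a) w = (%x. al*dd (dd f n) w x+et*dd (dd f (bp v)) w x)" for w unfolding fa by (rule dlin[OF pd(1) pd(1)])
  have fabb: "dd (dd (dd f a) w) w' = (%x. al*dd (dd (dd f n) w) w' x+et*dd (dd (dd f (bp v)) w) w' x)" for w w'
   unfolding fab by (rule dlin[OF pd(2) pd(2)])
  have e3: "3*(et*M v) = H v"
   using ab(7) unfolding bv fab by (simp add: H_def g3_def m1_def M_def al_def)
  have qa: "quad f p a = al^2 * k+2*al*et*m4 v+et^2*Q' v"
   unfolding a' by (simp add: quad_lincomb[OF f] k_def m4_def Q'_def)
  have e4: "g4 v - 6*(al*m2 v+et*m3 v)+3*(al^2 * k+2*al*et*m4 v+et^2*Q' v) = 3*(al^2+et^2)*Q v"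
   using ab(8) unfolding qa aa bv fabb by (simp add: g4_def m2_def m3_def Q_def)
  have A: "A0 v = g4 v - 6*al*m2 v+3*al^2 * k - 3*al^2*Q v" "A1 v = 6*al*m4 v - 6*m3 v"
   using nu by (simp_all add: A0_def B0_def A1_def al_def power_divide power2_eq_square field_simps)
  have e5: "A0 v+A1 v * et+A2 v * et^2 = 0" using e4 unfolding A A2_def by (simp add: algebra_simps)
  have RT: "R v - T v = 9*(M v * M v * A0 v)+3*(M v * H v * A1 v)+H v * H v * A2 v"
   by (simp add: R_def T_def A0_def algebra_simps)
  have "9*(M v * M v * A0 v)+3*(M v * H v * A1 v)+H v * H v * A2 v = 9*(M v * M v)*(A0 v+A1 v * et+A2 v * et^2)"
   unfolding e3[symmetric] by (simp add: power2_eq_square algebra_simps)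
  hence "R v - T v = 0" using RT e5 by simp
  hence "v:V1" using vU by (simp add: V1_def)
  have "(v, et):S"
  proof (cases "M v = 0")
   case True
   thus ?thesis using vU e5 by (simp add: S_def V2_def)
  next
   case False
   hence "et = H v/(3*M v)" using e3 by (simp add: field_simps)
   thus ?thesis using \<open>v:V1\<close> by (simp add: S_def)
  qed
  moreover have "ga = Ps (v, et)" using ab(4) unfolding bv by (simp add: Ps_def av_def a[symmetric])
  ultimately show "ga:Ps ` S" by blast
 qed
 hence "card \<C> <= card (Ps ` S)" using finS by (intro card_mono) auto
 also have "... <= card S" using finS by (rule card_image_le)
 finally show ?thesis using cardS by simp
qed

section \<open>Umbilic points\<close>

lemma tangent_basis:
 fixes N :: "real^3"
 assumes "N ~= 0"
 obtains z where "cross3 N z ~= 0"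
proof -
 obtain e where e: "norm e = 1" "N\<bullet>e = 0" by (rule unit_perp_exists)
 have "(norm (cross3 N e))^2 = (norm N)^2" using e by (simp add: norm_cross)
 hence "cross3 N e ~= 0" using assms by auto
 thus ?thesis by (rule that)
qed

lemma umbilic_quad:
 assumes "umbilic_at f x" "grad f x ~= 0"
 obtains k where "!!w. grad f x\<bullet>w = 0 ==> quad f x w = k*(w\<bullet>w)"
proof -
 define N where "N = grad f x"
 obtain z where z: "cross3 N z ~= 0" using tangent_basis assms(2) unfolding N_def by blast
 define v where "v = cross3 N z"
 have vv: "v\<bullet>v ~= 0" using z by (simp add: v_def)
 have "quad f x w = (quad f x v/(v\<bullet>v))*(w\<bullet>w)" if w: "N\<bullet>w = 0" for w
 proof -
  obtain y where "w = cross3 N y" using tangent_is_cross[OF _ w] assms(2) by (auto simp: N_def)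
  hence "quad f x w*(v\<bullet>v) = quad f x v * (w\<bullet>w)" using assms(1) unfolding umbilic_at_def v_def N_def by simp
  thus ?thesis using vv by (simp add: field_simps)
 qed
 thus ?thesis using that unfolding N_def by blast
qed

text \<open>If \<open>quad f x w = k |w|^2\<close> on tangent vectors, this is the plane or sphere
  \<open>N . (y - x) + k/2 |y - x|^2 = 0\<close> osculating the surface at \<open>x\<close>.
  Quantifying over \<open>w\<close> avoids choosing \<open>k\<close>.\<close>

definition tangent_sphere :: "(real^3 => real) => real^3 => (real^3) set" where
 "tangent_sphere f x = {y. ALL w. grad f x\<bullet>w = 0 -->
   (grad f x\<bullet>(y - x))*(w\<bullet>w)+quad f x w/2*((y - x)\<bullet>(y - x)) = 0}"

lemma tangent_sphere_eq:
 assumes "!!w. grad f x\<bullet>w = 0 ==> quad f x w = k*(w\<bullet>w)" "grad f x ~= 0"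
 shows "tangent_sphere f x = {y. grad f x\<bullet>(y - x)+k/2*((y - x)\<bullet>(y - x)) = 0}"
proof -
 define N where "N = grad f x"
 obtain z where z: "cross3 N z ~= 0" using tangent_basis assms(2) unfolding N_def by blast
 define v where "v = cross3 N z"
 have v: "v\<bullet>v ~= 0" "N\<bullet>v = 0" using z by (simp_all add: v_def dot_cross_self)
 have *: "(N\<bullet>(y - x))*(w\<bullet>w)+quad f x w/2*((y - x)\<bullet>(y - x)) = (N\<bullet>(y - x)+k/2*((y - x)\<bullet>(y - x)))*(w\<bullet>w)"
  if "N\<bullet>w = 0" for w y using assms(1)[of w] that unfolding N_def by (simp add: algebra_simps)
 show ?thesis unfolding tangent_sphere_def N_def[symmetric]
 proof (intro Collect_cong iffI allI impI)
  fix y assume "ALL w. N\<bullet>w = 0 --> (N\<bullet>(y - x))*(w\<bullet>w)+quad f x w/2*((y - x)\<bullet>(y - x)) = 0"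
  hence "(N\<bullet>(y - x)+k/2*((y - x)\<bullet>(y - x)))*(v\<bullet>v) = 0" using *[OF v(2)] v(2) by metis
  thus "N\<bullet>(y - x)+k/2*((y - x)\<bullet>(y - x)) = 0" using v(1) by simp
 next
  fix y w assume "N\<bullet>(y - x)+k/2*((y - x)\<bullet>(y - x)) = 0" "N\<bullet>w = 0"
  thus "(N\<bullet>(y - x))*(w\<bullet>w)+quad f x w/2*((y - x)\<bullet>(y - x)) = 0" using * by simp
 qed
qed

lemma tangent_sphere_plane_or_sphere:
 assumes "umbilic_at f x" "grad f x ~= 0"
 shows "is_plane (tangent_sphere f x) | is_sphere (tangent_sphere f x)"
proof -
 define N where "N = grad f x"
 have N: "N ~= 0" using assms by (simp add: N_def)
 obtain k where k: "!!w. grad f x\<bullet>w = 0 ==> quad f x w = k*(w\<bullet>w)" using umbilic_quad[OF assms] by blast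
 have S: "tangent_sphere f x = {y. N\<bullet>(y - x)+k/2*((y - x)\<bullet>(y - x)) = 0}"
  unfolding N_def by (rule tangent_sphere_eq[OF k assms(2)])
 show ?thesis
 proof (cases "k = 0")
  case True
  have "tangent_sphere f x = {y. N\<bullet>y = N\<bullet>x}" unfolding S True by (simp add: inner_diff_right)
  thus ?thesis using N unfolding is_plane_def by blast
 next
  case False
  define c where "c = x - (1/k) *\<^sub>R N"
  define r where "r = norm N/\<bar>k\<bar>"
  have r: "r > 0" "r^2 = (N\<bullet>N)/k^2" using N False by (simp_all add: r_def power_divide power2_norm_eq_inner)
  have eq: "N\<bullet>(y - x)+k/2*((y - x)\<bullet>(y - x)) = k/2*((y - c)\<bullet>(y - c) - r\<^sup>2)" for y
  proof -
   define w where "w = y - x"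
   define ka where "ka = 1/k"
   have yc: "y - c = w+ka *\<^sub>R N" by (simp add: c_def w_def ka_def)
   have r2: "r^2 = ka * ka*(N\<bullet>N)" unfolding r(2) ka_def by (simp add: power2_eq_square)
   have "(y - c)\<bullet>(y - c) - r\<^sup>2 = w\<bullet>w+2 * ka*(N\<bullet>w)"
    unfolding yc r2 by (simp add: inner_add_left inner_add_right inner_commute[of w N] algebra_simps)
   thus ?thesis using False unfolding w_def[symmetric] by (simp add: distrib_left ka_def)
  qed
  have "tangent_sphere f x = {y. (y - c)\<bullet>(y - c) = r^2}" unfolding S eq using False by simp
  also have "... = sphere c r"
  proof -
   have "(y - c)\<bullet>(y - c) = r^2 \<longleftrightarrow> dist c y = r" for y
    using r(1) by (simp add: power2_norm_eq_inner[symmetric] dist_norm norm_minus_commute power2_eq_iff_nonneg)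
   thus ?thesis by (simp add: sphere_def)
  qed
  finally show ?thesis using r(1) unfolding is_sphere_def by blast
 qed
qed

text \<open>In terms of a circle in the zero set, the sphere tangent at an umbilic point \<open>x\<close> is the member of the pencil of spheres through
 the circle with the coefficients \<open>X x\<close>, \<open>Y x\<close>.\<close>

lemma tangent_sphere_pencil:
 fixes f :: "real^3 => real"
 assumes f: "polyf d f" and u: "norm u = 1" and r: "r > 0" and ga: "ga = {x. dist x c = r & u\<bullet>(x - c) = 0}"
  and zero: "ALL y:ga. f y = 0" and x: "x:ga" and N: "grad f x ~= 0" and umb: "umbilic_at f x"
 shows "tangent_sphere f x = {y. dd f (x - c) x*((y - c)\<bullet>(y - c) - r\<^sup>2)+2*r^2*dd f u x*(u\<bullet>(y - c)) = 0}"
  and "dd f (x - c) x ~= 0 | dd f u x ~= 0"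
  and "dd f u x*dd (dd f (x - c)) (cross3 u (x - c)) x = dd f (x - c) x*dd (dd f u) (cross3 u (x - c)) x"
proof -
 define e where "e = x - c"
 define e' where "e' = cross3 u e"
 have e: "norm e = r" "u\<bullet>e = 0" using x by (auto simp: ga e_def dist_norm)
 have g: "ga = circ c e e'" unfolding ga e'_def by (rule circle_is_circ[OF u e(1) r e(2)])
 have z: "f y = 0" if "y:circ c e e'" for y using zero that by (simp add: g)
 have cx: "c+e = x" by (simp add: e_def)
 note ex = circle_expansion[where c = c and e = e and e' = e', OF f z, unfolded cx]
 define X Y where "X = dd f e x" and "Y = dd f u x"
 have uu: "u\<bullet>u = 1" "e\<bullet>e = r^2" using u e(1) by (metis one_power2 power2_norm_eq_inner)+
 have e'e': "e'\<bullet>e' = r^2" using uu e(2) by (simp add: e'_def dot_cross inner_commute)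
 have perp: "e'\<bullet>e = 0" "e'\<bullet>u = 0" by (simp_all add: e'_def dot_cross_self)
 define N where "N = grad f x"
 have Nv: "N\<bullet>v = dd f v x" for v unfolding N_def by (rule grad_inner[OF f])
 obtain k where k: "!!w. grad f x\<bullet>w = 0 ==> quad f x w = k*(w\<bullet>w)" using umbilic_quad[OF umb N] by blast
 have X: "X = k*r^2"
  using ex(2) k[of e'] ex(1) Nv[of e'] e'e' unfolding N_def quad_def X_def by simp
 have span: "N\<bullet>v = (X/r^2)*(e\<bullet>v)+Y*(u\<bullet>v)" for v
 proof -
  define e1 where "e1 = (1/r) *\<^sub>R e"
  have e1: "norm e1 = 1" "u\<bullet>e1 = 0" "e = r *\<^sub>R e1" using e r by (simp_all add: e1_def)
  have e'1: "e' = r *\<^sub>R cross3 u e1" by (simp add: e'_def e1(3) cross_mult_right)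
  have "v = (v\<bullet>e1) *\<^sub>R e1+(v\<bullet>cross3 u e1) *\<^sub>R cross3 u e1+(v\<bullet>u) *\<^sub>R u"
   by (rule orthonormal_expansion(1)[OF u e1(1,2)])
  hence "N\<bullet>v = (v\<bullet>e1)*(N\<bullet>e1)+(v\<bullet>cross3 u e1)*(N\<bullet>cross3 u e1)+(v\<bullet>u)*(N\<bullet>u)"
   by (metis inner_add_right inner_scaleR_right)
  moreover have "r*(N\<bullet>cross3 u e1) = 0" using ex(1) Nv[of e'] by (simp add: e'1)
  moreover have "r*(N\<bullet>e1) = X" using Nv[of e] by (simp add: X_def e1(3))
  moreover have "e\<bullet>v = r*(v\<bullet>e1)" by (simp add: e1(3) inner_commute)
  ultimately show ?thesis using r Nv[of u] by (simp add: Y_def inner_commute field_simps power2_eq_square)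
 qed
 have "N\<bullet>(y - x)+k/2*((y - x)\<bullet>(y - x)) = (X*((y - c)\<bullet>(y - c) - r\<^sup>2)+2*r^2*Y*(u\<bullet>(y - c)))/(2*r^2)" for y
 proof -
  define w where "w = y - c"
  have yx: "y - x = w - e" by (simp add: w_def e_def)
  have "e\<bullet>(w - e) = e\<bullet>w - r\<^sup>2" "u\<bullet>(w - e) = u\<bullet>w" "(w - e)\<bullet>(w - e) = w\<bullet>w - 2*(e\<bullet>w)+r^2"
   using uu e(2) by (simp_all add: inner_diff_left inner_diff_right inner_commute)
  hence "N\<bullet>(y - x)+k/2*((y - x)\<bullet>(y - x)) = (X/r^2)*(e\<bullet>w - r\<^sup>2)+Y*(u\<bullet>w)+(X/r^2)/2*(w\<bullet>w - 2*(e\<bullet>w)+r^2)"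
   using X r unfolding yx span by simp
  also have "... = (X*(w\<bullet>w - r\<^sup>2)+2*r^2*Y*(u\<bullet>w))/(2*r^2)" using r by (simp add: field_simps)
  finally show ?thesis by (simp add: w_def)
 qed
 hence "tangent_sphere f x = {y. (X*((y - c)\<bullet>(y - c) - r\<^sup>2)+2*r^2*Y*(u\<bullet>(y - c)))/(2*r^2) = 0}"
  using tangent_sphere_eq[OF k N] unfolding N_def by simp
 thus "tangent_sphere f x = {y. dd f (x - c) x*((y - c)\<bullet>(y - c) - r\<^sup>2)+2*r^2*dd f u x*(u\<bullet>(y - c)) = 0}"
  using r by (simp add: X_def Y_def e_def)
 show "dd f (x - c) x ~= 0 | dd f u x ~= 0"
 proof (rule ccontr)
  assume "~?thesis"
  hence "N\<bullet>N = 0" using span[of N] by (simp add: X_def Y_def e_def)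
  thus False using N by (simp add: N_def)
 qed
 \<comment> \<open>\<open>v\<close> is tangent and orthogonal to \<open>e'\<close>. At an umbilic
   point orthogonal tangent vectors are conjugate for the Hessian form, and written in
   \<open>X\<close> and \<open>Y\<close> this is the Wronskian relation of the third claim.\<close>
 define v where "v = Y *\<^sub>R e+(- X) *\<^sub>R u"
 have Nv0: "N\<bullet>v = 0" "N\<bullet>e' = 0" using Nv[of e] Nv[of u] Nv[of e'] ex(1) by (simp_all add: v_def inner_add_right inner_diff_right X_def Y_def)
 have ve': "v\<bullet>e' = 0" using perp by (simp add: v_def inner_add_left inner_diff_left inner_commute[of e e'] inner_commute[of u e'])
 have "quad f x (1 *\<^sub>R v+1 *\<^sub>R e') = quad f x v+quad f x e'"
 proof -
  have "N\<bullet>(v+e') = 0" using Nv0 by (simp add: inner_add_right)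
  thus ?thesis using k[of "v+e'"] k[of v] k[of e'] Nv0 ve'
   by (simp add: N_def inner_add_left inner_add_right inner_commute[of e' v] algebra_simps)
 qed
 hence "dd (dd f v) e' x = 0" using quad_lincomb[OF f, of x 1 v 1 e'] by simp
 hence "Y*dd (dd f e) e' x+(- X)*dd (dd f u) e' x = 0" unfolding v_def dd_dd_lincomb[OF f] .
 thus "dd f u x*dd (dd f (x - c)) (cross3 u (x - c)) x = dd f (x - c) x*dd (dd f u) (cross3 u (x - c)) x"
  by (simp add: X_def Y_def e_def e'_def)
qed

text \<open>The direction \<open>x - c\<close> moves with the point, and the product rule
  contributes \<open>dd f v x\<close>; this extra term is zero for \<open>v\<close> tangent to a
  curve in the zero set.\<close>

lemma radial_derivative:
 fixes f :: "'a::euclidean_space => real"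
 assumes f: "polyf d f"
 shows "polyf (d+1) (%x. dd f (x - c) x)" "dd (%x. dd f (x - c) x) v x = dd f v x+dd (dd f (x - c)) v x"
proof -
 have ex: "(%x. dd f (x - c) x) = (%x. SUM b:Basis. (x\<bullet>b - c\<bullet>b)*dd f b x)"
  by (rule ext) (simp add: dd_basis_sum[OF f, of "_ - c"] inner_diff_left)
 have "polyf (1+d) (%x. (x\<bullet>b - c\<bullet>b)*dd f b x)" for b
  using polyf_inner[of 0 b] by (intro polyf_mult polyf_diff polyf_const polyf_dd[OF f]) simp
 thus "polyf (d+1) (%x. dd f (x - c) x)" unfolding ex by (intro polyf_sum) (simp add: add.commute)
 have "((%x. SUM b:Basis. (x\<bullet>b - c\<bullet>b)*dd f b x) has_derivative
  (%v. SUM b:Basis. (x\<bullet>b - c\<bullet>b)*dd (dd f b) v x+(v\<bullet>b)*dd f b x)) (at x)"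
 proof (rule has_derivative_sum)
  fix b :: 'a
  have "((%x. dd f b x) has_derivative (%v. dd (dd f b) v x)) (at x)" using polyf_has_derivative[OF polyf_dd[OF f]] .
  moreover have "((%x. x\<bullet>b - c\<bullet>b) has_derivative (%v. v\<bullet>b)) (at x)" by (auto intro!: derivative_eq_intros)
  ultimately show "((%x. (x\<bullet>b - c\<bullet>b)*dd f b x) has_derivative (%v. (x\<bullet>b - c\<bullet>b)*dd (dd f b) v x+(v\<bullet>b)*dd f b x)) (at x)"
   by (rule has_derivative_mult[rotated])
 qed
 hence "dd (%x. dd f (x - c) x) v x = (SUM b:Basis. (x\<bullet>b - c\<bullet>b)*dd (dd f b) v x+(v\<bullet>b)*dd f b x)"
  unfolding ex by (rule dd_eqI)
 also have "... = (SUM b:Basis. ((x - c)\<bullet>b)*dd (dd f v) b x)+(SUM b:Basis. (v\<bullet>b)*dd f b x)"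
  by (simp add: sum.distrib inner_diff_left dd_commute[OF f, of _ v])
 also have "... = dd (dd f v) (x - c) x+dd f v x"
  using dd_basis_sum[OF polyf_dd[OF f, of v], of "x - c" x] dd_basis_sum[OF f, of v x] by simp
 finally show "dd (%x. dd f (x - c) x) v x = dd f v x+dd (dd f (x - c)) v x"
  using dd_commute[OF f, of v "x - c" x] by simp
qed

lemma circ_param_derivative:
 fixes g :: "real^3 => real"
 assumes g: "polyf d g" and u: "cross3 u e' = - e" "cross3 u e = e'"
 shows "((%t. g (circ_param c e e' t)) has_real_derivative
  (2/(1+t^2))*dd g (cross3 u (circ_param c e e' t - c)) (circ_param c e e' t)) (at t)"
proof -
 define x where "x = circ_param c e e' t"
 define a where "a = (%t::real. (1 - t\<^sup>2)/(1+t^2))"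
 define b where "b = (%t::real. 2*t/(1+t^2))"
 have nz: "1+t^2 ~= 0" for t :: real using one_plus_square_pos[of t] by simp
 have da: "(a has_real_derivative (2/(1+t^2)) * - b t) (at t)"
  unfolding a_def b_def by (rule derivative_eq_intros refl nz)+ (use nz[of t] in \<open>simp add: field_simps power2_eq_square\<close>)
 have db: "(b has_real_derivative (2/(1+t^2))*a t) (at t)"
 proof -
  have "(b has_real_derivative (2*(1+t^2) - 2*t*(2*t))/((1+t^2)*(1+t^2))) (at t)"
   unfolding b_def by (auto intro!: derivative_eq_intros simp: nz)
  moreover have "2*(1+t^2) - 2*t*(2*t) = 2*(1 - t\<^sup>2)" by (simp add: power2_eq_square algebra_simps)
  ultimately show ?thesis by (simp only: a_def times_divide_times_eq)
 qed
 have cp: "circ_param c e e' s = c+a s *\<^sub>R e+b s *\<^sub>R e'" for s by (simp add: circ_param_def a_def b_def)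
 have W: "cross3 u (x - c) = a t *\<^sub>R e' - b t *\<^sub>R e" by (simp add: x_def cp cross_add_right cross_mult_right u)
 have der: "((%t. circ_param c e e' t) has_derivative (%s. s *\<^sub>R ((2/(1+t^2)) *\<^sub>R cross3 u (x - c)))) (at t)"
 proof -
  have "((%s. c+a s *\<^sub>R e+b s *\<^sub>R e') has_derivative (%s. (s*((2/(1+t^2)) * - b t)) *\<^sub>R e+(s*((2/(1+t^2))*a t)) *\<^sub>R e')) (at t)"
   using da[unfolded has_field_derivative_def] db[unfolded has_field_derivative_def]
   by (auto intro!: derivative_eq_intros simp: mult.commute)
  thus ?thesis unfolding cp[abs_def] W by (simp add: scaleR_diff_right algebra_simps)
 qed
 have "(g has_derivative (%w. dd g w x)) (at (circ_param c e e' t))" using polyf_has_derivative[OF g] by (simp add: x_def)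
 from has_derivative_compose[OF der this]
 have "((%t. g (circ_param c e e' t)) has_derivative (%s. dd g (s *\<^sub>R ((2/(1+t^2)) *\<^sub>R cross3 u (x - c))) x)) (at t)" .
 note der2 = this
 have lin: "dd g (s *\<^sub>R ((2/(1+t^2)) *\<^sub>R w)) x = ((2/(1+t^2))*dd g w x) * s" for s w
  using linear_scale[OF linear_dd[OF g], of "s*(2/(1+t^2))" w x] by (simp add: mult_ac)
 from der2 show ?thesis unfolding has_field_derivative_def unfolding lin unfolding x_def .
qed

text \<open>The rotation field \<open>cross3 u (x - c)\<close> is a positive multiple of the
  velocity of the rational parametrisation, and the common factor \<open>(1 + t^2)^d\<close> cancels
  from the Wronskian of the two numerators. The missed point \<open>c - e\<close> is
  excluded.\<close>

lemma circle_wronskian: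
 fixes g h :: "real^3 => real"
 assumes g: "polyf d g" and h: "polyf d h" and u: "cross3 u e' = - e" "cross3 u e = e'"
  and w: "!!x. x:circ c e e' ==> dd g (cross3 u (x - c)) x*h x = g x*dd h (cross3 u (x - c)) x"
  and xy: "x:circ c e e' - {c - e}" "y:circ c e e' - {c - e}"
 shows "g x*h y = g y*h x"
proof -
 obtain P where P: "!!t. g (circ_param c e e' t)*(1+t^2)^d = poly P t" using polyf_circ_param[OF g] by blast
 obtain Q where Q: "!!t. h (circ_param c e e' t)*(1+t^2)^d = poly Q t" using polyf_circ_param[OF h] by blast
 define m where "m = (%t::real. (1+t^2)^d)"
 have m: "m t > 0" for t using one_plus_square_pos[of t] by (simp add: m_def)
 obtain m' where m': "(m has_real_derivative m' t) (at t)" for t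
 proof -
  have "(m has_real_derivative real d*(1+t^2)^(d - 1)*(2*t)) (at t)" for t
   unfolding m_def by (auto intro!: derivative_eq_intros)
  thus ?thesis by (rule that)
 qed
 have "poly (pderiv P*Q) t = poly (P*pderiv Q) t" for t
 proof -
  define x where "x = circ_param c e e' t"
  define l where "l = 2/(1+t^2)"
  have xc: "x:circ c e e'" unfolding x_def by (rule circ_param_mem)
  have "((%t. g (circ_param c e e' t)*m t) has_real_derivative (l*dd g (cross3 u (x - c)) x)*m t+m' t*g x) (at t)"
   using DERIV_mult[OF circ_param_derivative[OF g u, of c t] m'[of t]] by (simp add: x_def l_def)
  hence dP: "poly (pderiv P) t = (l*dd g (cross3 u (x - c)) x)*m t+m' t*g x"
   unfolding m_def P using DERIV_unique[OF poly_DERIV] by blast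
  have "((%t. h (circ_param c e e' t)*m t) has_real_derivative (l*dd h (cross3 u (x - c)) x)*m t+m' t*h x) (at t)"
   using DERIV_mult[OF circ_param_derivative[OF h u, of c t] m'[of t]] by (simp add: x_def l_def)
  hence dQ: "poly (pderiv Q) t = (l*dd h (cross3 u (x - c)) x)*m t+m' t*h x"
   unfolding m_def Q using DERIV_unique[OF poly_DERIV] by blast
  have pq: "poly P t = g x*m t" "poly Q t = h x*m t" using P[of t] Q[of t] by (simp_all add: x_def m_def)
  show ?thesis unfolding poly_mult dP dQ pq using w[OF xc] by algebra
 qed
 hence "pderiv P*Q = P*pderiv Q" using poly_eq_poly_eq_iff by blast
 note pr = wronskian_zero_proportional[OF this]
 obtain s t where st: "circ_param c e e' s = x" "circ_param c e e' t = y" using circ_param_surj xy by blast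
 have "(g x*m s)*(h y*m t) = (g y*m t)*(h x*m s)" using pr[of s t] P[of s] P[of t] Q[of s] Q[of t] by (simp add: st m_def)
 hence "(m s*m t)*(g x*h y) = (m s*m t)*(g y*h x)" by (simp add: mult_ac)
 thus ?thesis using m[of s] m[of t] by simp
qed

text \<open>The tangent sphere is the member of the pencil of spheres through the circle with
  coefficients \<open>X\<close> and \<open>Y\<close>; umbilicity makes their Wronskian vanish, so
  the ratio is constant. At singular points of \<open>f\<close> both coefficients are zero and the
  relation is trivial.\<close>

lemma tangent_sphere_constant:
 fixes f :: "real^3 => real"
 assumes f: "polyf d f" and ga: "is_circle ga" and zero: "!!y. y:ga ==> f y = 0" and umb: "!!y. y:ga ==> umbilic_at f y"
  and x: "x:ga" "grad f x ~= 0" and y: "y:ga" "grad f y ~= 0"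
 shows "tangent_sphere f x = tangent_sphere f y"
proof -
 obtain c u r where c: "norm u = 1" "r > 0" "ga = {x. dist x c = r & u\<bullet>(x - c) = 0}" by (rule is_circleE[OF ga])
 have zero': "ALL y:ga. f y = 0" using zero by blast
 \<comment> \<open>The parametrisation with axis \<open>e\<close> misses \<open>c - e\<close>; among
   three candidates one avoids both \<open>x\<close> and \<open>y\<close>.\<close>
 obtain e where e: "c+e:ga" "c - e ~= x" "c - e ~= y"
 proof -
  have mem: "c+v:ga \<longleftrightarrow> norm v = r & u\<bullet>v = 0" for v by (simp add: c(3) dist_norm)
  obtain e1 where e1: "norm e1 = 1" "u\<bullet>e1 = 0" by (rule unit_perp_exists)
  define e2 where "e2 = cross3 u e1"
  note on = orthonormal_expansion(2-6)[OF c(1) e1, folded e2_def]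
  have n2: "norm e2 = 1" "u\<bullet>e2 = 0" "e1\<bullet>e2 = 0" using on by (simp_all add: norm_eq_sqrt_inner inner_commute)
  have m: "c+r *\<^sub>R e1:ga" "c+r *\<^sub>R e2:ga" "c+(- r) *\<^sub>R e1:ga" unfolding mem using e1 n2 c(2) by simp_all
  have r0: "r ~= 0" using c(2) by simp
  have ne: "e1 ~= e2" "e1 ~= - e2" "e1 ~= 0"
   using n2(3) on(2) by auto
  have d: "c - r *\<^sub>R e1 ~= c - r *\<^sub>R e2" "c - r *\<^sub>R e1 ~= c - (- r) *\<^sub>R e1" "c - r *\<^sub>R e2 ~= c - (- r) *\<^sub>R e1"
  proof -
   show "c - r *\<^sub>R e1 ~= c - r *\<^sub>R e2" using r0 ne by simp
   show "c - r *\<^sub>R e1 ~= c - (- r) *\<^sub>R e1"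
   proof
    assume h: "c - r *\<^sub>R e1 = c - (- r) *\<^sub>R e1"
    from arg_cong[OF h, of "%v. v\<bullet>e1"] show False using r0 on(2) by (simp add: inner_diff_left inner_add_left)
   qed
   show "c - r *\<^sub>R e2 ~= c - (- r) *\<^sub>R e1"
   proof
    assume h: "c - r *\<^sub>R e2 = c - (- r) *\<^sub>R e1"
    from arg_cong[OF h, of "%v. v\<bullet>e2"] show False using r0 on(1) n2(3) by (simp add: inner_diff_left inner_add_left)
   qed
  qed
  show ?thesis using that[OF m(1)] that[OF m(2)] that[OF m(3)] d by metis
 qed
 define e' where "e' = cross3 u e"
 have en: "norm e = r" "u\<bullet>e = 0" using e(1) by (auto simp: c(3) dist_norm)
 have g: "ga = circ c e e'" unfolding c(3) e'_def by (rule circle_is_circ[OF c(1) en(1) c(2) en(2)])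
 have uu: "u\<bullet>u = 1" using c(1) by (metis one_power2 power2_norm_eq_inner)
 have ue': "cross3 u e' = - e" using uu en(2) by (simp add: e'_def Lagrange)
 define X where "X = (%x. dd f (x - c) x)"
 define Y where "Y = dd f u"
 have pX: "polyf (d+1) X" unfolding X_def by (rule radial_derivative(1)[OF f])
 have pY: "polyf (d+1) Y" unfolding Y_def by (rule polyf_mono[OF polyf_dd[OF f]]) simp
 have w: "dd X (cross3 u (z - c)) z*Y z = X z*dd Y (cross3 u (z - c)) z" if z: "z:circ c e e'" for z
 proof -
  define F where "F = cross3 u (z - c)"
  have zg: "z:ga" using z g by simp
  hence zn: "norm (z - c) = r" "u\<bullet>(z - c) = 0" by (auto simp: c(3) dist_norm)
  have gz: "ga = circ c (z - c) F" unfolding c(3) F_def by (rule circle_is_circ[OF c(1) zn(1) c(2) zn(2)])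
  have f0: "f y = 0" if "y:circ c (z - c) F" for y using zero that gz by simp
  have fF: "dd f F z = 0" using circle_expansion(1)[where c = c and e = "z - c" and e' = F, OF f f0] by simp
  show ?thesis
  proof (cases "grad f z = 0")
   case True
   hence "X z = 0" "Y z = 0" using grad_inner[OF f, of z] by (simp_all add: X_def Y_def)
   thus ?thesis by simp
  next
   case False
   have "Y z*dd (dd f (z - c)) F z = X z*dd (dd f u) F z"
    unfolding X_def Y_def F_def by (rule tangent_sphere_pencil(3)[OF f c(1,2,3) zero' zg False umb[OF zg]])
   moreover have "dd X F z = dd (dd f (z - c)) F z" unfolding X_def radial_derivative(2)[OF f] using fF by simp
   ultimately show ?thesis by (simp add: F_def[symmetric] Y_def mult.commute)
  qed
 qed
 have "X x*Y y = X y*Y x"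
  by (rule circle_wronskian[OF pX pY ue' e'_def[symmetric] w]) (use x y e g in auto)
 note prop1 = this
 note Tx = tangent_sphere_pencil(1,2)[OF f c(1,2,3) zero' x(1,2) umb[OF x(1)]]
 note Ty = tangent_sphere_pencil(1,2)[OF f c(1,2,3) zero' y(1,2) umb[OF y(1)]]
 have nx: "X x ~= 0 | Y x ~= 0" and ny: "X y ~= 0 | Y y ~= 0" using Tx(2) Ty(2) by (auto simp: X_def Y_def)
 have iff: "X x*p+Y x*q = 0 \<longleftrightarrow> X y*p+Y y*q = 0" for p q
 proof
  assume a: "X x*p+Y x*q = 0"
  have "X x*(X y*p+Y y*q) = 0" "Y x*(X y*p+Y y*q) = 0" using a prop1 by algebra+
  thus "X y*p+Y y*q = 0" using nx by auto
 next
  assume a: "X y*p+Y y*q = 0"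
  have "X y*(X x*p+Y x*q) = 0" "Y y*(X x*p+Y x*q) = 0" using a prop1 by algebra+
  thus "X x*p+Y x*q = 0" using ny by auto
 qed
 have "(X x*((z - c)\<bullet>(z - c) - r\<^sup>2)+2*r^2*Y x*(u\<bullet>(z - c)) = 0) \<longleftrightarrow> (X y*((z - c)\<bullet>(z - c) - r\<^sup>2)+2*r^2*Y y*(u\<bullet>(z - c)) = 0)" for z
  using iff[of "(z - c)\<bullet>(z - c) - r\<^sup>2" "2*r^2*(u\<bullet>(z - c))"] by (simp add: mult_ac)
 thus ?thesis unfolding Tx(1) Ty(1) X_def Y_def by simp
qed

lemma circle_in_tangent_sphere:
 fixes f :: "real^3 => real"
 assumes f: "polyf d f" and ga: "is_circle ga" and zero: "!!y. y:ga ==> f y = 0" and x: "x:ga" "grad f x ~= 0" "umbilic_at f x"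
 shows "ga <= tangent_sphere f x"
proof -
 obtain c u r where c: "norm u = 1" "r > 0" "ga = {x. dist x c = r & u\<bullet>(x - c) = 0}" by (rule is_circleE[OF ga])
 have zero': "ALL y:ga. f y = 0" using zero by blast
 have "(y - c)\<bullet>(y - c) = r^2" "u\<bullet>(y - c) = 0" if "y:ga" for y
  using that by (auto simp: c(3) dist_norm power2_norm_eq_inner)
 moreover note T = tangent_sphere_pencil(1)[OF f c(1,2,3) zero' x]
 ultimately show ?thesis by (intro subsetI) (simp add: T)
qed

lemma polyf_umbilic:
 fixes f :: "real^3 => real"
 assumes f: "polyf d f"
 shows "polyf (5*d) (%x. quad f x (cross3 (grad f x) z)*(cross3 (grad f x) w\<bullet>cross3 (grad f x) w)
   - quad f x (cross3 (grad f x) w)*(cross3 (grad f x) z\<bullet>cross3 (grad f x) z))"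
proof -
 have q: "polyf (d+2*d) (%x. quad f x (cross3 (grad f x) z))" for z
  by (rule polyf_quad_field[OF f polyf_grad_cross[OF f]])
 have n: "polyf (d+d) (%x. cross3 (grad f x) z\<bullet>cross3 (grad f x) z)" for z
 proof -
  have "(%x. cross3 (grad f x) z\<bullet>cross3 (grad f x) z) = (%x. SUM b:Basis. (cross3 (grad f x) z\<bullet>b)*(cross3 (grad f x) z\<bullet>b))"
   by (rule ext) (rule euclidean_inner)
  thus ?thesis by (simp only:) (intro polyf_sum polyf_mult polyf_grad_cross[OF f])
 qed
 have "polyf ((d+2*d)+(d+d)) (%x. quad f x (cross3 (grad f x) z)*(cross3 (grad f x) w\<bullet>cross3 (grad f x) w)
   - quad f x (cross3 (grad f x) w)*(cross3 (grad f x) z\<bullet>cross3 (grad f x) z))"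
  by (intro polyf_diff polyf_mult q n)
 thus ?thesis by (rule polyf_mono) simp
qed

section \<open>Circles in a plane or a sphere\<close>

text \<open>Common frame for planes and inverted spheres: in \<open>S\<close> each circle is cut out
  by a circle equation with squared radius \<open>rh\<close>. Being a sum of squares,
  \<open>rh\<close> is not negative, and two points on the circle exclude 0.\<close>

lemma transfer_to_plane:
 fixes ph :: "real^3 => real \<times> real"
 assumes K: "!!P G. finite P ==> finite G ==> ALL g:G. snd (snd g) > 0 ==>
   real (SUM g:G. card {p:P. on_circle g p}) <= K*planar_bound (rc P) (rc G)"
  and fin: "finite P" "finite \<C>" and inj: "inj_on ph S" and P: "P <= S" and sub: "!!ga. ga:\<C> ==> ga <= S"
  and two: "!!ga. ga:\<C> ==> EX x:ga. EX y:ga. x ~= y"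
  and eq: "!!ga. ga:\<C> ==> EX a b rh. ALL x:S. x:ga \<longleftrightarrow> (fst (ph x) - a)\<^sup>2+(snd (ph x) - b)^2 = rh"
 shows "real (SUM ga:\<C>. card {p:P. p:ga}) <= K*planar_bound (rc P) (rc \<C>)"
proof -
 have "ALL ga:\<C>. EX g. snd (snd g) > 0 & (ALL x:S. x:ga \<longleftrightarrow> on_circle g (ph x))"
 proof
  fix ga assume g: "ga:\<C>"
  obtain a b rh where e: "ALL x:S. x:ga \<longleftrightarrow> (fst (ph x) - a)\<^sup>2+(snd (ph x) - b)^2 = rh" using eq[OF g] by blast
  obtain x y where xy: "x:ga" "y:ga" "x ~= y" using two[OF g] by blast
  have S: "x:S" "y:S" using xy sub[OF g] by auto
  have ex: "(fst (ph x) - a)^2+(snd (ph x) - b)^2 = rh" "(fst (ph y) - a)^2+(snd (ph y) - b)^2 = rh" using e S xy by auto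
  have "rh ~= 0"
  proof
   assume "rh = 0"
   hence "ph x = (a, b)" "ph y = (a, b)" using ex by (auto simp: sum_power2_eq_zero_iff prod_eq_iff)
   thus False using inj S xy(3) by (metis inj_onD)
  qed
  moreover have "rh >= 0" unfolding ex(1)[symmetric] by simp
  ultimately have "rh > 0" by simp
  thus "EX g. snd (snd g) > 0 & (ALL x:S. x:ga \<longleftrightarrow> on_circle g (ph x))"
   using e by (intro exI[of _ "(a, b, sqrt rh)"]) (simp add: on_circle_def)
 qed
 then obtain g where g: "!!ga. ga:\<C> ==> snd (snd (g ga)) > 0" "!!ga x. ga:\<C> ==> x:S ==> x:ga \<longleftrightarrow> on_circle (g ga) (ph x)"
  by metis
 have injg: "inj_on g \<C>"
 proof (rule inj_onI)
  fix ga ga' assume a: "ga:\<C>" "ga':\<C>" "g ga = g ga'"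
  hence "x:ga \<longleftrightarrow> x:ga'" if "x:S" for x using g(2) that by metis
  thus "ga = ga'" using sub[OF a(1)] sub[OF a(2)] by blast
 qed
 have injP: "inj_on ph P" using inj P by (rule inj_on_subset)
 have "real (SUM c:g ` \<C>. card {p:ph ` P. on_circle c p}) <= K*planar_bound (rc (ph ` P)) (rc (g ` \<C>))"
  using fin g(1) by (intro K) auto
 moreover have "card {p:ph ` P. on_circle (g ga) p} = card {p:P. p:ga}" if "ga:\<C>" for ga
 proof -
  have "{p:ph ` P. on_circle (g ga) p} = ph ` {p:P. p:ga}" using g(2)[OF that] P by auto
  moreover have "inj_on ph {p:P. p:ga}" using injP by (rule inj_on_subset) auto
  ultimately show ?thesis by (simp add: card_image)
 qed
 ultimately show ?thesis by (simp add: sum.reindex[OF injg] card_image[OF injg] card_image[OF injP])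
qed

lemma circle_points:
 assumes u: "norm u = 1" and r: "r > 0" and ga: "ga = {x. dist x c = r & u\<bullet>(x - c) = 0}"
 obtains e1 where "norm e1 = 1" "u\<bullet>e1 = 0" "c+r *\<^sub>R e1:ga" "c - r *\<^sub>R e1:ga" "c+r *\<^sub>R cross3 u e1:ga" "c - r *\<^sub>R cross3 u e1:ga"
proof -
 obtain e1 where e1: "norm e1 = 1" "u\<bullet>e1 = 0" by (rule unit_perp_exists)
 note on = orthonormal_expansion(2-6)[OF u e1]
 have "norm (cross3 u e1) = 1" "u\<bullet>cross3 u e1 = 0" using on by (simp_all add: norm_eq_sqrt_inner inner_commute)
 thus ?thesis using e1 r by (intro that[of e1]) (simp_all add: ga dist_norm)
qed

lemma circle_in_plane:
 fixes u c n x :: "real^3"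
 assumes u: "norm u = 1" and r: "r > 0" and ga: "ga = {x. dist x c = r & u\<bullet>(x - c) = 0}"
  and sub: "ga <= {x. n\<bullet>x = de}" and n: "n ~= 0" and x: "n\<bullet>x = de"
 shows "u\<bullet>(x - c) = 0" "n\<bullet>c = de"
proof -
 obtain e1 where e1: "norm e1 = 1" "u\<bullet>e1 = 0" "c+r *\<^sub>R e1:ga" "c - r *\<^sub>R e1:ga" "c+r *\<^sub>R cross3 u e1:ga" "c - r *\<^sub>R cross3 u e1:ga"
  by (rule circle_points[OF u r ga])
 have m: "n\<bullet>(c+r *\<^sub>R e1) = de" "n\<bullet>(c - r *\<^sub>R e1) = de" "n\<bullet>(c+r *\<^sub>R cross3 u e1) = de" using e1 sub by auto
 show nc: "n\<bullet>c = de" using m(1,2) by (simp add: inner_add_right inner_diff_right)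
 hence z: "n\<bullet>e1 = 0" "n\<bullet>cross3 u e1 = 0" using m r by (simp_all add: inner_add_right)
 have nn: "n = (n\<bullet>u) *\<^sub>R u" using orthonormal_expansion(1)[OF u e1(1,2), of n] unfolding z by simp
 hence "n\<bullet>u ~= 0" using n by auto
 moreover have "(n\<bullet>u)*(u\<bullet>(x - c)) = n\<bullet>(x - c)" using arg_cong[OF nn, of "%v. v\<bullet>(x - c)"] by simp
 ultimately show "u\<bullet>(x - c) = 0" using x nc by (simp add: inner_diff_right)
qed

text \<open>Opposite points of the circle show that the vector joining the two centres is a multiple
  of \<open>u\<close>. Hence points of the sphere in the plane of the circle have constant distance
  from \<open>c\<close>.\<close>

lemma circle_in_sphere:
 fixes u c z x :: "real^3"
 assumes u: "norm u = 1" and r: "r > 0" and ga: "ga = {x. dist x c = r & u\<bullet>(x - c) = 0}"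
  and sub: "ga <= sphere z R" and x: "x:sphere z R" "u\<bullet>(x - c) = 0"
 shows "x:ga"
proof -
 obtain e1 where e1: "norm e1 = 1" "u\<bullet>e1 = 0" "c+r *\<^sub>R e1:ga" "c - r *\<^sub>R e1:ga" "c+r *\<^sub>R cross3 u e1:ga" "c - r *\<^sub>R cross3 u e1:ga"
  by (rule circle_points[OF u r ga])
 have sp: "y:sphere z R \<longleftrightarrow> norm (y - z) = R" for y by (simp add: dist_norm norm_minus_commute)
 have R: "(norm (y - z))^2 = R^2" if "y:ga" for y using sub that sp by auto
 define w where "w = c - z"
 have R': "w\<bullet>w+2*(v\<bullet>w)+v\<bullet>v = R^2" if "c+v:ga" for v
 proof -
  have "c+v - z = w+v" by (simp add: w_def)
  hence "(w+v)\<bullet>(w+v) = R^2" using R[OF that] by (simp only: power2_norm_eq_inner)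
  moreover have "(w+v)\<bullet>(w+v) = w\<bullet>w+2*(v\<bullet>w)+v\<bullet>v"
   by (simp add: inner_add_left inner_add_right inner_commute[of w v])
  ultimately show ?thesis by linarith
 qed
 have opp: "v\<bullet>w = 0" if "c+v:ga" "c - v:ga" for v
  using R'[of v] R'[of "- v"] that by simp
 have z: "w\<bullet>e1 = 0" "w\<bullet>cross3 u e1 = 0" using opp[OF e1(3,4)] opp[OF e1(5,6)] r by (simp_all add: inner_commute)
 have ww: "w = (w\<bullet>u) *\<^sub>R u" using orthonormal_expansion(1)[OF u e1(1,2), of w] unfolding z by simp
 define y where "y = x - c"
 have wy: "y\<bullet>w = 0" using arg_cong[OF ww, of "%v. y\<bullet>v"] x(2) by (simp add: y_def inner_commute)
 have "w\<bullet>w+r^2 = R^2"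
 proof -
  have "(r *\<^sub>R e1)\<bullet>(r *\<^sub>R e1) = r^2" using e1(1) by (simp add: power2_eq_square norm_eq_sqrt_inner)
  thus ?thesis using R'[OF e1(3)] opp[OF e1(3,4)] by linarith
 qed
 moreover have "w\<bullet>w+y\<bullet>y = R^2"
 proof -
  have "x - z = w+y" by (simp add: w_def y_def)
  hence "(norm (w+y))^2 = R^2" using x(1) sp by simp
  thus ?thesis using wy by (simp add: power2_norm_eq_inner inner_add_left inner_add_right inner_commute[of w y])
 qed
 ultimately have "(norm y)^2 = r^2" by (simp add: power2_norm_eq_inner)
 hence "norm y = r" using r by (simp add: power2_eq_iff_nonneg)
 thus ?thesis using x(2) by (simp add: ga y_def dist_norm)
qed

lemma circle_two_points: "is_circle ga ==> EX x:ga. EX y:ga. x ~= y"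
proof -
 assume "is_circle ga"
 then obtain c u r where c: "norm u = 1" "r > 0" "ga = {x. dist x c = r & u\<bullet>(x - c) = 0}" by (rule is_circleE)
 obtain e1 where e1: "norm e1 = 1" "u\<bullet>e1 = 0" "c+r *\<^sub>R e1:ga" "c - r *\<^sub>R e1:ga" "c+r *\<^sub>R cross3 u e1:ga" "c - r *\<^sub>R cross3 u e1:ga"
  by (rule circle_points[OF c])
 have "c+r *\<^sub>R e1 ~= c - r *\<^sub>R e1"
 proof
  assume h: "c+r *\<^sub>R e1 = c - r *\<^sub>R e1"
  have "e1\<bullet>e1 = 1" using e1(1) by (simp add: norm_eq_sqrt_inner)
  thus False using arg_cong[OF h, of "%v. v\<bullet>e1"] c(2) by (simp add: inner_add_left inner_diff_left)
 qed
 thus ?thesis using e1(3,4) by blast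
qed

lemma polyf_inner_self: "polyf 2 (%w :: real^3. w\<bullet>w)"
proof -
 have "(%w :: real^3. w\<bullet>w) = (%w. SUM b:Basis. (w\<bullet>b)*(w\<bullet>b))" by (rule ext) (rule euclidean_inner)
 moreover have "polyf (Suc 0+Suc 0) (%w :: real^3. SUM b:Basis. (w\<bullet>b)*(w\<bullet>b))" by (intro polyf_sum polyf_mult polyf_inner)
 ultimately show ?thesis by (simp add: numeral_2_eq_2)
qed

lemma plane_circle_incidences:
 assumes K: "!!P G. finite P ==> finite G ==> ALL g:G. snd (snd g) > 0 ==>
   real (SUM g:G. card {p:P. on_circle g p}) <= K*planar_bound (rc P) (rc G)"
  and S: "is_plane S" and fin: "finite P" "finite \<C>" and P: "P <= S" and \<C>: "!!ga. ga:\<C> ==> is_circle ga & ga <= S"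
 shows "real (SUM ga:\<C>. card {p:P. p:ga}) <= K*planar_bound (rc P) (rc \<C>)"
proof -
 obtain n0 de0 where n0: "n0 ~= 0" "S = {x. n0\<bullet>x = de0}" using S unfolding is_plane_def by blast
 define n where "n = (1/norm n0) *\<^sub>R n0"
 define de where "de = de0/norm n0"
 have n: "norm n = 1" "S = {x. n\<bullet>x = de}" "n ~= 0" using n0 by (auto simp: n_def de_def)
 obtain e1 where e1: "norm e1 = 1" "n\<bullet>e1 = 0" by (rule unit_perp_exists)
 note ex = orthonormal_expansion[OF n(1) e1]
 define e2 where "e2 = cross3 n e1"
 define ph where "ph = (%x. (x\<bullet>e1, x\<bullet>e2))"
 have dec: "w = (w\<bullet>e1) *\<^sub>R e1+(w\<bullet>e2) *\<^sub>R e2" if "n\<bullet>w = 0" for w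
 proof -
  have "w\<bullet>n = 0" using that by (simp add: inner_commute)
  thus ?thesis using ex(1)[of w] unfolding e2_def by (metis add.right_neutral scale_zero_left)
 qed
 show ?thesis
 proof (rule transfer_to_plane[OF K fin _ P])
  show "inj_on ph S"
  proof (rule inj_onI)
   fix x y assume xy: "x:S" "y:S" "ph x = ph y"
   have "n\<bullet>(x - y) = 0" "(x - y)\<bullet>e1 = 0" "(x - y)\<bullet>e2 = 0" using xy by (auto simp: n(2) ph_def inner_diff_right inner_diff_left)
   hence "x - y = 0" using dec[of "x - y"] by simp
   thus "x = y" by simp
  qed
  fix ga assume g: "ga:\<C>"
  thus "ga <= S" "EX x:ga. EX y:ga. x ~= y" using \<C> circle_two_points by blast+
  obtain c u r where c: "norm u = 1" "r > 0" "ga = {x. dist x c = r & u\<bullet>(x - c) = 0}" 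
   by (rule is_circleE[OF conjunct1[OF \<C>[OF g]]])
  have sub: "ga <= {x. n\<bullet>x = de}" using \<C>[OF g] n(2) by blast
  have "x:ga \<longleftrightarrow> (fst (ph x) - fst (ph c))\<^sup>2+(snd (ph x) - snd (ph c))^2 = r^2" if x: "x:S" for x
  proof -
   have nx: "n\<bullet>x = de" using x n(2) by simp
   note cp = circle_in_plane[OF c sub n(3) nx]
   define w where "w = x - c"
   have w0: "n\<bullet>w = 0" using nx cp(2) by (simp add: w_def inner_diff_right)
   define s t where "s = w\<bullet>e1" and "t = w\<bullet>e2"
   have "w = s *\<^sub>R e1+t *\<^sub>R e2" unfolding s_def t_def by (rule dec[OF w0])
   hence "w\<bullet>w = s^2+t^2"
    using ex(2,3,5) by (simp add: e2_def inner_add_left inner_add_right power2_eq_square inner_commute[of e1 "cross3 n e1"])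
   moreover have "dist x c = r \<longleftrightarrow> w\<bullet>w = r^2"
    using c(2) by (simp add: w_def dist_norm power2_norm_eq_inner[symmetric] power2_eq_iff_nonneg)
   moreover have "s = fst (ph x) - fst (ph c)" "t = snd (ph x) - snd (ph c)" by (simp_all add: s_def t_def w_def ph_def inner_diff_left)
   ultimately show ?thesis using cp(1) by (simp add: c(3))
  qed
  thus "EX a b rh. ALL x:S. x:ga \<longleftrightarrow> (fst (ph x) - a)\<^sup>2+(snd (ph x) - b)^2 = rh" by blast
 qed
qed

text \<open>Spheres are reduced to planes by an inversion in a point of the sphere that avoids the points and the circles.\<close>

lemma sphere_circle_incidences:
 assumes K: "!!P G. finite P ==> finite G ==> ALL g:G. snd (snd g) > 0 ==>
   real (SUM g:G. card {p:P. on_circle g p}) <= K*planar_bound (rc P) (rc G)"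
  and S: "is_sphere S" and fin: "finite P" "finite \<C>" and P: "P <= S" and \<C>: "!!ga. ga:\<C> ==> is_circle ga & ga <= S"
 shows "real (SUM ga:\<C>. card {p:P. p:ga}) <= K*planar_bound (rc P) (rc \<C>)"
proof -
 obtain z R where zR: "R > 0" "S = sphere z R" using S unfolding is_sphere_def by blast
 define data where "data = (%ga. SOME t :: (real^3) \<times> (real^3) \<times> real. norm (fst (snd t)) = 1 & snd (snd t) > 0 &
  ga = {x. dist x (fst t) = snd (snd t) & fst (snd t)\<bullet>(x - fst t) = 0})"
 define cc where "cc = (%ga. fst (data ga))"
 define uu where "uu = (%ga. fst (snd (data ga)))"
 define rr where "rr = (%ga. snd (snd (data ga)))"
 have c: "norm (uu ga) = 1" "rr ga > 0" "ga = {x. dist x (cc ga) = rr ga & uu ga\<bullet>(x - cc ga) = 0}" if g: "ga:\<C>" for ga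
 proof -
  obtain c u r where "norm u = 1" "r > 0" "ga = {x. dist x c = r & u\<bullet>(x - c) = 0}" by (rule is_circleE[OF conjunct1[OF \<C>[OF g]]])
  hence "EX t :: (real^3) \<times> (real^3) \<times> real. norm (fst (snd t)) = 1 & snd (snd t) > 0 &
   ga = {x. dist x (fst t) = snd (snd t) & fst (snd t)\<bullet>(x - fst t) = 0}" by (intro exI[of _ "(c, u, r)"]) simp
  from someI_ex[OF this]
  have "norm (fst (snd (data ga))) = 1 & snd (snd (data ga)) > 0 &
   ga = {x. dist x (fst (data ga)) = snd (snd (data ga)) & fst (snd (data ga))\<bullet>(x - fst (data ga)) = 0}"
   unfolding data_def .
  thus "norm (uu ga) = 1" "rr ga > 0" "ga = {x. dist x (cc ga) = rr ga & uu ga\<bullet>(x - cc ga) = 0}"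
   unfolding cc_def uu_def rr_def by blast+
 qed
 \<comment> \<open>Homogeneous quadratic conditions on \<open>w\<close>. With
   \<open>n = w / |w|\<close>, \<open>F1\<close> vanishes if \<open>z + R n\<close> is in the plane
   of the circle, \<open>F2\<close> if it equals \<open>p\<close>; squaring removes the
   norm.\<close>
 define F1 where "F1 = (%ga w. R^2*((w\<bullet>uu ga)*(w\<bullet>uu ga)) - (uu ga\<bullet>(cc ga - z))\<^sup>2*(w\<bullet>w))"
 define F2 where "F2 = (%p w. R^2*(w\<bullet>w) - (w\<bullet>(p - z))*(w\<bullet>(p - z)))"
 have lin2: "polyf 2 (%w :: real^3. (w\<bullet>v)*(w\<bullet>v))" for v
  using polyf_mult[OF polyf_inner[of 0 v] polyf_inner[of 0 v]] by (simp add: numeral_2_eq_2)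
 have "EX w. ALL f:insert (%w. w\<bullet>w) (F1 ` \<C> \<union> F2 ` P). f w ~= 0"
 proof (rule polyf_common_nonzero)
  show "finite (insert (%w. w\<bullet>w) (F1 ` \<C> \<union> F2 ` P))" using fin by simp
  fix f assume "f:insert (%w. w\<bullet>w) (F1 ` \<C> \<union> F2 ` P)"
  then consider "f = (%w. w\<bullet>w)" | ga where "ga:\<C>" "f = F1 ga" | p where "p:P" "f = F2 p" by blast
  thus "(EX d. polyf d f) & (EX x. f x ~= 0)"
  proof cases
   case 1
   have "(axis 1 1 :: real^3)\<bullet>axis 1 1 ~= 0" by simp
   thus ?thesis using polyf_inner_self unfolding 1 by blast
  next
   case 2
   have "polyf 2 (F1 ga)" unfolding F1_def by (intro polyf_diff polyf_cmult lin2 polyf_inner_self)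
   moreover have "EX w. F1 ga w ~= 0"
   proof (cases "uu ga\<bullet>(cc ga - z) = 0")
    case True
    have "uu ga\<bullet>uu ga = 1" using c(1)[OF 2(1)] by (simp add: norm_eq_sqrt_inner)
    hence "F1 ga (uu ga) = R^2" by (simp add: F1_def True)
    thus ?thesis using zR(1) by (intro exI[of _ "uu ga"]) simp
   next
    case False
    obtain e where e: "norm e = 1" "uu ga\<bullet>e = 0" by (rule unit_perp_exists)
    have "F1 ga e ~= 0" using e False by (simp add: F1_def inner_commute[of e "uu ga"] norm_eq_sqrt_inner)
    thus ?thesis by blast
   qed
   ultimately show ?thesis unfolding 2(2) by blast
  next
   case 3
   have "polyf 2 (F2 p)" unfolding F2_def by (intro polyf_diff polyf_cmult lin2 polyf_inner_self)
   moreover obtain e where e: "norm e = 1" "(p - z)\<bullet>e = 0" by (rule unit_perp_exists)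
   have "e\<bullet>(p - z) = 0" "e\<bullet>e = 1" using e by (simp_all add: inner_commute norm_eq_sqrt_inner)
   hence "F2 p e ~= 0" using zR(1) by (simp add: F2_def)
   ultimately show ?thesis unfolding 3(2) by blast
  qed
 qed
 then obtain w where w': "ALL f:insert (%w. w\<bullet>w) (F1 ` \<C> \<union> F2 ` P). f w ~= 0" ..
 have w: "w\<bullet>w ~= 0" by (rule bspec[OF w' insertI1])
 have wC: "F1 ga w ~= 0" if "ga:\<C>" for ga by (rule bspec[OF w']) (use that in simp)
 have wP: "F2 p w ~= 0" if "p:P" for p by (rule bspec[OF w']) (use that in simp)
 define n where "n = (1/norm w) *\<^sub>R w"
 define o' where "o' = z+R *\<^sub>R n"
 have w0: "w ~= 0" using w by auto
 have n: "norm n = 1" "w = norm w *\<^sub>R n" using w0 by (simp_all add: n_def)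
 have nn: "n\<bullet>n = 1" using n(1) by (simp add: norm_eq_sqrt_inner)
 have offP: "o' ~: P"
 proof
  assume a: "o':P"
  have "o' - z = R *\<^sub>R n" by (simp add: o'_def)
  hence "F2 o' w = 0" using nn unfolding F2_def by (subst (1 2 3 4) n(2)) (simp add: power2_eq_square)
  thus False using wP[OF a] by simp
 qed
 have offC: "uu ga\<bullet>(cc ga - o') ~= 0" if g: "ga:\<C>" for ga
 proof
  assume "uu ga\<bullet>(cc ga - o') = 0"
  hence a: "uu ga\<bullet>(cc ga - z) = R*(uu ga\<bullet>n)" by (simp add: o'_def inner_diff_right inner_add_right)
  have "F1 ga w = 0" unfolding F1_def a using nn
   by (subst (1 2 3 4) n(2)) (simp add: power2_eq_square inner_commute[of n "uu ga"])
  thus False using wC[OF g] by simp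
 qed
 obtain e1 where e1: "norm e1 = 1" "n\<bullet>e1 = 0" by (rule unit_perp_exists)
 define e2 where "e2 = cross3 n e1"
 note ex = orthonormal_expansion[OF n(1) e1, folded e2_def]
 have ex': "e1\<bullet>e2 = 0" "n\<bullet>e2 = 0" "e1\<bullet>n = 0" using ex(5,6) e1(2) by (simp_all add: inner_commute)
 \<comment> \<open>Inversion about \<open>o'\<close>, relative to \<open>o'\<close> as origin; the
   sphere goes to the plane of points whose inner product with \<open>n\<close> is
   \<open>- 1 / (2 R)\<close>.\<close>
 define \<iota> where "\<iota> = (%x. (1/((x - o')\<bullet>(x - o'))) *\<^sub>R (x - o'))"
 define ph where "ph = (%x. (\<iota> x\<bullet>e1, \<iota> x\<bullet>e2))"
 have iota: "\<iota> x\<bullet>n = - 1/(2*R)" "(x - o')\<bullet>(x - o') ~= 0" "\<iota> x\<bullet>\<iota> x = 1/((x - o')\<bullet>(x - o'))" if x: "x:S - {o'}" for x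
 proof -
  define v where "v = x - o'"
  have v: "v\<bullet>v ~= 0" using x by (simp add: v_def)
  thus "(x - o')\<bullet>(x - o') ~= 0" by (simp add: v_def)
  have "norm (x - z) = R" using x by (simp add: zR(2) dist_norm norm_minus_commute)
  hence "(v+R *\<^sub>R n)\<bullet>(v+R *\<^sub>R n) = R^2" by (simp add: v_def o'_def power2_norm_eq_inner[symmetric])
  moreover have "(v+R *\<^sub>R n)\<bullet>(v+R *\<^sub>R n) = v\<bullet>v+2*R*(v\<bullet>n)+R^2*(n\<bullet>n)"
   by (simp add: inner_add_left inner_add_right inner_commute[of n v] power2_eq_square algebra_simps)
  ultimately have "v\<bullet>v+2*R*(v\<bullet>n) = 0" using nn by simp
  hence "v\<bullet>n = - (v\<bullet>v)/(2*R)" using zR(1) by (simp add: field_simps)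
  thus "\<iota> x\<bullet>n = - 1/(2*R)" using v by (simp add: \<iota>_def v_def[symmetric])
  show "\<iota> x\<bullet>\<iota> x = 1/((x - o')\<bullet>(x - o'))" using v by (simp add: \<iota>_def v_def[symmetric])
 qed
 have exp: "\<iota> x = fst (ph x) *\<^sub>R e1+snd (ph x) *\<^sub>R e2+(- 1/(2*R)) *\<^sub>R n" if x: "x:S - {o'}" for x
  using ex(1)[of "\<iota> x"] unfolding iota(1)[OF x] by (simp add: ph_def)
 show ?thesis
 proof (rule transfer_to_plane[OF K fin, where S = "S - {o'}" and ph = ph])
  show "inj_on ph (S - {o'})"
  proof (rule inj_onI)
   fix x y assume xy: "x:S - {o'}" "y:S - {o'}" "ph x = ph y"
   have i: "\<iota> x = \<iota> y" using exp[OF xy(1)] exp[OF xy(2)] xy(3) by simp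
   hence "(x - o')\<bullet>(x - o') = (y - o')\<bullet>(y - o')" using iota(3)[OF xy(1)] iota(3)[OF xy(2)] by simp
   hence "x - o' = y - o'" using i iota(2)[OF xy(1)] unfolding \<iota>_def by simp
   thus "x = y" by simp
  qed
  show "P <= S - {o'}" using P offP by blast
  fix ga assume g: "ga:\<C>"
  thus "EX x:ga. EX y:ga. x ~= y" using \<C> circle_two_points by blast
  have "o' ~: ga"
  proof
   assume "o':ga"
   hence "uu ga\<bullet>(o' - cc ga) = 0" using c(3)[OF g] by blast
   thus False using offC[OF g] by (simp add: inner_diff_right)
  qed
  thus "ga <= S - {o'}" using \<C>[OF g] by blast
  define u where "u = uu ga"
  define k where "k = u\<bullet>(cc ga - o')"
  have k: "k ~= 0" using offC[OF g] by (simp add: k_def u_def)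
  \<comment> \<open>The plane \<open>u . v = k\<close> of the circle, where
    \<open>v = x - o'\<close>, becomes \<open>u . \<iota> x = k |\<iota> x|^2\<close>; these are the
    coefficients after completing squares.\<close>
  define a b rh where "a = (u\<bullet>e1)/(2 * k)" and "b = (u\<bullet>e2)/(2 * k)" and "rh = a^2+b^2 - 1/(4*R^2) - (u\<bullet>n)/(2*R * k)"
  have "x:ga \<longleftrightarrow> (fst (ph x) - a)\<^sup>2+(snd (ph x) - b)^2 = rh" if x: "x:S - {o'}" for x
  proof -
   define X Y where "X = fst (ph x)" and "Y = snd (ph x)"
   define v where "v = x - o'"
   have v: "v\<bullet>v ~= 0" using iota(2)[OF x] by (simp add: v_def)
   have e: "\<iota> x = X *\<^sub>R e1+Y *\<^sub>R e2+(- 1/(2*R)) *\<^sub>R n" using exp[OF x] by (simp add: X_def Y_def)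
   have n1: "\<iota> x\<bullet>\<iota> x = X^2+Y^2+1/(4*R^2)"
    unfolding e using ex(2-6) ex' e1(2) by (simp add: inner_add_left inner_add_right inner_diff_left inner_diff_right power2_eq_square)
   have n2: "u\<bullet>\<iota> x = X*(u\<bullet>e1)+Y*(u\<bullet>e2) - (u\<bullet>n)/(2*R)" unfolding e by (simp add: inner_add_right inner_diff_right)
   have "x:ga \<longleftrightarrow> u\<bullet>(x - cc ga) = 0"
    using circle_in_sphere[OF c(1)[OF g] c(2)[OF g] c(3)[OF g], of z R x] \<C>[OF g] x c(3)[OF g] zR(2) unfolding u_def by blast
   also have "... \<longleftrightarrow> u\<bullet>v = k" by (auto simp: k_def v_def inner_diff_right)
   also have "... \<longleftrightarrow> u\<bullet>\<iota> x = k*(\<iota> x\<bullet>\<iota> x)"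
   proof -
    have "u\<bullet>\<iota> x = (u\<bullet>v)/(v\<bullet>v)" by (simp add: \<iota>_def v_def[symmetric])
    thus ?thesis unfolding iota(3)[OF x] v_def[symmetric] using v by simp
   qed
   also have "... \<longleftrightarrow> (u\<bullet>\<iota> x)/k = \<iota> x\<bullet>\<iota> x" using k by (auto simp: field_simps)
   also have "(u\<bullet>\<iota> x)/k = 2*a*X+2*b*Y - (u\<bullet>n)/(2*R * k)"
    unfolding n2 a_def b_def using k zR(1) by (simp add: field_simps)
   also have "(2*a*X+2*b*Y - (u\<bullet>n)/(2*R * k) = \<iota> x\<bullet>\<iota> x) \<longleftrightarrow> (X - a)\<^sup>2+(Y - b)^2 = rh"
    unfolding n1 rh_def power2_diff by (auto simp: algebra_simps)
   finally show ?thesis by (simp add: X_def Y_def)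
  qed
  thus "EX a b rh. ALL x:S - {o'}. x:ga \<longleftrightarrow> (fst (ph x) - a)\<^sup>2+(snd (ph x) - b)^2 = rh" by blast
 qed
qed

lemma surface_circle_incidences:
 "EX K::real. K >= 1 & (ALL S P \<C>. is_plane S | is_sphere S --> finite P --> finite \<C> --> P <= S -->
  (ALL ga:\<C>. is_circle ga & ga <= S) --> real (SUM ga:\<C>. card {p:P. p:ga}) <= K*planar_bound (rc P) (rc \<C>))"
proof -
 obtain K :: real where K: "K >= 1" "!!P G. finite P ==> finite G ==> ALL g:G. snd (snd g) > 0 ==>
  real (SUM g:G. card {p:P. on_circle g p}) <= K*planar_bound (rc P) (rc G)"
  using planar_incidences by iprover
 show ?thesis
 proof (rule exI[of _ K], intro conjI K(1) allI impI)
  fix S P \<C> assume a: "is_plane S | is_sphere S" "finite P" "finite \<C>" "P <= S" "ALL ga:\<C>. is_circle ga & ga <= S"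
  from a(1) show "real (SUM ga:\<C>. card {p:P. p:ga}) <= K*planar_bound (rc P) (rc \<C>)"
  proof
   assume s: "is_plane S"
   show ?thesis by (rule plane_circle_incidences[OF K(2) s a(2-4)]) (use a(5) in simp_all)
  next
   assume s: "is_sphere S"
   show ?thesis by (rule sphere_circle_incidences[OF K(2) s a(2-4)]) (use a(5) in simp_all)
  qed
 qed
qed

text \<open>Three distinct points of a circle are not collinear, so their plane and the bisecting
  planes of two chords fix axis and centre.\<close>

lemma circle3_unique:
 assumes ga: "is_circle ga" "is_circle ga'" and on: "p:ga" "q:ga" "s:ga" "p:ga'" "q:ga'" "s:ga'"
  and ne: "p ~= q" "p ~= s" "q ~= s"
 shows "ga = ga'"
proof -
 obtain c u r where c: "norm u = 1" "r > 0" "ga = {x. dist x c = r & u\<bullet>(x - c) = 0}" by (rule is_circleE[OF ga(1)])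
 obtain c' u' r' where c': "norm u' = 1" "r' > 0" "ga' = {x. dist x c' = r' & u'\<bullet>(x - c') = 0}" by (rule is_circleE[OF ga(2)])
 define v w where "v = q - p" and "w = s - p"
 have vw: "v ~= 0" "w ~= 0" "v ~= w" using ne by (auto simp: v_def w_def)
 have half: "2*(t\<bullet>(d - p)) = t\<bullet>t" if "dist p d = rh" "dist (p+t) d = rh" for t d rh
 proof -
  have "(p - d)\<bullet>(p - d) = rh^2" "(p - d+t)\<bullet>(p - d+t) = rh^2" using that by (auto simp: dist_norm power2_norm_eq_inner[symmetric] algebra_simps)
  hence "2*(t\<bullet>(p - d))+t\<bullet>t = 0" by (simp add: inner_add_left inner_add_right inner_commute[of "p - d" t])
  thus ?thesis by (simp add: inner_diff_right)
 qed
 have pv: "p+v = q" "p+w = s" by (simp_all add: v_def w_def)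
 have h: "2*(v\<bullet>(c - p)) = v\<bullet>v" "2*(w\<bullet>(c - p)) = w\<bullet>w" "2*(v\<bullet>(c' - p)) = v\<bullet>v" "2*(w\<bullet>(c' - p)) = w\<bullet>w"
  using half[of c r v] half[of c r w] half[of c' r' v] half[of c' r' w] on unfolding pv by (auto simp: c(3) c'(3))
 have perp: "u\<bullet>v = 0" "u\<bullet>w = 0" "u'\<bullet>v = 0" "u'\<bullet>w = 0" "u\<bullet>(c - p) = 0" "u'\<bullet>(c' - p) = 0"
  using on by (auto simp: c(3) c'(3) v_def w_def inner_diff_right)
 have cr: "cross3 v w ~= 0"
 proof
  assume "cross3 v w = 0"
  hence "(v\<bullet>w) *\<^sub>R v - (v\<bullet>v) *\<^sub>R w = 0" using Lagrange[of v v w] by simp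
  hence eq: "(v\<bullet>v) *\<^sub>R w = (v\<bullet>w) *\<^sub>R v" by simp
  define VV VW WW where "VV = v\<bullet>v" and "VW = v\<bullet>w" and "WW = w\<bullet>w"
  have pos: "VV > 0" "WW > 0" using vw by (simp_all add: VV_def WW_def)
  have "VV*(2*(w\<bullet>(c - p))) = VW*(2*(v\<bullet>(c - p)))" using arg_cong[OF eq, of "%x. 2*(x\<bullet>(c - p))"] by (simp add: VV_def VW_def)
  hence "VV*WW = VW*VV" unfolding h VV_def[symmetric] WW_def[symmetric] .
  hence 1: "WW = VW" using pos by simp
  have "VV*WW = VW*VW" using arg_cong[OF eq, of "%x. x\<bullet>w"] by (simp add: VV_def VW_def WW_def)
  hence 2: "VV = VW" using 1 pos by simp
  have "(v - w)\<bullet>(v - w) = VV - 2*VW+WW" by (simp add: VV_def VW_def WW_def inner_diff_left inner_diff_right inner_commute[of w v])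
  thus False using 1 2 vw(3) by simp
 qed
 obtain k where k: "u = k *\<^sub>R cross3 v w" using perp_parallel_cross[OF perp(1,2) cr] by blast
 obtain k' where k': "u' = k' *\<^sub>R cross3 v w" using perp_parallel_cross[OF perp(3,4) cr] by blast
 have kk: "k ~= 0" "k' ~= 0" using k k' c(1) c'(1) by auto
 define M where "M = cross3 v w"
 have M: "M\<bullet>(c - p) = 0" "M\<bullet>(c' - p) = 0" using perp(5,6) kk unfolding k k' M_def by simp_all
 have "c - c' = 0"
 proof -
  define d where "d = c - c'"
  have "d = (c - p) - (c' - p)" by (simp add: d_def)
  hence dd: "t\<bullet>d = t\<bullet>(c - p) - t\<bullet>(c' - p)" for t by (simp only: inner_diff_right[of t "c - p" "c' - p"])
  have d: "d\<bullet>v = 0" "d\<bullet>w = 0" "d\<bullet>M = 0"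
   unfolding inner_commute[of d] dd using h M by linarith+
  obtain l where "d = l *\<^sub>R M" using perp_parallel_cross[OF d(1,2) cr] by (auto simp: M_def)
  thus ?thesis using d(3) cr by (auto simp: d_def[symmetric] M_def)
 qed
 hence cc: "c = c'" by simp
 have "r = r'" using on(1,4) by (auto simp: c(3) c'(3) cc)
 moreover have "u\<bullet>x = 0 \<longleftrightarrow> u'\<bullet>x = 0" for x using kk by (simp add: k k')
 ultimately show ?thesis by (simp add: c(3) c'(3) cc)
qed

section \<open>Adding the bounds of the surfaces\<close>

lemma holder_sum:
 fixes a b :: "'i => real"
 assumes S: "finite S" and nn: "!!i. i:S ==> a i >= 0" "!!i. i:S ==> b i >= 0" and th: "0 < th" "th < 1"
 shows "(SUM i:S. a i powr th*b i powr (1 - th)) <= (SUM i:S. a i) powr th*(SUM i:S. b i) powr (1 - th)"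
proof -
 define A B where "A = (SUM i:S. a i)" and "B = (SUM i:S. b i)"
 have AB: "A >= 0" "B >= 0" using nn by (auto simp: A_def B_def intro: sum_nonneg)
 show ?thesis
 proof (cases "A = 0 | B = 0")
  case True
  have "A = 0 \<longleftrightarrow> (ALL i:S. a i = 0)" unfolding A_def by (rule sum_nonneg_eq_0_iff[OF S nn(1)])
  moreover have "B = 0 \<longleftrightarrow> (ALL i:S. b i = 0)" unfolding B_def by (rule sum_nonneg_eq_0_iff[OF S nn(2)])
  ultimately have "ALL i:S. a i = 0 | b i = 0" using True by blast
  hence "(SUM i:S. a i powr th*b i powr (1 - th)) = 0" using th by (intro sum.neutral) auto
  moreover have "0 <= A powr th*B powr (1 - th)" by simp
  ultimately show ?thesis unfolding A_def B_def by linarith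
 next
  case False
  hence pos: "A > 0" "B > 0" using AB by auto
  have "a i powr th*b i powr (1 - th) <= A powr th*B powr (1 - th)*(th*(a i/A)+(1 - th)*(b i/B))" if i: "i:S" for i
  proof (cases "a i = 0 | b i = 0")
   case True
   have "0 <= th*(a i/A)+(1 - th)*(b i/B)" using pos nn i th by simp
   hence "0 <= A powr th*B powr (1 - th)*(th*(a i/A)+(1 - th)*(b i/B))" by simp
   moreover have "a i powr th*b i powr (1 - th) = 0" using True th by auto
   ultimately show ?thesis by linarith
  next
   case False
   hence ab: "a i/A > 0" "b i/B > 0" using nn[OF i] pos by auto
   have "(a i/A) powr th*(b i/B) powr (1 - th) <= th*(a i/A)+(1 - th)*(b i/B)"
    using ab th by (intro Youngs_inequality_0) auto
   hence "A powr th*B powr (1 - th)*((a i/A) powr th*(b i/B) powr (1 - th)) <= A powr th*B powr (1 - th)*(th*(a i/A)+(1 - th)*(b i/B))"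
    by (rule mult_left_mono) simp
   moreover have "A powr th*B powr (1 - th)*((a i/A) powr th*(b i/B) powr (1 - th)) = a i powr th*b i powr (1 - th)"
    using pos nn[OF i] by (simp add: powr_divide)
   ultimately show ?thesis by simp
  qed
  hence "(SUM i:S. a i powr th*b i powr (1 - th)) <= (SUM i:S. A powr th*B powr (1 - th)*(th*(a i/A)+(1 - th)*(b i/B)))" by (rule sum_mono)
  also have "... = A powr th*B powr (1 - th)*(th*(A/A)+(1 - th)*(B/B))"
   by (simp only: sum_distrib_left[symmetric] sum.distrib sum_divide_distrib[symmetric] A_def[symmetric] B_def[symmetric])
  also have "... = A powr th*B powr (1 - th)" using pos by simp
  finally show ?thesis by (simp add: A_def B_def)
 qed
qed

text \<open>The logarithm decreases in \<open>x\<close> while the power increases. For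
  \<open>y = q / x\<close> the logarithmic factor changes at most by \<open>1 + ln y <= y^2\<close>,
  and \<open>(y^2)^(2/11)\<close> is exactly the growth \<open>y^(4/11)\<close> of the
  power.\<close>

lemma log_factor_mono:
 fixes x q M :: real
 assumes "0 < x" "x <= q" "M > 0"
 shows "x powr (4/11)*max 1 (ln (M/x)) powr (2/11) <= q powr (4/11)*max 1 (ln (M/q)) powr (2/11)"
proof -
 define l where "l = max 1 (ln (M/q))"
 define y where "y = q/x"
 have y: "y >= 1" using assms by (simp add: y_def)
 have l: "l >= 1" "ln (M/q) <= l" by (simp_all add: l_def)
 have "ln (M/x) = ln (M/q)+ln y" using assms by (simp add: y_def ln_div)
 also have "... <= l+ln y*l" using l y by (intro add_mono) (auto simp: mult_le_cancel_left1)
 also have "... = l*(1+ln y)" by (simp add: algebra_simps)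
 finally have "max 1 (ln (M/x)) <= l*(1+ln y)" using l y mult_mono[of 1 l 1 "1+ln y"] by simp
 also have "... <= l*y^2"
 proof -
  have "1+ln y <= y" using ln_le_minus_one[of y] y by simp
  also have "y <= y\<^sup>2" using y by (simp add: power2_eq_square)
  finally show ?thesis using l by (intro mult_left_mono) auto
 qed
 finally have "max 1 (ln (M/x)) powr (2/11) <= (l*y^2) powr (2/11)" by (intro powr_mono2) auto
 also have "... = l powr (2/11)*(q powr (4/11)/x powr (4/11))"
 proof -
  have "(y^2) powr (2/11) = y powr (4/11)" using y by (simp add: powr_powr powr_numeral[symmetric] del: powr_numeral)
  thus ?thesis using l y assms by (simp add: powr_mult y_def powr_divide)
 qed
 finally show ?thesis using assms by (simp add: l_def field_simps)
qed

text \<open>The excess in the exponent of \<open>n'\<close> is moved to \<open>q\<close>, which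
  leaves products \<open>m'^th n'^(1 - th)\<close> that Hoelder's inequality can sum.\<close>

lemma planar_bound_le:
 assumes m': "m' <= m" "0 <= m'" "1 <= m" and n': "1 <= n'" "n' <= q"
 shows "planar_bound m' n' <= q powr (1/3)*(m' powr (2/3)*n' powr (1 - 2/3))
  + q powr (4/11)*max 1 (ln (m^3/q)) powr (2/11)*(m' powr (6/11)*n' powr (1 - 6/11))+m'+n'"
proof -
 have q: "q >= 1" using n' by simp
 have "n' powr (2/3) = n' powr (1/3)*n' powr (1 - 2/3)" using n' by (simp add: powr_add[symmetric])
 also have "... <= q powr (1/3)*n' powr (1 - 2/3)" using n' by (intro mult_right_mono powr_mono2) auto
 finally have "m' powr (2/3)*n' powr (2/3) <= m' powr (2/3)*(q powr (1/3)*n' powr (1 - 2/3))" by (rule mult_left_mono) simp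
 hence 1: "m' powr (2/3)*n' powr (2/3) <= q powr (1/3)*(m' powr (2/3)*n' powr (1 - 2/3))" by (simp add: mult_ac)
 have lm: "max 1 (ln (m'^3/n')) <= max 1 (ln (m^3/n'))"
 proof (cases "m' = 0")
  case False
  hence "m'^3/n' <= m^3/n'" "m'^3/n' > 0" using m' n' by (auto intro: divide_right_mono power_mono)
  hence "ln (m'^3/n') <= ln (m^3/n')" by (subst ln_le_cancel_iff) auto
  thus ?thesis by simp
 qed simp
 have "n' powr (9/11)*max 1 (ln (m'^3/n')) powr (2/11) <= n' powr (9/11)*max 1 (ln (m^3/n')) powr (2/11)"
  using lm by (intro mult_left_mono powr_mono2) auto
 also have "... = n' powr (1 - 6/11)*(n' powr (4/11)*max 1 (ln (m^3/n')) powr (2/11))"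
 proof -
  have "n' powr (9/11) = n' powr (1 - 6/11)*n' powr (4/11)" using n' by (simp add: powr_add[symmetric])
  thus ?thesis by (simp only: mult.assoc)
 qed
 also have "... <= n' powr (1 - 6/11)*(q powr (4/11)*max 1 (ln (m^3/q)) powr (2/11))"
  using n' m' by (intro mult_left_mono log_factor_mono) auto
 finally have "m' powr (6/11)*(n' powr (9/11)*max 1 (ln (m'^3/n')) powr (2/11)) <= m' powr (6/11)*(n' powr (1 - 6/11)*(q powr (4/11)*max 1 (ln (m^3/q)) powr (2/11)))"
  by (rule mult_left_mono) simp
 hence 2: "m' powr (6/11)*n' powr (9/11)*max 1 (ln (m'^3/n')) powr (2/11) <= q powr (4/11)*max 1 (ln (m^3/q)) powr (2/11)*(m' powr (6/11)*n' powr (1 - 6/11))"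
  by (simp only: mult_ac)
 show ?thesis unfolding planar_bound_def by (intro add_mono 1 2 order_refl)
qed

section \<open>Circles in three-space\<close>

lemma circle_parametrization:
 assumes "is_circle ga"
 shows "EX c e e'. ga = circ c e e' & inj (circ_param c e e') & continuous_on UNIV (circ_param c e e')"
proof -
 obtain c u r where c: "norm u = 1" "r > 0" "ga = {x. dist x c = r & u\<bullet>(x - c) = 0}" by (rule is_circleE[OF assms])
 obtain e1 where e1: "norm e1 = 1" "u\<bullet>e1 = 0" by (rule unit_perp_exists)
 define e where "e = r *\<^sub>R e1"
 define e' where "e' = cross3 u e"
 have e: "norm e = r" "u\<bullet>e = 0" using e1 c(2) by (simp_all add: e_def)
 have g: "ga = circ c e e'" unfolding c(3) e'_def by (rule circle_is_circ[OF c(1) e(1) c(2) e(2)])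
 have ee: "e\<bullet>e = r^2" "e'\<bullet>e = 0" "e\<bullet>e' = 0" using e(1) by (simp_all add: e'_def power2_norm_eq_inner[symmetric] dot_cross_self)
 have "(norm (cross3 u e))^2 = (norm u)^2*(norm e)^2 - (u\<bullet>e)\<^sup>2" by (rule norm_cross)
 hence ee': "e'\<bullet>e' = r^2" using c(1) e by (simp add: e'_def power2_norm_eq_inner)
 have r2: "r^2 ~= 0" using c(2) by simp
 have inj: "s = t" if eq: "circ_param c e e' s = circ_param c e e' t" for s t
 proof -
  have "(1 - s\<^sup>2)/(1+s^2)*r^2 = (1 - t\<^sup>2)/(1+t^2)*r^2" "2 * s/(1+s^2)*r^2 = 2*t/(1+t^2)*r^2"
   using arg_cong[OF eq, of "%x. (x - c)\<bullet>e"] arg_cong[OF eq, of "%x. (x - c)\<bullet>e'"]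
   by (simp_all add: circ_param_def inner_add_left ee ee')
  hence eqs: "(1 - s\<^sup>2)/(1+s^2) = (1 - t\<^sup>2)/(1+t^2)" "2 * s/(1+s^2) = 2*t/(1+t^2)" using r2 by (metis mult_right_cancel)+
  have q: "(2*u/(1+u^2))/(1+(1 - u\<^sup>2)/(1+u^2)) = u" for u :: real
  proof -
   have "1+u^2 ~= 0" using one_plus_square_pos[of u] by linarith
   hence "1+(1 - u\<^sup>2)/(1+u^2) = 2/(1+u^2)" by (simp add: add_divide_eq_iff)
   thus ?thesis using \<open>1+u^2 ~= 0\<close> by simp
  qed
  show ?thesis using q[of s] q[of t] unfolding eqs by linarith
 qed
 have "1+t^2 ~= 0" for t :: real using one_plus_square_pos[of t] by linarith
 hence "continuous_on UNIV (circ_param c e e')" unfolding circ_param_def by (intro continuous_intros) auto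
 moreover have "inj (circ_param c e e')" by (rule injI) (rule inj)
 ultimately show ?thesis using g by blast
qed

lemma incidences_eq_sum:
 assumes "finite P" "finite \<C>"
 shows "incidences P \<C> = (SUM ga:\<C>. card {p:P. p:ga})"
proof -
 have "incidences P \<C> = card (SIGMA ga:\<C>. {p:P. p:ga})"
  unfolding incidences_def by (rule bij_betw_same_card[of prod.swap], rule bij_betw_byWitness[where f' = prod.swap]) auto
 also have "... = (SUM ga:\<C>. card {p:P. p:ga})" using assms by simp
 finally show ?thesis .
qed

text \<open>Three consecutive points of a circle that lie in a common cell determine the circle.\<close>

lemma crossing_circle_incidences:
 assumes fin: "finite P" "finite \<C>" and circ: "!!ga. ga:\<C> ==> is_circle ga"
  and cells: "sign_cells fs P \<S>" and F: "polyf d (prodf fs)"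
  and cross: "!!ga. ga:\<C> ==> EX y:ga. (PROD f:fs. f y) ~= 0"
 shows "(SUM ga:\<C>. card {p:P. p:ga}) <= card \<C> * (6*d+6)+(SUM S:\<S>. card S^3)"
proof -
 have cl: "finite fs" "!!f. f:fs ==> EX d. polyf d f" "\<S> <= Pow P"
  "!!x y. x:P ==> y:P ==> ALL f:fs. f x*f y > 0 ==> EX S:\<S>. x:S & y:S" and disj: "disjoint \<S>"
  using cells by (simp_all add: sign_cells_def)
 have finS: "finite \<S>" "!!S. S:\<S> ==> finite S" using cl(3) fin(1) by (auto intro: finite_subset)
 define L where "L = (%ga. {(a, b, c). a ~= b & a ~= c & b ~= c & a:ga & b:ga & c:ga & (EX S:\<S>. a:S & b:S & c:S)})"
 have Lsub: "L ga <= (UN S:\<S>. S \<times> S \<times> S)" for ga by (auto simp: L_def)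
 have finU: "finite (UN S:\<S>. S \<times> S \<times> S)" using finS by blast
 have finL: "finite (L ga)" for ga by (rule finite_subset[OF Lsub finU])
 have one: "card {p:P. p:ga} <= 6*d+6+card (L ga)" if g: "ga:\<C>" for ga
 proof -
  obtain c e e' where ce: "ga = circ c e e'" "inj (circ_param c e e')" "continuous_on UNIV (circ_param c e e')"
   using circle_parametrization[OF circ[OF g]] by blast
  define ps where "ps = circ_param c e e'"
  have psi: "inj ps" "continuous_on UNIV ps" "!!t. ps t:ga" "!!y. y:ga ==> y ~= c - e ==> EX t. ps t = y"
   using ce(2,3) circ_param_mem circ_param_surj unfolding ps_def ce(1) by blast+
  define A where "A = {t. ps t:P}"
  have "A = ps -` P" by (auto simp: A_def)
  hence finA: "finite A" using finite_vimageI[OF fin(1) psi(1)] by simp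
  have "{p:P. p:ga} <= insert (c - e) (ps ` A)" using psi(4) by (fastforce simp: A_def)
  hence "card {p:P. p:ga} <= card (insert (c - e) (ps ` A))" using finA by (intro card_mono) auto
  also have "... <= 1+card (ps ` A)" using card_insert_le_m1 by (metis add.commute card_insert_if finite_imageI finA le_add1 order_refl plus_1_eq_Suc)
  also have "card (ps ` A) <= card A" by (rule card_image_le[OF finA])
  finally have PA: "card {p:P. p:ga} <= 1+card A" by simp
  define xs where "xs = sorted_list_of_set A"
  let ?t = "%i. (ps (xs ! i), ps (xs ! (i+1)), ps (xs ! (i+2)))"
  have xs: "set xs = A" "length xs = card A" "distinct xs" using finA by (auto simp: xs_def)
  define W where "W = {i. i+2 < card A & (ALL j:{i..i+2}. ALL k:{i..i+2}. ALL f:fs. f (ps (xs ! j))*f (ps (xs ! k)) > 0)}"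
  obtain y where y: "y:ga" "(PROD f:fs. f y) ~= 0" using cross[OF g] by blast
  \<comment> \<open>Triples are windows with \<open>w = 2\<close>. Together with the missed point of
    the parametrisation the loss is \<open>1 + 2 + 3 (2 d + 1) = 6 d + 6\<close>.\<close>
  have "card A <= 2+(2+1)*(2*d+1)+card W"
   unfolding W_def xs_def
  proof (rule curve_windows[OF cl(1,2) F _ y finA])
   show "zeros_le (2*d+1) d ga" unfolding ce(1) by (rule zeros_le_circ)
   show "continuous_on {a..b} ps & inj_on ps {a..b} & ps ` {a..b} <= ga" for a b
    using continuous_on_subset[OF psi(2)] inj_on_subset[OF psi(1)] psi(3) by blast
  qed
  also have "card W <= card (L ga)"
  proof (rule card_inj_on_le[where f = "%i. ?t i"])
   show "inj_on (%i. ?t i) W"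
   proof (rule inj_onI)
    fix i j assume ij: "i:W" "j:W" "?t i = (ps (xs ! j), ps (xs ! (j+1)), ps (xs ! (j+2)))"
    hence l: "i < length xs" "j < length xs" using xs(2) by (auto simp: W_def)
    have "ps (xs ! i) = ps (xs ! j)" using ij(3) by simp
    hence "xs ! i = xs ! j" by (rule injD[OF psi(1)])
    thus "i = j" using nth_eq_iff_index_eq[OF xs(3) l] by simp
   qed
   show "(%i. ?t i) ` W <= L ga"
   proof (rule image_subsetI)
    fix i assume i: "i:W"
    hence l: "i+2 < length xs" "i+1 < length xs" "i < length xs" using xs(2) by (auto simp: W_def)
    have P: "ps (xs ! j):P" if "j < length xs" for j using nth_mem[OF that] xs(1) by (simp add: A_def)
    have ne: "ps (xs ! j) ~= ps (xs ! k)" if "j < length xs" "k < length xs" "j ~= k" for j k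
     using nth_eq_iff_index_eq[OF xs(3) that(1,2)] that(3) injD[OF psi(1), of "xs ! j" "xs ! k"] by blast
    have sgn: "EX S:\<S>. ps (xs ! i):S & ps (xs ! k):S" if "k:{i..i+2}" "k < length xs" for k
     using i that by (intro cl(4) P l(3)) (auto simp: W_def)
    obtain S1 where S1: "S1:\<S>" "ps (xs ! i):S1" "ps (xs ! (i+1)):S1" using sgn[of "i+1"] l(2) by auto
    obtain S2 where S2: "S2:\<S>" "ps (xs ! i):S2" "ps (xs ! (i+2)):S2" using sgn[of "i+2"] l(1) by auto
    have "S1 = S2" using disjointD[OF disj S1(1) S2(1)] S1(2) S2(2) by blast
    thus "?t i:L ga"
     using S1 S2 ne[OF l(3,2)] ne[OF l(3,1)] ne[OF l(2,1)] psi(3) unfolding L_def by auto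
   qed
  qed (rule finL)
  finally show ?thesis using PA by simp
 qed
 have "(SUM ga:\<C>. card (L ga)) = card (UN ga:\<C>. L ga)"
 proof (rule card_UN_disjoint[symmetric, OF fin(2)])
  show "ALL ga:\<C>. finite (L ga)" using finL by blast
  show "ALL ga:\<C>. ALL ga':\<C>. ga ~= ga' --> L ga \<inter> L ga' = {}"
  proof (intro ballI impI)
   fix ga ga' assume g: "ga:\<C>" "ga':\<C>" "ga ~= ga'"
   have "ga = ga'" if "(a, b, c):L ga" "(a, b, c):L ga'" for a b c
    using that circle3_unique[OF circ[OF g(1)] circ[OF g(2)], of a b c] by (simp add: L_def)
   thus "L ga \<inter> L ga' = {}" using g(3) by (metis disjoint_iff prod_cases3)
  qed
 qed
 also have "... <= card (UN S:\<S>. S \<times> S \<times> S)" using Lsub by (intro card_mono finU) blast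
 also have "... <= (SUM S:\<S>. card (S \<times> S \<times> S))" by (rule card_UN_le[OF finS(1)])
 also have "... = (SUM S:\<S>. card S^3)" by (simp add: card_cartesian_product power3_eq_cube mult.assoc)
 finally have 1: "(SUM ga:\<C>. card (L ga)) <= (SUM S:\<S>. card S^3)" .
 have "(SUM ga:\<C>. card {p:P. p:ga}) <= (SUM ga:\<C>. 6*d+6+card (L ga))" by (rule sum_mono[OF one])
 also have "... = card \<C> * (6*d+6)+(SUM ga:\<C>. card (L ga))" by (simp add: sum.distrib)
 finally show ?thesis using 1 by linarith
qed

text \<open>\<open>D = m^(3/7) n^(-1/7)\<close> equates \<open>n D\<close> with
  \<open>m^3 / D^6\<close>; rounding up costs \<open>n\<close>.\<close>

lemma partition_degree:
 fixes m n :: real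
 assumes m: "m > 0" "n > 0"
 shows "EX D::nat. D >= 1 & n*real D <= m powr (3/7)*n powr (6/7)+n & m^3/real D^6 <= m powr (3/7)*n powr (6/7)"
proof -
 define x where "x = m powr (3/7)*n powr (-1/7)"
 have x: "x > 0" using m by (simp add: x_def)
 define D where "D = nat \<lceil>x\<rceil>"
 have D: "real D <= x+1" "x <= real D" using x unfolding D_def by linarith+
 hence "D >= 1" using x by (cases D) auto
 have "n*real D <= n*(x+1)" using D(1) m by simp
 also have "... = m powr (3/7)*(n powr 1*n powr (-1/7))+n" using m by (simp add: x_def algebra_simps)
 also have "n powr 1*n powr (-1/7) = n powr (6/7)" by (subst powr_add[symmetric]) simp
 finally have 1: "n*real D <= m powr (3/7)*n powr (6/7)+n" .
 have "x^6 = x powr 6" using x by (simp add: powr_numeral)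
 also have "... = m powr (18/7)*n powr (-6/7)" using m by (simp add: x_def powr_mult powr_powr)
 finally have x6: "x^6 = m powr (18/7)*n powr (-6/7)" .
 have "(m powr (3/7)*n powr (6/7))*x^6 = (m powr (3/7)*m powr (18/7))*(n powr (6/7)*n powr (-6/7))" by (simp add: x6)
 also have "... = m powr 3" using m by (simp add: powr_add[symmetric])
 also have "... = m^3" using m by (simp add: powr_numeral)
 finally have "m^3/x^6 = m powr (3/7)*n powr (6/7)" using x by (simp add: field_simps)
 moreover have "m^3/real D^6 <= m^3/x^6" using x D(2) m by (intro divide_left_mono power_mono mult_pos_pos) auto
 ultimately show ?thesis using 1 \<open>D >= 1\<close> by auto
qed

text \<open>Incidences with circles of a surface: at most 31 through a smooth point that is not umbilic, and along a circle
 consisting of umbilic points the osculating sphere is constant, so the remaining incidences split into problems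
 on planes and spheres.\<close>

lemma circles_in_surface:
 fixes P :: "(real^3) set"
 assumes K: "K >= 1" "!!S P \<C>. is_plane S | is_sphere S ==> finite P ==> finite \<C> ==> P <= S ==>
   ALL ga:\<C>. is_circle ga & ga <= S ==> real (SUM ga:\<C>. card {p:P. p:ga}) <= K*planar_bound (rc P) (rc \<C>)"
  and fin: "finite P" "P ~= {}" "finite \<C>" and F: "polyf d F" "EX x. F x ~= 0"
  and circles: "!!ga. ga:\<C> ==> is_circle ga" "!!ga y. ga:\<C> ==> y:ga ==> F y = 0"
  and q: "!!S. is_plane S | is_sphere S ==> card {ga:\<C>. ga <= S} <= q"
 shows "real (SUM ga:\<C>. card {p:P. p:ga}) <= rc \<C> * real (12*d+2)+31*rc P
  + K*(real q powr (1/3)*(rc P powr (2/3)*rc \<C> powr (1 - 2/3))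
   + real q powr (4/11)*max 1 (ln (rc P^3/real q)) powr (2/11)*(rc P powr (6/11)*rc \<C> powr (1 - 6/11))
   + rc P+rc \<C>)"
proof -
 have zl: "zeros_le (2*d'+1) d' ga" if "ga:\<C>" for d' ga
  using circle_parametrization[OF circles(1)[OF that]] zeros_le_circ by blast
 have inf: "infinite ga" if g: "ga:\<C>" for ga
 proof
  assume fg: "finite ga"
  obtain c e e' where ce: "ga = circ c e e'" "inj (circ_param c e e')" using circle_parametrization[OF circles(1)[OF g]] by blast
  have "range (circ_param c e e') <= ga" using circ_param_mem ce(1) by auto
  thus False using finite_imageD[OF finite_subset[OF _ fg] ce(2)] infinite_UNIV_char_0 by blast
 qed
 obtain h :: "real^3 => real^3 => real" where h: "!!x. polyf d (h x)"
  "!!Y B. zeros_le B d Y ==> ALL y:Y. F y = 0 ==> EX E<=Y. finite E & card E <= B &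
   (ALL x:Y - E. (ALL y:Y. h x y = 0) & (EX v. dd (h x) v x ~= 0) & (ALL x':Y - E. h x' = h x))"
  by (rule smooth_representative[OF F]) (rule that; assumption)
 have "ALL ga:\<C>. EX E<=ga. finite E & card E <= 2*d+1 &
   (ALL x:ga - E. (ALL y:ga. h x y = 0) & (EX v. dd (h x) v x ~= 0) & (ALL x':ga - E. h x' = h x))"
  using h(2)[OF zl] circles(2) by blast
 from bchoice[OF this] obtain E where E0: "ALL ga:\<C>. E ga <= ga & finite (E ga) & card (E ga) <= 2*d+1 &
   (ALL x:ga - E ga. (ALL y:ga. h x y = 0) & (EX v. dd (h x) v x ~= 0) & (ALL x':ga - E ga. h x' = h x))" ..
 have E: "finite (E ga)" "card (E ga) <= 2*d+1" if "ga:\<C>" for ga using E0 that by auto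
 have zero: "h x y = 0" if "ga:\<C>" "x:ga - E ga" "y:ga" for ga x y using bspec[OF E0 that(1)] that(2,3) by metis
 have smooth: "EX v. dd (h x) v x ~= 0" if "ga:\<C>" "x:ga - E ga" for ga x using bspec[OF E0 that(1)] that(2) by metis
 have const: "h x' = h x" if "ga:\<C>" "x:ga - E ga" "x':ga - E ga" for ga x x' using bspec[OF E0 that(1)] that(2,3) by metis
 have nz: "grad (h x) x ~= 0" if l: "ga:\<C>" "x:ga - E ga" for ga x
 proof
  assume "grad (h x) x = 0"
  hence "dd (h x) v x = 0" for v using grad_inner[OF h(1), of x x v] by simp
  thus False using smooth[OF l] by blast
 qed
 define rep where "rep = (%ga. SOME x. x:ga - E ga)"
 have rep: "rep ga:ga - E ga" if "ga:\<C>" for ga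
 proof -
  have "ga - E ga ~= {}" using inf[OF that] E(1)[OF that] by (metis Diff_eq_empty_iff finite_subset)
  thus ?thesis unfolding rep_def by (metis ex_in_conv someI_ex)
 qed
 define umb where "umb = (%x. umbilic_at (h x) x)"
 let ?M = "%x. {ga:\<C>. x:ga - E ga & ~umb x}"
 let ?N = "%ga. {x:P. x:ga - E ga & ~umb x}"
 let ?U = "%ga. {x:P. x:ga - E ga & umb x}"
 define full where "full = {ga:\<C>. ALL x:ga. umbilic_at (h (rep ga)) x}"
 define T where "T = (%x. tangent_sphere (h x) x)"
 define TT where "TT = (%ga. T (rep ga))"
 have full: "full <= \<C>" "finite full" using fin(3) by (auto simp: full_def)
 \<comment> \<open>One instance of the umbilic equation, of degree \<open>5 d\<close>, is not
   identically zero on the circle and has at most \<open>2 (5 d) + 1\<close> zeros there.\<close>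
 have not_full: "card (?U ga) <= 10*d+1" if g: "ga:\<C> - full" for ga
 proof -
  have gC: "ga:\<C>" using g by simp
  define f where "f = h (rep ga)"
  obtain x0 where x0: "x0:ga" "~umbilic_at f x0" using g by (auto simp: full_def f_def)
  then obtain z w where zw: "quad f x0 (cross3 (grad f x0) z)*(cross3 (grad f x0) w\<bullet>cross3 (grad f x0) w)
    - quad f x0 (cross3 (grad f x0) w)*(cross3 (grad f x0) z\<bullet>cross3 (grad f x0) z) ~= 0" unfolding umbilic_at_def by auto
  have pf: "polyf d f" using h(1) by (simp add: f_def)
  define U where "U = (%x. quad f x (cross3 (grad f x) z)*(cross3 (grad f x) w\<bullet>cross3 (grad f x) w)
    - quad f x (cross3 (grad f x) w)*(cross3 (grad f x) z\<bullet>cross3 (grad f x) z))"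
  have U: "polyf (5*d) U" unfolding U_def by (rule polyf_umbilic[OF pf])
  have "U x0 ~= 0" using zw by (simp only: U_def not_False_eq_True)
  note ZZ = zeros_leD[OF zl[OF gC, of "5*d"] U x0(1) this]
  have "card (?U ga) <= card {y:ga. U y = 0}"
  proof (rule card_mono[OF ZZ(1)], rule subsetI)
   fix x assume "x:(?U ga)"
   hence x: "x:ga - E ga" "umbilic_at (h x) x" by (auto simp: umb_def)
   hence "umbilic_at f x" using const[OF gC rep[OF gC] x(1)] by (simp add: f_def)
   hence "U x = 0" by (simp add: U_def umbilic_at_def)
   thus "x:{y:ga. U y = 0}" using x(1) by simp
  qed
  thus ?thesis using ZZ(2) by simp
 qed
 have nonumb: "(SUM ga:\<C>. card (?N ga)) <= 31*card P"
 proof -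
  have "(SUM ga:\<C>. card (?N ga)) = card (SIGMA ga:\<C>. (?N ga))"
   using fin by simp
  also have "... = card (SIGMA x:P. (?M x))"
   by (rule bij_betw_same_card[of prod.swap], rule bij_betw_byWitness[where f' = prod.swap]) auto
  also have "... = (SUM x:P. card (?M x))" using fin by simp
  also have "... <= (SUM x:P. 31)"
  proof (rule sum_mono)
   fix x assume "x:P"
   show "card (?M x) <= 31"
   proof (cases "(?M x) = {}")
    case True
    thus ?thesis by (metis card.empty le0)
   next
    case False
    then obtain ga0 where g0: "ga0:\<C>" "x:ga0 - E ga0" "~umbilic_at (h x) x" by (auto simp: umb_def)
    show ?thesis
    proof (rule circles_through_nonumbilic_point[OF h(1) nz[OF g0(1,2)] g0(3)])
     show "finite (?M x)" using fin by simp
     show "is_circle ga & x:ga & (ALL y:ga. h x y = 0)" if "ga:(?M x)" for ga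
      using that circles(1) zero[of ga x] by blast
    qed
   qed
  qed
  finally show ?thesis by (simp add: mult.commute)
 qed
 have T_const: "T x = TT ga" "ga <= TT ga" "is_plane (TT ga) | is_sphere (TT ga)" "rep ga:TT ga" if l: "ga:full" "x:ga - E ga" for ga x
 proof -
  have gC: "ga:\<C>" using l(1) full by blast
  note r = rep[OF gC]
  define f where "f = h (rep ga)"
  have hx: "h x = f" using const[OF gC r l(2)] by (simp add: f_def)
  have pf: "polyf d f" using h(1) by (simp add: f_def)
  have z: "!!y. y:ga ==> f y = 0" using zero[OF gC r] by (simp add: f_def)
  have u: "!!y. y:ga ==> umbilic_at f y" using l(1) by (auto simp: full_def f_def)
  have nzr: "grad f (rep ga) ~= 0" using nz[OF gC r] by (simp add: f_def)
  have nzx: "grad f x ~= 0" using nz[OF gC l(2)] by (simp add: hx)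
  have mem: "x:ga" "rep ga:ga" using l(2) r by auto
  have TTf: "TT ga = tangent_sphere f (rep ga)" by (simp add: TT_def T_def f_def)
  show "T x = TT ga" unfolding TTf T_def hx by (rule tangent_sphere_constant[OF pf circles(1)[OF gC] z u mem(1) nzx mem(2) nzr])
  show "ga <= TT ga" unfolding TTf by (rule circle_in_tangent_sphere[OF pf circles(1)[OF gC] z mem(2) nzr u[OF mem(2)]])
  thus "rep ga:TT ga" using mem(2) by blast
  show "is_plane (TT ga) | is_sphere (TT ga)" unfolding TTf by (rule tangent_sphere_plane_or_sphere[OF u[OF mem(2)] nzr])
 qed
 define \<T> where "\<T> = TT ` full"
 \<comment> \<open>A point may lie on many of the surfaces but is assigned only to its own
   osculating surface \<open>T x\<close>; this makes the point sets disjoint, as Hoelder's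
   inequality requires.\<close>
 define PS where "PS = (%S. {x:P. T x = S & x:S})"
 define CS where "CS = (%S. {ga:full. TT ga = S})"
 define m n where "m = rc P" and "n = rc \<C>"
 define mS where "mS = (%S. rc (PS S))"
 define nS where "nS = (%S. rc (CS S))"
 have fT: "finite \<T>" using full by (simp add: \<T>_def)
 have finS: "finite (PS S)" "finite (CS S)" for S using fin full by (auto simp: PS_def CS_def)
 have sum_m: "(SUM S:\<T>. mS S) <= m"
 proof -
  have "(SUM S:\<T>. card (PS S)) <= (SUM S:\<T>. card {x:P. T x = S})" using fin by (intro sum_mono card_mono) (auto simp: PS_def)
  also have "... <= card P" by (rule sum_card_fibres_le[OF fin(1) fT])
  finally show ?thesis unfolding mS_def m_def of_nat_sum[symmetric] of_nat_le_iff .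
 qed
 have sum_n: "(SUM S:\<T>. nS S) <= n"
 proof -
  have "(SUM S:\<T>. card (CS S)) <= card full" unfolding CS_def by (rule sum_card_fibres_le[OF full(2) fT])
  also have "... <= card \<C>" by (rule card_mono[OF fin(3) full(1)])
  finally show ?thesis unfolding nS_def n_def of_nat_sum[symmetric] of_nat_le_iff .
 qed
 have S: "is_plane S | is_sphere S" "!!ga. ga:CS S ==> is_circle ga & ga <= S" "1 <= nS S" "nS S <= real q" if ST: "S:\<T>" for S
 proof -
  obtain ga where g: "ga:full" "S = TT ga" using ST by (auto simp: \<T>_def)
  show ps: "is_plane S | is_sphere S" unfolding g(2) using T_const(3)[OF g(1)] rep g(1) full(1) by blast
  show sub: "is_circle ga & ga <= S" if "ga:CS S" for ga
   using that T_const(2)[of ga] rep[of ga] full(1) circles(1)[of ga] unfolding CS_def by blast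
  have "CS S ~= {}" using g by (auto simp: CS_def)
  thus "1 <= nS S" using finS(2)[of S] by (simp add: nS_def Suc_le_eq card_gt_0_iff)
  have "card (CS S) <= card {ga:\<C>. ga <= S}" using fin sub full(1) by (intro card_mono) (auto simp: CS_def)
  also have "... <= q" by (rule q[OF ps])
  finally show "nS S <= real q" by (simp add: nS_def)
 qed
 define IS where "IS = (%S. real (SUM ga:CS S. card {p:PS S. p:ga}))"
 define Q1 Q2 where "Q1 = real q powr (1/3)" and "Q2 = real q powr (4/11)*max 1 (ln (m^3/real q)) powr (2/11)"
 have Q: "Q1 >= 0" "Q2 >= 0" by (simp_all add: Q1_def Q2_def)
 have m1: "1 <= m" using fin by (simp add: m_def Suc_le_eq card_gt_0_iff)
 define G where "G = (%S. Q1*(mS S powr (2/3)*nS S powr (1 - 2/3))+Q2*(mS S powr (6/11)*nS S powr (1 - 6/11))+mS S+nS S)"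
 have bound: "IS S <= K*G S" if ST: "S:\<T>" for S
 proof -
  have "IS S <= K*planar_bound (mS S) (nS S)" unfolding IS_def mS_def nS_def
  proof (rule K(2)[OF S(1)[OF ST] finS])
   show "PS S <= S" by (auto simp: PS_def)
   show "ALL ga:CS S. is_circle ga & ga <= S" using S(2)[OF ST] by blast
  qed
  also have "planar_bound (mS S) (nS S) <= G S" unfolding G_def Q1_def Q2_def
  proof (rule planar_bound_le[OF _ _ m1 S(3,4)[OF ST]])
   show "0 <= mS S" by (simp add: mS_def)
   show "mS S <= m" unfolding mS_def m_def of_nat_le_iff using fin by (intro card_mono) (auto simp: PS_def)
  qed
  hence "K*planar_bound (mS S) (nS S) <= K*G S" using K(1) by simp
  finally show ?thesis .
 qed
 have nn: "mS S >= 0" "nS S >= 0" for S by (simp_all add: mS_def nS_def)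
 have hold: "(SUM S:\<T>. mS S powr th*nS S powr (1 - th)) <= m powr th*n powr (1 - th)" if th: "0 < th" "th < 1" for th
 proof -
  have "(SUM S:\<T>. mS S powr th*nS S powr (1 - th)) <= (SUM S:\<T>. mS S) powr th*(SUM S:\<T>. nS S) powr (1 - th)"
   by (rule holder_sum[OF fT nn(1) nn(2) th])
  also have "... <= m powr th*n powr (1 - th)" using th sum_m sum_n
   by (intro mult_mono powr_mono2 sum_nonneg nn) auto
  finally show ?thesis .
 qed
 have sumG: "(SUM S:\<T>. G S) <= Q1*(m powr (2/3)*n powr (1 - 2/3))+Q2*(m powr (6/11)*n powr (1 - 6/11))+m+n"
 proof -
  have "(SUM S:\<T>. G S) = Q1*(SUM S:\<T>. mS S powr (2/3)*nS S powr (1 - 2/3))+Q2*(SUM S:\<T>. mS S powr (6/11)*nS S powr (1 - 6/11))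
    + (SUM S:\<T>. mS S)+(SUM S:\<T>. nS S)"
   unfolding G_def sum.distrib sum_distrib_left ..
  also have "... <= Q1*(m powr (2/3)*n powr (1 - 2/3))+Q2*(m powr (6/11)*n powr (1 - 6/11))+m+n"
   by (intro add_mono mult_left_mono hold sum_m sum_n Q) auto
  finally show ?thesis .
 qed
 have "(SUM ga:full. card (?U ga)) <= (SUM ga:full. card {x:PS (TT ga). x:ga})"
 proof (rule sum_mono, rule card_mono)
  fix ga assume g: "ga:full"
  show "finite {x:PS (TT ga). x:ga}" using finS(1) by simp
  show "(?U ga) <= {x:PS (TT ga). x:ga}"
   using T_const(1,2)[OF g] unfolding PS_def by blast
 qed
 also have "... = (SUM S:\<T>. SUM ga:{ga:full. TT ga = S}. card {x:PS (TT ga). x:ga})"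
  unfolding \<T>_def by (rule sum.image_gen[OF full(2)])
 also have "... = (SUM S:\<T>. SUM ga:CS S. card {x:PS S. x:ga})" unfolding CS_def by (intro sum.cong refl) auto
 finally have "real (SUM ga:full. card (?U ga)) <= (SUM S:\<T>. IS S)"
  unfolding IS_def of_nat_sum[symmetric] of_nat_le_iff .
 also have "... <= K*(SUM S:\<T>. G S)" unfolding sum_distrib_left by (rule sum_mono[OF bound])
 also have "... <= K*(Q1*(m powr (2/3)*n powr (1 - 2/3))+Q2*(m powr (6/11)*n powr (1 - 6/11))+m+n)"
  using sumG K(1) by (intro mult_left_mono) auto
 finally have full_sum: "real (SUM ga:full. card (?U ga)) <= ..." .
 have "card {p:P. p:ga} <= (2*d+1)+card (?N ga)+card (?U ga)" if g: "ga:\<C>" for ga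
 proof -
  have "card {p:P. p:ga} <= card (E ga \<union> (?N ga) \<union> (?U ga))"
   using fin E(1)[OF g] by (intro card_mono) auto
  also have "... <= card (E ga)+card (?N ga)+card (?U ga)"
   by (intro order.trans[OF card_Un_le] add_right_mono card_Un_le)
  finally show ?thesis using E(2)[OF g] by linarith
 qed
 hence "(SUM ga:\<C>. card {p:P. p:ga}) <= (SUM ga:\<C>. (2*d+1)+card (?N ga)+card (?U ga))"
  by (rule sum_mono)
 also have "... = card \<C> * (2*d+1)+(SUM ga:\<C>. card (?N ga))
   + ((SUM ga:full. card (?U ga))+(SUM ga:\<C> - full. card (?U ga)))"
  unfolding sum.distrib sum.subset_diff[OF full(1) fin(3), of "%ga. card (?U ga)"]
  by (simp add: algebra_simps)
 finally have 1: "(SUM ga:\<C>. card {p:P. p:ga}) <= ..." .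
 have "(SUM ga:\<C> - full. card (?U ga)) <= (SUM ga:\<C> - full. 10*d+1)" by (rule sum_mono[OF not_full])
 also have "... = card (\<C> - full)*(10*d+1)" by simp
 also have "... <= card \<C> * (10*d+1)" using fin by (intro mult_right_mono card_mono) auto
 finally have "(SUM ga:\<C>. card {p:P. p:ga}) <= card \<C> * (2*d+1)+31*card P
   + (SUM ga:full. card (?U ga))+card \<C> * (10*d+1)" using 1 nonumb by linarith
 also have "... = card \<C> * (12*d+2)+31*card P+(SUM ga:full. card (?U ga))"
  by (simp add: algebra_simps)
 finally have "real (SUM ga:\<C>. card {p:P. p:ga}) <= n*real (12*d+2)+31*m+real (SUM ga:full. card (?U ga))"
  unfolding m_def n_def of_nat_mult[symmetric] of_nat_numeral[symmetric, where 'a = real] of_nat_add[symmetric] of_nat_le_iff .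
 thus ?thesis using full_sum unfolding m_def[symmetric] n_def[symmetric] Q1_def Q2_def by linarith
qed

lemma incidence_bound_combine:
 fixes n m B :: real
 assumes C: "C >= 1" and K: "K >= 1" and D: "n*D <= B+n" and s: "s <= C*B" and nn: "n >= 0" "m >= 0" "B >= 0" "X >= 0" "Y >= 0"
  and I1: "I1 <= n*(6*(C*D)+6)+s" and I2: "I2 <= n*(12*(C*D)+2)+31*m+K*(X+Y+m+n)"
 shows "I1+I2 <= (27*C+32*K)*(B+X+Y+m+n)"
proof -
 have "C*(n*D) <= C*(B+n)" using D C by simp
 hence "I1+I2 <= 18*(C*(B+n))+8*n+C*B+31*m+K*(X+Y+m+n)"
  using I1 I2 s by (simp add: algebra_simps)
 moreover have "n <= C*n" "m <= K*m" using C K nn by (simp_all add: mult_le_cancel_right1)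
 moreover have "0 <= C*n" "0 <= C*m" "0 <= C*B" "0 <= C*X" "0 <= C*Y" "0 <= K*n" "0 <= K*m" "0 <= K*B" "0 <= K*X" "0 <= K*Y"
  using C K nn by simp_all
 ultimately show ?thesis unfolding distrib_left distrib_right mult.assoc by linarith
qed

theorem theorem1p6:
  "\<exists>K::real. K > 0 \<and>
    (\<forall>(P :: (real^3) set) (\<C> :: (real^3) set set) (m::nat) (n::nat) (q::nat).
       finite P \<and> card P = m \<and> finite \<C> \<and> card \<C> = n \<and>
       (\<forall>\<gamma>\<in>\<C>. is_circle \<gamma>) \<and>
       (\<forall>S. is_plane S \<longrightarrow> card {\<gamma>\<in>\<C>. \<gamma> \<subseteq> S} \<le> q) \<and>
       (\<forall>S. is_sphere S \<longrightarrow> card {\<gamma>\<in>\<C>. \<gamma> \<subseteq> S} \<le> q)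
     \<longrightarrow> real (incidences P \<C>) \<le>
          K * (real m powr (3/7) * real n powr (6/7)
             + real m powr (2/3) * real n powr (1/3) * real q powr (1/3)
             + real m powr (6/11) * real n powr (5/11) * real q powr (4/11)
                 * (max 1 (ln (real m ^ 3 / real q))) powr (2/11)
             + real m + real n))"
proof -
 obtain K :: real where K: "K >= 1" "!!S P \<C>. is_plane S | is_sphere S ==> finite P ==> finite \<C> ==> P <= S ==>
   ALL ga:\<C>. is_circle ga & ga <= S ==> real (SUM ga:\<C>. card {p:P. p:ga}) <= K*planar_bound (rc P) (rc \<C>)"
  using surface_circle_incidences by iprover
 obtain C :: nat where C: "C >= 1" "!!(X :: (real^3) set) D. finite X ==> D >= 1 ==>
  (EX fs \<S>. sign_cells fs X \<S> & polyf (C*D) (prodf fs) &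
   cubes \<S> * real D^(2*DIM(real^3)) <= real C*rc X^3)"
  using polynomial_partition[where 'a = "real^3"] by iprover
 have main: "real (incidences P \<C>) <= (27*real C+32*K)*(real m powr (3/7)*real n powr (6/7)
       + real m powr (2/3)*real n powr (1/3)*real q powr (1/3)
       + real m powr (6/11)*real n powr (5/11)*real q powr (4/11)
         * (max 1 (ln (real m^3/real q))) powr (2/11)
       + real m+real n)"
  if P: "finite P" "card P = m" and \<C>: "finite \<C>" "card \<C> = n" and circles: "ALL ga:\<C>. is_circle ga"
   and q: "ALL S. is_plane S --> card {ga:\<C>. ga <= S} <= q" "ALL S. is_sphere S --> card {ga:\<C>. ga <= S} <= q"
  for P \<C> m n q
 proof (cases "m = 0 | n = 0")
  case True
  hence "P = {} | \<C> = {}" using P \<C> by auto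
  hence "incidences P \<C> = 0" by (auto simp: incidences_eq_sum[OF P(1) \<C>(1)])
  thus ?thesis using K(1) by simp
 next
  case False
  hence mn: "real m > 0" "real n > 0" "P ~= {}" using P by auto
  define B where "B = real m powr (3/7)*real n powr (6/7)"
  obtain D :: nat where D: "D >= 1" "real n*real D <= B+real n" "real m^3/real D^6 <= B"
   using partition_degree[OF mn(1,2)] unfolding B_def by blast
  obtain fs \<S> where fs: "sign_cells fs P \<S>" "polyf (C*D) (prodf fs)"
   "cubes \<S> * real D^(2*DIM(real^3)) <= real C*real m^3"
   using C(2)[OF P(1) D(1)] unfolding P(2) by blast
  define F where "F = (prodf fs)"
  have pF: "polyf (C*D) F" using fs(2) by (simp add: F_def)
  have "finite fs" "EX x. ALL f:fs. f x ~= 0" using fs(1) by (simp_all add: sign_cells_def)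
  hence Fnz: "EX x. F x ~= 0" by (auto simp: F_def)
  have "D > 0" using D(1) by simp
  have s: "cubes \<S> <= real C*B"
  proof -
   have "cubes \<S> <= real C*(real m^3/real D^6)"
    using fs(3) \<open>D > 0\<close> by (simp add: pos_le_divide_eq)
   also have "... <= real C*B" by (intro mult_left_mono D(3)) simp
   finally show ?thesis .
  qed
  define \<C>1 where "\<C>1 = {ga:\<C>. EX y:ga. F y ~= 0}"
  define \<C>2 where "\<C>2 = {ga:\<C>. ALL y:ga. F y = 0}"
  have parts: "\<C>1 <= \<C>" "\<C>2 <= \<C>" "\<C>1 \<inter> \<C>2 = {}" "\<C> = \<C>1 \<union> \<C>2" by (auto simp: \<C>1_def \<C>2_def)
  have fin: "finite \<C>1" "finite \<C>2" using parts \<C>(1) by (auto intro: finite_subset)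
  have c12: "card \<C>1 <= n" "card \<C>2 <= n" using card_mono[OF \<C>(1)] parts(1,2) \<C>(2) by auto
  define L where "L = max 1 (ln (real m^3/real q)) powr (2/11)"
  define X Y where "X = real m powr (2/3)*real n powr (1/3)*real q powr (1/3)"
   and "Y = real m powr (6/11)*real n powr (5/11)*real q powr (4/11)*L"
  define I1 I2 where "I1 = real (SUM ga:\<C>1. card {p:P. p:ga})" and "I2 = real (SUM ga:\<C>2. card {p:P. p:ga})"
  have "(SUM ga:\<C>1. card {p:P. p:ga}) <= card \<C>1*(6*(C*D)+6)+(SUM S:\<S>. card S^3)"
   by (rule crossing_circle_incidences[OF P(1) fin(1) _ fs(1,2)]) (use circles in \<open>auto simp: \<C>1_def \<C>2_def F_def\<close>)
  also have "... <= n*(6*(C*D)+6)+(SUM S:\<S>. card S^3)" using c12(1) by (intro add_right_mono mult_right_mono) auto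
  finally have "I1 <= real (n*(6*(C*D)+6)+(SUM S:\<S>. card S^3))" unfolding I1_def I2_def of_nat_le_iff .
  hence I1: "I1 <= real n*(6*(real C*real D)+6)+cubes \<S>" by simp
  have "I2 <= rc \<C>2*real (12*(C*D)+2)+31*rc P
  + K*(real q powr (1/3)*(rc P powr (2/3)*rc \<C>2 powr (1 - 2/3))
   + real q powr (4/11)*max 1 (ln (rc P^3/real q)) powr (2/11)*(rc P powr (6/11)*rc \<C>2 powr (1 - 6/11))
   + rc P+rc \<C>2)" unfolding I2_def
  proof (rule circles_in_surface[OF K P(1) mn(3) fin(2) pF Fnz])
   show "is_circle ga" "!!y. y:ga ==> F y = 0" if "ga:\<C>2" for ga using that circles by (auto simp: \<C>1_def \<C>2_def)
   fix S :: "(real^3) set" assume S: "is_plane S | is_sphere S"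
   have "card {ga:\<C>2. ga <= S} <= card {ga:\<C>. ga <= S}" using \<C>(1) parts(2) by (intro card_mono) auto
   thus "card {ga:\<C>2. ga <= S} <= q" using q S order_trans by blast
  qed
  also have "... <= real n*real (12*(C*D)+2)+31*real m
  + K*(real q powr (1/3)*(real m powr (2/3)*real n powr (1 - 2/3))
   + real q powr (4/11)*max 1 (ln (real m^3/real q)) powr (2/11)*(real m powr (6/11)*real n powr (1 - 6/11))
   + real m+real n)"
   unfolding P(2) using c12(2) K(1) by (intro add_mono mult_left_mono mult_right_mono powr_mono2 order_refl) auto
  also have "... = real n*(12*(real C*real D)+2)+31*real m+K*(X+Y+real m+real n)"
   by (simp add: X_def Y_def L_def mult_ac)
  finally have I2: "I2 <= real n*(12*(real C*real D)+2)+31*real m+K*(X+Y+real m+real n)" .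
  have "(SUM ga:\<C>. card {p:P. p:ga}) = (SUM ga:\<C>1. card {p:P. p:ga})+(SUM ga:\<C>2. card {p:P. p:ga})"
   unfolding parts(4) by (rule sum.union_disjoint[OF fin parts(3)])
  hence "real (incidences P \<C>) = I1+I2" unfolding incidences_eq_sum[OF P(1) \<C>(1)] I1_def I2_def by (simp only: of_nat_add)
  also have "... <= (27*real C+32*K)*(B+X+Y+real m+real n)"
   by (rule incidence_bound_combine[OF _ K(1) D(2) s _ _ _ _ _ I1 I2]) (use C(1) in \<open>simp_all add: B_def X_def Y_def L_def\<close>)
  finally show ?thesis unfolding B_def X_def Y_def L_def .
 qed
 have pos: "27*real C+32*K > 0" using K(1) by simp
 show ?thesis
  by (rule exI[of _ "27*real C+32*K"], intro conjI pos allI impI) (elim conjE, rule main; assumption)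
qed

end
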